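(* Let $\mathcal K$ be either the class of all tensor products of Kirillov–Reshetikhin crystals $B^{r,s}$ of type $A_n^{(1)}$, or the class of all tensor products of Kirillov–Reshetikhin crystals $B^{1,s}$ of type $D_n^{(1)}$ (then always $r=1$ below). Under the family of bijections $\bar\phi:P(B)\to\mathrm{RC}(L)$, $B\in\mathcal K$, the following operations correspond: 1. $\mathrm{ls}$ with $\bar j$: $\bar\phi\circ\mathrm{ls}=\bar j\circ\bar\phi$ on $P(B)$ for $B=B^{r,s}\otimes B'$, $s\ge2$. 2. $\mathrm{lh}$ with $\bar\delta$: $\bar\phi\circ\mathrm{lh}=\bar\delta\circ\bar\phi$ on $P(B)$ for $B=B^1\otimes B'$. 3. $\mathrm{rs}$ with $\tilde j$: $\bar\phi\circ\mathrm{rs}=\tilde j\circ\bar\phi$ on $P(B)$ for $B=B'\otimes B^{r,s}$, $s\ge2$. 4. $\mathrm{rh}$ with $\tilde\delta$: $\bar\phi\circ\mathrm{rh}=\tilde\delta\circ\bar\phi$ on $P(B)$ for $B=B'\otimes B^1$. 5. $*$ with $\theta$: $\bar\phi\circ *=\theta\circ\bar\phi$ on $P(B)$. 6. $R$ with the identity: $\bar\phi\circ R_j=\bar\phi$ on $P(B)$ for every combinatorial $R$-matrix $R_j$ exchanging two adjacent tensor factors. 7. (Type $A_n^{(1)}$ only) $\mathrm{lb}$ with $\bar i$ and $\mathrm{rb}$ with $\tilde i$: $\bar\phi\circ\mathrm{lb}=\bar i\circ\bar\phi$ on $P(B)$ for $B=B^{r,1}\otimes B'$, $r\ge2$, and $\bar\phi\circ\mathrm{rb}=\tilde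 i\circ\bar\phi$ on $P(B)$ for $B=B'\otimes B^{r,1}$, $r\ge2$.
   Context: **Crystals.** Nodes $\{0\}\cup\bar I$, $\bar I=\{1,\dots,n\}$; $\bar{\mathfrak g}$ the simple Lie algebra with nodes $\bar I$, dominant weights $\bar P^+$, fundamental weights $\bar\Lambda_a$, $(\alpha_a|\alpha_b)$ its Cartan matrix. Tensor products: $e_i(b_2\otimes b_1)=e_i(b_2)\otimes b_1$ if $\varepsilon_i(b_2)>\varphi_i(b_1)$, else $b_2\otimes e_i(b_1)$; $f_i(b_2\otimes b_1)=f_i(b_2)\otimes b_1$ if $\varepsilon_i(b_2)\ge\varphi_i(b_1)$, else $b_2\otimes f_i(b_1)$. Classical components are connected components after removing $0$-arrows; each contains a unique classical highest weight vector ($\varepsilon_i(b)=0$ for $i\in\bar I$). $P(B)$ (resp. $P(B,\lambda)$) is the set of classical highest weight vectors (of weight $\lambda$), identified with the set of classical components. In type $A_n^{(1)}$, $B^{r,s}$ consists of semistandard tableaux of $r\times s$ rectangular shape in $\{1,\dots,n+1\}$; in type $D_n^{(1)}$, $B^s=B^{1,s}\cong B(s\bar\Lambda_1)$ consists of words of length $s$ in the crystal $B^1=B^{1,1}=\{1<\dots<n,\bar n<\dots<\bar1\}$ (via $B(s\bar\Lambda_1)\hookrightarrow B(\bar\Lambda_1)^{\otimes s}$). The combinatorial $R$-matrix $B\otimes B'\to B'\otimes B$ is the unique affine crystal isomorphism. **Path maps.** $\mathrm{lh}$ (resp. $\mathrm{rh}$) drops the left (resp. right) factor $B^1$; these maps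 send classical components into classical components and denote also the induced maps on $P$ (so $\mathrm{rh}(b)$ for $b\in P(B)$ is the highest weight vector of the component of the element obtained by dropping the right factor). $\mathrm{ls}$ replaces the left factor $b\in B^{r,s}$ by its leftmost column (letter) in $B^{r,1}$ tensored with the rest in $B^{r,s-1}$; $\mathrm{rs}$ replaces the right factor $b\in B^{r,s}$ by $b_2\otimes b_1\in B^{r,s-1}\otimes B^{r,1}$, $b_1$ the rightmost column (letter), $b_2$ the rest. In type $A$, $\mathrm{lb}$ replaces a left factor $b\in B^{r,1}$ by $b_2\otimes b_1\in B^{1,1}\otimes B^{r-1,1}$, $b_2$ the bottom entry, $b_1$ the rest; $\mathrm{rb}$ replaces a right factor $b\in B^{r,1}$ by $b_2\otimes b_1\in B^{r-1,1}\otimes B^{1,1}$, $b_1$ the top entry, $b_2$ the rest. The involution $*$: on letters, in type $A_n^{(1)}$, $i\leftrightarrow n+2-i$; in type $D_n^{(1)}$, $i\leftrightarrow\bar i$, except that for $n$ odd $n$ and $\bar n$ are fixed. On $B^{r,s}$ of type $A$, $b^*$ is obtained by replacing every entry $c$ by $c^*$ and rotating by 180 degrees; on words $(b_1\cdots b_s)^*=b_s^*\cdots b_1^*$. For $B=B_N\otimes\cdots\otimes B_1$, $B^*=B_1\otimes\cdots\otimes B_N$ and $(b_N\otimes\cdots\otimes b_1)^*=b_1^*\otimes\cdots\otimes b_N^*$; this maps classical components to classical components of the same highest weight, and $*:P(B)\to P(B^* )$ is the induced map. **Rigged configurations.** $L_i^{(a)}$ is the number of factors $B^{a,i}$ of $B$.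 $\mathrm{RC}(L,\lambda)$ is the set of $(\nu,J)$: $\nu=(\nu^{(a)})_{a\in\bar I}$ partitions with $m_i^{(a)}$ parts of size $i$ in $\nu^{(a)}$, $\sum i m_i^{(a)}\alpha_a=\sum iL_i^{(a)}\bar\Lambda_a-\lambda$, vacancy numbers $p_i^{(a)}=\sum_j\min(i,j)L_j^{(a)}-\sum_b(\alpha_a|\alpha_b)\sum_j\min(i,j)m_j^{(b)}\ge0$ for all $a,i$, and $J^{(a,i)}$ a multiset of $m_i^{(a)}$ integers in $[0,p_i^{(a)}]$, attached as riggings to the parts ("strings") of length $i$ of $\nu^{(a)}$. $\mathrm{RC}(L)=\bigsqcup_\lambda\mathrm{RC}(L,\lambda)$. $J^{(a,i)}$ is singular if it has a part $p_i^{(a)}$; a string $(i,x)$ is singular if $x=p_i^{(a)}$ and cosingular if $x=0$. $\theta$ fixes $\nu$ and replaces each rigging $x$ of a string of length $i$ in $\nu^{(a)}$ by $p_i^{(a)}-x$. **RC maps** (with $L$ changed according to the corresponding path map). $\bar j(\nu,J)=(\nu,J)$; $\tilde j$ adds $1$ to the rigging of each string of length $<s$ in $(\nu,J)^{(r)}$. $\bar i$ (resp. $\tilde i$) adds a singular (resp. cosingular) string of length $1$ to $(\nu,J)^{(a)}$ for each $1\le a<r$. $\bar\delta$ is the following algorithm. *Type $A_n^{(1)}$*: $\ell^{(0)}=1$; for $a=1,\dots,n$ let $\ell^{(a)}$ be the least $i\ge\ell^{(a-1)}$ with $J^{(a,i)}$ singular; if none exists stop. *Type $D_n^{(1)}$*: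 do the same for $a=1,\dots,n-2$; if not stopped, find minimal $i,j\ge\ell^{(n-2)}$ with $J^{(n-1,i)}$, $J^{(n,j)}$ singular; if neither exists stop; if only $i$ (only $j$) exists, set $\ell^{(n-1)}=i$ ($\ell^{(n)}=j$) and stop; if both exist set $\ell^{(n-1)}=i,\ell^{(n)}=j$, $\bar\ell^{(n-1)}=\max(i,j)$, and for $a=n-2,\dots,1$ let $\bar\ell^{(a)}$ be the least $i\ge\bar\ell^{(a+1)}$ with $J^{(a,i)}$ singular (having two parts $p_i^{(a)}$ if $i=\ell^{(a)}$), stopping if none exists. Undefined $\ell^{(a)},\bar\ell^{(a)}$ are $\infty$. $\bar\delta(\nu,J)$ is obtained by removing one box from each selected string (a singular string of length $\ell^{(a)}$ in $(\nu,J)^{(a)}$ for each finite $\ell^{(a)}$, and one of length $\bar\ell^{(a)}$ for each finite $\bar\ell^{(a)}$, $a\le n-2$), making the shortened strings singular for the new vacancy numbers, and leaving all other riggings unchanged. $\tilde\delta=\theta\circ\bar\delta\circ\theta$. **The bijection.** $\bar\phi$ is the unique family of bijections $P(B,\lambda)\to\mathrm{RC}(L,\lambda)$, $B\in\mathcal K$, sending the empty path to the empty rigged configuration with $\bar\phi\circ\mathrm{lh}=\bar\delta\circ\bar\phi$, $\bar\phi\circ\mathrm{ls}=\bar j\circ\bar\phi$ and, in type $A$, $\bar\phi\circ\mathrm{lb}=\bar i\circ\bar\phi$, whenever these maps are defined. *)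

theory Defs
  imports Main "HOL-Library.Multiset"
begin

section \<open>Types and letters\<close>

datatype affine_type = TypeA nat | TypeD nat

fun rank :: "affine_type \<Rightarrow> nat" where
  "rank (TypeA n) = n"
| "rank (TypeD n) = n"

fun valid_type :: "affine_type \<Rightarrow> bool" where
  "valid_type (TypeA n) \<longleftrightarrow> 1 \<le> n"
| "valid_type (TypeD n) \<longleftrightarrow> 4 \<le> n"

definition classical_nodes :: "affine_type \<Rightarrow> nat set" where
  "classical_nodes T = {1..rank T}"

definition dynkin_edge :: "affine_type \<Rightarrow> nat \<Rightarrow> nat \<Rightarrow> bool" where
  "dynkin_edge T a b = (case T of
      TypeA n \<Rightarrow> b = a + 1
    | TypeD n \<Rightarrow> (b = a + 1 \<and> b \<le> n - 1) \<or> (a = n - 2 \<and> b = n))"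

definition cartan :: "affine_type \<Rightarrow> nat \<Rightarrow> nat \<Rightarrow> int" where
  "cartan T a b = (if a = b then 2 else if dynkin_edge T a b \<or> dynkin_edge T b a then - 1 else 0)"

text \<open>The letter \<open>i\<close> is the integer \<open>i\<close>; in type \<open>D\<close> the barred letter \<open>i\<close> is the integer \<open>-i\<close>.\<close>

definition letters :: "affine_type \<Rightarrow> int set" where
  "letters T = (case T of TypeA n \<Rightarrow> {1..int n + 1} | TypeD n \<Rightarrow> {1..int n} \<union> {- int n..- 1})"

text \<open>In type \<open>D\<close> the letters \<open>n\<close> and \<open>-n\<close> have the same height and are incomparable.\<close>

definition letter_height :: "affine_type \<Rightarrow> int \<Rightarrow> int" where
  "letter_height T c = (if 0 < c then c else 2 * int (rank T) + c)"

definition letter_le :: "affine_type \<Rightarrow> int \<Rightarrow> int \<Rightarrow> bool" where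
  "letter_le T c d \<longleftrightarrow> c = d \<or> letter_height T c < letter_height T d"

fun letter_f :: "affine_type \<Rightarrow> nat \<Rightarrow> int \<Rightarrow> int option" where
  "letter_f (TypeA n) i c = (if c = int i then Some (c + 1) else None)"
| "letter_f (TypeD n) i c =
    (if i < n then (if c = int i \<or> c = - (int i + 1) then Some (c + 1) else None)
     else if c = int n - 1 then Some (- int n)
     else if c = int n then Some (- (int n - 1)) else None)"

fun letter_e :: "affine_type \<Rightarrow> nat \<Rightarrow> int \<Rightarrow> int option" where
  "letter_e (TypeA n) i c = (if c = int i + 1 then Some (c - 1) else None)"
| "letter_e (TypeD n) i c =
    (if i < n then (if c = int i + 1 \<or> c = - int i then Some (c - 1) else None)
     else if c = - int n then Some (int n - 1)
     else if c = - (int n - 1) then Some (int n) else None)"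


section \<open>Crystals\<close>

text \<open>The value \<open>None\<close> plays the role of the element 0 of a crystal.\<close>

record 'b crystal =
  cr_e :: "nat \<Rightarrow> 'b \<Rightarrow> 'b option"
  cr_f :: "nat \<Rightarrow> 'b \<Rightarrow> 'b option"
  cr_eps :: "nat \<Rightarrow> 'b \<Rightarrow> nat"
  cr_phi :: "nat \<Rightarrow> 'b \<Rightarrow> nat"

definition letter_crystal :: "affine_type \<Rightarrow> int crystal" where
  "letter_crystal T = \<lparr>
     cr_e = letter_e T,
     cr_f = letter_f T,
     cr_eps = (\<lambda>i c. if letter_e T i c = None then 0 else 1),
     cr_phi = (\<lambda>i c. if letter_f T i c = None then 0 else 1)\<rparr>"

text \<open>
  The list \<open>[b\<^sub>N, \<dots>, b\<^sub>1]\<close> stands for \<open>b\<^sub>N \<otimes> \<dots> \<otimes> b\<^sub>1\<close>. The functions \<open>eps\<close> and \<open>phi\<close> of a tensor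
  product are those forced by the tensor product rule for the operators; truncated subtraction
  supplies \<open>max 0\<close>.
\<close>

fun tensor_eps :: "'b crystal \<Rightarrow> nat \<Rightarrow> 'b list \<Rightarrow> nat"
  and tensor_phi :: "'b crystal \<Rightarrow> nat \<Rightarrow> 'b list \<Rightarrow> nat" where
  "tensor_eps C i [] = 0"
| "tensor_eps C i (b # bs) = tensor_eps C i bs + (cr_eps C i b - tensor_phi C i bs)"
| "tensor_phi C i [] = 0"
| "tensor_phi C i (b # bs) = cr_phi C i b + (tensor_phi C i bs - cr_eps C i b)"

fun tensor_e :: "'b crystal \<Rightarrow> nat \<Rightarrow> 'b list \<Rightarrow> 'b list option" where
  "tensor_e C i [] = None"
| "tensor_e C i (b # bs) =
    (if cr_eps C i b > tensor_phi C i bs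
     then map_option (\<lambda>b'. b' # bs) (cr_e C i b)
     else map_option (\<lambda>bs'. b # bs') (tensor_e C i bs))"

fun tensor_f :: "'b crystal \<Rightarrow> nat \<Rightarrow> 'b list \<Rightarrow> 'b list option" where
  "tensor_f C i [] = None"
| "tensor_f C i (b # bs) =
    (if cr_eps C i b \<ge> tensor_phi C i bs
     then map_option (\<lambda>b'. b' # bs) (cr_f C i b)
     else map_option (\<lambda>bs'. b # bs') (tensor_f C i bs))"

definition tensor_crystal :: "'b crystal \<Rightarrow> 'b list crystal" where
  "tensor_crystal C = \<lparr>
     cr_e = tensor_e C, cr_f = tensor_f C, cr_eps = tensor_eps C, cr_phi = tensor_phi C\<rparr>"

definition crystal_iso ::
    "nat set \<Rightarrow> 'b crystal \<Rightarrow> 'b set \<Rightarrow> 'c crystal \<Rightarrow> 'c set \<Rightarrow> ('b \<Rightarrow> 'c) \<Rightarrow> bool" where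
  "crystal_iso I C X D Y g \<longleftrightarrow>
     bij_betw g X Y \<and>
     (\<forall>b\<in>X. \<forall>i\<in>I.
        cr_e D i (g b) = map_option g (cr_e C i b) \<and>
        cr_f D i (g b) = map_option g (cr_f C i b) \<and>
        cr_eps D i (g b) = cr_eps C i b \<and>
        cr_phi D i (g b) = cr_phi C i b)"


section \<open>Kirillov--Reshetikhin crystals\<close>

text \<open>
  An element of \<open>B\<^sup>r\<^sup>,\<^sup>s\<close> is the list of its \<open>s\<close> columns from left to right, each column being the list
  of its \<open>r\<close> entries from bottom to top. Concatenating the columns gives the column reading word,
  so the classical crystal structure is that of a tensor product of tensor products of letters.
\<close>

type_synonym tableau = "int list list"

type_synonym path = "tableau list"

definition KR :: "affine_type \<Rightarrow> nat \<times> nat \<Rightarrow> tableau set" where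
  "KR T = (\<lambda>(r, s). {b. length b = s \<and>
     (\<forall>col \<in> set b. length col = r \<and> set col \<subseteq> letters T) \<and>
     (case T of
        TypeA n \<Rightarrow> (\<forall>col \<in> set b. sorted_wrt (>) col) \<and> (\<forall>k<r. sorted (map (\<lambda>col. col ! k) b))
      | TypeD n \<Rightarrow> sorted_wrt (letter_le T) (concat b))})"

definition KR_shape :: "tableau \<Rightarrow> nat \<times> nat" where
  "KR_shape b = (length (hd b), length b)"

text \<open>
  Promotion in type \<open>A\<close>, on tableaux given as functions of (row from the top, column from the left),
  both starting at 1. Vacated cells and cells outside the tableau hold 0. The hole at the given cell
  is moved to the north-west by jeu de taquin.
\<close>

fun slide :: "(nat \<Rightarrow> nat \<Rightarrow> int) \<Rightarrow> nat \<Rightarrow> nat \<Rightarrow> (nat \<Rightarrow> nat \<Rightarrow> int)" where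
  "slide t (Suc i) (Suc j) =
    (let up = t i (Suc j); left = t (Suc i) j; put = (\<lambda>x. t(Suc i := (t (Suc i))(Suc j := x)))
     in if up = 0 \<and> left = 0 then put 0
        else if left \<le> up then slide (put up) i (Suc j)
        else slide (put left) (Suc i) j)"
| "slide t i j = t"

definition cells :: "tableau \<Rightarrow> nat \<Rightarrow> nat \<Rightarrow> int" where
  "cells b i j = (case KR_shape b of (r, s) \<Rightarrow>
     if i \<in> {1..r} \<and> j \<in> {1..s} then b ! (j - 1) ! (r - i) else 0)"

text \<open>
  In a rectangular tableau all entries \<open>n + 1\<close> lie in the bottom row. They are removed, the holes are
  moved out from left to right, the vacated cells are filled with 0 and all entries are raised by 1.
\<close>

definition promotion :: "nat \<Rightarrow> tableau \<Rightarrow> tableau" where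
  "promotion n b = (case KR_shape b of (r, s) \<Rightarrow>
     let t = fold (\<lambda>j t. if t r j = int n + 1 then slide t r j else t) [1..<s + 1] (cells b)
     in map (\<lambda>j. map (\<lambda>i. t i j + 1) (rev [1..<r + 1])) [1..<s + 1])"

text \<open>The automorphism of \<open>B\<^sup>1\<^sup>,\<^sup>s\<close> in type \<open>D\<close> exchanging the multiplicities of the letters 1 and \<open>-1\<close>.\<close>

definition flip_one :: "tableau \<Rightarrow> tableau" where
  "flip_one b = replicate (count_list b [- 1]) [1] @ filter (\<lambda>col. col \<noteq> [1] \<and> col \<noteq> [- 1]) b
     @ replicate (count_list b [1]) [- 1]"

text \<open>
  The twist carries the node 0 of the affine Dynkin diagram to the node 1, so that
  \<open>e\<^sub>0 = twist\<^sup>-\<^sup>1 \<circ> e\<^sub>1 \<circ> twist\<close> and likewise for \<open>f\<^sub>0\<close>. In type \<open>D\<close> this gives the usual action of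
  \<open>e\<^sub>0\<close> on words \<open>(x\<^sub>1, \<dots>, x\<^sub>n, y\<^sub>n, \<dots>, y\<^sub>1)\<close> in multiplicity coordinates (\<open>y\<^sub>i\<close> counting \<open>-i\<close>):
  lower \<open>x\<^sub>2\<close> and raise \<open>y\<^sub>1\<close> if \<open>x\<^sub>2 > y\<^sub>2\<close>, otherwise lower \<open>x\<^sub>1\<close> and raise \<open>y\<^sub>2\<close>.
\<close>

definition twist :: "affine_type \<Rightarrow> tableau \<Rightarrow> tableau" where
  "twist T = (case T of TypeA n \<Rightarrow> promotion n | TypeD n \<Rightarrow> flip_one)"

definition untwist :: "affine_type \<Rightarrow> nat \<times> nat \<Rightarrow> tableau \<Rightarrow> tableau" where
  "untwist T p = inv_into (KR T p) (twist T)"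

definition KR_crystal :: "affine_type \<Rightarrow> tableau crystal" where
  "KR_crystal T = (let C = tensor_crystal (tensor_crystal (letter_crystal T)) in \<lparr>
     cr_e = (\<lambda>i b. if i = 0 then map_option (untwist T (KR_shape b)) (cr_e C 1 (twist T b))
                   else cr_e C i b),
     cr_f = (\<lambda>i b. if i = 0 then map_option (untwist T (KR_shape b)) (cr_f C 1 (twist T b))
                   else cr_f C i b),
     cr_eps = (\<lambda>i b. if i = 0 then cr_eps C 1 (twist T b) else cr_eps C i b),
     cr_phi = (\<lambda>i b. if i = 0 then cr_phi C 1 (twist T b) else cr_phi C i b)\<rparr>)"


section \<open>Paths\<close>

text \<open>
  A tensor product \<open>B = B\<^sub>N \<otimes> \<dots> \<otimes> B\<^sub>1\<close> of KR crystals is the list of the pairs \<open>(r, s)\<close> of its factors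
  \<open>B\<^sup>r\<^sup>,\<^sup>s\<close> from left to right.
\<close>

definition KR_indices :: "affine_type \<Rightarrow> (nat \<times> nat) set" where
  "KR_indices T = (case T of TypeA n \<Rightarrow> {1..n} \<times> {1..} | TypeD n \<Rightarrow> {1} \<times> {1..})"

definition tensor_class :: "affine_type \<Rightarrow> (nat \<times> nat) list set" where
  "tensor_class T = lists (KR_indices T)"

definition elements :: "affine_type \<Rightarrow> (nat \<times> nat) list \<Rightarrow> path set" where
  "elements T B = {b. list_all2 (\<lambda>t p. t \<in> KR T p) b B}"

definition path_crystal :: "affine_type \<Rightarrow> path crystal" where
  "path_crystal T = tensor_crystal (KR_crystal T)"

definition path_weight :: "affine_type \<Rightarrow> path \<Rightarrow> nat \<Rightarrow> int" where
  "path_weight T b i = int (cr_phi (path_crystal T) i b) - int (cr_eps (path_crystal T) i b)"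

definition classical_hw :: "affine_type \<Rightarrow> path \<Rightarrow> bool" where
  "classical_hw T b \<longleftrightarrow> (\<forall>i\<in>classical_nodes T. cr_eps (path_crystal T) i b = 0)"

definition paths :: "affine_type \<Rightarrow> (nat \<times> nat) list \<Rightarrow> path set" where
  "paths T B = {b \<in> elements T B. classical_hw T b}"

text \<open>A dominant weight is given by its coefficients in the fundamental weights.\<close>

definition paths_wt :: "affine_type \<Rightarrow> (nat \<times> nat) list \<Rightarrow> (nat \<Rightarrow> nat) \<Rightarrow> path set" where
  "paths_wt T B lam = {b \<in> paths T B. \<forall>i\<in>classical_nodes T. path_weight T b i = int (lam i)}"

definition classical_arrow :: "affine_type \<Rightarrow> path \<Rightarrow> path \<Rightarrow> bool" where
  "classical_arrow T b c \<longleftrightarrow> (\<exists>i\<in>classical_nodes T. cr_f (path_crystal T) i b = Some c)"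

definition highest :: "affine_type \<Rightarrow> path \<Rightarrow> path" where
  "highest T b = (THE h. equivclp (classical_arrow T) b h \<and> classical_hw T h)"

text \<open>
  The map induced on classical components, which are represented by their highest weight vectors,
  by a map of elements.
\<close>

definition induced :: "affine_type \<Rightarrow> (path \<Rightarrow> path) \<Rightarrow> path \<Rightarrow> path" where
  "induced T g b = highest T (g b)"

definition lh :: "path \<Rightarrow> path" where
  "lh b = tl b"

definition rh :: "path \<Rightarrow> path" where
  "rh b = butlast b"

definition ls :: "path \<Rightarrow> path" where
  "ls b = [hd (hd b)] # tl (hd b) # tl b"

definition rs :: "path \<Rightarrow> path" where
  "rs b = butlast b @ [butlast (last b), [last (last b)]]"

definition lb :: "path \<Rightarrow> path" where
  "lb b = (let col = hd (hd b) in [[hd col]] # [tl col] # tl b)"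

definition rb :: "path \<Rightarrow> path" where
  "rb b = (let col = hd (last b) in butlast b @ [[butlast col], [[last col]]])"

fun letter_star :: "affine_type \<Rightarrow> int \<Rightarrow> int" where
  "letter_star (TypeA n) c = int n + 2 - c"
| "letter_star (TypeD n) c = (if odd n \<and> \<bar>c\<bar> = int n then c else - c)"

definition tableau_star :: "affine_type \<Rightarrow> tableau \<Rightarrow> tableau" where
  "tableau_star T b = rev (map (\<lambda>col. rev (map (letter_star T) col)) b)"

definition path_star :: "affine_type \<Rightarrow> path \<Rightarrow> path" where
  "path_star T b = rev (map (tableau_star T) b)"

text \<open>A combinatorial \<open>R\<close>-matrix, as a map on two-element lists.\<close>

definition combinatorial_R ::
    "affine_type \<Rightarrow> nat \<times> nat \<Rightarrow> nat \<times> nat \<Rightarrow> (path \<Rightarrow> path) \<Rightarrow> bool" where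
  "combinatorial_R T p q R \<longleftrightarrow>
     crystal_iso (insert 0 (classical_nodes T))
       (path_crystal T) (elements T [p, q]) (path_crystal T) (elements T [q, p]) R"

text \<open>The factors acted on are those at the list positions \<open>j\<close> and \<open>j + 1\<close>, counted from 0.\<close>

definition apply_at :: "nat \<Rightarrow> (path \<Rightarrow> path) \<Rightarrow> path \<Rightarrow> path" where
  "apply_at j R b = take j b @ R [b ! j, b ! Suc j] @ drop (j + 2) b"

definition swap_at :: "nat \<Rightarrow> (nat \<times> nat) list \<Rightarrow> (nat \<times> nat) list" where
  "swap_at j B = take j B @ [B ! Suc j, B ! j] @ drop (j + 2) B"


section \<open>Rigged configurations\<close>

text \<open>
  A multiplicity array \<open>L\<close> is the multiset in which \<open>(a, i)\<close> occurs \<open>L\<^sub>i\<^sup>(\<^sup>a\<^sup>)\<close> times; for \<open>B\<close> it is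
  \<open>mset B\<close>. A configuration assigns to each node the multiset of its parts, a rigged configuration
  assigns to each node the multiset of its strings (length, rigging).
\<close>

type_synonym multiplicities = "(nat \<times> nat) multiset"

type_synonym configuration = "nat \<Rightarrow> nat multiset"

type_synonym rigged = "nat \<Rightarrow> (nat \<times> int) multiset"

definition shape :: "rigged \<Rightarrow> configuration" where
  "shape rc a = image_mset fst (rc a)"

definition vacancy :: "affine_type \<Rightarrow> multiplicities \<Rightarrow> configuration \<Rightarrow> nat \<Rightarrow> nat \<Rightarrow> int" where
  "vacancy T L nu a i =
     (\<Sum>p \<in># filter_mset (\<lambda>p. fst p = a) L. int (min i (snd p)))
     - (\<Sum>b \<in> classical_nodes T. cartan T a b * (\<Sum>j \<in># nu b. int (min i j)))"

text \<open>
  The weight condition \<open>\<Sum> i m\<^sub>i\<^sup>(\<^sup>a\<^sup>) \<alpha>\<^sub>a = \<Sum> i L\<^sub>i\<^sup>(\<^sup>a\<^sup>) \<Lambda>\<^sub>a - lam\<close> is stated coefficientwise in the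
  fundamental weights, using that the coefficient of \<open>\<Lambda>\<^sub>b\<close> in \<open>\<alpha>\<^sub>a\<close> is the Cartan matrix entry.
\<close>

definition RC :: "affine_type \<Rightarrow> multiplicities \<Rightarrow> (nat \<Rightarrow> nat) \<Rightarrow> rigged set" where
  "RC T L lam = {rc.
     (\<forall>a. a \<notin> classical_nodes T \<longrightarrow> rc a = {#}) \<and>
     (\<forall>a \<in> classical_nodes T. \<forall>i\<in>#shape rc a. 1 \<le> i) \<and>
     (\<forall>b \<in> classical_nodes T.
        (\<Sum>a \<in> classical_nodes T. int (\<Sum>\<^sub># (shape rc a)) * cartan T a b) =
        (\<Sum>p \<in># filter_mset (\<lambda>p. fst p = b) L. int (snd p)) - int (lam b)) \<and>
     (\<forall>a \<in> classical_nodes T. \<forall>i\<ge>1. 0 \<le> vacancy T L (shape rc) a i) \<and>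
     (\<forall>a \<in> classical_nodes T. \<forall>(i, x) \<in># rc a. 0 \<le> x \<and> x \<le> vacancy T L (shape rc) a i)}"

definition theta :: "affine_type \<Rightarrow> multiplicities \<Rightarrow> rigged \<Rightarrow> rigged" where
  "theta T L rc a = image_mset (\<lambda>(i, x). (i, vacancy T L (shape rc) a i - x)) (rc a)"

definition jbar :: "rigged \<Rightarrow> rigged" where
  "jbar rc = rc"

definition jtilde :: "nat \<Rightarrow> nat \<Rightarrow> rigged \<Rightarrow> rigged" where
  "jtilde r s rc a =
     (if a = r then image_mset (\<lambda>(i, x). (i, if i < s then x + 1 else x)) (rc a) else rc a)"

text \<open>
  In \<open>ibar\<close> the array \<open>L\<close> is that of the domain. The new strings are singular for the vacancy numbers
  of the target.
\<close>

definition ibar :: "affine_type \<Rightarrow> multiplicities \<Rightarrow> nat \<Rightarrow> rigged \<Rightarrow> rigged" where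
  "ibar T L r rc =
     (let L' = L - {#(r, 1)#} + {#(1, 1), (r - 1, 1)#};
          nu' = (\<lambda>a. if 1 \<le> a \<and> a < r then add_mset 1 (shape rc a) else shape rc a)
      in (\<lambda>a. if 1 \<le> a \<and> a < r then add_mset (1, vacancy T L' nu' a 1) (rc a) else rc a))"

definition itilde :: "nat \<Rightarrow> rigged \<Rightarrow> rigged" where
  "itilde r rc = (\<lambda>a. if 1 \<le> a \<and> a < r then add_mset (1, 0) (rc a) else rc a)"

definition singular_mult :: "affine_type \<Rightarrow> multiplicities \<Rightarrow> rigged \<Rightarrow> nat \<Rightarrow> nat \<Rightarrow> nat" where
  "singular_mult T L rc a i = count (rc a) (i, vacancy T L (shape rc) a i)"

text \<open>The value \<open>None\<close> stands for infinity.\<close>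

definition least_from :: "nat option \<Rightarrow> (nat \<Rightarrow> bool) \<Rightarrow> nat option" where
  "least_from l P = (case l of
      None \<Rightarrow> None
    | Some m \<Rightarrow> if \<exists>i\<ge>m. P i then Some (LEAST i. m \<le> i \<and> P i) else None)"

fun ell_chain :: "affine_type \<Rightarrow> multiplicities \<Rightarrow> rigged \<Rightarrow> nat \<Rightarrow> nat option" where
  "ell_chain T L rc 0 = Some 1"
| "ell_chain T L rc (Suc a) =
     least_from (ell_chain T L rc a) (\<lambda>i. 1 \<le> singular_mult T L rc (Suc a) i)"

definition ell :: "affine_type \<Rightarrow> multiplicities \<Rightarrow> rigged \<Rightarrow> nat \<Rightarrow> nat option" where
  "ell T L rc a = (case T of
      TypeA n \<Rightarrow> ell_chain T L rc a
    | TypeD n \<Rightarrow>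
        if a \<le> n - 2 then ell_chain T L rc a
        else least_from (ell_chain T L rc (n - 2)) (\<lambda>i. 1 \<le> singular_mult T L rc a i))"

text \<open>In type \<open>D\<^sub>n\<close>, \<open>ellbar_chain n L rc k\<close> belongs to the node \<open>n - 1 - k\<close>.\<close>

fun ellbar_chain :: "nat \<Rightarrow> multiplicities \<Rightarrow> rigged \<Rightarrow> nat \<Rightarrow> nat option" where
  "ellbar_chain n L rc 0 =
     (case (ell (TypeD n) L rc (n - 1), ell (TypeD n) L rc n) of
        (Some i, Some j) \<Rightarrow> Some (max i j)
      | _ \<Rightarrow> None)"
| "ellbar_chain n L rc (Suc k) =
     (let a = n - 1 - Suc k in
      least_from (ellbar_chain n L rc k)
        (\<lambda>i. (if ell (TypeD n) L rc a = Some i then 2 else 1) \<le> singular_mult (TypeD n) L rc a i))"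

text \<open>The lengths of the strings selected at a node.\<close>

definition selected :: "affine_type \<Rightarrow> multiplicities \<Rightarrow> rigged \<Rightarrow> nat \<Rightarrow> nat multiset" where
  "selected T L rc a =
     (if a \<in> classical_nodes T
      then mset_set (set_option (ell T L rc a)) +
        (case T of
           TypeA n \<Rightarrow> {#}
         | TypeD n \<Rightarrow>
             if a \<le> n - 2 then mset_set (set_option (ellbar_chain n L rc (n - 1 - a))) else {#})
      else {#})"

text \<open>Here \<open>L\<close> is again the array of the domain; that of the target has one \<open>(1, 1)\<close> less.\<close>

definition deltabar :: "affine_type \<Rightarrow> multiplicities \<Rightarrow> rigged \<Rightarrow> rigged" where
  "deltabar T L rc =
     (let L' = L - {#(1, 1)#};
          kept = (\<lambda>a. rc a - image_mset (\<lambda>i. (i, vacancy T L (shape rc) a i)) (selected T L rc a));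
          shortened = (\<lambda>a. filter_mset (\<lambda>i. 0 < i) (image_mset (\<lambda>i. i - 1) (selected T L rc a)));
          nu' = (\<lambda>a. shape kept a + shortened a)
      in (\<lambda>a. kept a + image_mset (\<lambda>i. (i, vacancy T L' nu' a i)) (shortened a)))"

definition deltatilde :: "affine_type \<Rightarrow> multiplicities \<Rightarrow> rigged \<Rightarrow> rigged" where
  "deltatilde T L rc = theta T (L - {#(1, 1)#}) (deltabar T L (theta T L rc))"


section \<open>The bijection\<close>

text \<open>The defining properties of the family of bijections from paths to rigged configurations.\<close>

definition path_RC_bijection ::
    "affine_type \<Rightarrow> ((nat \<times> nat) list \<Rightarrow> path \<Rightarrow> rigged) \<Rightarrow> bool" where
  "path_RC_bijection T \<phi> \<longleftrightarrow>
     (\<forall>B \<in> tensor_class T. \<forall>lam. bij_betw (\<phi> B) (paths_wt T B lam) (RC T (mset B) lam)) \<and>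
     \<phi> [] [] = (\<lambda>_. {#}) \<and>
     (\<forall>B' b. (1, 1) # B' \<in> tensor_class T \<longrightarrow> b \<in> paths T ((1, 1) # B') \<longrightarrow>
        \<phi> B' (induced T lh b) = deltabar T (mset ((1, 1) # B')) (\<phi> ((1, 1) # B') b)) \<and>
     (\<forall>r s B' b. (r, s) # B' \<in> tensor_class T \<longrightarrow> 2 \<le> s \<longrightarrow> b \<in> paths T ((r, s) # B') \<longrightarrow>
        \<phi> ((r, 1) # (r, s - 1) # B') (induced T ls b) = jbar (\<phi> ((r, s) # B') b)) \<and>
     (\<forall>n r B' b. T = TypeA n \<longrightarrow> (r, 1) # B' \<in> tensor_class T \<longrightarrow> 2 \<le> r \<longrightarrow>
        b \<in> paths T ((r, 1) # B') \<longrightarrow>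
        \<phi> ((1, 1) # (r - 1, 1) # B') (induced T lb b) =
          ibar T (mset ((r, 1) # B')) r (\<phi> ((r, 1) # B') b))"

end

theory Submission
  imports Defs
begin

text \<open>
  Allow riggings of arbitrary sign, bounded by the vacancy numbers. Such rigged configurations carry
  operators \<open>e\<^sub>a\<close> acting on a string of least rigging, and their conjugates under the exchange of
  riggings and coriggings, acting on a string of least corigging. Removing a factor \<open>B\<^sup>1\<close> from \<open>B\<close>
  creates coriggings \<open>-1\<close>; repairing them by conjugate operators, along a path of arrows in the crystal
  of letters that starts at the letter 1, has only one possible outcome, namely the map \<open>\<delta>\<close>, and the
  last letter of the path is the letter removed by \<open>lh\<close>. At a given node, operators of the two kinds
  commute or coincide. Hence the words read off by \<open>\<delta>\<close> are compatible with all \<open>e\<^sub>a\<close>, and a highest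
  weight word is the reading word of the preimage under \<open>\<phi>\<close>.

  The operations on the right factor become shifts of riggings (or insertions of cosingular strings),
  which commute with the conjugate operators. For \<open>rh\<close>, the shift makes riggings negative, and the
  conjugate of \<open>\<delta>\<close> is the sequence of operators \<open>e\<^sub>a\<close> leading to the highest weight vector. The
  statements on \<open>*\<close> and \<open>R\<close> follow by induction on \<open>B\<close>, since \<open>\<delta>\<close> is injective on configurations of a
  given weight: for \<open>*\<close> one also needs that dual components have the same highest weight, which
  follows from the action of the Weyl group on weights; for \<open>R\<close> the induction removes factors on both
  sides and ends with two factors, whose tensor product is multiplicity free.
\<close>

section \<open>Tensor products of crystals\<close>

text \<open>Taken as a whole, \<delta> and its conjugate interact at several nodes at once. Factored
  into operators at single nodes, only one interaction remains, at one node, and concavity of the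
  vacancy numbers in the string length settles it. The two kinds of operators coincide exactly when
  the vacancy numbers stay at their minimum from the selected length on. What remains after the
  coincidence then has vanishing \<open>phi\<close>, which is the condition under which the tensor
  product rule makes \<open>e_a\<close> act on the removed letter instead of the rest of the word.

  The bijections are given on highest weight vectors only, whereas dropping a right factor leaves
  this set, and \<open>highest\<close> is a definite description. Hence every component must first
  be shown to have exactly one highest weight vector. This is confluence of the raising operators;
  the delicate case is that of two adjacent nodes, a crystal of sl_3, where column insertion
  supplies an invariant of the component.

  Bijectivity of \<phi> replaces the construction of an inverse: a configuration with the right
  bounds is the image of some path, and the word that it reads identifies this path.\<close>

text \<open>The positivity clauses and the last clause force \<open>cr_eps\<close> and
  \<open>cr_phi\<close> to be the string lengths, without mentioning iterated operators.\<close>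

definition normal_at :: "'b crystal \<Rightarrow> nat \<Rightarrow> bool" where
  "normal_at C i \<longleftrightarrow>
     (\<forall>b c. cr_e C i b = Some c \<longleftrightarrow> cr_f C i c = Some b) \<and>
     (\<forall>b. cr_eps C i b > 0 \<longleftrightarrow> cr_e C i b \<noteq> None) \<and>
     (\<forall>b. cr_phi C i b > 0 \<longleftrightarrow> cr_f C i b \<noteq> None) \<and>
     (\<forall>b c. cr_e C i b = Some c \<longrightarrow> cr_eps C i b = Suc (cr_eps C i c) \<and> cr_phi C i c = Suc (cr_phi C i b))"

lemma normal_atD:
  assumes "normal_at C i"
  shows "cr_e C i b = Some c \<longleftrightarrow> cr_f C i c = Some b"
    and "cr_eps C i b > 0 \<longleftrightarrow> cr_e C i b \<noteq> None"
    and "cr_phi C i b > 0 \<longleftrightarrow> cr_f C i b \<noteq> None"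
    and "cr_e C i b = Some c \<Longrightarrow> cr_eps C i b = Suc (cr_eps C i c)"
    and "cr_e C i b = Some c \<Longrightarrow> cr_phi C i c = Suc (cr_phi C i b)"
    and "cr_f C i b = Some c \<Longrightarrow> cr_phi C i b = Suc (cr_phi C i c)"
    and "cr_f C i b = Some c \<Longrightarrow> cr_eps C i c = Suc (cr_eps C i b)"
  using assms unfolding normal_at_def by metis+

lemma tensor_crystal_sel [simp]:
  "cr_e (tensor_crystal C) = tensor_e C" "cr_f (tensor_crystal C) = tensor_f C"
  "cr_eps (tensor_crystal C) = tensor_eps C" "cr_phi (tensor_crystal C) = tensor_phi C"
  by (simp_all add: tensor_crystal_def)

lemma tensor_e_Some:
  assumes "normal_at C i" "tensor_e C i bs = Some cs"
  shows "tensor_f C i cs = Some bs \<and> tensor_eps C i bs = Suc (tensor_eps C i cs) \<and>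
    tensor_phi C i cs = Suc (tensor_phi C i bs)"
  using assms(2)
proof (induction bs arbitrary: cs)
  case (Cons b bs)
  note N = normal_atD[OF assms(1)]
  show ?case
  proof (cases "cr_eps C i b > tensor_phi C i bs")
    case True
    then obtain b' where "cr_e C i b = Some b'" "cs = b' # bs" using Cons.prems by auto
    moreover have "cr_f C i b' = Some b" "cr_eps C i b = Suc (cr_eps C i b')" "cr_phi C i b' = Suc (cr_phi C i b)"
      using N calculation by auto
    ultimately show ?thesis using True by auto
  next
    case False
    then obtain bs' where "tensor_e C i bs = Some bs'" "cs = b # bs'" using Cons.prems by auto
    with Cons.IH[of bs'] False show ?thesis by auto
  qed
qed simp

lemma tensor_f_Some:
  assumes "normal_at C i" "tensor_f C i bs = Some cs"
  shows "tensor_e C i cs = Some bs \<and> tensor_phi C i bs = Suc (tensor_phi C i cs)"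
  using assms(2)
proof (induction bs arbitrary: cs)
  case (Cons b bs)
  note N = normal_atD[OF assms(1)]
  show ?case
  proof (cases "cr_eps C i b \<ge> tensor_phi C i bs")
    case True
    then obtain b' where "cr_f C i b = Some b'" "cs = b' # bs" using Cons.prems by auto
    moreover have "cr_e C i b' = Some b" "cr_eps C i b' = Suc (cr_eps C i b)" "cr_phi C i b = Suc (cr_phi C i b')"
      using N calculation by auto
    ultimately show ?thesis using True by auto
  next
    case False
    then obtain bs' where "tensor_f C i bs = Some bs'" "cs = b # bs'" using Cons.prems by auto
    with Cons.IH[of bs'] False show ?thesis by auto
  qed
qed simp

lemma normal_at_tensor:
  assumes "normal_at C i"
  shows "normal_at (tensor_crystal C) i"
proof -
  note N = normal_atD[OF assms]
  have "tensor_eps C i bs > 0 \<longleftrightarrow> tensor_e C i bs \<noteq> None" for bs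
  proof (induction bs)
    case (Cons b bs)
    have "cr_e C i b \<noteq> None" if "tensor_phi C i bs < cr_eps C i b"
      using N(2)[of b] that by simp
    with Cons.IH show ?case by auto
  qed simp
  moreover have "tensor_phi C i bs > 0 \<longleftrightarrow> tensor_f C i bs \<noteq> None" for bs
  proof (induction bs)
    case (Cons b bs)
    with N(3)[of b] show ?case by (cases "tensor_phi C i bs \<le> cr_eps C i b") auto
  qed simp
  ultimately show ?thesis
    unfolding normal_at_def tensor_crystal_sel
    using tensor_e_Some[OF assms] tensor_f_Some[OF assms] by blast
qed

lemma tensor_eps_phi_append:
  "tensor_eps C i (xs @ ys) = tensor_eps C i ys + (tensor_eps C i xs - tensor_phi C i ys)"
  "tensor_phi C i (xs @ ys) = tensor_phi C i xs + (tensor_phi C i ys - tensor_eps C i xs)"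
  by (induction xs) auto

text \<open>Associativity of the tensor product: a whole block of factors obeys the same rule as a
  single one.\<close>

lemma tensor_e_append:
  "tensor_e C i (xs @ ys) =
    (if tensor_eps C i xs > tensor_phi C i ys then map_option (\<lambda>xs'. xs' @ ys) (tensor_e C i xs)
     else map_option ((@) xs) (tensor_e C i ys))"
proof (induction xs)
  case Nil
  show ?case by (cases "tensor_e C i ys") auto
next
  case (Cons x xs)
  consider "cr_eps C i x > tensor_phi C i (xs @ ys)"
    | "\<not> cr_eps C i x > tensor_phi C i (xs @ ys)" "tensor_eps C i xs > tensor_phi C i ys"
    | "\<not> cr_eps C i x > tensor_phi C i (xs @ ys)" "\<not> tensor_eps C i xs > tensor_phi C i ys"
    by blast
  then show ?case
    using Cons.IH by cases (auto simp: tensor_eps_phi_append option.map_comp comp_def)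
qed

text \<open>Through this flattening a path, which is a list of lists of lists, may be replaced by
  its reading word; from here on the classical crystal structure is studied on words of
  letters.\<close>

lemma tensor_flatten:
  "tensor_eps (tensor_crystal C) i bss = tensor_eps C i (concat bss)"
  "tensor_phi (tensor_crystal C) i bss = tensor_phi C i (concat bss)"
  by (induction bss) (auto simp: tensor_eps_phi_append)

lemma tensor_e_flatten:
  "map_option concat (tensor_e (tensor_crystal C) i bss) = tensor_e C i (concat bss)"
proof (induction bss)
  case (Cons b bss)
  show ?case
    unfolding concat.simps tensor_e_append tensor_e.simps tensor_crystal_sel tensor_flatten Cons.IH[symmetric]
    by (auto simp: option.map_comp comp_def)
qed simp

lemma tensor_e_length: "tensor_e C i bs = Some cs \<Longrightarrow> length cs = length bs"
  by (induction bs arbitrary: cs) (auto split: if_splits)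

lemma tensor_e_map:
  assumes "\<And>b c. cr_e C i b = Some c \<Longrightarrow> g c = g b" "tensor_e C i bs = Some cs"
  shows "map g cs = map g bs"
  using assms(2) by (induction bs arbitrary: cs) (auto split: if_splits simp: assms(1))

text \<open>At a node where two factor crystals agree, so do their tensor powers.
  \<open>KR_crystal\<close> agrees with the crystal of columns at every node except 0, where the
  twist enters.\<close>

lemma tensor_cong:
  assumes "cr_e C i = cr_e D i" "cr_f C i = cr_f D i" "cr_eps C i = cr_eps D i" "cr_phi C i = cr_phi D i"
  shows "tensor_e C i = tensor_e D i" "tensor_f C i = tensor_f D i"
    "tensor_eps C i = tensor_eps D i" "tensor_phi C i = tensor_phi D i"
proof -
  have A: "tensor_eps C i bs = tensor_eps D i bs \<and> tensor_phi C i bs = tensor_phi D i bs" for bs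
    by (induction bs) (auto simp: assms)
  then show "tensor_eps C i = tensor_eps D i" "tensor_phi C i = tensor_phi D i" by auto
  have "tensor_e C i bs = tensor_e D i bs" for bs
    by (induction bs) (auto simp: assms A)
  then show "tensor_e C i = tensor_e D i" by auto
  have "tensor_f C i bs = tensor_f D i bs" for bs
    by (induction bs) (auto simp: assms A)
  then show "tensor_f C i = tensor_f D i" by auto
qed

section \<open>Letters and words\<close>

lemma letter_crystal_sel [simp]:
  "cr_e (letter_crystal T) = letter_e T" "cr_f (letter_crystal T) = letter_f T"
  "cr_eps (letter_crystal T) i c = (if letter_e T i c = None then 0 else 1)"
  "cr_phi (letter_crystal T) i c = (if letter_f T i c = None then 0 else 1)"
  by (simp_all add: letter_crystal_def)

lemma classical_nodes_cases:
  assumes "i \<in> classical_nodes T" "valid_type T"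
  obtains (A) n where "T = TypeA n" "1 \<le> i" "i \<le> n"
    | (D) n where "T = TypeD n" "1 \<le> i" "i < n" "4 \<le> n"
    | (Dn) n where "T = TypeD n" "i = n" "4 \<le> n"
  using assms by (cases T) (auto simp: classical_nodes_def, fastforce)

lemma normal_at_letter:
  assumes "i \<in> classical_nodes T" "valid_type T"
  shows "normal_at (letter_crystal T) i"
  using assms by (cases rule: classical_nodes_cases) (auto simp: normal_at_def)

abbreviation "w_eps T \<equiv> tensor_eps (letter_crystal T)"
abbreviation "w_phi T \<equiv> tensor_phi (letter_crystal T)"
abbreviation "w_e T \<equiv> tensor_e (letter_crystal T)"
abbreviation "w_f T \<equiv> tensor_f (letter_crystal T)"

text \<open>The pairing of the weight of a letter with the simple coroot of node \<open>i\<close>.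
  In contrast to \<open>eps\<close> and \<open>phi\<close> it is additive along words.\<close>

definition letter_wt :: "affine_type \<Rightarrow> nat \<Rightarrow> int \<Rightarrow> int" where
  "letter_wt T i c = (if letter_f T i c = None then 0 else 1) - (if letter_e T i c = None then 0 else 1)"

lemma w_wt_Cons:
  "int (w_phi T i (x # w)) - int (w_eps T i (x # w)) =
    letter_wt T i x + (int (w_phi T i w) - int (w_eps T i w))"
  by (auto simp: letter_wt_def)

lemma w_wt_append:
  "int (w_phi T i (v @ w)) - int (w_eps T i (v @ w)) =
    (int (w_phi T i v) - int (w_eps T i v)) + (int (w_phi T i w) - int (w_eps T i w))"
  by (auto simp: tensor_eps_phi_append)

definition w_hw :: "affine_type \<Rightarrow> int list \<Rightarrow> bool" where
  "w_hw T w \<longleftrightarrow> (\<forall>i\<in>classical_nodes T. w_eps T i w = 0)"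

text \<open>Steps are oriented towards highest weight vectors, which turns their uniqueness into
  confluence of a terminating relation.\<close>

definition w_up :: "affine_type \<Rightarrow> int list \<Rightarrow> int list \<Rightarrow> bool" where
  "w_up T v w \<longleftrightarrow> (\<exists>i\<in>classical_nodes T. w_e T i v = Some w)"

definition path_word :: "path \<Rightarrow> int list" where
  "path_word b = concat (concat b)"

text \<open>The information lost in passing from a path to its word. Crystal operators leave it
  unchanged, so word and lengths together determine a path and its images.\<close>

definition path_lens :: "path \<Rightarrow> nat list list" where
  "path_lens b = map (map length) b"

lemma columns_word_inj:
  "concat b = concat c \<Longrightarrow> map length b = map length c \<Longrightarrow> b = c"
proof (induction b arbitrary: c)
  case (Cons x b)
  then obtain y c' where "c = y # c'" by (cases c) auto
  with Cons show ?case by auto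
qed auto

lemma path_word_inj:
  assumes "path_word b = path_word c" "path_lens b = path_lens c"
  shows "b = c"
proof -
  have L: "map length (concat d) = concat (path_lens d)" for d :: path
    by (simp add: path_lens_def map_concat)
  have "concat b = concat c"
    by (rule columns_word_inj) (use assms in \<open>auto simp: path_word_def L\<close>)
  moreover have "map length b = map length c"
    using arg_cong[OF assms(2), of "map length"] by (simp add: path_lens_def comp_def)
  ultimately show ?thesis by (rule columns_word_inj)
qed

lemma KR_crystal_sel:
  assumes "i \<noteq> 0"
  shows "cr_e (KR_crystal T) i = tensor_e (tensor_crystal (letter_crystal T)) i"
    "cr_f (KR_crystal T) i = tensor_f (tensor_crystal (letter_crystal T)) i"
    "cr_eps (KR_crystal T) i = tensor_eps (tensor_crystal (letter_crystal T)) i"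
    "cr_phi (KR_crystal T) i = tensor_phi (tensor_crystal (letter_crystal T)) i"
  using assms by (auto simp: KR_crystal_def Let_def fun_eq_iff)

lemma classical_node_pos: "i \<in> classical_nodes T \<Longrightarrow> i \<noteq> 0"
  by (simp add: classical_nodes_def)

lemma path_crystal_eq:
  assumes "i \<noteq> 0"
  shows "cr_e (path_crystal T) i = tensor_e (tensor_crystal (tensor_crystal (letter_crystal T))) i"
    "cr_f (path_crystal T) i = tensor_f (tensor_crystal (tensor_crystal (letter_crystal T))) i"
    "cr_eps (path_crystal T) i = tensor_eps (tensor_crystal (tensor_crystal (letter_crystal T))) i"
    "cr_phi (path_crystal T) i = tensor_phi (tensor_crystal (tensor_crystal (letter_crystal T))) i"
  unfolding path_crystal_def tensor_crystal_sel
  by (rule tensor_cong; simp add: KR_crystal_sel[OF assms])+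

lemma path_eps_phi:
  assumes "i \<noteq> 0"
  shows "cr_eps (path_crystal T) i b = w_eps T i (path_word b)"
    "cr_phi (path_crystal T) i b = w_phi T i (path_word b)"
  unfolding path_crystal_eq[OF assms] tensor_flatten path_word_def by auto

lemma path_e_word:
  assumes "i \<noteq> 0"
  shows "map_option path_word (cr_e (path_crystal T) i b) = w_e T i (path_word b)"
proof -
  have "map_option path_word (cr_e (path_crystal T) i b) =
    map_option concat (map_option concat (tensor_e (tensor_crystal (tensor_crystal (letter_crystal T))) i b))"
    unfolding path_crystal_eq[OF assms] by (simp add: option.map_comp comp_def path_word_def[abs_def])
  then show ?thesis unfolding tensor_e_flatten path_word_def .
qed

lemma path_e_lens:
  assumes "i \<noteq> 0" "cr_e (path_crystal T) i b = Some c"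
  shows "path_lens c = path_lens b"
  unfolding path_lens_def
proof (rule tensor_e_map)
  show "tensor_e (tensor_crystal (tensor_crystal (letter_crystal T))) i b = Some c"
    using assms(2) unfolding path_crystal_eq[OF assms(1)] .
  show "map length c' = map length b'" if "cr_e (tensor_crystal (tensor_crystal (letter_crystal T))) i b' = Some c'" for b' c'
    by (rule tensor_e_map[OF _ that[unfolded tensor_crystal_sel]]) (auto simp: tensor_e_length)
qed

lemma normal_at_path:
  assumes "i \<in> classical_nodes T" "valid_type T"
  shows "normal_at (path_crystal T) i"
proof -
  have "normal_at (tensor_crystal (tensor_crystal (tensor_crystal (letter_crystal T)))) i"
    by (intro normal_at_tensor normal_at_letter assms)
  then show ?thesis
    unfolding normal_at_def tensor_crystal_sel path_crystal_eq[OF classical_node_pos[OF assms(1)]] .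
qed

lemma path_e_iff:
  assumes "i \<in> classical_nodes T" "valid_type T"
  shows "cr_e (path_crystal T) i b = Some c \<longleftrightarrow>
    w_e T i (path_word b) = Some (path_word c) \<and> path_lens c = path_lens b"
proof
  note i0 = classical_node_pos[OF assms(1)]
  show "cr_e (path_crystal T) i b = Some c \<Longrightarrow>
    w_e T i (path_word b) = Some (path_word c) \<and> path_lens c = path_lens b"
    using path_e_word[OF i0, of T b] path_e_lens[OF i0, of T b] by auto
  assume R: "w_e T i (path_word b) = Some (path_word c) \<and> path_lens c = path_lens b"
  then obtain d where d: "cr_e (path_crystal T) i b = Some d" "path_word d = path_word c"
    using path_e_word[OF i0, of T b] by auto
  then have "d = c" using R path_e_lens[OF i0 d(1)] by (intro path_word_inj) auto
  with d show "cr_e (path_crystal T) i b = Some c" by simp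
qed

lemma path_e_lift:
  assumes "i \<in> classical_nodes T" "w_e T i (path_word b) = Some w"
  obtains c where "cr_e (path_crystal T) i b = Some c" "path_word c = w"
  using path_e_word[OF classical_node_pos[OF assms(1)], of T b] assms(2) by auto

lemma classical_hw_word: "classical_hw T b \<longleftrightarrow> w_hw T (path_word b)"
  unfolding classical_hw_def w_hw_def using path_eps_phi(1) classical_node_pos by simp

lemma path_weight_word:
  "i \<in> classical_nodes T \<Longrightarrow> path_weight T b i = int (w_phi T i (path_word b)) - int (w_eps T i (path_word b))"
  unfolding path_weight_def using path_eps_phi classical_node_pos by simp

lemma classical_arrow_e:
  assumes "valid_type T"
  shows "classical_arrow T b c \<longleftrightarrow> (\<exists>i\<in>classical_nodes T. cr_e (path_crystal T) i c = Some b)"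
  unfolding classical_arrow_def using normal_atD(1)[OF normal_at_path[OF _ assms]] by blast

lemma classical_arrow_word:
  assumes "valid_type T"
  shows "classical_arrow T b c \<longleftrightarrow> w_up T (path_word c) (path_word b) \<and> path_lens b = path_lens c"
  unfolding classical_arrow_e[OF assms] w_up_def using path_e_iff[OF _ assms] by blast

section \<open>Uniqueness of highest weight vectors\<close>

text \<open>
  Words in the letters 1, 2, 3 are mapped to their insertion tableaux. A semistandard tableau with
  row lengths \<open>A \<ge> B \<ge> C\<close> is encoded by the Gelfand--Tsetlin pattern \<open>(A, B, C, d, e, f)\<close>, where
  \<open>d\<close> and \<open>e\<close> count the letters at most 2 in the first two rows and \<open>f\<close> counts the letters 1.
\<close>

type_synonym gt = "nat \<times> nat \<times> nat \<times> nat \<times> nat \<times> nat"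

fun gt_ok :: "gt \<Rightarrow> bool" where
  "gt_ok (A, B, C, d, e, f) \<longleftrightarrow> d \<le> A \<and> B \<le> d \<and> e \<le> B \<and> C \<le> e \<and> f \<le> d \<and> e \<le> f"

text \<open>Column insertion.\<close>

fun gt_ins :: "int \<Rightarrow> gt \<Rightarrow> gt" where
  "gt_ins x (A, B, C, d, e, f) =
    (if x = 1 then (A + 1, B, C, d + 1, e, f + 1)
     else if x = 2 then
       (if f = e then (A + 1, B, C, d + 1, e, f)
        else if d > B then (A, B + 1, C, d, e + 1, f) else (A + 1, B, C, d, e + 1, f))
     else (if e > C then (A, B, C + 1, d, e, f)
        else if d > B then (A, B + 1, C, d, e, f) else (A + 1, B, C, d, e, f)))"

definition gt_of :: "int list \<Rightarrow> gt" where
  "gt_of w = foldr gt_ins w (0, 0, 0, 0, 0, 0)"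

lemma gt_of_simps [simp]: "gt_of [] = (0, 0, 0, 0, 0, 0)" "gt_of (x # w) = gt_ins x (gt_of w)"
  by (simp_all add: gt_of_def)

text \<open>Row 1 holds \<open>f\<close> ones, \<open>d - f\<close> twos and \<open>A - d\<close>
  threes, row 2 holds \<open>e\<close> twos and \<open>B - e\<close> threes, row 3 holds
  \<open>C\<close> threes. What is counted is left over after the twos of row 2 are cancelled
  against ones, the threes of row 3 against twos of row 2, and the threes of row 2 against twos of
  row 1; only the last cancellation can be incomplete on either side.\<close>

fun gt_eps :: "nat \<Rightarrow> gt \<Rightarrow> nat" where
  "gt_eps i (A, B, C, d, e, f) = (if i = 1 then d - f else (A - d) + ((B - e) - (d - f)))"

fun gt_phi :: "nat \<Rightarrow> gt \<Rightarrow> nat" where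
  "gt_phi i (A, B, C, d, e, f) = (if i = 1 then f - e else (e - C) + ((d - f) - (B - e)))"

fun gt_e :: "nat \<Rightarrow> gt \<Rightarrow> gt" where
  "gt_e i (A, B, C, d, e, f) =
    (if i = 1 then (A, B, C, d, e, f + 1)
     else if B - e > d - f then (A, B, C, d, e + 1, f) else (A, B, C, d + 1, e, f))"

fun gt_shape :: "gt \<Rightarrow> nat \<times> nat \<times> nat" where
  "gt_shape (A, B, C, d, e, f) = (A, B, C)"

lemma gt_shape_e: "gt_shape (gt_e i g) = gt_shape g"
  by (cases g) auto

lemma letter_A2:
  assumes "i \<in> {1, 2}" "x \<in> {1, 2, 3}"
  shows "letter_e (TypeA 2) i x = (if x = int i + 1 then Some (x - 1) else None)"
    "letter_f (TypeA 2) i x = (if x = int i then Some (x + 1) else None)"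
  using assms by auto

text \<open>Nonnegative increments absorb all interlacing inequalities except
  \<open>B \<le> d\<close>, which survives as \<open>s \<le> r + p\<close>. In these parameters the
  truncated subtractions are within reach of linear arithmetic.\<close>

lemma gt_params:
  assumes "gt_ok (A, B, C, d, e, f)"
  obtains p q r s t where "e = C + t" "B = C + t + s" "f = C + t + r" "d = C + t + r + p" "A = C + t + r + p + q" "s \<le> r + p"
proof -
  have "e = C + (e - C)" "B = C + (e - C) + (B - e)" "f = C + (e - C) + (f - e)" "d = C + (e - C) + (f - e) + (d - f)"
     "A = C + (e - C) + (f - e) + (d - f) + (A - d)" "B - e \<le> (f - e) + (d - f)"
    using assms by auto
  then show ?thesis using that by blast
qed

text \<open>Insertion of a letter is a morphism from the tensor product of a letter and a tableau.
  The last two claims are the two branches of the tensor product rule: the operator acts on the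
  inserted letter, or on the tableau.\<close>

lemma gt_ins_crystal:
  assumes "gt_ok g" "x \<in> {1, 2, 3}" "i \<in> {1, 2}"
  shows "gt_ok (gt_ins x g)"
    and "gt_eps i (gt_ins x g) = gt_eps i g + ((if x = int i + 1 then 1 else 0) - gt_phi i g)"
    and "gt_phi i (gt_ins x g) = (if x = int i then 1 else 0) + (gt_phi i g - (if x = int i + 1 then 1 else 0))"
    and "x = int i + 1 \<Longrightarrow> gt_phi i g = 0 \<Longrightarrow> gt_ins (x - 1) g = gt_e i (gt_ins x g)"
    and "x \<noteq> int i + 1 \<or> gt_phi i g \<noteq> 0 \<Longrightarrow> gt_eps i g > 0 \<Longrightarrow> gt_ins x (gt_e i g) = gt_e i (gt_ins x g)"
proof -
  obtain A B C d e f where g: "g = (A, B, C, d, e, f)" by (metis prod_cases6)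
  obtain p q r s t where *: "e = C + t" "B = C + t + s" "f = C + t + r" "d = C + t + r + p"
    "A = C + t + r + p + q" "s \<le> r + p"
    using gt_params assms(1) unfolding g by metis
  show "gt_ok (gt_ins x g)" using assms(1) by (cases g) auto
  show "gt_eps i (gt_ins x g) = gt_eps i g + ((if x = int i + 1 then 1 else 0) - gt_phi i g)"
    using assms(2,3) * unfolding g by (elim insertE emptyE) (simp; linarith?)+
  show "gt_phi i (gt_ins x g) = (if x = int i then 1 else 0) + (gt_phi i g - (if x = int i + 1 then 1 else 0))"
    using assms(2,3) * unfolding g by (elim insertE emptyE) (simp; linarith?)+
  show "gt_ins (x - 1) g = gt_e i (gt_ins x g)" if "x = int i + 1" "gt_phi i g = 0"
    using that assms(3) * unfolding g by (elim insertE emptyE) (simp split: if_split; linarith?)+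
  show "gt_ins x (gt_e i g) = gt_e i (gt_ins x g)" if "x \<noteq> int i + 1 \<or> gt_phi i g \<noteq> 0" "gt_eps i g > 0"
    using that assms(2,3) * unfolding g by (elim insertE emptyE) (simp split: if_split; linarith?)+
qed

lemma gt_of_crystal:
  assumes "set w \<subseteq> {1, 2, 3}"
  shows "gt_ok (gt_of w)"
    and "i \<in> {1, 2} \<Longrightarrow> gt_eps i (gt_of w) = w_eps (TypeA 2) i w"
    and "i \<in> {1, 2} \<Longrightarrow> gt_phi i (gt_of w) = w_phi (TypeA 2) i w"
    and "i \<in> {1, 2} \<Longrightarrow> w_e (TypeA 2) i w = Some w' \<Longrightarrow> gt_of w' = gt_e i (gt_of w)"
proof -
  have "gt_ok (gt_of w) \<and> (\<forall>i\<in>{1, 2}. gt_eps i (gt_of w) = w_eps (TypeA 2) i w \<and>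
    gt_phi i (gt_of w) = w_phi (TypeA 2) i w \<and>
    (\<forall>w'. w_e (TypeA 2) i w = Some w' \<longrightarrow> gt_of w' = gt_e i (gt_of w)))"
    using assms
  proof (induction w)
    case (Cons x w)
    have x: "x \<in> {1, 2, 3}" using Cons.prems by auto
    have IH: "gt_ok (gt_of w)"
      "\<And>i. i \<in> {1, 2} \<Longrightarrow> w_eps (TypeA 2) i w = gt_eps i (gt_of w)"
      "\<And>i. i \<in> {1, 2} \<Longrightarrow> w_phi (TypeA 2) i w = gt_phi i (gt_of w)"
      "\<And>i w'. i \<in> {1, 2} \<Longrightarrow> w_e (TypeA 2) i w = Some w' \<Longrightarrow> gt_of w' = gt_e i (gt_of w)"
      using Cons by auto
    have pos: "gt_eps i (gt_of w) > 0" if "i \<in> {1, 2}" "w_e (TypeA 2) i w = Some w'" for i w'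
    proof -
      have "normal_at (tensor_crystal (letter_crystal (TypeA 2))) i"
        using that(1) by (intro normal_at_tensor normal_at_letter) (auto simp: classical_nodes_def)
      from normal_atD(2)[OF this, of w] that show ?thesis using IH(2)[OF that(1)] by simp
    qed
    have 1: "gt_eps i (gt_of (x # w)) = w_eps (TypeA 2) i (x # w)"
        "gt_phi i (gt_of (x # w)) = w_phi (TypeA 2) i (x # w)" if i: "i \<in> {1, 2}" for i
      unfolding gt_of_simps gt_ins_crystal(2,3)[OF IH(1) x i] by (simp_all add: IH(2,3)[OF i] letter_A2[OF i x])
    have "gt_of w' = gt_e i (gt_of (x # w))" if i: "i \<in> {1, 2}" and w': "w_e (TypeA 2) i (x # w) = Some w'" for i w'
    proof (cases "x = int i + 1 \<and> gt_phi i (gt_of w) = 0")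
      case True
      then have "w' = (x - 1) # w" using w' by (simp add: IH(3)[OF i] letter_A2[OF i x])
      with True gt_ins_crystal(4)[OF IH(1) x i] show ?thesis by simp
    next
      case False
      then obtain v where v: "w_e (TypeA 2) i w = Some v" "w' = x # v"
        using w' by (auto simp: IH(3)[OF i] letter_A2[OF i x] split: if_splits)
      from False gt_ins_crystal(5)[OF IH(1) x i] IH(4)[OF i v(1)] pos[OF i v(1)] v(2) show ?thesis by auto
    qed
    with 1 gt_ins_crystal(1)[OF IH(1) x, of 1] show ?case by simp
  qed auto
  then show "gt_ok (gt_of w)"
    and "i \<in> {1, 2} \<Longrightarrow> gt_eps i (gt_of w) = w_eps (TypeA 2) i w"
    and "i \<in> {1, 2} \<Longrightarrow> gt_phi i (gt_of w) = w_phi (TypeA 2) i w"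
    and "i \<in> {1, 2} \<Longrightarrow> w_e (TypeA 2) i w = Some w' \<Longrightarrow> gt_of w' = gt_e i (gt_of w)"
    by blast+
qed

section \<open>Two adjacent nodes: reduction to crystals of sl_3\<close>

definition adjacent_nodes :: "affine_type \<Rightarrow> nat \<Rightarrow> nat \<Rightarrow> bool" where
  "adjacent_nodes T i j \<longleftrightarrow> i \<in> classical_nodes T \<and> j \<in> classical_nodes T \<and> i \<noteq> j \<and> cartan T i j \<noteq> 0"

lemma adjacent_nodes_cases:
  assumes "adjacent_nodes T i j" "valid_type T"
  obtains n where "T = TypeA n" "1 \<le> i" "i < n" "j = Suc i"
  | n where "T = TypeA n" "1 \<le> j" "j < n" "i = Suc j"
  | n where "T = TypeD n" "4 \<le> n" "1 \<le> i" "Suc i < n" "j = Suc i"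
  | n where "T = TypeD n" "4 \<le> n" "1 \<le> j" "Suc j < n" "i = Suc j"
  | n m where "T = TypeD n" "4 \<le> n" "n = m + 2" "i = m" "j = n"
  | n m where "T = TypeD n" "4 \<le> n" "n = m + 2" "j = m" "i = n"
proof -
  have edge: "dynkin_edge T i j \<or> dynkin_edge T j i" and ij: "i \<in> classical_nodes T" "j \<in> classical_nodes T"
    using assms(1) unfolding adjacent_nodes_def cartan_def by (auto split: if_splits)
  show ?thesis
  proof (cases T)
    case (TypeA n)
    have "1 \<le> i \<and> i < n \<and> j = Suc i \<or> 1 \<le> j \<and> j < n \<and> i = Suc j"
      using edge ij by (auto simp: TypeA dynkin_edge_def classical_nodes_def)
    then show ?thesis using that(1,2)[OF TypeA] by blast
  next
    case (TypeD n)
    have n: "4 \<le> n" using assms(2) by (simp add: TypeD)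
    have e: "dynkin_edge T a b \<Longrightarrow> a \<in> classical_nodes T \<Longrightarrow>
        1 \<le> a \<and> Suc a < n \<and> b = Suc a \<or> n = a + 2 \<and> b = n" for a b
      using n unfolding TypeD dynkin_edge_def classical_nodes_def by (simp, linarith)
    from e[of i j] e[of j i] edge ij
    consider "1 \<le> i \<and> Suc i < n \<and> j = Suc i" | "n = i + 2 \<and> j = n"
      | "1 \<le> j \<and> Suc j < n \<and> i = Suc j" | "n = j + 2 \<and> i = n" by blast
    then show ?thesis using that(3-6)[OF TypeD n] by cases blast+
  qed
qed

text \<open>
  Restricted to two adjacent nodes, the crystal of letters is a union of copies of the crystals of
  the vector representation of \<open>sl\<^sub>3\<close>, of its dual (realised on columns of height two), and of
  trivial crystals.
\<close>

definition A2_letter :: "affine_type \<Rightarrow> nat \<Rightarrow> nat \<Rightarrow> int \<Rightarrow> int list" where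
  "A2_letter T i j c =
    (if letter_f T i c \<noteq> None then (if letter_e T j c \<noteq> None then [3, 1] else [1])
     else if letter_e T i c \<noteq> None then (if letter_f T j c \<noteq> None then [2] else [3, 2])
     else if letter_f T j c \<noteq> None then [2, 1]
     else if letter_e T j c \<noteq> None then [3] else [])"

lemma letter_ef:
  assumes "i \<in> classical_nodes T" "valid_type T"
  shows "letter_e T i c = Some d \<longleftrightarrow> letter_f T i d = Some c"
  using normal_atD(1)[OF normal_at_letter[OF assms]] by simp

text \<open>The vector representation is minuscule, so strings have length at most one. A weight
  pairing to 1 with two adjacent simple coroots would pair to 2 with their sum, again a coroot;
  hence there are no two outgoing arrows, and likewise no two incoming ones.\<close>

lemma pair_letter_status:
  assumes "adjacent_nodes T i j" "valid_type T"
  shows "letter_e T i c = None \<or> letter_f T i c = None" (is ?A)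
    "letter_e T i c = None \<or> letter_e T j c = None" (is ?B)
    "letter_f T i c = None \<or> letter_f T j c = None" (is ?C)
proof -
  have "?A \<and> ?B \<and> ?C"
    using assms [[linarith_neq_limit = 1]] by (cases rule: adjacent_nodes_cases; simp)
  then show ?A ?B ?C by simp_all
qed

lemma pair_letter_e:
  assumes "adjacent_nodes T i j" "valid_type T" "letter_e T i c = Some d"
  shows "letter_f T i d = Some c" (is ?A)
    "letter_f T j c = None \<longleftrightarrow> letter_e T j d \<noteq> None" (is ?B)
    "letter_f T j d = None" (is ?C)
proof -
  have "?A \<and> ?B \<and> ?C"
    using assms [[linarith_neq_limit = 1]] by (cases rule: adjacent_nodes_cases; simp split: if_splits; elim disjE; simp)
  then show ?A ?B ?C by simp_all
qed

lemma adjacent_nodes_sym: "adjacent_nodes T i j \<longleftrightarrow> adjacent_nodes T j i"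
  by (auto simp: adjacent_nodes_def cartan_def)

lemma A2_letter_crystal:
  assumes "adjacent_nodes T i j" "valid_type T"
  shows "w_eps (TypeA 2) 1 (A2_letter T i j c) = cr_eps (letter_crystal T) i c"
    "w_phi (TypeA 2) 1 (A2_letter T i j c) = cr_phi (letter_crystal T) i c"
    "w_eps (TypeA 2) 2 (A2_letter T i j c) = cr_eps (letter_crystal T) j c"
    "w_phi (TypeA 2) 2 (A2_letter T i j c) = cr_phi (letter_crystal T) j c"
  using pair_letter_status[OF assms, of c] pair_letter_status[OF assms(1)[unfolded adjacent_nodes_sym[of T i]] assms(2), of c]
  by (auto simp: A2_letter_def)

lemma A2_letter_e:
  assumes "adjacent_nodes T i j" "valid_type T"
  shows "w_e (TypeA 2) 1 (A2_letter T i j c) = map_option (A2_letter T i j) (letter_e T i c)"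
    "w_e (TypeA 2) 2 (A2_letter T i j c) = map_option (A2_letter T i j) (letter_e T j c)"
proof -
  note S = pair_letter_status[OF assms] pair_letter_status[OF assms(1)[unfolded adjacent_nodes_sym[of T i]] assms(2)]
  note E = pair_letter_e[OF assms] pair_letter_e[OF assms(1)[unfolded adjacent_nodes_sym[of T i]] assms(2)]
  show "w_e (TypeA 2) 1 (A2_letter T i j c) = map_option (A2_letter T i j) (letter_e T i c)"
  proof (cases "letter_e T i c")
    case None
    then show ?thesis unfolding A2_letter_def by (simp split: if_split)
  next
    case (Some d)
    then show ?thesis using S(1,2)[of c] E(1-3)[OF Some] unfolding A2_letter_def by (simp split: if_split)
  qed
  show "w_e (TypeA 2) 2 (A2_letter T i j c) = map_option (A2_letter T i j) (letter_e T j c)"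
  proof (cases "letter_e T j c")
    case None
    then show ?thesis unfolding A2_letter_def by (simp split: if_split)
  next
    case (Some d)
    then show ?thesis using S(4,5)[of c] S(1)[of d] E(4-6)[OF Some] unfolding A2_letter_def by (simp split: if_split)
  qed
qed

text \<open>The top of the component of a letter under two adjacent nodes. Such components have one
  or three elements, so two raising steps are enough; which node comes first tells the vector
  representation from its dual.\<close>

definition pair_top :: "affine_type \<Rightarrow> nat \<Rightarrow> nat \<Rightarrow> int \<Rightarrow> int" where
  "pair_top T i j x = (case letter_e T i x of
      Some y \<Rightarrow> (case letter_e T j y of Some z \<Rightarrow> z | None \<Rightarrow> y)
    | None \<Rightarrow> (case letter_e T j x of
        Some y \<Rightarrow> (case letter_e T i y of Some z \<Rightarrow> z | None \<Rightarrow> y)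
      | None \<Rightarrow> x))"

lemma pair_top_e:
  assumes "adjacent_nodes T i j" "valid_type T" "letter_e T i x = Some y \<or> letter_e T j x = Some y"
  shows "pair_top T i j x = pair_top T i j y"
proof -
  note S = pair_letter_status[OF assms(1,2)] pair_letter_status[OF assms(1)[unfolded adjacent_nodes_sym[of T i]] assms(2)]
  note E = pair_letter_e[OF assms(1,2)] pair_letter_e[OF assms(1)[unfolded adjacent_nodes_sym[of T i]] assms(2)]
  from assms(3) show ?thesis
  proof
    assume x: "letter_e T i x = Some y"
    show ?thesis
      using x S(1)[of y] E(1)[OF x] E(5)[of y] by (cases "letter_e T j y") (auto simp: pair_top_def)
  next
    assume x: "letter_e T j x = Some y"
    show ?thesis
      using x S(1,2,4)[of y] S(2)[of x] E(4)[OF x] E(2)[of y] by (cases "letter_e T i y") (auto simp: pair_top_def)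
  qed
qed

text \<open>The small components of letters are multiplicity free: once the component is fixed by
  its top, the weight at both nodes singles out the letter.\<close>

lemma pair_top_inj:
  assumes "adjacent_nodes T i j" "valid_type T" "pair_top T i j x = pair_top T i j y"
    "letter_wt T i x = letter_wt T i y" "letter_wt T j x = letter_wt T j y"
  shows "x = y"
proof -
  note S = pair_letter_status[OF assms(1,2)] pair_letter_status[OF assms(1)[unfolded adjacent_nodes_sym[of T i]] assms(2)]
  note E = pair_letter_e[OF assms(1,2)] pair_letter_e[OF assms(1)[unfolded adjacent_nodes_sym[of T i]] assms(2)]
  have I: "i \<in> classical_nodes T" "j \<in> classical_nodes T" using assms(1) by (auto simp: adjacent_nodes_def)
  note ef = letter_ef[OF I(1) assms(2)] letter_ef[OF I(2) assms(2)]
  have e: "letter_wt T k c = - 1 \<longleftrightarrow> letter_e T k c \<noteq> None" if "k = i \<or> k = j" for k c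
    using that S(1,4)[of c] by (auto simp: letter_wt_def)
  have f: "letter_wt T k c = 1 \<longleftrightarrow> letter_f T k c \<noteq> None" if "k = i \<or> k = j" for k c
    using that S(1,4)[of c] by (auto simp: letter_wt_def)
  have ne: "letter_e T k x = None \<longleftrightarrow> letter_e T k y = None" if "k = i \<or> k = j" for k
    using e[OF that, of x] e[OF that, of y] assms(4,5) that by auto
  have nf: "letter_f T k x = None \<longleftrightarrow> letter_f T k y = None" if "k = i \<or> k = j" for k
    using f[OF that, of x] f[OF that, of y] assms(4,5) that by auto
  consider (i) x1 y1 where "letter_e T i x = Some x1" "letter_e T i y = Some y1"
    | (j) x1 y1 where "letter_e T i x = None" "letter_e T i y = None" "letter_e T j x = Some x1" "letter_e T j y = Some y1"
    | (none) "letter_e T i x = None" "letter_e T i y = None" "letter_e T j x = None" "letter_e T j y = None"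
    using ne[of i] ne[of j]
    by (cases "letter_e T i x"; cases "letter_e T i y"; cases "letter_e T j x"; cases "letter_e T j y") auto
  then show ?thesis
  proof cases
    case i
    have iff: "letter_e T j x1 = None \<longleftrightarrow> letter_e T j y1 = None"
      using E(2)[OF i(1)] E(2)[OF i(2)] nf[of j] by auto
    have "x1 = y1"
    proof (cases "letter_e T j x1")
      case None
      with iff have "letter_e T j y1 = None" by simp
      with None assms(3) i show ?thesis by (simp add: pair_top_def)
    next
      case (Some a)
      with iff obtain b where b: "letter_e T j y1 = Some b" by auto
      with Some assms(3) i have "a = b" by (simp add: pair_top_def)
      with Some b ef show ?thesis by simp
    qed
    with i show ?thesis by (simp add: ef)
  next
    case j
    have iff: "letter_e T i x1 = None \<longleftrightarrow> letter_e T i y1 = None"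
      using E(5)[OF j(3)] E(5)[OF j(4)] nf[of i] by auto
    have "x1 = y1"
    proof (cases "letter_e T i x1")
      case None
      with iff have "letter_e T i y1 = None" by simp
      with None assms(3) j show ?thesis by (simp add: pair_top_def)
    next
      case (Some a)
      with iff obtain b where b: "letter_e T i y1 = Some b" by auto
      with Some assms(3) j have "a = b" by (simp add: pair_top_def)
      with Some b ef show ?thesis by simp
    qed
    with j show ?thesis by (simp add: ef)
  next
    case none
    with assms(3) show ?thesis by (simp add: pair_top_def)
  qed
qed

lemma tensor_hom:
  assumes "\<And>c. cr_eps D k (g c) = cr_eps C i c" "\<And>c. cr_phi D k (g c) = cr_phi C i c"
    "\<And>c. cr_e D k (g c) = map_option g (cr_e C i c)"
  shows "tensor_eps D k (map g w) = tensor_eps C i w" "tensor_phi D k (map g w) = tensor_phi C i w"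
    "tensor_e D k (map g w) = map_option (map g) (tensor_e C i w)"
proof -
  have A: "tensor_eps D k (map g v) = tensor_eps C i v \<and> tensor_phi D k (map g v) = tensor_phi C i v" for v
    by (induction v) (auto simp: assms)
  then show "tensor_eps D k (map g w) = tensor_eps C i w" "tensor_phi D k (map g w) = tensor_phi C i w" by auto
  show "tensor_e D k (map g w) = map_option (map g) (tensor_e C i w)"
    by (induction w) (auto simp: assms A option.map_comp comp_def)
qed

definition A2_word :: "affine_type \<Rightarrow> nat \<Rightarrow> nat \<Rightarrow> int list \<Rightarrow> int list" where
  "A2_word T i j w = concat (map (A2_letter T i j) w)"

lemma A2_word_crystal:
  assumes "adjacent_nodes T i j" "valid_type T"
  shows "w_eps (TypeA 2) 1 (A2_word T i j w) = w_eps T i w"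
    "w_phi (TypeA 2) 1 (A2_word T i j w) = w_phi T i w"
    "w_e (TypeA 2) 1 (A2_word T i j w) = map_option (A2_word T i j) (w_e T i w)"
    "w_eps (TypeA 2) 2 (A2_word T i j w) = w_eps T j w"
    "w_phi (TypeA 2) 2 (A2_word T i j w) = w_phi T j w"
    "w_e (TypeA 2) 2 (A2_word T i j w) = map_option (A2_word T i j) (w_e T j w)"
proof -
  note C = A2_letter_crystal[OF assms] A2_letter_e[OF assms]
  let ?D = "tensor_crystal (letter_crystal (TypeA 2))"
  note 1 = tensor_hom[of ?D 1 "A2_letter T i j" "letter_crystal T" i, unfolded tensor_crystal_sel,
    OF C(1) C(2) C(5)[folded letter_crystal_sel(1)]]
  note 2 = tensor_hom[of ?D 2 "A2_letter T i j" "letter_crystal T" j, unfolded tensor_crystal_sel,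
    OF C(3) C(4) C(6)[folded letter_crystal_sel(1)]]
  show "w_eps (TypeA 2) 1 (A2_word T i j w) = w_eps T i w"
    "w_phi (TypeA 2) 1 (A2_word T i j w) = w_phi T i w"
    "w_eps (TypeA 2) 2 (A2_word T i j w) = w_eps T j w"
    "w_phi (TypeA 2) 2 (A2_word T i j w) = w_phi T j w"
    unfolding A2_word_def tensor_flatten[symmetric] by (simp_all only: 1 2)
  show "w_e (TypeA 2) 1 (A2_word T i j w) = map_option (A2_word T i j) (w_e T i w)"
    "w_e (TypeA 2) 2 (A2_word T i j w) = map_option (A2_word T i j) (w_e T j w)"
    unfolding A2_word_def tensor_e_flatten[symmetric] 1 2 by (simp_all add: option.map_comp comp_def A2_word_def[abs_def])
qed

lemma A2_word_set: "set (A2_word T i j w) \<subseteq> {1, 2, 3}"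
  by (auto simp: A2_word_def A2_letter_def split: if_splits)

text \<open>Insertion commutes with the raising operators and these keep the shape, so this is an
  invariant of the component under both nodes. It carries the weight of the highest weight vectors
  of that component.\<close>

definition pair_shape :: "affine_type \<Rightarrow> nat \<Rightarrow> nat \<Rightarrow> int list \<Rightarrow> nat \<times> nat \<times> nat" where
  "pair_shape T i j w = gt_shape (gt_of (A2_word T i j w))"

definition pair_up :: "affine_type \<Rightarrow> nat \<Rightarrow> nat \<Rightarrow> int list \<Rightarrow> int list \<Rightarrow> bool" where
  "pair_up T i j v w \<longleftrightarrow> w_e T i v = Some w \<or> w_e T j v = Some w"

lemma pair_shape_up:
  assumes "adjacent_nodes T i j" "valid_type T" "pair_up T i j v w"
  shows "pair_shape T i j v = pair_shape T i j w"
proof -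
  note G = gt_of_crystal(4)[OF A2_word_set[of T i j v]]
  from assms(3) have "w_e (TypeA 2) 1 (A2_word T i j v) = Some (A2_word T i j w) \<or>
      w_e (TypeA 2) 2 (A2_word T i j v) = Some (A2_word T i j w)"
    unfolding pair_up_def using A2_word_crystal(3,6)[OF assms(1,2), of v] by auto
  with G[of 1] G[of 2] show ?thesis unfolding pair_shape_def by (auto simp: gt_shape_e)
qed

text \<open>A highest weight tableau has only letters \<open>i\<close> in row \<open>i\<close>, so
  its weight is given by the differences of the row lengths.\<close>

lemma pair_shape_phi:
  assumes "adjacent_nodes T i j" "valid_type T" "w_eps T i w = 0" "w_eps T j w = 0"
    "pair_shape T i j w = (A, B, C)"
  shows "w_phi T i w = A - B" "w_phi T j w = B - C"
proof -
  obtain d e f where g: "gt_of (A2_word T i j w) = (A, B, C, d, e, f)"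
    using assms(5) unfolding pair_shape_def by (cases "gt_of (A2_word T i j w)") auto
  note G = gt_of_crystal(1-3)[OF A2_word_set[of T i j w]]
  have ok: "gt_ok (A, B, C, d, e, f)" using G(1) g by simp
  have e1: "gt_eps 1 (A, B, C, d, e, f) = 0"
    using G(2)[of 1] g A2_word_crystal(1)[OF assms(1,2), of w] assms(3) by simp
  have e2: "gt_eps 2 (A, B, C, d, e, f) = 0"
    using G(2)[of 2] g A2_word_crystal(4)[OF assms(1,2), of w] assms(4) by simp
  have "gt_phi 1 (A, B, C, d, e, f) = A - B \<and> gt_phi 2 (A, B, C, d, e, f) = B - C"
    using ok e1 e2 by auto
  then show "w_phi T i w = A - B" "w_phi T j w = B - C"
    using G(3)[of 1] G(3)[of 2] g A2_word_crystal(2,5)[OF assms(1,2), of w] by auto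
qed

lemma pair_up_Cons:
  "pair_up T i j (x # v) w' \<Longrightarrow> \<exists>y w. w' = y # w \<and>
    (x = y \<and> pair_up T i j v w \<or> v = w \<and> (letter_e T i x = Some y \<or> letter_e T j x = Some y))"
  by (auto simp: pair_up_def split: if_splits)

text \<open>Each step changes either the first letter or the tail. Connectedness is therefore
  inherited by the tail, and the first letter never leaves its own component.\<close>

lemma pair_up_conn_Cons:
  assumes "adjacent_nodes T i j" "valid_type T" "equivclp (pair_up T i j) (x # v) w'"
  shows "\<exists>y w. w' = y # w \<and> equivclp (pair_up T i j) v w \<and> pair_top T i j x = pair_top T i j y"
  using assms(3)
proof (induction rule: equivclp_induct)
  case base
  then show ?case by simp
next
  case (step w1 w2)
  then obtain y w where yw: "w1 = y # w" "equivclp (pair_up T i j) v w" "pair_top T i j x = pair_top T i j y" by blast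
  from step(2) obtain y' w' where "w2 = y' # w'" "w = w' \<or> pair_up T i j w w' \<or> pair_up T i j w' w"
    "y = y' \<or> letter_e T i y = Some y' \<or> letter_e T j y = Some y' \<or> letter_e T i y' = Some y \<or> letter_e T j y' = Some y"
  proof
    assume "pair_up T i j w1 w2"
    then show ?thesis using that pair_up_Cons[of T i j y w w2] yw(1) by blast
  next
    assume U: "pair_up T i j w2 w1"
    then obtain y' w' where w2: "w2 = y' # w'" by (cases w2) (auto simp: pair_up_def)
    show ?thesis using that[of y' w'] w2 pair_up_Cons[of T i j y' w' w1] U yw(1) by blast
  qed
  moreover have "pair_top T i j y = pair_top T i j y'"
    using calculation(3) pair_top_e[OF assms(1,2)] by metis
  moreover have "equivclp (pair_up T i j) v w'"
    using calculation(2) yw(2) equivclp_into_equivclp by metis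
  ultimately show ?case using yw(3) by auto
qed

text \<open>Tails of highest weight words are of highest weight, hence equal by induction. The
  common shape makes the total weights equal, so the first letters have equal weights and lie in the
  same component of letters.\<close>

lemma pair_hw_unique:
  assumes "adjacent_nodes T i j" "valid_type T" "equivclp (pair_up T i j) v w"
    "w_eps T i v = 0" "w_eps T j v = 0" "w_eps T i w = 0" "w_eps T j w = 0"
  shows "v = w"
  using assms(3-7)
proof (induction v arbitrary: w)
  case Nil
  from Nil(1) have "w = []"
    by (induction rule: equivclp_induct) (auto simp: pair_up_def dest: tensor_e_length)
  then show ?case by simp
next
  case (Cons x v)
  obtain y w' where w: "w = y # w'" "equivclp (pair_up T i j) v w'" "pair_top T i j x = pair_top T i j y"
    using pair_up_conn_Cons[OF assms(1,2) Cons.prems(1)] by blast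
  have "v = w'" using Cons.IH[OF w(2)] Cons.prems w(1) by simp
  moreover have "pair_shape T i j (x # v) = pair_shape T i j w"
    using Cons.prems(1) by (induction rule: equivclp_induct) (auto dest: pair_shape_up[OF assms(1,2)])
  then have "w_phi T i (x # v) = w_phi T i w \<and> w_phi T j (x # v) = w_phi T j w"
    using pair_shape_phi[OF assms(1,2) Cons.prems(2,3)] pair_shape_phi[OF assms(1,2) Cons.prems(4,5)]
    by (metis prod_cases3)
  then have "letter_wt T i x = letter_wt T i y" "letter_wt T j x = letter_wt T j y"
    using w_wt_Cons[of T i x v] w_wt_Cons[of T j x v] w_wt_Cons[of T i y v] w_wt_Cons[of T j y v]
      Cons.prems w(1) \<open>v = w'\<close> by simp_all
  ultimately show ?case using pair_top_inj[OF assms(1,2) w(3)] w(1) by simp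
qed

section \<open>Termination of the raising operators, and commutation at remote nodes\<close>

lemma letter_e_height:
  assumes "i \<in> classical_nodes T" "valid_type T" "letter_e T i c = Some d"
  shows "0 \<le> letter_height T d" "letter_height T d < letter_height T c"
  using assms by (cases rule: classical_nodes_cases; auto simp: letter_height_def split: if_splits)+

definition word_height :: "affine_type \<Rightarrow> int list \<Rightarrow> nat" where
  "word_height T w = (\<Sum>c\<leftarrow>w. nat (letter_height T c))"

lemma w_e_height:
  assumes "i \<in> classical_nodes T" "valid_type T" "w_e T i v = Some w"
  shows "word_height T w < word_height T v"
  using assms(3)
proof (induction v arbitrary: w)
  case (Cons x v)
  then show ?case
    using letter_e_height[OF assms(1,2)]
    by (fastforce simp: word_height_def split: if_splits)
qed simp

lemma w_e_defined:
  assumes "i \<in> classical_nodes T" "valid_type T"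
  shows "w_eps T i w > 0 \<longleftrightarrow> w_e T i w \<noteq> None"
  using normal_atD(2)[OF normal_at_tensor[OF normal_at_letter[OF assms]]] by simp

lemma pair_raise:
  assumes "i \<in> classical_nodes T" "j \<in> classical_nodes T" "valid_type T"
  shows "\<exists>z. (pair_up T i j)\<^sup>*\<^sup>* w z \<and> w_eps T i z = 0 \<and> w_eps T j z = 0"
proof (induction "word_height T w" arbitrary: w rule: less_induct)
  case less
  show ?case
  proof (cases "w_eps T i w = 0 \<and> w_eps T j w = 0")
    case True
    then show ?thesis by blast
  next
    case False
    then obtain v where v: "w_e T i w = Some v \<or> w_e T j w = Some v"
      using w_e_defined[OF assms(1,3), of w] w_e_defined[OF assms(2,3), of w] by auto
    then have "word_height T v < word_height T w" using w_e_height assms by blast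
    from less[OF this] v show ?thesis
      by (metis converse_rtranclp_into_rtranclp pair_up_def)
  qed
qed

lemma remote_nodes_cases:
  assumes "i \<in> classical_nodes T" "j \<in> classical_nodes T" "valid_type T" "i \<noteq> j" "cartan T i j = 0"
  obtains n where "T = TypeA n" "i \<noteq> j" "Suc i \<noteq> j" "Suc j \<noteq> i"
  | n where "T = TypeD n" "1 \<le> i" "1 \<le> j" "i < n" "j < n" "i \<noteq> j" "Suc i \<noteq> j" "Suc j \<noteq> i"
  | n where "T = TypeD n" "4 \<le> n" "1 \<le> j" "Suc (Suc j) < n" "i = n"
  | n where "T = TypeD n" "4 \<le> n" "1 \<le> i" "Suc (Suc i) < n" "j = n"
  | m where "T = TypeD (Suc m)" "3 \<le> m" "i = m" "j = Suc m"
  | m where "T = TypeD (Suc m)" "3 \<le> m" "j = m" "i = Suc m"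
proof -
  have edge: "\<not> dynkin_edge T i j" "\<not> dynkin_edge T j i"
    using assms(4,5) unfolding cartan_def by (auto split: if_splits)
  show ?thesis
  proof (cases T)
    case (TypeA n)
    show ?thesis using that(1)[OF TypeA] edge assms(4) by (auto simp: TypeA dynkin_edge_def)
  next
    case (TypeD n)
    have n: "4 \<le> n" and ij: "1 \<le> i" "i \<le> n" "1 \<le> j" "j \<le> n"
      using assms(1-3) by (auto simp: TypeD classical_nodes_def)
    have e: "\<not> (j = i + 1 \<and> j \<le> n - 1)" "\<not> (i = n - 2 \<and> j = n)" "\<not> (i = j + 1 \<and> i \<le> n - 1)" "\<not> (j = n - 2 \<and> i = n)"
      using edge by (auto simp: TypeD dynkin_edge_def)
    consider "i < n" "j < n" | "i = n" "Suc (Suc j) < n" | "j = n" "Suc (Suc i) < n" | "i = n" "Suc j = n" | "j = n" "Suc i = n"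
    proof (cases "i = n"; cases "j = n")
      assume "i = n" "j \<noteq> n"
      moreover from this have "Suc (Suc j) < n \<or> Suc j = n" using ij e(4) by auto
      ultimately show ?thesis using that(2,4) by blast
    next
      assume "i \<noteq> n" "j = n"
      moreover from this have "Suc (Suc i) < n \<or> Suc i = n" using ij e(2) by auto
      ultimately show ?thesis using that(3,5) by blast
    qed (use that(1) ij assms(4) in auto)
    then show ?thesis
    proof cases
      case 1
      then show ?thesis using that(2)[OF TypeD] ij e assms(4) by auto
    qed (use that(3,4)[OF TypeD n] that(5,6) n ij TypeD in auto)
  qed
qed

text \<open>At non-adjacent nodes the crystal of letters contains only commuting squares; in type D
  the spin nodes \<open>n - 1\<close> and \<open>n\<close> form such a square at the fork.\<close>

lemma remote_letter:
  assumes "i \<in> classical_nodes T" "j \<in> classical_nodes T" "valid_type T" "i \<noteq> j" "cartan T i j = 0"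
    "letter_e T i c = Some d"
  shows "letter_e T j c = None \<longleftrightarrow> letter_e T j d = None" (is ?A)
    "letter_f T j c = None \<longleftrightarrow> letter_f T j d = None" (is ?B)
    "letter_e T j c = Some d' \<Longrightarrow> \<exists>z. letter_e T j d = Some z \<and> letter_e T i d' = Some z" (is "_ \<Longrightarrow> ?C")
proof -
  have "?A \<and> ?B"
    using assms [[linarith_neq_limit = 1]]
    by (cases rule: remote_nodes_cases; simp split: if_splits; (elim disjE conjE)?; simp?; auto?)
  then show ?A ?B by simp_all
  show ?C if "letter_e T j c = Some d'"
    using assms that [[linarith_neq_limit = 1]]
    by (cases rule: remote_nodes_cases; simp split: if_splits; (elim disjE conjE)?; simp?; auto?)
qed

lemma w_e_remote:
  assumes "i \<in> classical_nodes T" "j \<in> classical_nodes T" "valid_type T" "i \<noteq> j" "cartan T i j = 0"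
    "w_e T i w = Some u"
  shows "w_eps T j u = w_eps T j w" "w_phi T j u = w_phi T j w"
proof -
  have "w_eps T j u = w_eps T j w \<and> w_phi T j u = w_phi T j w"
    using assms(6)
  proof (induction w arbitrary: u)
    case (Cons x w)
    then show ?case using remote_letter(1,2)[OF assms(1-5), of x] by (auto split: if_splits)
  qed simp
  then show "w_eps T j u = w_eps T j w" "w_phi T j u = w_phi T j w" by auto
qed

lemma cartan_sym: "cartan T i j = cartan T j i"
  by (auto simp: cartan_def)

text \<open>An operator at one node leaves \<open>eps\<close> and \<open>phi\<close> of a remote
  node unchanged on every subword, so the tensor product rule selects the same position before and
  after. If both operators select the same letter, the square of letters closes the diagram.\<close>

lemma w_e_commute:
  assumes "i \<in> classical_nodes T" "j \<in> classical_nodes T" "valid_type T" "i \<noteq> j" "cartan T i j = 0"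
    "w_e T i w = Some u" "w_e T j w = Some v"
  shows "\<exists>z. w_e T j u = Some z \<and> w_e T i v = Some z"
  using assms(6,7)
proof (induction w arbitrary: u v)
  case (Cons x w)
  note R = w_e_remote[OF assms(1-5)] w_e_remote[OF assms(2,1,3) assms(4)[symmetric] assms(5)[unfolded cartan_sym[of T i]]]
  note L = remote_letter[OF assms(1-5)] remote_letter[OF assms(2,1,3) assms(4)[symmetric] assms(5)[unfolded cartan_sym[of T i]]]
  let ?ci = "cr_eps (letter_crystal T) i x > w_phi T i w" and ?cj = "cr_eps (letter_crystal T) j x > w_phi T j w"
  consider "?ci" "?cj" | "?ci" "\<not> ?cj" | "\<not> ?ci" "?cj" | "\<not> ?ci" "\<not> ?cj" by blast
  then show ?case
  proof cases
    case 1
    then obtain d d' where d: "letter_e T i x = Some d" "letter_e T j x = Some d'" "u = d # w" "v = d' # w"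
      using Cons.prems by auto
    obtain z where "letter_e T j d = Some z" "letter_e T i d' = Some z" using L(3)[OF d(1,2)] by blast
    then show ?thesis using d 1 by (auto split: if_splits)
  next
    case 2
    then obtain d v' where d: "letter_e T i x = Some d" "w_e T j w = Some v'" "u = d # w" "v = x # v'"
      using Cons.prems by auto
    then show ?thesis using 2 L(1)[OF d(1)] R(4)[OF d(2)] by (auto split: if_splits)
  next
    case 3
    then obtain d u' where d: "letter_e T j x = Some d" "w_e T i w = Some u'" "v = d # w" "u = x # u'"
      using Cons.prems by auto
    then show ?thesis using 3 L(4)[OF d(1)] R(2)[OF d(2)] by (auto split: if_splits)
  next
    case 4
    then obtain u' v' where d: "w_e T i w = Some u'" "w_e T j w = Some v'" "u = x # u'" "v = x # v'"
      using Cons.prems by (auto split: if_splits)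
    obtain z where "w_e T j u' = Some z" "w_e T i v' = Some z" using Cons.IH[OF d(1,2)] by blast
    then show ?thesis using d 4 R(2)[OF d(1)] R(4)[OF d(2)] by (auto split: if_splits)
  qed
qed simp

section \<open>Confluence, and highest weight vectors of words and paths\<close>

text \<open>Remote nodes close up in one step. For adjacent nodes both branches are raised as far as
  the two nodes allow; the ends are connected and of highest weight for the pair, hence
  equal.\<close>

lemma w_up_joinable:
  assumes "valid_type T" "w_up T w u" "w_up T w v"
  shows "\<exists>z. (w_up T)\<^sup>*\<^sup>* u z \<and> (w_up T)\<^sup>*\<^sup>* v z"
proof -
  obtain i j where ij: "i \<in> classical_nodes T" "j \<in> classical_nodes T" "w_e T i w = Some u" "w_e T j w = Some v"
    using assms by (auto simp: w_up_def)
  consider "i = j" | "i \<noteq> j" "cartan T i j = 0" | "adjacent_nodes T i j"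
    using ij by (auto simp: adjacent_nodes_def)
  then show ?thesis
  proof cases
    case 1
    with ij show ?thesis by auto
  next
    case 2
    from w_e_commute[OF ij(1,2) assms(1) this ij(3,4)] ij(1,2) show ?thesis
      unfolding w_up_def by blast
  next
    case 3
    obtain y where y: "(pair_up T i j)\<^sup>*\<^sup>* u y" "w_eps T i y = 0" "w_eps T j y = 0"
      using pair_raise[OF ij(1,2) assms(1)] by blast
    obtain z where z: "(pair_up T i j)\<^sup>*\<^sup>* v z" "w_eps T i z = 0" "w_eps T j z = 0"
      using pair_raise[OF ij(1,2) assms(1)] by blast
    have "(pair_up T i j)\<^sup>*\<^sup>* w y" "(pair_up T i j)\<^sup>*\<^sup>* w z"
      using y(1) z(1) ij by (auto simp: pair_up_def intro: converse_rtranclp_into_rtranclp)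
    then have "equivclp (pair_up T i j) y z"
      by (meson equivclp_trans rtranclp_into_equivclp converse_rtranclp_into_equivclp)
    then have "y = z" using pair_hw_unique[OF 3 assms(1)] y z by blast
    moreover have "pair_up T i j \<le> w_up T" using ij by (auto simp: pair_up_def w_up_def)
    ultimately show ?thesis using y(1) z(1) rtranclp_mono by blast
  qed
qed

lemma w_up_height: "valid_type T \<Longrightarrow> w_up T v w \<Longrightarrow> word_height T w < word_height T v"
  by (auto simp: w_up_def w_e_height)

lemma w_hw_iff:
  assumes "valid_type T"
  shows "w_hw T w \<longleftrightarrow> \<not> (\<exists>v. w_up T w v)"
proof -
  have "w_eps T i w = 0 \<longleftrightarrow> (\<forall>v. w_e T i w \<noteq> Some v)" if "i \<in> classical_nodes T" for i
    using w_e_defined[OF that assms, of w] by auto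
  then have "(\<forall>i\<in>classical_nodes T. w_eps T i w = 0) \<longleftrightarrow> (\<forall>i\<in>classical_nodes T. \<forall>v. w_e T i w \<noteq> Some v)"
    by (intro ball_cong refl)
  then show ?thesis unfolding w_hw_def w_up_def by (metis (no_types, lifting))
qed

lemma w_raise:
  assumes "valid_type T"
  shows "\<exists>z. (w_up T)\<^sup>*\<^sup>* w z \<and> w_hw T z"
proof (induction "word_height T w" arbitrary: w rule: less_induct)
  case less
  show ?case
  proof (cases "w_hw T w")
    case False
    then obtain v where v: "w_up T w v" using w_hw_iff[OF assms] by blast
    from less[OF w_up_height[OF assms v]] v show ?thesis
      by (meson converse_rtranclp_into_rtranclp)
  qed blast
qed

text \<open>Newman's lemma.\<close>

lemma w_raise_unique:
  assumes "valid_type T" "(w_up T)\<^sup>*\<^sup>* w y" "w_hw T y" "(w_up T)\<^sup>*\<^sup>* w z" "w_hw T z"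
  shows "y = z"
  using assms(2-5)
proof (induction "word_height T w" arbitrary: w y z rule: less_induct)
  case less
  note hw = w_hw_iff[OF assms(1)]
  show ?case
  proof (cases "w_hw T w")
    case True
    then show ?thesis using less.prems hw by (metis converse_rtranclpE)
  next
    case False
    then have "w \<noteq> y" "w \<noteq> z" using less.prems by auto
    then obtain u v where u: "w_up T w u" "(w_up T)\<^sup>*\<^sup>* u y" and v: "w_up T w v" "(w_up T)\<^sup>*\<^sup>* v z"
      using less.prems by (metis converse_rtranclpE)
    obtain t where t: "(w_up T)\<^sup>*\<^sup>* u t" "(w_up T)\<^sup>*\<^sup>* v t"
      using w_up_joinable[OF assms(1) u(1) v(1)] by blast
    obtain s where s: "(w_up T)\<^sup>*\<^sup>* t s" "w_hw T s" using w_raise[OF assms(1)] by blast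
    have us: "(w_up T)\<^sup>*\<^sup>* u s" and vs: "(w_up T)\<^sup>*\<^sup>* v s" using t s by (meson rtranclp_trans)+
    have "y = s" by (rule less.hyps[OF w_up_height[OF assms(1) u(1)] u(2) less.prems(2) us s(2)])
    moreover have "z = s" by (rule less.hyps[OF w_up_height[OF assms(1) v(1)] v(2) less.prems(4) vs s(2)])
    ultimately show ?thesis by simp
  qed
qed

text \<open>Church-Rosser form of confluence: a zigzag ending at a word below \<open>y\<close> can
  be straightened into a purely raising path to \<open>y\<close>.\<close>

lemma w_conn_raise:
  assumes "valid_type T" "equivclp (w_up T) v w" "(w_up T)\<^sup>*\<^sup>* w y" "w_hw T y"
  shows "(w_up T)\<^sup>*\<^sup>* v y"
  using assms(2,3)
proof (induction rule: equivclp_induct)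
  case (step w1 w2)
  obtain z where z: "(w_up T)\<^sup>*\<^sup>* w1 z" "w_hw T z" using w_raise[OF assms(1)] by blast
  from step(2) have "z = y"
  proof
    assume "w_up T w1 w2"
    then show ?thesis using w_raise_unique[OF assms(1) z] step.prems assms(4)
      by (meson converse_rtranclp_into_rtranclp)
  next
    assume "w_up T w2 w1"
    then show ?thesis using w_raise_unique[OF assms(1) _ z(2) step.prems assms(4)] z(1)
      by (meson converse_rtranclp_into_rtranclp)
  qed
  with z step.IH show ?case by simp
qed simp

lemma arrows_word:
  assumes "valid_type T" "equivclp (classical_arrow T) b c"
  shows "equivclp (w_up T) (path_word b) (path_word c) \<and> path_lens b = path_lens c"
  using assms(2)
proof (induction rule: equivclp_induct)
  case (step c d)
  then show ?case unfolding classical_arrow_word[OF assms(1)]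
    by (metis equivclp_into_equivclp)
qed simp

text \<open>Raising a word happens inside one column, so it lifts to a raising of the path with the
  same column lengths.\<close>

lemma w_up_lift:
  assumes "valid_type T" "(w_up T)\<^sup>*\<^sup>* (path_word b) w"
  shows "\<exists>c. path_word c = w \<and> path_lens c = path_lens b \<and> equivclp (classical_arrow T) b c"
  using assms(2)
proof (induction rule: rtranclp_induct)
  case (step v w)
  then obtain c where c: "path_word c = v" "path_lens c = path_lens b" "equivclp (classical_arrow T) b c" by blast
  obtain i where i: "i \<in> classical_nodes T" "w_e T i (path_word c) = Some w"
    using step(2) c(1) by (auto simp: w_up_def)
  obtain d where d: "cr_e (path_crystal T) i c = Some d" "path_word d = w" using path_e_lift[OF i] .
  have "path_lens d = path_lens c" by (rule path_e_lens[OF classical_node_pos[OF i(1)] d(1)])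
  moreover have "classical_arrow T d c" using classical_arrow_e[OF assms(1)] i d by blast
  ultimately show ?case using c d by (metis equivclp_into_equivclp)
qed auto

text \<open>This discharges the definite description: any highest weight vector connected to
  \<open>b\<close> is the one that \<open>highest\<close> denotes.\<close>

lemma highest_eqI:
  assumes "valid_type T" "equivclp (classical_arrow T) b h" "classical_hw T h"
  shows "highest T b = h"
  unfolding highest_def
proof (rule the_equality)
  fix k assume k: "equivclp (classical_arrow T) b k \<and> classical_hw T k"
  then have "equivclp (classical_arrow T) k h" using assms(2) by (meson equivclp_sym equivclp_trans)
  from arrows_word[OF assms(1) this] have kh: "equivclp (w_up T) (path_word k) (path_word h)" "path_lens k = path_lens h"
    by auto
  have "(w_up T)\<^sup>*\<^sup>* (path_word k) (path_word h)"
    using w_conn_raise[OF assms(1) kh(1)] assms(3) classical_hw_word by blast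
  then have "path_word k = path_word h"
    using k classical_hw_word w_hw_iff[OF assms(1)] by (metis converse_rtranclpE)
  with kh(2) show "k = h" by (rule path_word_inj[rotated])
qed (use assms in blast)

lemma highest_props:
  assumes "valid_type T"
  shows "equivclp (classical_arrow T) b (highest T b)" "classical_hw T (highest T b)"
    "(w_up T)\<^sup>*\<^sup>* (path_word b) (path_word (highest T b))" "path_lens (highest T b) = path_lens b"
proof -
  obtain w where w: "(w_up T)\<^sup>*\<^sup>* (path_word b) w" "w_hw T w" using w_raise[OF assms] by blast
  obtain c where c: "path_word c = w" "path_lens c = path_lens b" "equivclp (classical_arrow T) b c"
    using w_up_lift[OF assms w(1)] by blast
  have "highest T b = c" by (rule highest_eqI[OF assms c(3)]) (use c w classical_hw_word in auto)
  with c w show "equivclp (classical_arrow T) b (highest T b)" "classical_hw T (highest T b)"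
    "(w_up T)\<^sup>*\<^sup>* (path_word b) (path_word (highest T b))" "path_lens (highest T b) = path_lens b"
    by (auto simp: classical_hw_word)
qed

lemma highest_self: "valid_type T \<Longrightarrow> classical_hw T b \<Longrightarrow> highest T b = b"
  by (rule highest_eqI) auto

section \<open>Vacancy numbers\<close>

text \<open>At the first minimum the left neighbour is strictly larger. Choosing the first one is
  what makes the contradiction with concavity strict.\<close>

lemma least_minimizer:
  fixes p :: "nat \<Rightarrow> int"
  obtains k where "k \<le> j" "\<And>i. i \<le> j \<Longrightarrow> p k \<le> p i" "\<And>i. i < k \<Longrightarrow> p k < p i"
proof -
  let ?P = "\<lambda>k. k \<le> j \<and> (\<forall>i\<le>j. p k \<le> p i)"
  have "Min (p ` {..j}) \<in> p ` {..j}" by (rule Min_in) auto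
  then obtain k0 where "k0 \<le> j" "p k0 = Min (p ` {..j})" by (metis imageE atMost_iff)
  then have "?P k0" by auto
  then have L: "?P (LEAST k. ?P k)" by (rule LeastI)
  show ?thesis
  proof (rule that[of "LEAST k. ?P k"])
    fix i assume i: "i < (LEAST k. ?P k)"
    then have "\<not> ?P i" by (rule not_less_Least)
    moreover have "i \<le> j" using L i by simp
    ultimately obtain l where "l \<le> j" "p l < p i" by auto
    then show "p (LEAST k. ?P k) < p i" using L by (meson le_less_trans)
  qed (use L in auto)
qed

definition concave_at :: "(nat \<Rightarrow> int) \<Rightarrow> nat \<Rightarrow> bool" where
  "concave_at p i \<longleftrightarrow> p (i + 1) + p (i - 1) \<le> 2 * p i"

text \<open>If some value before \<open>j\<close> were at most \<open>m\<close>, the first minimum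
  would avoid 0 because \<open>m < p 0\<close> and avoid \<open>j\<close> because
  \<open>m \<le> p j\<close>. At an interior first minimum concavity fails.\<close>

lemma concave_gt:
  assumes "m < p 0" "m \<le> p j" "\<And>i. 0 < i \<Longrightarrow> i < j \<Longrightarrow> m < p i \<or> concave_at p i" "i < j"
  shows "m < p i"
proof (rule ccontr)
  assume i: "\<not> m < p i"
  obtain k where k: "k \<le> j" "\<And>i. i \<le> j \<Longrightarrow> p k \<le> p i" "\<And>i. i < k \<Longrightarrow> p k < p i"
    using least_minimizer[of j p] by blast
  have pk: "p k \<le> m" using k(2)[of i] assms(4) i by simp
  then have "0 < k" using assms(1) by (metis gr0I not_le)
  moreover have "k \<noteq> j" using k(3)[of i] assms(2,4) i by auto
  ultimately show False
    using assms(3)[of k] pk k(1) k(2)[of "k + 1"] k(3)[of "k - 1"] by (auto simp: concave_at_def)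
qed

text \<open>Eventual constancy takes the place of the right end point: beyond \<open>J\<close> the
  right neighbour of the minimum is not smaller.\<close>

lemma concave_ge_all:
  assumes "m \<le> p 0" "\<And>i. 0 < i \<Longrightarrow> m \<le> p i \<or> concave_at p i" "\<And>i. J \<le> i \<Longrightarrow> p i = p J"
  shows "m \<le> p i"
proof (rule ccontr)
  assume i: "\<not> m \<le> p i"
  obtain k where k: "k \<le> J + i" "\<And>l. l \<le> J + i \<Longrightarrow> p k \<le> p l" "\<And>l. l < k \<Longrightarrow> p k < p l"
    using least_minimizer[of "J + i" p] by blast
  have pk: "p k < m" using k(2)[of i] i by simp
  then have k0: "0 < k" using assms(1) by (metis gr0I not_le)
  have "p k \<le> p (k + 1)"
  proof (cases "k + 1 \<le> J + i")
    case False
    with k(1) assms(3)[of k] assms(3)[of "k + 1"] show ?thesis by simp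
  qed (use k(2) in blast)
  then show False using assms(2)[OF k0] pk k(3)[of "k - 1"] k0 by (auto simp: concave_at_def)
qed

section \<open>Vacancy numbers and their second differences\<close>

text \<open>The number of boxes in the first \<open>i\<close> columns of the partition
  \<open>M\<close>; its second difference counts the parts equal to \<open>i\<close>.\<close>

definition min_sum :: "nat multiset \<Rightarrow> nat \<Rightarrow> int" where
  "min_sum M i = (\<Sum>j\<in>#M. int (min i j))"

lemma min_sum_simps [simp]:
  "min_sum {#} i = 0" "min_sum (add_mset j M) i = int (min i j) + min_sum M i"
  "min_sum (M + N) i = min_sum M i + min_sum N i" "min_sum M 0 = 0"
  by (simp_all add: min_sum_def)

lemma min_sum_second_diff:
  assumes "0 < i"
  shows "min_sum M (i + 1) + min_sum M (i - 1) = 2 * min_sum M i - int (count M i)"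
  using assms by (induction M) auto

lemma min_sum_large: "\<forall>j\<in>#M. j \<le> i \<Longrightarrow> min_sum M i = int (\<Sum>\<^sub># M)"
  by (induction M) auto

definition row_lengths :: "multiplicities \<Rightarrow> nat \<Rightarrow> nat multiset" where
  "row_lengths L a = image_mset snd (filter_mset (\<lambda>p. fst p = a) L)"

lemma row_lengths_simps [simp]:
  "row_lengths {#} a = {#}"
  "row_lengths (add_mset (b, s) L) a = (if a = b then add_mset s (row_lengths L a) else row_lengths L a)"
  "row_lengths (L + L') a = row_lengths L a + row_lengths L' a"
  by (simp_all add: row_lengths_def)

lemma vacancy_min_sum:
  "vacancy T L nu a i = min_sum (row_lengths L a) i - (\<Sum>b\<in>classical_nodes T. cartan T a b * min_sum (nu b) i)"
  by (simp add: vacancy_def min_sum_def row_lengths_def image_mset.compositionality comp_def)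

lemma finite_classical_nodes [simp]: "finite (classical_nodes T)"
  by (simp add: classical_nodes_def)

lemma vacancy_0 [simp]: "vacancy T L nu a 0 = 0"
  by (simp add: vacancy_min_sum)

text \<open>The part of the bending of the vacancy numbers at \<open>i\<close> that comes from the
  tensor factors and the neighbouring nodes. It is nonnegative and bends downwards, so only strings
  of the node itself can destroy concavity.\<close>

definition kink :: "affine_type \<Rightarrow> multiplicities \<Rightarrow> configuration \<Rightarrow> nat \<Rightarrow> nat \<Rightarrow> int" where
  "kink T L nu a i = int (count (row_lengths L a) i)
     + (\<Sum>b\<in>classical_nodes T - {a}. - cartan T a b * int (count (nu b) i))"

lemma cartan_diag [simp]: "cartan T a a = 2"
  by (simp add: cartan_def)

lemma cartan_nonpos: "a \<noteq> b \<Longrightarrow> cartan T a b \<le> 0"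
  by (simp add: cartan_def)

lemma kink_nonneg: "0 \<le> kink T L nu a i"
  unfolding kink_def
  by (intro add_nonneg_nonneg sum_nonneg mult_nonneg_nonneg) (auto intro: cartan_nonpos)

lemma vacancy_second_diff:
  assumes "a \<in> classical_nodes T" "0 < i"
  shows "vacancy T L nu a (i + 1) + vacancy T L nu a (i - 1) =
    2 * vacancy T L nu a i + 2 * int (count (nu a) i) - kink T L nu a i"
proof -
  let ?I = "classical_nodes T"
  have "(\<Sum>b\<in>?I. cartan T a b * min_sum (nu b) (i + 1)) + (\<Sum>b\<in>?I. cartan T a b * min_sum (nu b) (i - 1))
      = (\<Sum>b\<in>?I. cartan T a b * (min_sum (nu b) (i + 1) + min_sum (nu b) (i - 1)))"
    by (simp add: sum.distrib algebra_simps)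
  also have "\<dots> = (\<Sum>b\<in>?I. cartan T a b * (2 * min_sum (nu b) i - int (count (nu b) i)))"
    by (simp only: min_sum_second_diff[OF assms(2)])
  also have "\<dots> = 2 * (\<Sum>b\<in>?I. cartan T a b * min_sum (nu b) i) - (\<Sum>b\<in>?I. cartan T a b * int (count (nu b) i))"
    by (simp add: sum_subtractf sum_distrib_left algebra_simps)
  also have "(\<Sum>b\<in>?I. cartan T a b * int (count (nu b) i)) =
      2 * int (count (nu a) i) + (\<Sum>b\<in>?I - {a}. cartan T a b * int (count (nu b) i))"
    using assms(1) by (subst sum.remove[of _ a]) auto
  finally show ?thesis
    unfolding vacancy_min_sum kink_def using min_sum_second_diff[OF assms(2), of "row_lengths L a"]
    by (simp add: sum_negf)
qed

lemma vacancy_concave: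
  assumes "a \<in> classical_nodes T" "0 < i" "i \<notin># nu a"
  shows "concave_at (vacancy T L nu a) i"
  using vacancy_second_diff[OF assms(1,2), of L nu] kink_nonneg[of T L nu a i] assms(3)
  by (simp add: concave_at_def not_in_iff)

text \<open>All summands of \<open>kink\<close> are nonnegative, so where it vanishes no neighbour
  has a string of that length. This is how equalities between vacancy numbers yield information on
  other nodes.\<close>

lemma kink_zero:
  assumes "kink T L nu a i = 0" "b \<in> classical_nodes T" "b \<noteq> a" "cartan T a b \<noteq> 0"
  shows "i \<notin># nu b"
proof -
  have "cartan T a b = - 1" using assms(3,4) by (auto simp: cartan_def split: if_splits)
  have nn: "0 \<le> - cartan T a c * int (count (nu c) i)" if "c \<in> classical_nodes T - {a}" for c
    using that cartan_nonpos[of a c T] by (intro mult_nonneg_nonneg) auto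
  have "0 \<le> (\<Sum>c\<in>classical_nodes T - {a}. - cartan T a c * int (count (nu c) i))"
    by (rule sum_nonneg) (rule nn)
  then have "(\<Sum>c\<in>classical_nodes T - {a}. - cartan T a c * int (count (nu c) i)) = 0"
    using assms(1) unfolding kink_def by linarith
  then have "- cartan T a b * int (count (nu b) i) = 0"
    using assms(2,3) by (subst (asm) sum_nonneg_eq_0_iff[OF _ nn]) auto
  then show ?thesis using \<open>cartan T a b = - 1\<close> by (simp add: not_in_iff)
qed

text \<open>The limit of the vacancy numbers of a node; it is the coefficient of the weight.\<close>

definition rc_wt :: "affine_type \<Rightarrow> multiplicities \<Rightarrow> configuration \<Rightarrow> nat \<Rightarrow> int" where
  "rc_wt T L nu a = int (\<Sum>\<^sub># (row_lengths L a)) - (\<Sum>b\<in>classical_nodes T. cartan T a b * int (\<Sum>\<^sub># (nu b)))"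

lemma vacancy_large:
  obtains J where "\<And>i. J \<le> i \<Longrightarrow> vacancy T L nu a i = rc_wt T L nu a"
    "\<And>i b. J \<le> i \<Longrightarrow> b \<in> classical_nodes T \<Longrightarrow> i \<notin># nu b"
proof -
  let ?S = "row_lengths L a + (\<Sum>b\<in>classical_nodes T. nu b)"
  have S: "j \<le> \<Sum>\<^sub># ?S" if j: "j \<in># ?S" for j
  proof -
    obtain N where "?S = add_mset j N" using multi_member_split[OF j] by blast
    then show ?thesis by simp
  qed
  show ?thesis
  proof (rule that[of "Suc (\<Sum>\<^sub># ?S)"])
    fix i assume i: "Suc (\<Sum>\<^sub># ?S) \<le> i"
    have m: "j \<in># ?S" if "b \<in> classical_nodes T" "j \<in># nu b" for j b
    proof -
      have "nu b \<subseteq># (\<Sum>b\<in>classical_nodes T. nu b)"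
        using that(1) by (simp add: sum.remove)
      then show ?thesis using that(2) by (auto dest: mset_subset_eqD)
    qed
    have 1: "min_sum (row_lengths L a) i = int (\<Sum>\<^sub># (row_lengths L a))"
    proof (rule min_sum_large, intro ballI)
      fix j assume "j \<in># row_lengths L a"
      then show "j \<le> i" using S[of j] i by simp
    qed
    have 2: "min_sum (nu b) i = int (\<Sum>\<^sub># (nu b))" if b: "b \<in> classical_nodes T" for b
    proof (rule min_sum_large, intro ballI)
      fix j assume "j \<in># nu b"
      then show "j \<le> i" using S[OF m[OF b]] i by fastforce
    qed
    show "vacancy T L nu a i = rc_wt T L nu a"
      unfolding vacancy_min_sum rc_wt_def 1 using 2 by simp
    fix b assume "b \<in> classical_nodes T"
    then show "i \<notin># nu b" using S[OF m] i by fastforce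
  qed
qed

text \<open>Only lengths of existing strings have to be checked: elsewhere the vacancy numbers are
  concave, they start at 0, and they are eventually constant.\<close>

lemma vacancy_ge:
  assumes "a \<in> classical_nodes T" "m \<le> 0" "\<And>i. i \<in># nu a \<Longrightarrow> m \<le> vacancy T L nu a i"
  shows "m \<le> vacancy T L nu a i"
proof -
  obtain J where J: "\<And>i. J \<le> i \<Longrightarrow> vacancy T L nu a i = rc_wt T L nu a"
    using vacancy_large[of T L nu a] by metis
  show ?thesis
  proof (rule concave_ge_all[where J = J])
    show "m \<le> vacancy T L nu a i \<or> concave_at (vacancy T L nu a) i" if "0 < i" for i
      using vacancy_concave[OF assms(1) that] assms(3) by blast
  qed (use assms(2) J in auto)
qed

definition remove_box :: "nat \<Rightarrow> nat multiset \<Rightarrow> nat multiset" where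
  "remove_box l M = M - {#l#} + (if 1 < l then {#l - 1#} else {#})"

lemma min_sum_remove_box:
  assumes "l \<in># M" "0 < l"
  shows "min_sum (remove_box l M) i = min_sum M i - (if l \<le> i then 1 else 0)"
proof -
  obtain N where "M = add_mset l N" using assms(1) by (meson multi_member_split)
  then show ?thesis using assms(2) by (auto simp: remove_box_def)
qed

lemma sum_remove_box:
  assumes "l \<in># M" "0 < l"
  shows "int (\<Sum>\<^sub># (remove_box l M)) = int (\<Sum>\<^sub># M) - 1"
proof -
  obtain N where "M = add_mset l N" using assms(1) by (meson multi_member_split)
  then show ?thesis using assms(2) by (auto simp: remove_box_def)
qed

lemma vacancy_remove_box:
  assumes "a \<in> classical_nodes T" "l \<in># nu a" "0 < l" "nu' = nu(a := remove_box l (nu a))"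
  shows "vacancy T L nu' b i = vacancy T L nu b i + (if l \<le> i then cartan T b a else 0)"
    "rc_wt T L nu' b = rc_wt T L nu b + cartan T b a"
proof -
  have 1: "(\<Sum>c\<in>classical_nodes T - {a}. cartan T b c * min_sum (nu' c) i) =
      (\<Sum>c\<in>classical_nodes T - {a}. cartan T b c * min_sum (nu c) i)"
    "(\<Sum>c\<in>classical_nodes T - {a}. cartan T b c * int (\<Sum>\<^sub># (nu' c))) =
      (\<Sum>c\<in>classical_nodes T - {a}. cartan T b c * int (\<Sum>\<^sub># (nu c)))"
    by (intro sum.cong; simp add: assms(4))+
  show "vacancy T L nu' b i = vacancy T L nu b i + (if l \<le> i then cartan T b a else 0)"
    unfolding vacancy_min_sum sum.remove[OF finite_classical_nodes assms(1)] 1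
    by (simp add: assms(4) min_sum_remove_box[OF assms(2,3)] algebra_simps)
  show "rc_wt T L nu' b = rc_wt T L nu b + cartan T b a"
    unfolding rc_wt_def sum.remove[OF finite_classical_nodes assms(1)] 1
    by (simp add: assms(4) sum_remove_box[OF assms(2,3)] algebra_simps del: of_nat_sum_mset)
qed

section \<open>Crystal operators on rigged configurations\<close>

definition rc_ok :: "affine_type \<Rightarrow> rigged \<Rightarrow> bool" where
  "rc_ok T rc \<longleftrightarrow> (\<forall>a. a \<notin> classical_nodes T \<longrightarrow> rc a = {#}) \<and> (\<forall>a i x. (i, x) \<in># rc a \<longrightarrow> 0 < i)"

text \<open>Stated node by node, since along a chain of operators the upper bounds are lost and
  regained at single nodes.\<close>

definition node_valid :: "affine_type \<Rightarrow> multiplicities \<Rightarrow> rigged \<Rightarrow> nat \<Rightarrow> bool" where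
  "node_valid T L rc a \<longleftrightarrow> (\<forall>i x. (i, x) \<in># rc a \<longrightarrow> x \<le> vacancy T L (shape rc) a i)"

definition rc_valid :: "affine_type \<Rightarrow> multiplicities \<Rightarrow> rigged \<Rightarrow> bool" where
  "rc_valid T L rc \<longleftrightarrow> rc_ok T rc \<and> (\<forall>a. node_valid T L rc a)"

lemma shape_memI: "(i, x) \<in># rc a \<Longrightarrow> i \<in># shape rc a"
  by (force simp: shape_def)

lemma shape_memE: "i \<in># shape rc a \<Longrightarrow> (\<And>x. (i, x) \<in># rc a \<Longrightarrow> P) \<Longrightarrow> P"
  by (force simp: shape_def)

text \<open>The element 0 in the minimum accounts for nodes that have no strings or only positive
  riggings.\<close>

definition rc_eps :: "rigged \<Rightarrow> nat \<Rightarrow> nat" where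
  "rc_eps rc a = nat (- Min (insert 0 (snd ` set_mset (rc a))))"

lemma rc_eps_le: "(i, x) \<in># rc a \<Longrightarrow> - int (rc_eps rc a) \<le> x"
proof -
  assume "(i, x) \<in># rc a"
  then have "Min (insert 0 (snd ` set_mset (rc a))) \<le> x" "Min (insert 0 (snd ` set_mset (rc a))) \<le> 0"
    by (force intro: Min_le)+
  then show ?thesis unfolding rc_eps_def by linarith
qed

lemma rc_eps_attained: "0 < rc_eps rc a \<Longrightarrow> \<exists>i. (i, - int (rc_eps rc a)) \<in># rc a"
proof -
  assume "0 < rc_eps rc a"
  then have neg: "Min (insert 0 (snd ` set_mset (rc a))) < 0"
    unfolding rc_eps_def by linarith
  have "Min (insert 0 (snd ` set_mset (rc a))) \<in> insert 0 (snd ` set_mset (rc a))"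
    by (rule Min_in) auto
  with neg have "Min (insert 0 (snd ` set_mset (rc a))) \<in> snd ` set_mset (rc a)" by auto
  moreover have "- int (rc_eps rc a) = Min (insert 0 (snd ` set_mset (rc a)))"
    unfolding rc_eps_def using neg by linarith
  ultimately show ?thesis by fastforce
qed

lemma rc_eps_eqI:
  assumes "\<And>i x. (i, x) \<in># rc a \<Longrightarrow> - int k \<le> x" "0 < k \<Longrightarrow> \<exists>i. (i, - int k) \<in># rc a"
  shows "rc_eps rc a = k"
proof (rule antisym)
  show "rc_eps rc a \<le> k"
    using rc_eps_attained[of rc a] assms(1) by (cases "rc_eps rc a = 0") fastforce+
  show "k \<le> rc_eps rc a"
    using assms(2) rc_eps_le[of _ "- int k" rc a] by (cases "k = 0") auto
qed

definition e_sel :: "rigged \<Rightarrow> nat \<Rightarrow> int \<Rightarrow> nat \<Rightarrow> bool" where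
  "e_sel rc a k l \<longleftrightarrow> 1 \<le> k \<and> (l, - k) \<in># rc a \<and>
     (\<forall>i x. (i, x) \<in># rc a \<longrightarrow> - k \<le> x \<and> (x = - k \<longrightarrow> l \<le> i))"

definition relabel :: "int \<Rightarrow> nat \<Rightarrow> (nat \<times> int) multiset \<Rightarrow> (nat \<times> int) multiset" where
  "relabel d l M = image_mset (\<lambda>(i, x). (i, if l \<le> i then x + d else x)) M"

text \<open>
  The operator \<open>e\<^sub>a\<close> on (unrestricted) rigged configurations: the selected string \<open>(l, -k)\<close> is replaced
  by \<open>(l - 1, 1 - k)\<close>, and all other strings keep the difference of vacancy number and rigging.
\<close>

definition e_app :: "affine_type \<Rightarrow> nat \<Rightarrow> int \<Rightarrow> nat \<Rightarrow> rigged \<Rightarrow> rigged" where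
  "e_app T a k l rc = (\<lambda>b.
     if b = a then relabel 2 l (rc a - {#(l, - k)#}) + (if 1 < l then {#(l - 1, 1 - k)#} else {#})
     else relabel (cartan T a b) l (rc b))"

definition es_sel :: "affine_type \<Rightarrow> multiplicities \<Rightarrow> rigged \<Rightarrow> nat \<Rightarrow> nat \<Rightarrow> bool" where
  "es_sel T L rc a m \<longleftrightarrow> (m, vacancy T L (shape rc) a m + 1) \<in># rc a \<and>
     (\<forall>i x. (i, x) \<in># rc a \<longrightarrow> x \<le> vacancy T L (shape rc) a i + 1 \<and>
        (x = vacancy T L (shape rc) a i + 1 \<longrightarrow> m \<le> i))"

text \<open>
  The conjugate of \<open>e\<^sub>a\<close> under the exchange of riggings and coriggings, in the case where the least
  corigging is \<open>-1\<close>.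
\<close>

definition es_app :: "affine_type \<Rightarrow> multiplicities \<Rightarrow> nat \<Rightarrow> nat \<Rightarrow> rigged \<Rightarrow> rigged" where
  "es_app T L a m rc = rc(a := rc a - {#(m, vacancy T L (shape rc) a m + 1)#} +
     (if 1 < m then {#(m - 1, vacancy T L (shape rc) a (m - 1))#} else {#}))"

lemma relabel_0 [simp]: "relabel 0 l M = M"
  by (simp add: relabel_def case_prod_beta' if_distrib cong: if_cong)

lemma relabel_simps [simp]:
  "relabel d l {#} = {#}" "relabel d l (add_mset s M) = add_mset (fst s, if l \<le> fst s then snd s + d else snd s) (relabel d l M)"
  "relabel d l (M + N) = relabel d l M + relabel d l N"
  by (auto simp: relabel_def case_prod_beta')

lemma relabel_mem: "(i, x) \<in># relabel d l M \<longleftrightarrow> (i, if l \<le> i then x - d else x) \<in># M"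
proof
  assume "(i, x) \<in># relabel d l M"
  then show "(i, if l \<le> i then x - d else x) \<in># M" by (auto simp: relabel_def)
next
  assume "(i, if l \<le> i then x - d else x) \<in># M"
  then show "(i, x) \<in># relabel d l M" unfolding relabel_def by (force split: if_splits)
qed

lemma relabel_shape [simp]: "image_mset fst (relabel d l M) = image_mset fst M"
  by (simp add: relabel_def image_mset.compositionality comp_def case_prod_beta')

lemma relabel_cong:
  assumes "\<And>i x. (i, x) \<in># M \<Longrightarrow> l \<le> i \<longleftrightarrow> l' \<le> i"
  shows "relabel d l M = relabel d l' M"
  unfolding relabel_def by (rule image_mset_cong) (use assms in auto)

lemma relabel_idI:
  assumes "\<And>i x. (i, x) \<in># M \<Longrightarrow> i < l"
  shows "relabel d l M = M"
proof -
  have "relabel d l M = image_mset id M"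
    unfolding relabel_def by (rule image_mset_cong) (use assms in force)
  then show ?thesis by simp
qed

lemma e_sel_length: "rc_ok T rc \<Longrightarrow> e_sel rc a k l \<Longrightarrow> 0 < l"
  by (auto simp: rc_ok_def e_sel_def)

lemma es_sel_length: "rc_ok T rc \<Longrightarrow> es_sel T L rc a m \<Longrightarrow> 0 < m"
  by (auto simp: rc_ok_def es_sel_def)

lemma e_sel_node: "rc_ok T rc \<Longrightarrow> e_sel rc a k l \<Longrightarrow> a \<in> classical_nodes T"
  by (auto simp: rc_ok_def e_sel_def)

lemma es_sel_node: "rc_ok T rc \<Longrightarrow> es_sel T L rc a m \<Longrightarrow> a \<in> classical_nodes T"
  by (auto simp: rc_ok_def es_sel_def)

lemma e_sel_eps: "e_sel rc a k l \<Longrightarrow> int (rc_eps rc a) = k"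
proof -
  assume e: "e_sel rc a k l"
  have "rc_eps rc a = nat k"
    by (rule rc_eps_eqI) (use e in \<open>auto simp: e_sel_def\<close>)
  with e show ?thesis by (simp add: e_sel_def)
qed

lemma e_sel_ex:
  assumes "0 < rc_eps rc a"
  obtains l where "e_sel rc a (int (rc_eps rc a)) l"
proof -
  let ?P = "\<lambda>i. (i, - int (rc_eps rc a)) \<in># rc a"
  have "?P (LEAST i. ?P i)" using rc_eps_attained[OF assms] by (rule LeastI_ex)
  then show ?thesis
    using assms by (intro that[of "LEAST i. ?P i"]) (auto simp: e_sel_def rc_eps_le intro: Least_le)
qed

lemma shape_remove:
  assumes "(l, x) \<in># M" "0 < l"
  shows "image_mset fst (M - {#(l, x)#} + (if 1 < l then {#(l - 1, y)#} else {#})) = remove_box l (image_mset fst M)"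
  using assms by (auto simp: remove_box_def image_mset_Diff)

lemma shape_e_app:
  assumes "(l, - k) \<in># rc a" "0 < l"
  shows "shape (e_app T a k l rc) = (shape rc)(a := remove_box l (shape rc a))"
  using shape_remove[OF assms] by (auto simp: shape_def e_app_def fun_eq_iff)

lemma shape_es_app:
  assumes "(m, vacancy T L (shape rc) a m + 1) \<in># rc a" "0 < m"
  shows "shape (es_app T L a m rc) = (shape rc)(a := remove_box m (shape rc a))"
  using shape_remove[OF assms] by (auto simp: shape_def es_app_def fun_eq_iff)

lemma vacancy_e_app:
  assumes "rc_ok T rc" "e_sel rc a k l"
  shows "vacancy T L (shape (e_app T a k l rc)) b i =
      vacancy T L (shape rc) b i + (if l \<le> i then cartan T b a else 0)"
    "rc_wt T L (shape (e_app T a k l rc)) b = rc_wt T L (shape rc) b + cartan T b a"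
proof -
  have 1: "(l, - k) \<in># rc a" using assms(2) by (simp add: e_sel_def)
  note 2 = vacancy_remove_box[OF e_sel_node[OF assms] shape_memI[of l "- k" rc a, OF 1] e_sel_length[OF assms]
      shape_e_app[of l k rc a T, OF 1 e_sel_length[OF assms]]]
  show "vacancy T L (shape (e_app T a k l rc)) b i =
      vacancy T L (shape rc) b i + (if l \<le> i then cartan T b a else 0)"
    "rc_wt T L (shape (e_app T a k l rc)) b = rc_wt T L (shape rc) b + cartan T b a"
    using 2 by blast+
qed

lemma vacancy_es_app:
  assumes "rc_ok T rc" "es_sel T L rc a m"
  shows "vacancy T L' (shape (es_app T L a m rc)) b i =
      vacancy T L' (shape rc) b i + (if m \<le> i then cartan T b a else 0)"
    "rc_wt T L' (shape (es_app T L a m rc)) b = rc_wt T L' (shape rc) b + cartan T b a"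
proof -
  have 1: "(m, vacancy T L (shape rc) a m + 1) \<in># rc a" using assms(2) by (simp add: es_sel_def)
  note 2 = vacancy_remove_box[OF es_sel_node[OF assms] shape_memI[of m _ rc a, OF 1] es_sel_length[OF assms]
      shape_es_app[of m T L rc a, OF 1 es_sel_length[OF assms]]]
  show "vacancy T L' (shape (es_app T L a m rc)) b i =
      vacancy T L' (shape rc) b i + (if m \<le> i then cartan T b a else 0)"
    "rc_wt T L' (shape (es_app T L a m rc)) b = rc_wt T L' (shape rc) b + cartan T b a"
    using 2 by blast+
qed

lemma e_app_mem:
  assumes "(i, x) \<in># e_app T a k l rc b"
  shows "if b = a then (\<exists>y. (i, y) \<in># rc a - {#(l, - k)#} \<and> x = y + (if l \<le> i then 2 else 0)) \<or> 1 < l \<and> i = l - 1 \<and> x = 1 - k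
     else \<exists>y. (i, y) \<in># rc b \<and> x = y + (if l \<le> i then cartan T a b else 0)"
  using assms by (auto simp: e_app_def relabel_mem split: if_splits)

lemma es_app_mem:
  assumes "(i, x) \<in># es_app T L a m rc b"
  shows "if b = a then (i, x) \<in># rc a - {#(m, vacancy T L (shape rc) a m + 1)#} \<or>
       1 < m \<and> i = m - 1 \<and> x = vacancy T L (shape rc) a (m - 1)
     else (i, x) \<in># rc b"
  using assms by (auto simp: es_app_def split: if_splits)

lemma rc_ok_e_app:
  assumes "rc_ok T rc" "e_sel rc a k l"
  shows "rc_ok T (e_app T a k l rc)"
  unfolding rc_ok_def
proof (intro conjI allI impI)
  fix b assume "b \<notin> classical_nodes T"
  then show "e_app T a k l rc b = {#}"
    using e_sel_node[OF assms] assms(1) by (auto simp: e_app_def rc_ok_def)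
next
  fix b i x assume "(i, x) \<in># e_app T a k l rc b"
  then show "0 < i"
    using e_app_mem[of i x T a k l rc b] assms(1) by (auto simp: rc_ok_def split: if_splits dest!: in_diffD)
qed

lemma rc_ok_es_app:
  assumes "rc_ok T rc" "es_sel T L rc a m"
  shows "rc_ok T (es_app T L a m rc)"
  unfolding rc_ok_def
proof (intro conjI allI impI)
  fix b assume "b \<notin> classical_nodes T"
  then show "es_app T L a m rc b = {#}"
    using es_sel_node[OF assms] assms(1) by (auto simp: es_app_def rc_ok_def)
next
  fix b i x assume "(i, x) \<in># es_app T L a m rc b"
  then show "0 < i"
    using es_app_mem[of i x T L a m rc b] assms(1) by (auto simp: rc_ok_def split: if_splits dest!: in_diffD)
qed

text \<open>\<open>e_app\<close> moves the riggings of another node together with its vacancy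
  numbers. Coriggings there are preserved, and conjugate operators see nothing but
  coriggings.\<close>

lemma es_sel_e_app:
  assumes "rc_ok T rc" "e_sel rc a k l" "b \<noteq> a"
  shows "es_sel T L (e_app T a k l rc) b m \<longleftrightarrow> es_sel T L rc b m"
proof -
  note V = vacancy_e_app(1)[OF assms(1,2), of L b] cartan_sym[of T a b]
  have M: "(i, x) \<in># e_app T a k l rc b \<longleftrightarrow> (i, x - (if l \<le> i then cartan T b a else 0)) \<in># rc b" for i x
    using assms(3) by (simp add: e_app_def relabel_mem V(2))
  have "(\<forall>i x. (i, x) \<in># e_app T a k l rc b \<longrightarrow> Q i (x - (if l \<le> i then cartan T b a else 0))) \<longleftrightarrow>
      (\<forall>i x. (i, x) \<in># rc b \<longrightarrow> Q i x)" for Q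
    unfolding M by (metis add_diff_cancel_right')
  from this[of "\<lambda>i x. x \<le> vacancy T L (shape rc) b i + 1 \<and> (x = vacancy T L (shape rc) b i + 1 \<longrightarrow> m \<le> i)"]
  show ?thesis unfolding es_sel_def V(1) M by (simp add: algebra_simps)
qed

lemma node_valid_e_app:
  assumes "rc_ok T rc" "e_sel rc a k l" "b \<noteq> a"
  shows "node_valid T L (e_app T a k l rc) b \<longleftrightarrow> node_valid T L rc b"
proof -
  note V = vacancy_e_app(1)[OF assms(1,2), of L b] cartan_sym[of T a b]
  have M: "(i, x) \<in># e_app T a k l rc b \<longleftrightarrow> (i, x - (if l \<le> i then cartan T b a else 0)) \<in># rc b" for i x
    using assms(3) by (simp add: e_app_def relabel_mem V(2))
  have "(\<forall>i x. (i, x) \<in># e_app T a k l rc b \<longrightarrow> Q i (x - (if l \<le> i then cartan T b a else 0))) \<longleftrightarrow>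
      (\<forall>i x. (i, x) \<in># rc b \<longrightarrow> Q i x)" for Q
    unfolding M by (metis add_diff_cancel_right')
  from this[of "\<lambda>i x. x \<le> vacancy T L (shape rc) b i"]
  show ?thesis unfolding node_valid_def V(1) by (simp add: algebra_simps)
qed

lemma es_app_other: "b \<noteq> a \<Longrightarrow> es_app T L a m rc b = rc b"
  by (simp add: es_app_def)

lemma rc_eps_cong: "rc a = rc' a \<Longrightarrow> rc_eps rc a = rc_eps rc' a"
  by (simp add: rc_eps_def)

lemma e_sel_cong: "rc a = rc' a \<Longrightarrow> e_sel rc a k l \<longleftrightarrow> e_sel rc' a k l"
  by (simp add: e_sel_def)

lemma relabel_diff:
  assumes "s \<in># M"
  shows "relabel d l (M - {#s#}) = relabel d l M - {#(fst s, if l \<le> fst s then snd s + d else snd s)#}"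
proof -
  obtain N where "M = add_mset s N" using multi_member_split[OF assms] by blast
  then show ?thesis by simp
qed

text \<open>The conjugate operator leaves the riggings at \<open>a\<close> alone, and
  \<open>e_app\<close> leaves the coriggings at \<open>b\<close> alone, so neither disturbs the
  selection made by the other.\<close>

lemma e_es_commute_other:
  assumes "rc_ok T rc" "e_sel rc a k l" "es_sel T L rc b m" "a \<noteq> b"
  shows "es_app T L b m (e_app T a k l rc) = e_app T a k l (es_app T L b m rc)"
proof
  fix c
  note V = vacancy_e_app(1)[OF assms(1,2), of L b] cartan_sym[of T a b]
  have m: "(m, vacancy T L (shape rc) b m + 1) \<in># rc b" using assms(3) by (simp add: es_sel_def)
  show "es_app T L b m (e_app T a k l rc) c = e_app T a k l (es_app T L b m rc) c"
  proof (cases "c = b")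
    case True
    with assms(4) show ?thesis
      unfolding es_app_def V(1) using relabel_diff[OF m, of "cartan T b a" l]
      by (simp add: e_app_def V(2) algebra_simps)
  next
    case False
    then show ?thesis by (simp add: es_app_def e_app_def)
  qed
qed

text \<open>Strings that survive keep their coriggings or, if shorter than \<open>l\<close>, all
  their data; only the new string could violate the bound.\<close>

lemma node_valid_e_app_same:
  assumes "rc_ok T rc" "e_sel rc a k l" "node_valid T L rc a"
  shows "node_valid T L (e_app T a k l rc) a"
proof -
  define p where "p = vacancy T L (shape rc) a"
  note V = vacancy_e_app(1)[OF assms(1,2), of L a]
  have a: "a \<in> classical_nodes T" and l: "0 < l" and k: "1 \<le> k"
    using e_sel_node[OF assms(1,2)] e_sel_length[OF assms(1,2)] assms(2) by (auto simp: e_sel_def)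
  have S: "- k \<le> p i" "i < l \<Longrightarrow> - k < p i" if "i \<in># shape rc a" for i
    using that assms(2,3) unfolding e_sel_def node_valid_def p_def[symmetric]
    by (meson shape_memE[of i rc a] order_trans, meson shape_memE[of i rc a] not_le order_le_imp_less_or_eq order_less_le_trans)
  \<comment> \<open>The new string has rigging \<open>1 - k\<close>, so the strict bound is the
    right one. Strings shorter than \<open>l\<close> have riggings above \<open>- k\<close>, and
    concavity bridges the lengths without strings.\<close>
  have "- k < p (l - 1)"
  proof (rule concave_gt[where j = l])
    show "- k \<le> p l" using S(1) assms(2) by (auto simp: e_sel_def intro: shape_memI)
    show "- k < p i \<or> concave_at p i" if "0 < i" "i < l" for i
      using vacancy_concave[OF a that(1)] S(2)[OF _ that(2)] unfolding p_def by blast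
  qed (use k l in \<open>auto simp: p_def\<close>)
  then have new: "1 < l \<Longrightarrow> 1 - k \<le> vacancy T L (shape (e_app T a k l rc)) a (l - 1)"
    unfolding V using l by (auto simp: p_def[symmetric])
  show ?thesis
    unfolding node_valid_def
  proof (intro allI impI)
    fix i x assume "(i, x) \<in># e_app T a k l rc a"
    from e_app_mem[OF this] show "x \<le> vacancy T L (shape (e_app T a k l rc)) a i"
      using new assms(3) unfolding node_valid_def V by (auto dest!: in_diffD)
  qed
qed

lemma rc_valid_e_app:
  assumes "rc_valid T L rc" "e_sel rc a k l"
  shows "rc_valid T L (e_app T a k l rc)"
  using assms unfolding rc_valid_def
  by (metis node_valid_e_app node_valid_e_app_same rc_ok_e_app)

text \<open>The new string of length \<open>m - 1\<close> is singular, so its rigging is a vacancy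
  number, and this is nonnegative by the same minimum principle: strings shorter than
  \<open>m\<close> have nonnegative coriggings.\<close>

lemma rc_eps_es_app_zero:
  assumes "rc_ok T rc" "es_sel T L rc a m" "rc_eps rc a = 0"
  shows "rc_eps (es_app T L a m rc) a = 0"
proof -
  define p where "p = vacancy T L (shape rc) a"
  have a: "a \<in> classical_nodes T" and m: "0 < m"
    using es_sel_node[OF assms(1,2)] es_sel_length[OF assms(1,2)] by auto
  have lab: "0 \<le> x" if "(i, x) \<in># rc a" for i x using rc_eps_le[of i x rc a] that assms(3) by simp
  have S: "- 1 \<le> p i" "i < m \<Longrightarrow> - 1 < p i" if i: "i \<in># shape rc a" for i
  proof -
    obtain x where x: "(i, x) \<in># rc a" using shape_memE[OF i] by blast
    have "x \<le> p i + 1 \<and> (x = p i + 1 \<longrightarrow> m \<le> i)" using assms(2) x unfolding es_sel_def p_def by blast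
    with lab[OF x] show "- 1 \<le> p i" "i < m \<Longrightarrow> - 1 < p i" by auto
  qed
  have "- 1 < p (m - 1)"
  proof (rule concave_gt[where j = m])
    show "- 1 \<le> p m" using S(1) assms(2) by (auto simp: es_sel_def intro: shape_memI)
    show "- 1 < p i \<or> concave_at p i" if "0 < i" "i < m" for i
      using vacancy_concave[OF a that(1)] S(2)[OF _ that(2)] unfolding p_def by blast
  qed (use m in \<open>auto simp: p_def\<close>)
  then have new: "0 \<le> vacancy T L (shape rc) a (m - 1)" by (simp add: p_def)
  show ?thesis
  proof (rule rc_eps_eqI)
    fix i x assume "(i, x) \<in># es_app T L a m rc a"
    from es_app_mem[OF this] show "- int 0 \<le> x" using new lab by (auto dest!: in_diffD)
  qed simp
qed

lemma add_mset2:
  assumes "s \<in># M" "t \<in># M" "s \<noteq> t \<or> 2 \<le> count M s"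
  obtains N where "M = add_mset s (add_mset t N)"
proof -
  obtain N where N: "M = add_mset s N" using multi_member_split[OF assms(1)] by blast
  have "t \<in># N" using assms(2,3) N by (auto simp: Suc_le_eq)
  then obtain N' where "N = add_mset t N'" using multi_member_split[of t N] by blast
  with N that show ?thesis by blast
qed

text \<open>
  The two operators at one node commute unless they select the same string and no longer strings are
  present, in which case they agree. Below, \<open>P = - k - 1\<close> is a lower bound of the vacancy numbers.
\<close>

locale single_node =
  fixes T :: affine_type and L :: multiplicities and rc :: rigged and a :: nat and k :: int and l m :: nat
  assumes ok: "rc_ok T rc" and e: "e_sel rc a k l" and es: "es_sel T L rc a m"
begin

definition p :: "nat \<Rightarrow> int" where "p = vacancy T L (shape rc) a"

definition commuting :: bool where
  "commuting \<longleftrightarrow> (\<exists>l' m'. e_sel (es_app T L a m rc) a k l' \<and> es_sel T L (e_app T a k l rc) a m' \<and>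
     es_app T L a m' (e_app T a k l rc) = e_app T a k l' (es_app T L a m rc))"

lemma a: "a \<in> classical_nodes T" and l0: "0 < l" and m0: "0 < m" and k1: "1 \<le> k"
  using e_sel_node[OF ok e] e_sel_length[OF ok e] es_sel_length[OF ok es] e by (auto simp: e_sel_def)

lemma lmem: "(l, - k) \<in># rc a" and mmem: "(m, p m + 1) \<in># rc a"
  using e es by (auto simp: e_sel_def es_sel_def p_def)

lemma lab: "(i, x) \<in># rc a \<Longrightarrow> - k \<le> x" "(i, x) \<in># rc a \<Longrightarrow> x = - k \<Longrightarrow> l \<le> i"
  using e by (auto simp: e_sel_def)

lemma colab: "(i, x) \<in># rc a \<Longrightarrow> x \<le> p i + 1" "(i, x) \<in># rc a \<Longrightarrow> x = p i + 1 \<Longrightarrow> m \<le> i"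
  using es by (auto simp: es_sel_def p_def)

text \<open>Rigging and corigging of a string add up to its vacancy number. The former is at least
  \<open>- k\<close>, the latter at least \<open>- 1\<close>, and each gains one below the
  respective selected length.\<close>

lemma string_vac:
  assumes "i \<in># shape rc a"
  shows "- k - 1 \<le> p i" "i < l \<or> i < m \<Longrightarrow> - k \<le> p i" "i < l \<Longrightarrow> i < m \<Longrightarrow> 1 - k \<le> p i"
proof -
  obtain x where x: "(i, x) \<in># rc a" using shape_memE[OF assms] by blast
  show "- k - 1 \<le> p i" "i < l \<or> i < m \<Longrightarrow> - k \<le> p i" "i < l \<Longrightarrow> i < m \<Longrightarrow> 1 - k \<le> p i"
    using lab[OF x] colab[OF x] by linarith+
qed

lemma vac_ge: "- k - 1 \<le> p i"
  unfolding p_def by (rule vacancy_ge[OF a]) (use k1 string_vac(1) p_def in auto)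

lemma p0: "p 0 = 0" by (simp add: p_def)

lemma concave: "0 < i \<Longrightarrow> i \<notin># shape rc a \<Longrightarrow> concave_at p i"
  unfolding p_def by (rule vacancy_concave[OF a])

lemma lshape: "l \<in># shape rc a" and mshape: "m \<in># shape rc a"
  using lmem mmem by (auto intro: shape_memI)

lemma below:
  assumes "i < l" "i < m \<or> l = m"
  shows "- k \<le> p i"
proof -
  have "- k - 1 < p i"
  proof (rule concave_gt[where j = l])
    show "- k - 1 < p i \<or> concave_at p i" if "0 < i" "i < l" for i
      using string_vac(2)[of i] concave[OF that(1)] that(2) by fastforce
  qed (use vac_ge assms k1 p0 in auto)
  then show ?thesis by simp
qed

lemma below_l: "- k \<le> p (l - 1)"
proof -
  have "- k - 1 < p (l - 1)"
  proof (rule concave_gt[where j = l])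
    show "- k - 1 < p i \<or> concave_at p i" if "0 < i" "i < l" for i
      using string_vac(2)[of i] concave[OF that(1)] that(2) by fastforce
  qed (use vac_ge l0 k1 p0 in auto)
  then show ?thesis by simp
qed

lemma below_m: "- k \<le> p (m - 1)"
proof -
  have "- k - 1 < p (m - 1)"
  proof (rule concave_gt[where j = m])
    show "- k - 1 < p i \<or> concave_at p i" if "0 < i" "i < m" for i
      using string_vac(2)[of i] concave[OF that(1)] that(2) by fastforce
  qed (use vac_ge m0 k1 p0 in auto)
  then show ?thesis by simp
qed

lemma below_both:
  assumes "j \<le> l" "j \<le> m" "- k \<le> p j" "i < j"
  shows "1 - k \<le> p i"
proof -
  have "- k < p i"
  proof (rule concave_gt[where j = j])
    show "- k < p i \<or> concave_at p i" if "0 < i" "i < j" for i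
      using string_vac(3)[of i] concave[OF that(1)] that(2) assms(1,2) by fastforce
  qed (use assms k1 p0 in auto)
  then show ?thesis by simp
qed

lemma vac_e: "vacancy T L (shape (e_app T a k l rc)) a i = p i + (if l \<le> i then 2 else 0)"
  unfolding vacancy_e_app(1)[OF ok e] p_def by simp

text \<open>With two distinct strings, or two copies of one, each operator acts on its own. The two
  bounds prevent the string created by one operator from being selected by the other in place of a
  longer one.\<close>

lemma commuting_two_strings:
  assumes N: "rc a = add_mset (l, - k) (add_mset (m, p m + 1) N)"
    and l: "l \<le> m \<Longrightarrow> 1 - k \<le> p (l - 1)" and m: "m \<le> l \<Longrightarrow> 1 - k \<le> p (m - 1)"
  shows commuting
proof -
  have eN: "e_app T a k l rc a = relabel 2 l N + {#(m, p m + 1 + (if l \<le> m then 2 else 0))#} +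
      (if 1 < l then {#(l - 1, 1 - k)#} else {#})"
    by (simp add: e_app_def N)
  have esN: "es_app T L a m rc a = N + {#(l, - k)#} + (if 1 < m then {#(m - 1, p (m - 1))#} else {#})"
    by (simp add: es_app_def p_def[symmetric] N add_mset_commute)
  have "es_sel T L (e_app T a k l rc) a m"
    unfolding es_sel_def vac_e
  proof (intro conjI allI impI)
    show "(m, p m + (if l \<le> m then 2 else 0) + 1) \<in># e_app T a k l rc a" by (simp add: eN)
    fix i x assume "(i, x) \<in># e_app T a k l rc a"
    then consider "(i, x - (if l \<le> i then 2 else 0)) \<in># N" | "i = m" "x = p m + 1 + (if l \<le> m then 2 else 0)"
      | "1 < l" "i = l - 1" "x = 1 - k"
      unfolding eN by (auto simp: relabel_mem split: if_splits)
    then have "x \<le> p i + (if l \<le> i then 2 else 0) + 1 \<and> (x = p i + (if l \<le> i then 2 else 0) + 1 \<longrightarrow> m \<le> i)"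
    proof cases
      case 1
      then have "(i, x - (if l \<le> i then 2 else 0)) \<in># rc a" using N by simp
      from colab[OF this] show ?thesis by (cases "l \<le> i") auto
    next
      case 3
      then show ?thesis using l below_l by (cases "l \<le> m") auto
    qed auto
    then show "x \<le> p i + (if l \<le> i then 2 else 0) + 1" "x = p i + (if l \<le> i then 2 else 0) + 1 \<Longrightarrow> m \<le> i"
      by blast+
  qed
  moreover have "e_sel (es_app T L a m rc) a k l"
    unfolding e_sel_def
  proof (intro conjI allI impI)
    show "(l, - k) \<in># es_app T L a m rc a" by (simp add: esN)
    fix i x assume "(i, x) \<in># es_app T L a m rc a"
    then consider "(i, x) \<in># N" | "i = l" "x = - k" | "1 < m" "i = m - 1" "x = p (m - 1)"
      unfolding esN by (auto split: if_splits)
    then have "- k \<le> x \<and> (x = - k \<longrightarrow> l \<le> i)"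
    proof cases
      case 1
      then show ?thesis using lab[of i x] N by auto
    next
      case 3
      then show ?thesis using m below_m by (cases "m \<le> l") auto
    qed auto
    then show "- k \<le> x" "x = - k \<Longrightarrow> l \<le> i" by blast+
  qed (rule k1)
  moreover have "es_app T L a m (e_app T a k l rc) = e_app T a k l (es_app T L a m rc)"
  proof
    fix b
    show "es_app T L a m (e_app T a k l rc) b = e_app T a k l (es_app T L a m rc) b"
    proof (cases "b = a")
      case True
      have "es_app T L a m (e_app T a k l rc) a = relabel 2 l N + (if 1 < l then {#(l - 1, 1 - k)#} else {#}) +
          (if 1 < m then {#(m - 1, p (m - 1) + (if l \<le> m - 1 then 2 else 0))#} else {#})"
        unfolding es_app_def vac_e by (simp add: eN)
      moreover have "e_app T a k l (es_app T L a m rc) a = relabel 2 l N + (if 1 < l then {#(l - 1, 1 - k)#} else {#}) +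
          (if 1 < m then {#(m - 1, p (m - 1) + (if l \<le> m - 1 then 2 else 0))#} else {#})"
        unfolding e_app_def esN by simp
      ultimately show ?thesis using True by simp
    next
      case False
      then show ?thesis by (simp add: es_app_def e_app_def)
    qed
  qed
  ultimately show ?thesis unfolding commuting_def by blast
qed

lemma second_diff: "0 < i \<Longrightarrow> p (i + 1) + p (i - 1) = 2 * p i + 2 * int (count (shape rc a) i) - kink T L (shape rc) a i"
  unfolding p_def by (rule vacancy_second_diff[OF a])

lemma kink_ge: "0 \<le> kink T L (shape rc) a i" by (rule kink_nonneg)

text \<open>The threshold of the relabelling may be moved across lengths without a kink, because the
  neighbours have no strings of these lengths.\<close>

lemma relabel_other_node:
  assumes "b \<noteq> a" "\<And>i. min j j' \<le> i \<Longrightarrow> i < max j j' \<Longrightarrow> kink T L (shape rc) a i = 0"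
  shows "relabel (cartan T a b) j (rc b) = relabel (cartan T a b) j' (rc b)"
proof (cases "b \<in> classical_nodes T \<and> cartan T a b \<noteq> 0")
  case True
  show ?thesis
  proof (rule relabel_cong)
    fix i x assume "(i, x) \<in># rc b"
    then have "i \<in># shape rc b" by (rule shape_memI[of i x])
    then have "kink T L (shape rc) a i \<noteq> 0"
      using kink_zero[of T L "shape rc" a i b] True assms(1) by blast
    then have "\<not> (min j j' \<le> i \<and> i < max j j')" using assms(2) by blast
    then show "j \<le> i \<longleftrightarrow> j' \<le> i" by (auto simp: min_def max_def split: if_splits)
  qed
next
  case False
  then show ?thesis using ok by (auto simp: rc_ok_def)
qed

text \<open>The selected strings agree, and the string above is moved twice.\<close>

lemma commuting_slope:
  assumes "l = m" "p l = - k - 1" "p (l - 1) = - k"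
  shows commuting
proof -
  have l1: "1 < l" using assms(3) p0 k1 l0 by (cases "l = 1") auto
  then have l2: "l = Suc (Suc (l - 2))" and "\<not> l \<le> l - 1" by auto
  have no: "l - 1 \<notin># shape rc a" using string_vac(3)[of "l - 1"] assms l1 by auto
  have "1 - k \<le> p (l - 2)" using below_both[of "l - 1" "l - 2"] assms l1 by auto
  \<comment> \<open>The second difference at \<open>l - 1\<close> gives
    \<open>p (l - 2) = 1 - k\<close> minus the kink, so the bound just obtained forces the kink to
    vanish.\<close>
  then have q: "p (l - 2) = 1 - k" "kink T L (shape rc) a (l - 1) = 0"
    using second_diff[of "l - 1"] l1 no assms kink_ge[of "l - 1"] l2 by (auto simp: not_in_iff numeral_2_eq_2)
  obtain N where N: "rc a = add_mset (l, - k) N" using multi_member_split[OF lmem] by blast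
  have Nno: "(l - 1, x) \<notin># N" for x using no N by (auto simp: shape_def image_iff)
  have eN: "e_app T a k l rc a = add_mset (l - 1, 1 - k) (relabel 2 l N)"
    using l1 by (simp add: e_app_def N)
  have esN: "es_app T L a m rc a = add_mset (l - 1, - k) N"
    using l1 assms by (simp add: es_app_def p_def[symmetric] N)
  have "es_sel T L (e_app T a k l rc) a (l - 1)"
    unfolding es_sel_def vac_e
  proof (intro conjI allI impI)
    show "(l - 1, p (l - 1) + (if l \<le> l - 1 then 2 else 0) + 1) \<in># e_app T a k l rc a"
      using assms(2,3) \<open>\<not> l \<le> l - 1\<close> by (simp add: eN)
    fix i x assume "(i, x) \<in># e_app T a k l rc a"
    then consider "(i, x - (if l \<le> i then 2 else 0)) \<in># N" | "i = l - 1" "x = 1 - k"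
      unfolding eN by (auto simp: relabel_mem split: if_splits)
    then have "x \<le> p i + (if l \<le> i then 2 else 0) + 1 \<and> (x = p i + (if l \<le> i then 2 else 0) + 1 \<longrightarrow> l - 1 \<le> i)"
    proof cases
      case 1
      then have "(i, x - (if l \<le> i then 2 else 0)) \<in># rc a" using N by simp
      from colab[OF this] show ?thesis using assms(1) by (cases "l \<le> i") auto
    qed (use assms in auto)
    then show "x \<le> p i + (if l \<le> i then 2 else 0) + 1" "x = p i + (if l \<le> i then 2 else 0) + 1 \<Longrightarrow> l - 1 \<le> i"
      by blast+
  qed
  moreover have "e_sel (es_app T L a m rc) a k (l - 1)"
    unfolding e_sel_def
  proof (intro conjI allI impI)
    show "(l - 1, - k) \<in># es_app T L a m rc a" by (simp add: esN)
    fix i x assume "(i, x) \<in># es_app T L a m rc a"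
    then have "- k \<le> x \<and> (x = - k \<longrightarrow> l - 1 \<le> i)"
      unfolding esN using lab[of i x] N by auto
    then show "- k \<le> x" "x = - k \<Longrightarrow> l - 1 \<le> i" by blast+
  qed (rule k1)
  moreover have "es_app T L a (l - 1) (e_app T a k l rc) = e_app T a k (l - 1) (es_app T L a m rc)"
  proof
    fix b
    show "es_app T L a (l - 1) (e_app T a k l rc) b = e_app T a k (l - 1) (es_app T L a m rc) b"
    proof (cases "b = a")
      case True
      have r: "relabel 2 (l - 1) N = relabel 2 l N"
      proof (rule relabel_cong)
        fix i x assume "(i, x) \<in># N"
        then have "i \<noteq> l - 1" using Nno by auto
        then show "l - 1 \<le> i \<longleftrightarrow> l \<le> i" by auto
      qed
      have "l - 1 - 1 = l - 2" "\<not> l \<le> l - 2" using l1 by auto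
      then have "es_app T L a (l - 1) (e_app T a k l rc) a = relabel 2 l N + (if 1 < l - 1 then {#(l - 2, 1 - k)#} else {#})"
        unfolding es_app_def vac_e using assms(2,3) q l1 \<open>\<not> l \<le> l - 1\<close> by (simp add: eN)
      moreover have "e_app T a k (l - 1) (es_app T L a m rc) a = relabel 2 l N + (if 1 < l - 1 then {#(l - 2, 1 - k)#} else {#})"
        unfolding e_app_def esN using \<open>l - 1 - 1 = l - 2\<close> r by simp
      ultimately show ?thesis using True by simp
    next
      case False
      have "relabel (cartan T a b) l (rc b) = relabel (cartan T a b) (l - 1) (rc b)"
      proof (rule relabel_other_node[OF False])
        fix i assume "min l (l - 1) \<le> i" "i < max l (l - 1)"
        then have "i = l - 1" by auto
        then show "kink T L (shape rc) a i = 0" using q by simp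
      qed
      with False show ?thesis by (simp add: es_app_def e_app_def)
    qed
  qed
  ultimately show ?thesis unfolding commuting_def by blast
qed

text \<open>The single string at \<open>l\<close> contributes 2 to the second difference, and this
  is just the drop from \<open>1 - k\<close> to the lower bound \<open>- k - 1\<close>. There is no
  slack for a kink, and beyond \<open>l\<close> concavity together with the lower bound keeps the
  sequence constant as long as no further string occurs.\<close>

lemma flat_above:
  assumes "l = m" "p l = - k - 1" "1 - k \<le> p (l - 1)" "count (shape rc a) l = 1"
    "\<And>i. l < i \<Longrightarrow> i < j \<Longrightarrow> i \<notin># shape rc a" "l < j"
  shows "p j = - k - 1 \<and> p (j - 1) = - k - 1 \<and> (\<forall>i. l \<le> i \<longrightarrow> i < j \<longrightarrow> kink T L (shape rc) a i = 0) \<and> p (l - 1) = 1 - k"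
  using assms(5,6)
proof (induction j)
  case (Suc j)
  show ?case
  proof (cases "l = j")
    case True
    then show ?thesis
      using second_diff[OF l0] assms(2-4) vac_ge[of "l + 1"] kink_ge[of l] by (auto simp: less_Suc_eq)
  next
    case False
    then have lj: "l < j" using Suc.prems by simp
    then have IH: "p j = - k - 1" "p (j - 1) = - k - 1" "\<And>i. l \<le> i \<Longrightarrow> i < j \<Longrightarrow> kink T L (shape rc) a i = 0" "p (l - 1) = 1 - k"
      using Suc by auto
    have "count (shape rc a) j = 0" using Suc.prems(1)[of j] lj by (simp add: not_in_iff)
    then have "p (Suc j) = - k - 1 \<and> kink T L (shape rc) a j = 0"
      using second_diff[of j] IH(1,2) vac_ge[of "Suc j"] kink_ge[of j] lj by auto
    with IH show ?thesis by (auto simp: less_Suc_eq)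
  qed
qed simp

text \<open>Both operators want the string of length \<open>l\<close>, but the next longer string,
  of length \<open>j\<close>, also has rigging \<open>- k\<close> and corigging \<open>- 1\<close>.
  Whichever operator comes second uses that string, and the two results agree.\<close>

lemma commuting_flat:
  assumes "l = m" "p l = - k - 1" "1 - k \<le> p (l - 1)" "count (shape rc a) l = 1"
    "\<And>i. l < i \<Longrightarrow> i < j \<Longrightarrow> i \<notin># shape rc a" "l < j" "j \<in># shape rc a"
  shows commuting
proof -
  have F: "p j = - k - 1" "p (j - 1) = - k - 1" "\<And>i. l \<le> i \<Longrightarrow> i < j \<Longrightarrow> kink T L (shape rc) a i = 0" "p (l - 1) = 1 - k"
    using flat_above[OF assms(1-6)] by auto
  obtain x where x: "(j, x) \<in># rc a" using shape_memE[OF assms(7)] by blast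
  \<comment> \<open>The rigging is squeezed between the least rigging \<open>- k\<close> and
    \<open>p j + 1\<close>, which is \<open>- k\<close> as well.\<close>
  have "x = - k" using lab(1)[OF x] colab(1)[OF x] F(1) by simp
  then obtain N where N: "rc a = add_mset (l, - k) (add_mset (j, - k) N)"
    using add_mset2[OF lmem x] assms(6) by blast
  have Nlen: "i < l \<or> j \<le> i" if "(i, y) \<in># N" for i y
  proof -
    have "i \<in># shape rc a" using that N by (intro shape_memI[of i y]) auto
    moreover have "i \<noteq> l"
    proof
      assume "i = l"
      then have "l \<in># image_mset fst N" using that by force
      then have "count (shape rc a) l \<ge> 2" unfolding shape_def N by (simp add: Suc_le_eq)
      then show False using assms(4) by simp
    qed
    ultimately show ?thesis using assms(5)[of i] by fastforce
  qed
  have j1: "1 < j" and "\<not> j \<le> l - 1" using assms(6) l0 by auto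
  have eN: "e_app T a k l rc a = relabel 2 l N + {#(j, 2 - k)#} + (if 1 < l then {#(l - 1, 1 - k)#} else {#})"
    using assms(6) by (simp add: e_app_def N)
  have esN: "es_app T L a m rc a = N + {#(j, - k)#} + (if 1 < l then {#(l - 1, 1 - k)#} else {#})"
    using assms(1,2) F(4) by (simp add: es_app_def p_def[symmetric] N)
  have "es_sel T L (e_app T a k l rc) a j"
    unfolding es_sel_def vac_e
  proof (intro conjI allI impI)
    show "(j, p j + (if l \<le> j then 2 else 0) + 1) \<in># e_app T a k l rc a"
      using F assms(6) by (simp add: eN)
    fix i x assume "(i, x) \<in># e_app T a k l rc a"
    then consider "(i, x - (if l \<le> i then 2 else 0)) \<in># N" | "i = j" "x = 2 - k" | "1 < l" "i = l - 1" "x = 1 - k"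
      unfolding eN by (auto simp: relabel_mem split: if_splits)
    then have "x \<le> p i + (if l \<le> i then 2 else 0) + 1 \<and> (x = p i + (if l \<le> i then 2 else 0) + 1 \<longrightarrow> j \<le> i)"
    proof cases
      case 1
      then have "(i, x - (if l \<le> i then 2 else 0)) \<in># rc a" using N by simp
      from colab[OF this] show ?thesis using assms(1) Nlen[OF 1] by (cases "l \<le> i") auto
    qed (use F assms(6) in auto)
    then show "x \<le> p i + (if l \<le> i then 2 else 0) + 1" "x = p i + (if l \<le> i then 2 else 0) + 1 \<Longrightarrow> j \<le> i"
      by blast+
  qed
  moreover have "e_sel (es_app T L a m rc) a k j"
    unfolding e_sel_def
  proof (intro conjI allI impI)
    show "(j, - k) \<in># es_app T L a m rc a" by (simp add: esN)
    fix i x assume "(i, x) \<in># es_app T L a m rc a"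
    then have "- k \<le> x \<and> (x = - k \<longrightarrow> j \<le> i)"
      unfolding esN using lab[of i x] N Nlen[of i x] by (auto split: if_splits)
    then show "- k \<le> x" "x = - k \<Longrightarrow> j \<le> i" by blast+
  qed (rule k1)
  moreover have "es_app T L a j (e_app T a k l rc) = e_app T a k j (es_app T L a m rc)"
  proof
    fix b
    show "es_app T L a j (e_app T a k l rc) b = e_app T a k j (es_app T L a m rc) b"
    proof (cases "b = a")
      case True
      have r: "relabel 2 j N = relabel 2 l N"
        by (rule relabel_cong) (use Nlen assms(6) in fastforce)
      have "es_app T L a j (e_app T a k l rc) a = relabel 2 l N + (if 1 < l then {#(l - 1, 1 - k)#} else {#}) + {#(j - 1, 1 - k)#}"
        unfolding es_app_def vac_e using F assms(6) j1 by (simp add: eN)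
      moreover have "e_app T a k j (es_app T L a m rc) a = relabel 2 l N + (if 1 < l then {#(l - 1, 1 - k)#} else {#}) + {#(j - 1, 1 - k)#}"
        unfolding e_app_def esN using assms(6) j1 \<open>\<not> j \<le> l - 1\<close> by (simp add: r)
      ultimately show ?thesis using True by simp
    next
      case False
      have "relabel (cartan T a b) l (rc b) = relabel (cartan T a b) j (rc b)"
        by (rule relabel_other_node[OF False]) (use F(3) assms(6) in auto)
      with False show ?thesis by (simp add: es_app_def e_app_def)
    qed
  qed
  ultimately show ?thesis unfolding commuting_def by blast
qed

text \<open>Without longer strings the vacancy numbers remain at \<open>- k - 1\<close> for ever. So
  the weight is \<open>- k - 1\<close>, there are no kinks from \<open>l\<close> on, the neighbours
  have no strings to be relabelled, and both operators just replace the string of length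
  \<open>l\<close> by one of length \<open>l - 1\<close> with rigging \<open>1 - k\<close>.\<close>

lemma not_commuting:
  assumes "l = m" "p l = - k - 1" "1 - k \<le> p (l - 1)" "count (shape rc a) l = 1"
    "\<And>i. l < i \<Longrightarrow> i \<notin># shape rc a"
  shows "e_app T a k l rc = es_app T L a m rc" "rc_wt T L (shape rc) a = - k - 1"
    "node_valid T L (e_app T a k l rc) a" "int (rc_eps (e_app T a k l rc) a) = k - 1"
proof -
  have F: "p j = - k - 1" "\<And>i. l \<le> i \<Longrightarrow> i < j \<Longrightarrow> kink T L (shape rc) a i = 0" "p (l - 1) = 1 - k" if "l < j" for j
    using flat_above[OF assms(1-4) assms(5) that] by auto
  have F': "p (l - 1) = 1 - k" using F(3)[of "Suc l"] by simp
  obtain N where N: "rc a = add_mset (l, - k) N" using multi_member_split[OF lmem] by blast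
  have Nlen: "i < l" if "(i, y) \<in># N" for i y
  proof -
    have "i \<in># shape rc a" using that N by (intro shape_memI[of i y]) auto
    moreover have "i \<noteq> l"
    proof
      assume "i = l"
      then have "l \<in># image_mset fst N" using that by force
      then have "count (shape rc a) l \<ge> 2" unfolding shape_def N by (simp add: Suc_le_eq)
      then show False using assms(4) by simp
    qed
    ultimately show ?thesis using assms(5)[of i] by fastforce
  qed
  have r: "relabel 2 l N = N" by (rule relabel_idI) (use Nlen in blast)
  have eN: "e_app T a k l rc a = N + (if 1 < l then {#(l - 1, 1 - k)#} else {#})"
    by (simp add: e_app_def N r)
  have esN: "es_app T L a m rc a = N + (if 1 < l then {#(l - 1, 1 - k)#} else {#})"
    using assms(1,2) F' by (simp add: es_app_def p_def[symmetric] N)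
  show "e_app T a k l rc = es_app T L a m rc"
  proof
    fix b
    show "e_app T a k l rc b = es_app T L a m rc b"
    proof (cases "b = a")
      case True
      then show ?thesis using eN esN by simp
    next
      case False
      obtain J where J: "\<And>i. J \<le> i \<Longrightarrow> b \<in> classical_nodes T \<Longrightarrow> i \<notin># shape rc b"
        using vacancy_large[of T L "shape rc" a] by metis
      have "relabel (cartan T a b) l (rc b) = relabel (cartan T a b) (max J (Suc l)) (rc b)"
        by (rule relabel_other_node[OF False]) (use F(2)[of "max J (Suc l)"] in auto)
      also have "\<dots> = rc b"
      proof (rule relabel_idI)
        fix i x assume i: "(i, x) \<in># rc b"
        then have "b \<in> classical_nodes T" using ok by (auto simp: rc_ok_def)
        then show "i < max J (Suc l)" using J shape_memI[of i x rc b, OF i] by (meson max.cobounded1 not_le order_trans)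
      qed
      finally show ?thesis using False by (simp add: e_app_def es_app_def)
    qed
  qed
  obtain J where J: "\<And>i. J \<le> i \<Longrightarrow> p i = rc_wt T L (shape rc) a"
    unfolding p_def using vacancy_large[of T L "shape rc" a] by metis
  show "rc_wt T L (shape rc) a = - k - 1" using J[of "max J (Suc l)"] F(1)[of "max J (Suc l)"] by simp
  have N2: "1 - k \<le> y \<and> y \<le> p i" if "(i, y) \<in># N" for i y
  proof -
    have "(i, y) \<in># rc a" using that N by simp
    then show ?thesis
      using lab[of i y] colab[of i y] Nlen[OF that] assms(1) by (cases "y = - k"; cases "y = p i + 1") auto
  qed
  show "node_valid T L (e_app T a k l rc) a"
    unfolding node_valid_def vac_e
  proof (intro allI impI)
    fix i x assume "(i, x) \<in># e_app T a k l rc a"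
    then show "x \<le> p i + (if l \<le> i then 2 else 0)"
      unfolding eN using N2[of i x] F' by (auto split: if_splits)
  qed
  have "rc_eps (e_app T a k l rc) a = nat (k - 1)"
  proof (rule rc_eps_eqI)
    fix i x assume "(i, x) \<in># e_app T a k l rc a"
    then show "- int (nat (k - 1)) \<le> x" unfolding eN using N2[of i x] k1 by (auto split: if_splits)
  next
    assume "0 < nat (k - 1)"
    then have "l \<noteq> 1" using F' p0 by auto
    then have "1 < l" using l0 by simp
    then show "\<exists>i. (i, - int (nat (k - 1))) \<in># e_app T a k l rc a" unfolding eN using k1 by auto
  qed
  then show "int (rc_eps (e_app T a k l rc) a) = k - 1" using k1 by simp
qed

lemma commuting_or_equal:
  "commuting \<or> e_app T a k l rc = es_app T L a m rc \<and> rc_wt T L (shape rc) a = - k - 1 \<and>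
    node_valid T L (e_app T a k l rc) a \<and> int (rc_eps (e_app T a k l rc) a) = k - 1"
\<comment> \<open>Exactly in this case both operators select strings with the same length and
  rigging.\<close>
proof (cases "l = m \<and> p l = - k - 1")
  case True
  show ?thesis
  proof (cases "p (l - 1) = - k")
    case True
    then show ?thesis using commuting_slope \<open>l = m \<and> p l = - k - 1\<close> by blast
  next
    case False
    then have b: "1 - k \<le> p (l - 1)" using below_l by simp
    have ml: "(m, p m + 1) = (l, - k)" using \<open>l = m \<and> p l = - k - 1\<close> by auto
    show ?thesis
    proof (cases "2 \<le> count (shape rc a) l")
      case two: True
      obtain N where N: "rc a = add_mset (l, - k) N" using multi_member_split[OF lmem] by blast
      with two have "l \<in># image_mset fst N" by (simp add: shape_def Suc_le_eq)
      then obtain x where x: "(l, x) \<in># N" by force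
      then have "x = - k" using lab(1)[of l x] colab(1)[of l x] N True by auto
      then obtain N' where "N = add_mset (l, - k) N'" using x multi_member_split[of "(l, x)" N] by blast
      then have "rc a = add_mset (l, - k) (add_mset (m, p m + 1) N')" unfolding ml using N by simp
      from commuting_two_strings[OF this] b True show ?thesis by auto
    next
      case False
      moreover have "0 < count (shape rc a) l" using lshape by simp
      ultimately have one: "count (shape rc a) l = 1" by linarith
      show ?thesis
      proof (cases "\<exists>j>l. j \<in># shape rc a")
        case True
        let ?j = "LEAST j. l < j \<and> j \<in># shape rc a"
        have j: "l < ?j" "?j \<in># shape rc a" using LeastI_ex[OF True] by auto
        have "i \<notin># shape rc a" if "l < i" "i < ?j" for i using not_less_Least[OF that(2)] that(1) by blast
        then show ?thesis using commuting_flat[OF _ _ b one _ j] \<open>l = m \<and> p l = - k - 1\<close> by blast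
      next
        case False
        then show ?thesis using not_commuting[OF _ _ b one] True by blast
      qed
    qed
  qed
next
  case False
  have "(l, - k) \<noteq> (m, p m + 1)" using False by auto
  then obtain N where N: "rc a = add_mset (l, - k) (add_mset (m, p m + 1) N)"
    using add_mset2[OF lmem mmem] by blast
  have "1 - k \<le> p (l - 1)" if "l \<le> m"
    using below_both[of l "l - 1"] that False string_vac(2)[OF lshape] vac_ge[of l] l0 by fastforce
  moreover have "1 - k \<le> p (m - 1)" if "m \<le> l"
    using below_both[of m "m - 1"] that False string_vac(2)[OF mshape] vac_ge[of m] m0 by fastforce
  ultimately show ?thesis using commuting_two_strings[OF N] by blast
qed

end

section \<open>Chains of operators\<close>

lemma letter_status:
  assumes "i \<in> classical_nodes T" "valid_type T"
  shows "letter_e T i c = None \<or> letter_f T i c = None"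
    "letter_f T i c = Some d \<Longrightarrow> letter_f T i d = None"
  using assms [[linarith_neq_limit = 1]] by (cases rule: classical_nodes_cases; auto split: if_splits)+

text \<open>An arrow subtracts the simple root. For letters this follows from the three possible
  positions of \<open>c\<close> relative to \<open>a\<close>: equal, remote or adjacent.\<close>

lemma letter_wt_f:
  assumes "a \<in> classical_nodes T" "c \<in> classical_nodes T" "valid_type T" "letter_f T a y = Some z"
  shows "letter_wt T c z = letter_wt T c y - cartan T c a"
proof -
  have e: "letter_e T a z = Some y" using letter_ef[OF assms(1,3)] assms(4) by blast
  consider "c = a" | "c \<noteq> a" "cartan T a c = 0" | "adjacent_nodes T a c"
    using assms by (auto simp: adjacent_nodes_def)
  then show ?thesis
  proof cases
    case 1
    then show ?thesis
      using e assms(4) letter_status(1)[OF assms(1,3), of y] letter_status(2)[OF assms(1,3,4)] by (auto simp: letter_wt_def)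
  next
    case 2
    then show ?thesis
      using remote_letter(1,2)[OF assms(1,2,3) _ _ e] cartan_sym[of T a c] by (auto simp: letter_wt_def)
  next
    case 3
    have "cartan T c a = - 1"
      using 3 cartan_sym[of T a c] by (auto simp: adjacent_nodes_def cartan_def split: if_splits)
    then show ?thesis
      using pair_letter_e[OF 3 assms(3) e] pair_letter_status(2)[OF 3 assms(3), of z] e by (auto simp: letter_wt_def)
  qed
qed

text \<open>Letters with two outgoing arrows occur only at the fork of type \<open>D\<close>.\<close>

lemma letter_fork:
  assumes "a \<in> classical_nodes T" "b \<in> classical_nodes T" "valid_type T" "a \<noteq> b"
    "letter_f T a y = Some z" "letter_f T b y = Some z'"
  shows "cartan T a b = 0"
    "\<exists>u. letter_f T b z = Some u \<and> letter_f T a z' = Some u"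
    "c \<in> classical_nodes T \<Longrightarrow> letter_f T c z \<noteq> None \<Longrightarrow> c = b"
proof -
  obtain n where n: "T = TypeD n" "4 \<le> n" "y = int n - 1"
    "a = n - 1 \<and> b = n \<and> z = int n \<and> z' = - int n \<or> b = n - 1 \<and> a = n \<and> z' = int n \<and> z = - int n"
  proof (cases T)
    case (TypeA n)
    with assms show ?thesis by (auto split: if_splits)
  next
    case (TypeD n)
    have n4: "4 \<le> n" and ab: "1 \<le> a" "a \<le> n" "1 \<le> b" "b \<le> n"
      using assms(1-3) by (auto simp: TypeD classical_nodes_def)
    have f: "y = int a \<and> z = y + 1 \<or> y = - int a - 1 \<and> z = y + 1" if "a < n"
      using assms(5) that by (auto simp: TypeD split: if_splits)
    have f': "y = int b \<and> z' = y + 1 \<or> y = - int b - 1 \<and> z' = y + 1" if "b < n"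
      using assms(6) that by (auto simp: TypeD split: if_splits)
    have g: "y = int n - 1 \<and> z = - int n \<or> y = int n \<and> z = - int n + 1" if "a = n"
      using assms(5) that n4 by (auto simp: TypeD split: if_splits)
    have g': "y = int n - 1 \<and> z' = - int n \<or> y = int n \<and> z' = - int n + 1" if "b = n"
      using assms(6) that n4 by (auto simp: TypeD split: if_splits)
    consider "a < n" "b < n" | "a < n" "b = n" | "a = n" "b < n" using ab assms(4) by linarith
    then show ?thesis
    proof cases
      case 1
      then show ?thesis using f f' assms(4) ab by auto
    next
      case 2
      then show ?thesis using f g' ab n4 that[OF TypeD n4] by auto
    next
      case 3
      then show ?thesis using f' g ab n4 that[OF TypeD n4] by auto
    qed
  qed
  show "cartan T a b = 0" using n by (auto simp: cartan_def dynkin_edge_def)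
  have "letter_f (TypeD n) n (int n) = Some (1 - int n)" using n(2) by simp
  moreover have "letter_f (TypeD n) (n - 1) (- int n) = Some (1 - int n)" using n(2) by (simp add: of_nat_diff)
  ultimately show "\<exists>u. letter_f T b z = Some u \<and> letter_f T a z' = Some u" using n(1,4) by metis
  show "c = b" if "c \<in> classical_nodes T" "letter_f T c z \<noteq> None"
  proof -
    have c: "1 \<le> c" "c \<le> n" using that(1) by (auto simp: n(1) classical_nodes_def)
    have f: "letter_f (TypeD n) c z \<noteq> None" using that(2) n(1) by simp
    from n(4) show ?thesis
    proof
      assume *: "a = n - 1 \<and> b = n \<and> z = int n \<and> z' = - int n"
      have "\<not> c < n" using f c n(2) * by (auto split: if_splits)
      with c * show ?thesis by simp
    next
      assume *: "b = n - 1 \<and> a = n \<and> z' = int n \<and> z = - int n"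
      have "c < n" using f c n(2) * by (cases "c < n") (auto split: if_splits)
      moreover from this have "- int n = - (int c + 1)" using f c n(2) * by (auto split: if_splits)
      ultimately show ?thesis using * by simp
    qed
  qed
qed

lemma es_sel_unique: "es_sel T L rc a m \<Longrightarrow> es_sel T L rc a m' \<Longrightarrow> m = m'"
  unfolding es_sel_def by (meson order_antisym)

lemma e_sel_unique: "e_sel rc a k l \<Longrightarrow> e_sel rc a k l' \<Longrightarrow> l = l'"
  unfolding e_sel_def by (meson order_antisym)

lemma es_sel_not_valid: "es_sel T L rc a m \<Longrightarrow> \<not> node_valid T L rc a"
  unfolding es_sel_def node_valid_def by fastforce

lemma es_remote:
  assumes "rc_ok T rc" "es_sel T L rc a m" "b \<noteq> a" "cartan T b a = 0"
  shows "es_sel T L (es_app T L a m rc) b m' \<longleftrightarrow> es_sel T L rc b m'"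
    "node_valid T L (es_app T L a m rc) b \<longleftrightarrow> node_valid T L rc b"
  using vacancy_es_app(1)[OF assms(1,2), of L b] assms(3,4)
  by (simp_all add: es_sel_def node_valid_def es_app_other)

lemma es_es_commute:
  assumes "rc_ok T rc" "es_sel T L rc a m" "es_sel T L rc b m'" "b \<noteq> a" "cartan T b a = 0"
  shows "es_app T L a m (es_app T L b m' rc) = es_app T L b m' (es_app T L a m rc)"
proof -
  have "cartan T a b = 0" using assms(5) cartan_sym[of T a b] by simp
  then show ?thesis
    using vacancy_es_app(1)[OF assms(1,2), of L b] vacancy_es_app(1)[OF assms(1,3), of L a] assms(4,5)
    by (auto simp: fun_eq_iff es_app_def)
qed

section \<open>Chains: exchange of steps, uniqueness, compatibility with raising operators\<close>

inductive chain :: "affine_type \<Rightarrow> multiplicities \<Rightarrow> int \<Rightarrow> rigged \<Rightarrow> int \<Rightarrow> rigged \<Rightarrow> bool" for T L where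
  chain_refl: "chain T L y Y y Y"
| chain_step: "a \<in> classical_nodes T \<Longrightarrow> letter_f T a y = Some z \<Longrightarrow> es_sel T L Y a m \<Longrightarrow>
    chain T L z (es_app T L a m Y) x X \<Longrightarrow> chain T L y Y x X"

lemma chain_append: "chain T L y Y z Z \<Longrightarrow> chain T L z Z x X \<Longrightarrow> chain T L y Y x X"
  by (induction rule: chain.induct) (auto intro: chain_step)

lemma chain_snoc:
  assumes "chain T L y Y z Z" "a \<in> classical_nodes T" "letter_f T a z = Some u" "es_sel T L Z a m"
  shows "chain T L y Y u (es_app T L a m Z)"
  by (rule chain_append[OF assms(1) chain_step[OF assms(2-4) chain_refl]])

lemma chain_ok: "chain T L y Y x X \<Longrightarrow> rc_ok T Y \<Longrightarrow> rc_ok T X"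
  by (induction rule: chain.induct) (auto intro: rc_ok_es_app)

lemma chain_valid_refl:
  assumes "chain T L y Y x X" "rc_valid T L Y"
  shows "x = y" "X = Y"
proof -
  have "x = y \<and> X = Y"
    using assms(1)
  proof (cases rule: chain.cases)
    case (chain_step a z m)
    then show ?thesis using assms(2) es_sel_not_valid[OF chain_step(3)] by (simp add: rc_valid_def)
  qed simp
  then show "x = y" "X = Y" by auto
qed

text \<open>The conjugate operator at \<open>a\<close> adds the simple root to the weight of the
  configuration, and the arrow subtracts it from that of the letter.\<close>

lemma chain_wt:
  assumes "chain T L y Y x X" "rc_ok T Y" "c \<in> classical_nodes T" "valid_type T"
  shows "rc_wt T L (shape X) c + letter_wt T c x = rc_wt T L (shape Y) c + letter_wt T c y"
  using assms
proof (induction rule: chain.induct)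
  case (chain_step a y z Y m x X)
  then show ?case
    using rc_ok_es_app[of T Y L a m] vacancy_es_app(2)[of T Y L a m L c] letter_wt_f[of a T c y z] by auto
qed simp

text \<open>A repair that is possible now must occur in the chain, since the end is valid. If the
  chain starts differently, the letter is at the fork, the two nodes are orthogonal, and the two
  steps can be exchanged.\<close>

lemma chain_head:
  assumes "chain T L y Y x X" "rc_ok T Y" "rc_valid T L X" "valid_type T"
    "a \<in> classical_nodes T" "letter_f T a y = Some z" "es_sel T L Y a m"
  shows "chain T L z (es_app T L a m Y) x X"
  using assms(1)
proof (cases rule: chain.cases)
  case chain_refl
  then show ?thesis using assms(3,7) es_sel_not_valid unfolding rc_valid_def by blast
next
  case (chain_step b z' m')
  show ?thesis
  proof (cases "b = a")
    case True
    then show ?thesis using chain_step assms(6,7) es_sel_unique by (metis option.inject)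
  next
    case False
    note F = letter_fork[OF assms(5) chain_step(1) assms(4) False[symmetric] assms(6) chain_step(2)]
      letter_fork[OF chain_step(1) assms(5,4) False chain_step(2) assms(6)]
    obtain u where u: "letter_f T b z = Some u" "letter_f T a z' = Some u" using F(2) by blast
    let ?Z' = "es_app T L b m' Y"
    have s: "es_sel T L ?Z' a m" using es_remote(1)[OF assms(2) chain_step(3) False[symmetric] F(1)] assms(7) by blast
    have s': "es_sel T L (es_app T L a m Y) b m'" using es_remote(1)[OF assms(2,7) False F(4)] chain_step(3) by blast
    have eq: "es_app T L a m ?Z' = es_app T L b m' (es_app T L a m Y)"
      by (rule es_es_commute[OF assms(2,7) chain_step(3) False F(4)])
    have "chain T L u (es_app T L a m ?Z') x X"
      using chain_step(4)
    proof (cases rule: chain.cases)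
      case chain_refl
      then show ?thesis using assms(3) s es_sel_not_valid unfolding rc_valid_def by blast
    next
      case (chain_step c z2 m2)
      have "c = a" using F(6)[OF chain_step(1)] chain_step(2) by simp
      then show ?thesis using chain_step u s es_sel_unique by (metis option.inject)
    qed
    then show ?thesis using chain.chain_step[OF chain_step(1) u(1) s'] eq by simp
  qed
qed

lemma chain_unique:
  assumes "chain T L y Y x X" "rc_ok T Y" "rc_valid T L X" "valid_type T" "chain T L y Y x' X'" "rc_valid T L X'"
  shows "x' = x \<and> X' = X"
  using assms
proof (induction rule: chain.induct)
  case (chain_refl y Y)
  then show ?case using chain_valid_refl by blast
next
  case (chain_step a y z Y m x X)
  from chain_step.IH[OF rc_ok_es_app[OF chain_step.prems(1) chain_step.hyps(3)] chain_step.prems(2,3)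
      chain_head[OF chain_step.prems(4,1,5,3) chain_step.hyps(1-3)] chain_step.prems(5)]
  show ?case .
qed

text \<open>A raising operator is pushed through the chain step by step. Either it arrives at the
  end, or at some step it coincides with the repair, and the letter then lags one arrow behind. In
  the latter case the values of \<open>rc_eps\<close> and \<open>rc_wt\<close> add up to 0, so that
  \<open>phi\<close> of the rest vanishes and the tensor product rule raises the letter.\<close>

theorem chain_e:
  assumes "chain T L y Y x X" "rc_ok T Y" "rc_valid T L X" "valid_type T" "e_sel Y a k l"
    "chain T L y (e_app T a k l Y) x2 X2" "rc_valid T L X2"
  shows "(\<exists>l'. x2 = x \<and> e_sel X a k l' \<and> X2 = e_app T a k l' X) \<or>
    X2 = X \<and> letter_e T a x = Some x2 \<and> int (rc_eps X a) = k - 1 \<and> rc_wt T L (shape X) a = 1 - k"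
  using assms
proof (induction arbitrary: l rule: chain.induct)
  case (chain_refl y Y)
  have "rc_valid T L (e_app T a k l Y)" by (rule rc_valid_e_app[OF chain_refl(2,4)])
  from chain_valid_refl[OF chain_refl(5) this] chain_refl(4) show ?case by blast
next
  case (chain_step b y z Y m x X)
  note ok = \<open>rc_ok T Y\<close> and esel = \<open>e_sel Y a k l\<close> and bsel = \<open>es_sel T L Y b m\<close>
  note c2 = \<open>chain T L y (e_app T a k l Y) x2 X2\<close>
  have okE: "rc_ok T (e_app T a k l Y)" by (rule rc_ok_e_app[OF ok esel])
  have okZ: "rc_ok T (es_app T L b m Y)" by (rule rc_ok_es_app[OF ok bsel])
  have a: "a \<in> classical_nodes T" by (rule e_sel_node[OF ok esel])
  show ?case
  proof (cases "b = a")
    case False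
    have s: "es_sel T L (e_app T a k l Y) b m" using es_sel_e_app[OF ok esel False] bsel by simp
    have "chain T L z (es_app T L b m (e_app T a k l Y)) x2 X2"
      by (rule chain_head[OF c2 okE chain_step.prems(6,3) chain_step.hyps(1,2) s])
    then have "chain T L z (e_app T a k l (es_app T L b m Y)) x2 X2"
      using e_es_commute_other[OF ok esel bsel False[symmetric]] by simp
    moreover have "e_sel (es_app T L b m Y) a k l"
      using esel e_sel_cong[of "es_app T L b m Y" a Y] es_app_other[OF False[symmetric]] by simp
    ultimately show ?thesis using chain_step.IH okZ chain_step.prems by blast
  next
    case True
    interpret single_node T L Y a k l m
      by unfold_locales (use ok esel bsel True in auto)
    show ?thesis
    proof (cases commuting)
      case True
      then obtain l' m' where C: "e_sel (es_app T L a m Y) a k l'" "es_sel T L (e_app T a k l Y) a m'"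
        "es_app T L a m' (e_app T a k l Y) = e_app T a k l' (es_app T L a m Y)"
        unfolding commuting_def by blast
      have "chain T L z (es_app T L a m' (e_app T a k l Y)) x2 X2"
        by (rule chain_head[OF c2 okE chain_step.prems(6,3) a _ C(2)]) (use chain_step.hyps(2) \<open>b = a\<close> in simp)
      then show ?thesis using chain_step.IH[of l'] okZ C chain_step.prems \<open>b = a\<close> by simp
    next
      case False
      \<comment> \<open>Raising \<open>Y\<close> has the same result as the first repair, but the
        second chain still stands at the letter \<open>y\<close>. Node \<open>a\<close> is repaired,
        so this chain can only stop or take the other branch of the fork.\<close>
      define Z where "Z = es_app T L a m Y"
      from False commuting_or_equal have Z: "e_app T a k l Y = Z" "rc_wt T L (shape Y) a = - k - 1"
        "node_valid T L Z a" "int (rc_eps Z a) = k - 1"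
        by (auto simp: Z_def)
      have wtZ: "rc_wt T L (shape Z) a = 1 - k"
        using vacancy_es_app(2)[OF ok es, of L a] Z(2) by (simp add: Z_def)
      have chain1: "chain T L z Z x X" using chain_step.hyps(4) True by (simp add: Z_def)
      have yz: "letter_f T a y = Some z" using chain_step.hyps(2) True by simp
      have okZ: "rc_ok T Z" using okE Z(1) by simp
      from c2[unfolded Z(1)] show ?thesis
      proof (cases rule: chain.cases)
        case chain_refl
        then have "rc_valid T L Z" using chain_step.prems(6) by simp
        from chain_valid_refl[OF chain1 this] chain_refl Z(4) wtZ yz letter_ef[OF a chain_step.prems(3), of z y]
        show ?thesis by simp
      next
        case (chain_step c z2 m2)
        have ca: "c \<noteq> a" using chain_step(3) Z(3) es_sel_not_valid by blast
        note F = letter_fork[OF a chain_step(1) \<open>valid_type T\<close> ca[symmetric] yz chain_step(2)]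
          letter_fork[OF chain_step(1) a \<open>valid_type T\<close> ca chain_step(2) yz]
        obtain u where u: "letter_f T c z = Some u" "letter_f T a z2 = Some u" using F(2) by blast
        let ?W = "es_app T L c m2 Z"
        have va: "node_valid T L ?W a"
          using es_remote(2)[OF okZ chain_step(3) ca[symmetric] F(1)] Z(3) by simp
        have W: "x2 = z2 \<and> X2 = ?W"
          using chain_step(4)
        proof (cases rule: chain.cases)
          case (chain_step c' z3 m3)
          have "c' = a" using F(6)[OF chain_step(1)] chain_step(2) by simp
          then show ?thesis using chain_step(3) va es_sel_not_valid by blast
        qed simp
        have "chain T L u ?W x X"
          by (rule chain_head[OF chain1 okZ \<open>rc_valid T L X\<close> \<open>valid_type T\<close> chain_step(1) u(1) chain_step(3)])
        moreover have "rc_valid T L ?W" using W \<open>rc_valid T L X2\<close> by simp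
        ultimately have X: "x = u" "X = ?W" using chain_valid_refl by blast+
        moreover have "rc_eps ?W a = rc_eps Z a"
          by (rule rc_eps_cong) (simp add: es_app_other[OF ca[symmetric]])
        moreover have "rc_wt T L (shape ?W) a = rc_wt T L (shape Z) a"
          using vacancy_es_app(2)[OF okZ chain_step(3), of L a] F(1) by simp
        ultimately show ?thesis
          using W Z(4) wtZ u(2) letter_ef[OF a \<open>valid_type T\<close>, of u z2] by simp
      qed
    qed
  qed
qed

lemma chain_eps_zero:
  assumes "chain T L y Y x X" "rc_ok T Y" "rc_eps Y a = 0"
  shows "rc_eps X a = 0"
  using assms
proof (induction rule: chain.induct)
  case (chain_step b y z Y m x X)
  have "rc_eps (es_app T L b m Y) a = 0"
  proof (cases "b = a")
    case True
    then show ?thesis using rc_eps_es_app_zero[of T Y L a m] chain_step.hyps chain_step.prems by simp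
  next
    case False
    then have "rc_eps (es_app T L b m Y) a = rc_eps Y a"
      by (intro rc_eps_cong) (simp add: es_app_def)
    then show ?thesis using chain_step.prems by simp
  qed
  then show ?case using chain_step.IH[OF rc_ok_es_app[OF chain_step.prems(1) chain_step.hyps(3)]] by simp
qed simp

section \<open>The map \<open>\<delta>\<close> as a chain of operators\<close>

text \<open>\<open>deltabar\<close> is split up for an arbitrary choice of lengths: partial
  selections describe the configurations in the middle of a chain.\<close>

definition kept_strings :: "affine_type \<Rightarrow> multiplicities \<Rightarrow> rigged \<Rightarrow> (nat \<Rightarrow> nat multiset) \<Rightarrow> rigged" where
  "kept_strings T L rc sel a = rc a - image_mset (\<lambda>i. (i, vacancy T L (shape rc) a i)) (sel a)"

definition shortened :: "(nat \<Rightarrow> nat multiset) \<Rightarrow> nat \<Rightarrow> nat multiset" where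
  "shortened sel a = filter_mset (\<lambda>i. 0 < i) (image_mset (\<lambda>i. i - 1) (sel a))"

definition short_shape :: "affine_type \<Rightarrow> multiplicities \<Rightarrow> rigged \<Rightarrow> (nat \<Rightarrow> nat multiset) \<Rightarrow> configuration" where
  "short_shape T L rc sel a = shape (kept_strings T L rc sel) a + shortened sel a"

definition shorten :: "affine_type \<Rightarrow> multiplicities \<Rightarrow> rigged \<Rightarrow> (nat \<Rightarrow> nat multiset) \<Rightarrow> rigged" where
  "shorten T L rc sel a = kept_strings T L rc sel a +
     image_mset (\<lambda>i. (i, vacancy T (L - {#(1, 1)#}) (short_shape T L rc sel) a i)) (shortened sel a)"

lemma deltabar_shorten: "deltabar T L rc = shorten T L rc (selected T L rc)"
  by (auto simp: deltabar_def shorten_def kept_strings_def[abs_def] shortened_def[abs_def] short_shape_def[abs_def] Let_def fun_eq_iff)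

lemma shape_shorten: "shape (shorten T L rc sel) = short_shape T L rc sel"
  by (simp add: fun_eq_iff shape_def shorten_def short_shape_def image_mset.compositionality comp_def)

definition sel_ok :: "affine_type \<Rightarrow> multiplicities \<Rightarrow> rigged \<Rightarrow> (nat \<Rightarrow> nat multiset) \<Rightarrow> bool" where
  "sel_ok T L rc sel \<longleftrightarrow> (\<forall>a. image_mset (\<lambda>i. (i, vacancy T L (shape rc) a i)) (sel a) \<subseteq># rc a)"

definition count_le :: "nat multiset \<Rightarrow> nat \<Rightarrow> int" where
  "count_le M i = int (size (filter_mset (\<lambda>j. j \<le> i) M))"

lemma count_le_simps [simp]:
  "count_le {#} i = 0" "count_le (add_mset j M) i = (if j \<le> i then 1 else 0) + count_le M i"
  "count_le (M + N) i = count_le M i + count_le N i"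
  by (auto simp: count_le_def)

text \<open>The effect on the vacancy numbers of removing one factor \<open>(1, 1)\<close>, which
  accounts for the \<open>- 1\<close> at node 1, and of shortening the selected strings; a shortened
  string loses a box only for lengths that reach it.\<close>

definition vac_change :: "affine_type \<Rightarrow> (nat \<Rightarrow> nat multiset) \<Rightarrow> nat \<Rightarrow> nat \<Rightarrow> int" where
  "vac_change T sel a i = (if a = 1 \<and> 1 \<le> i then - 1 else 0) +
     (\<Sum>c\<in>classical_nodes T. cartan T a c * count_le (sel c) i)"

lemma min_sum_shorten:
  assumes "\<And>j. j \<in># M \<Longrightarrow> 0 < j"
  shows "min_sum (filter_mset (\<lambda>i. 0 < i) (image_mset (\<lambda>i. i - 1) M)) i = min_sum M i - count_le M i"
  using assms
proof (induction M)
  case (add x M)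
  have "0 < x" using add.prems by simp
  then have "x = Suc 0 \<or> 1 < x" by auto
  then show ?case using add by auto
qed simp

lemma short_shape_min_sum:
  assumes "rc_ok T rc" "sel_ok T L rc sel"
  shows "min_sum (short_shape T L rc sel a) i = min_sum (shape rc a) i - count_le (sel a) i"
proof -
  obtain N where N: "rc a = image_mset (\<lambda>i. (i, vacancy T L (shape rc) a i)) (sel a) + N"
    using assms(2) unfolding sel_ok_def by (metis mset_subset_eq_exists_conv)
  have pos: "0 < j" if "j \<in># sel a" for j
  proof -
    have "(j, vacancy T L (shape rc) a j) \<in># rc a" unfolding N using that by auto
    then show ?thesis using assms(1) by (auto simp: rc_ok_def)
  qed
  have 1: "shape rc a = sel a + image_mset fst N"
    using arg_cong[OF N, of "image_mset fst"] by (simp add: shape_def image_mset.compositionality comp_def)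
  have 2: "shape (kept_strings T L rc sel) a = image_mset fst N"
  proof -
    have "kept_strings T L rc sel a = N" unfolding kept_strings_def by (subst N) simp
    then show ?thesis by (simp add: shape_def)
  qed
  show ?thesis
    unfolding short_shape_def 2 1 shortened_def using min_sum_shorten[OF pos] by simp
qed

lemma row_lengths_diff:
  assumes "(1, 1) \<in># L"
  shows "row_lengths L a = row_lengths (L - {#(1, 1)#}) a + (if a = 1 then {#1#} else {#})"
proof -
  obtain K where "L = add_mset (1, 1) K" using multi_member_split[OF assms] by blast
  then show ?thesis by simp
qed

lemma vacancy_shorten:
  assumes "rc_ok T rc" "sel_ok T L rc sel" "(1, 1) \<in># L"
  shows "vacancy T (L - {#(1, 1)#}) (short_shape T L rc sel) a i = vacancy T L (shape rc) a i + vac_change T sel a i"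
proof -
  have "min_sum (row_lengths L a) i = min_sum (row_lengths (L - {#(1, 1)#}) a) i + (if a = 1 \<and> 1 \<le> i then 1 else 0)"
    unfolding row_lengths_diff[OF assms(3), of a] by auto
  then show ?thesis
    unfolding vacancy_min_sum vac_change_def short_shape_min_sum[OF assms(1,2)]
    by (simp add: algebra_simps sum_subtractf)
qed

lemma vac_change_add:
  assumes "a \<in> classical_nodes T"
  shows "vac_change T (sel(a := add_mset l (sel a))) b i = vac_change T sel b i + (if l \<le> i then cartan T b a else 0)"
proof -
  have "(\<Sum>c\<in>classical_nodes T - {a}. cartan T b c * count_le ((sel(a := add_mset l (sel a))) c) i) =
     (\<Sum>c\<in>classical_nodes T - {a}. cartan T b c * count_le (sel c) i)"
    by (rule sum.cong) auto
  then show ?thesis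
    unfolding vac_change_def sum.remove[OF finite_classical_nodes assms] by (simp add: algebra_simps)
qed

text \<open>A kept singular string acquires corigging \<open>- 1\<close> exactly where
  \<open>vac_change\<close> is \<open>- 1\<close>. Strings shortened before at \<open>a\<close> or
  its neighbours are shorter than \<open>l\<close>, hence outside the range of the new change of
  vacancy numbers, and they remain singular.\<close>

lemma shorten_step:
  assumes "rc_valid T L rc" "sel_ok T L rc sel" "(1, 1) \<in># L" "a \<in> classical_nodes T"
    and l: "(l, vacancy T L (shape rc) a l) \<in># kept_strings T L rc sel a"
    and sorted: "\<And>c j. c \<in> classical_nodes T \<Longrightarrow> cartan T a c \<noteq> 0 \<Longrightarrow> j \<in># sel c \<Longrightarrow> j \<le> l"
    and ge: "\<And>i. 0 < i \<Longrightarrow> - 1 \<le> vac_change T sel a i"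
    and least: "\<And>i. (i, vacancy T L (shape rc) a i) \<in># kept_strings T L rc sel a \<Longrightarrow> vac_change T sel a i = - 1 \<Longrightarrow> l \<le> i"
    and at: "vac_change T sel a l = - 1"
  shows "es_sel T (L - {#(1, 1)#}) (shorten T L rc sel) a l"
    "es_app T (L - {#(1, 1)#}) a l (shorten T L rc sel) = shorten T L rc (sel(a := add_mset l (sel a)))"
    "sel_ok T L rc (sel(a := add_mset l (sel a)))"
proof -
  let ?L' = "L - {#(1, 1)#}" and ?Y = "shorten T L rc sel" and ?sel' = "sel(a := add_mset l (sel a))"
  let ?p = "vacancy T L (shape rc)"
  have ok: "rc_ok T rc" using assms(1) by (simp add: rc_valid_def)
  have keptsub: "s \<in># rc b" if "s \<in># kept_strings T L rc sel b" for s b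
    using that unfolding kept_strings_def by (rule in_diffD)
  have l0: "0 < l" using keptsub[OF l] ok by (auto simp: rc_ok_def)
  have V: "vacancy T ?L' (shape ?Y) b i = ?p b i + vac_change T sel b i" for b i
    unfolding shape_shorten by (rule vacancy_shorten[OF ok assms(2,3)])
  show ok': "sel_ok T L rc ?sel'"
    unfolding sel_ok_def
  proof
    fix b
    show "image_mset (\<lambda>i. (i, ?p b i)) (?sel' b) \<subseteq># rc b"
    proof (cases "b = a")
      case True
      have "image_mset (\<lambda>i. (i, ?p a i)) (sel a) \<subseteq># rc a" using assms(2) by (simp add: sel_ok_def)
      then have "rc a = image_mset (\<lambda>i. (i, ?p a i)) (sel a) + kept_strings T L rc sel a"
        by (simp add: kept_strings_def)
      with l True show ?thesis by (metis (no_types, lifting) add_mset_add_single fun_upd_same image_mset_add_mset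
          mset_subset_eq_mono_add_left_cancel single_subset_iff)
    next
      case False
      then show ?thesis using assms(2) by (simp add: sel_ok_def)
    qed
  qed
  show sel: "es_sel T ?L' ?Y a l"
    unfolding es_sel_def V at
  proof (intro conjI allI impI)
    show "(l, ?p a l + - 1 + 1) \<in># ?Y a" using l by (simp add: shorten_def)
    fix i x assume i: "(i, x) \<in># ?Y a"
    then consider "(i, x) \<in># kept_strings T L rc sel a" | "x = ?p a i + vac_change T sel a i"
      unfolding shorten_def shape_shorten[symmetric] V by auto
    then have "x \<le> ?p a i + vac_change T sel a i + 1 \<and> (x = ?p a i + vac_change T sel a i + 1 \<longrightarrow> l \<le> i)"
    proof cases
      case 1
      then have "(i, x) \<in># rc a" by (rule keptsub)
      then have "x \<le> ?p a i" "0 < i" using assms(1) ok by (auto simp: rc_valid_def node_valid_def rc_ok_def)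
      moreover have "l \<le> i" if "x = ?p a i + vac_change T sel a i + 1"
        using least[of i] 1 that ge[OF \<open>0 < i\<close>] \<open>x \<le> ?p a i\<close> by (cases "vac_change T sel a i = - 1") auto
      ultimately show ?thesis using ge[of i] by auto
    qed simp
    then show "x \<le> ?p a i + vac_change T sel a i + 1" "x = ?p a i + vac_change T sel a i + 1 \<Longrightarrow> l \<le> i"
      by blast+
  qed
  have V': "vacancy T ?L' (short_shape T L rc ?sel') b i = vacancy T ?L' (short_shape T L rc sel) b i + (if l \<le> i then cartan T b a else 0)" for b i
    unfolding vacancy_shorten[OF ok ok' assms(3)] vacancy_shorten[OF ok assms(2,3)] vac_change_add[OF assms(4)] by simp
  have short: "image_mset (\<lambda>i. (i, vacancy T ?L' (short_shape T L rc ?sel') b i)) (shortened sel b) =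
      image_mset (\<lambda>i. (i, vacancy T ?L' (short_shape T L rc sel) b i)) (shortened sel b)" for b
  proof (rule image_mset_cong)
    fix i assume "i \<in># shortened sel b"
    then obtain j where j: "j \<in># sel b" "i = j - 1" "0 < i" by (auto simp: shortened_def)
    have "b \<in> classical_nodes T"
    proof (rule ccontr)
      assume "b \<notin> classical_nodes T"
      then have "rc b = {#}" using ok by (simp add: rc_ok_def)
      then show False using assms(2) j(1) unfolding sel_ok_def by (metis empty_iff image_mset_is_empty_iff set_mset_empty subset_mset.le_zero_eq)
    qed
    then have "cartan T b a = 0 \<or> \<not> l \<le> i" using sorted[of b j] j cartan_sym[of T a b] by auto
    then show "(i, vacancy T ?L' (short_shape T L rc ?sel') b i) = (i, vacancy T ?L' (short_shape T L rc sel) b i)"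
      unfolding V' by auto
  qed
  show "es_app T ?L' a l ?Y = shorten T L rc ?sel'"
  proof
    fix b
    show "es_app T ?L' a l ?Y b = shorten T L rc ?sel' b"
    proof (cases "b = a")
      case True
      have 1: "kept_strings T L rc ?sel' a = kept_strings T L rc sel a - {#(l, ?p a l)#}"
        by (simp add: kept_strings_def)
      have 2: "shortened ?sel' a = shortened sel a + (if 1 < l then {#l - 1#} else {#})"
        by (auto simp: shortened_def)
      obtain K where K: "kept_strings T L rc sel a = add_mset (l, ?p a l) K" using multi_member_split[OF l] by blast
      have "shorten T L rc ?sel' a = K + image_mset (\<lambda>i. (i, vacancy T ?L' (short_shape T L rc sel) a i)) (shortened sel a)
          + (if 1 < l then {#(l - 1, vacancy T ?L' (short_shape T L rc ?sel') a (l - 1))#} else {#})"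
        unfolding shorten_def 1 2 image_mset_union short K by simp
      also have "vacancy T ?L' (short_shape T L rc ?sel') a (l - 1) = vacancy T ?L' (shape ?Y) a (l - 1)"
        unfolding V' shape_shorten using l0 by simp
      also have "K + image_mset (\<lambda>i. (i, vacancy T ?L' (short_shape T L rc sel) a i)) (shortened sel a) = ?Y a - {#(l, ?p a l)#}"
        unfolding shorten_def K by simp
      also have "(l, ?p a l) = (l, vacancy T ?L' (shape ?Y) a l + 1)" unfolding V at by simp
      finally show ?thesis unfolding True es_app_def fun_upd_same by (rule sym)
    next
      case False
      then show ?thesis
        unfolding es_app_def shorten_def using short[of b] by (simp add: kept_strings_def shortened_def)
    qed
  qed
qed

text \<open>A drop by one is harmless for strings that had positive corigging; only the singular
  strings that are kept need the stronger hypothesis.\<close>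

lemma shorten_valid:
  assumes "rc_valid T L rc" "sel_ok T L rc sel" "(1, 1) \<in># L"
    and ge: "\<And>a i. a \<in> classical_nodes T \<Longrightarrow> 0 < i \<Longrightarrow> - 1 \<le> vac_change T sel a i"
    and sing: "\<And>a i. a \<in> classical_nodes T \<Longrightarrow> (i, vacancy T L (shape rc) a i) \<in># kept_strings T L rc sel a \<Longrightarrow>
        0 \<le> vac_change T sel a i"
    and ok': "rc_ok T (shorten T L rc sel)"
  shows "rc_valid T (L - {#(1, 1)#}) (shorten T L rc sel)"
  unfolding rc_valid_def node_valid_def
proof (intro conjI allI impI)
  have ok: "rc_ok T rc" using assms(1) by (simp add: rc_valid_def)
  let ?p = "vacancy T L (shape rc)"
  fix a i x assume i: "(i, x) \<in># shorten T L rc sel a"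
  then have a: "a \<in> classical_nodes T" and i0: "0 < i" using ok' by (auto simp: rc_ok_def)
  have V: "vacancy T (L - {#(1, 1)#}) (short_shape T L rc sel) a i = ?p a i + vac_change T sel a i"
    by (rule vacancy_shorten[OF ok assms(2,3)])
  from i consider "(i, x) \<in># kept_strings T L rc sel a" | "x = ?p a i + vac_change T sel a i"
    unfolding shorten_def using V by auto
  then show "x \<le> vacancy T (L - {#(1, 1)#}) (shape (shorten T L rc sel)) a i"
    unfolding shape_shorten V
  proof cases
    case 1
    then have "(i, x) \<in># rc a" unfolding kept_strings_def by (rule in_diffD)
    then have "x \<le> ?p a i" using assms(1) by (auto simp: rc_valid_def node_valid_def)
    then show "x \<le> ?p a i + vac_change T sel a i"
      using ge[OF a i0] sing[OF a, of i] 1 by (cases "x = ?p a i") auto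
  qed simp
qed (rule ok')

lemma shorten_empty: "shorten T L rc (\<lambda>_. {#}) = rc"
  by (simp add: shorten_def kept_strings_def shortened_def fun_eq_iff)

lemma sel_ok_empty: "sel_ok T L rc (\<lambda>_. {#})"
  by (simp add: sel_ok_def)

section \<open>The selected lengths in type A\<close>

lemma least_from_None [simp]: "least_from None P = None"
  by (simp add: least_from_def)

lemma least_from_SomeD:
  assumes "least_from l P = Some j"
  obtains m where "l = Some m" "m \<le> j" "P j" "\<And>i. m \<le> i \<Longrightarrow> P i \<Longrightarrow> j \<le> i"
proof -
  obtain m where m: "l = Some m" "\<exists>i\<ge>m. P i" "j = (LEAST i. m \<le> i \<and> P i)"
    using assms unfolding least_from_def by (auto split: option.splits if_splits)
  then have "m \<le> j \<and> P j" by (metis (mono_tags, lifting) LeastI_ex)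
  moreover have "j \<le> i" if "m \<le> i" "P i" for i using m(3) that by (simp add: Least_le)
  ultimately show ?thesis using that m(1) by blast
qed

lemma least_from_NoneD: "least_from (Some m) P = None \<Longrightarrow> m \<le> i \<Longrightarrow> \<not> P i"
  by (auto simp: least_from_def split: if_splits)

abbreviation option_mset :: "nat option \<Rightarrow> nat multiset" where
  "option_mset l \<equiv> mset_set (set_option l)"

abbreviation singular_at :: "affine_type \<Rightarrow> multiplicities \<Rightarrow> rigged \<Rightarrow> nat \<Rightarrow> nat \<Rightarrow> bool" where
  "singular_at T L rc a i \<equiv> (i, vacancy T L (shape rc) a i) \<in># rc a"

lemma singular_mult_pos: "1 \<le> singular_mult T L rc a i \<longleftrightarrow> singular_at T L rc a i"
  by (auto simp: singular_mult_def Suc_le_eq)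

lemma singular_at_pos: "rc_ok T rc \<Longrightarrow> singular_at T L rc a i \<Longrightarrow> 0 < i"
  by (auto simp: rc_ok_def)

lemma option_prefix:
  fixes f :: "nat \<Rightarrow> nat option"
  assumes "f 0 \<noteq> None"
  obtains k where "k \<le> n" "\<And>a. a \<le> k \<Longrightarrow> f a \<noteq> None" "k < n \<Longrightarrow> f (Suc k) = None"
proof -
  have "\<exists>k\<le>n. (\<forall>a\<le>k. f a \<noteq> None) \<and> (k < n \<longrightarrow> f (Suc k) = None)"
  proof (induction n)
    case 0
    then show ?case using assms by auto
  next
    case (Suc n)
    then obtain k where k: "k \<le> n" "\<forall>a\<le>k. f a \<noteq> None" "k < n \<longrightarrow> f (Suc k) = None" by blast
    show ?case
    proof (cases "k = n \<and> f (Suc n) \<noteq> None")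
      case True
      then have "\<forall>a\<le>Suc n. f a \<noteq> None" using k(2) by (auto simp: le_Suc_eq)
      then show ?thesis by blast
    next
      case False
      then show ?thesis using k by (intro exI[of _ k]) (auto simp: less_Suc_eq)
    qed
  qed
  then show ?thesis using that by blast
qed

lemma ell_chain_None:
  "ell_chain T L rc a = None \<Longrightarrow> a \<le> b \<Longrightarrow> ell_chain T L rc b = None"
  by (induction b) (auto simp: le_Suc_eq)

lemma ell_chain_Suc:
  assumes "ell_chain T L rc (Suc a) = Some j"
  obtains m where "ell_chain T L rc a = Some m" "m \<le> j" "singular_at T L rc (Suc a) j"
    "\<And>i. m \<le> i \<Longrightarrow> singular_at T L rc (Suc a) i \<Longrightarrow> j \<le> i"
  using assms unfolding ell_chain.simps
  by (elim least_from_SomeD) (use that singular_mult_pos[of T L rc "Suc a"] in blast)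

lemma ell_chain_Suc_None:
  assumes "ell_chain T L rc (Suc a) = None" "ell_chain T L rc a = Some m" "m \<le> i"
  shows "\<not> singular_at T L rc (Suc a) i"
  using least_from_NoneD[OF assms(1)[unfolded ell_chain.simps assms(2)] assms(3)] singular_mult_pos by blast

text \<open>Minimality of the selected length as an inequality between counts: a singular string of
  length \<open>i\<close> at the next node forces the next selected length down to \<open>i\<close>
  as soon as the previous one is at most \<open>i\<close>.\<close>

lemma ell_chain_gap:
  assumes "rc_ok T rc" "singular_at T L rc (Suc a) i"
  shows "count_le (option_mset (ell_chain T L rc a)) i \<le> count_le (option_mset (ell_chain T L rc (Suc a))) i"
proof (cases "ell_chain T L rc a")
  case None
  then show ?thesis using ell_chain_None[of T L rc a "Suc a"] by simp
next
  case (Some m)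
  show ?thesis
  proof (cases "ell_chain T L rc (Suc a)")
    case None
    then show ?thesis using ell_chain_Suc_None[OF None Some, of i] assms(2) Some by auto
  next
    case (Some j)
    then obtain m' where "ell_chain T L rc a = Some m'" "\<And>i. m' \<le> i \<Longrightarrow> singular_at T L rc (Suc a) i \<Longrightarrow> j \<le> i"
      by (rule ell_chain_Suc) blast
    then show ?thesis using Some assms(2) by auto
  qed
qed

lemma ell_chain_mono:
  "count_le (option_mset (ell_chain T L rc (Suc a))) i \<le> count_le (option_mset (ell_chain T L rc a)) i"
proof (cases "ell_chain T L rc (Suc a)")
  case (Some j)
  then obtain m where "ell_chain T L rc a = Some m" "m \<le> j" by (rule ell_chain_Suc) blast
  with Some show ?thesis by auto
qed (simp add: count_le_def)

lemma count_le_option: "count_le (option_mset l) i = (case l of None \<Rightarrow> 0 | Some m \<Rightarrow> if m \<le> i then 1 else 0)"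
  by (cases l) auto

lemma kept_mem: "s \<in># kept_strings T L rc sel a \<Longrightarrow> s \<in># rc a"
  unfolding kept_strings_def by (rule in_diffD)

lemma chain_shorten:
  assumes "rc_valid T L rc" "(1, 1) \<in># L"
    "chain T (L - {#(1, 1)#}) 1 rc y (shorten T L rc sel) \<and> sel_ok T L rc sel"
    "a \<in> classical_nodes T" "letter_f T a y = Some z"
    "(l, vacancy T L (shape rc) a l) \<in># kept_strings T L rc sel a"
    "\<forall>c\<in>classical_nodes T. cartan T a c \<noteq> 0 \<longrightarrow> (\<forall>j. j \<in># sel c \<longrightarrow> j \<le> l)"
    "\<forall>i>0. - 1 \<le> vac_change T sel a i"
    "\<forall>i. (i, vacancy T L (shape rc) a i) \<in># kept_strings T L rc sel a \<longrightarrow> vac_change T sel a i = - 1 \<longrightarrow> l \<le> i"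
    "vac_change T sel a l = - 1" "sel(a := add_mset l (sel a)) = sel'"
  shows "chain T (L - {#(1, 1)#}) 1 rc z (shorten T L rc sel') \<and> sel_ok T L rc sel'"
proof -
  have s: "es_sel T (L - {#(1, 1)#}) (shorten T L rc sel) a l"
    "es_app T (L - {#(1, 1)#}) a l (shorten T L rc sel) = shorten T L rc (sel(a := add_mset l (sel a)))"
    "sel_ok T L rc (sel(a := add_mset l (sel a)))"
    using assms(1-10) by (intro shorten_step; blast)+
  have "chain T (L - {#(1, 1)#}) 1 rc z (es_app T (L - {#(1, 1)#}) a l (shorten T L rc sel))"
    by (rule chain_snoc[OF _ assms(4,5) s(1)]) (use assms(3) in blast)
  then show ?thesis using s(3) unfolding s(2) assms(11) by blast
qed

lemma vac_change_A:
  assumes "1 \<le> a" "a \<le> n"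
  shows "vac_change (TypeA n) sel a i = (if a = 1 then (if 1 \<le> i then - 1 else 0) else - count_le (sel (a - 1)) i)
    + 2 * count_le (sel a) i - (if a < n then count_le (sel (Suc a)) i else 0)"
proof -
  let ?g = "\<lambda>c. count_le (sel c) i"
  have "(\<Sum>c\<in>{1..n}. cartan (TypeA n) a c * ?g c) =
      (\<Sum>c\<in>{1..n}. (if c = a then 2 * ?g c else 0) - (if c = Suc a then ?g c else 0) - (if c = a - 1 then ?g c else 0))"
    by (rule sum.cong) (auto simp: cartan_def dynkin_edge_def)
  also have "\<dots> = 2 * ?g a - (if a < n then ?g (Suc a) else 0) - (if a = 1 then 0 else ?g (a - 1))"
    using assms by (auto simp: sum_subtractf sum.delta)
  finally show ?thesis by (simp add: vac_change_def classical_nodes_def)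
qed

lemma delta_chain_A:
  assumes T: "T = TypeA n" and valid: "rc_valid T L rc" and L: "(1, 1) \<in># L"
  shows "\<exists>x. chain T (L - {#(1, 1)#}) 1 rc x (deltabar T L rc) \<and> rc_valid T (L - {#(1, 1)#}) (deltabar T L rc)"
proof -
  let ?l = "ell_chain T L rc" and ?L' = "L - {#(1, 1)#}"
  let ?c = "\<lambda>a i. count_le (option_mset (?l a)) i"
  \<comment> \<open>The selection after \<open>k\<close> steps; the letter of the chain is then
    \<open>k + 1\<close>.\<close>
  define sel where "sel k a = (if 1 \<le> a \<and> a \<le> k then option_mset (?l a) else {#})" for k a
  have ok: "rc_ok T rc" using valid by (simp add: rc_valid_def)
  obtain K where K: "K \<le> n" "\<And>a. a \<le> K \<Longrightarrow> ?l a \<noteq> None" "K < n \<Longrightarrow> ?l (Suc K) = None"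
    using option_prefix[of ?l n] by auto
  have c0: "?c 0 i = (if 1 \<le> i then 1 else 0)" for i by simp
  have "chain T ?L' 1 rc (int k + 1) (shorten T L rc (sel k)) \<and> sel_ok T L rc (sel k)" if "k \<le> K" for k
    using that
  proof (induction k)
    case 0
    have "sel 0 = (\<lambda>_. {#})" by (auto simp: sel_def)
    then show ?case using chain_refl shorten_empty sel_ok_empty by simp
  next
    case (Suc k)
    obtain j where j: "?l (Suc k) = Some j" using K(2)[OF Suc.prems] by auto
    obtain m where m: "?l k = Some m" "m \<le> j" "singular_at T L rc (Suc k) j"
      "\<And>i. m \<le> i \<Longrightarrow> singular_at T L rc (Suc k) i \<Longrightarrow> j \<le> i"
      using j by (rule ell_chain_Suc) blast
    have node: "Suc k \<in> classical_nodes T" using Suc.prems K(1) by (simp add: T classical_nodes_def)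
    have V: "vac_change T (sel k) (Suc k) i = - ?c k i" if "0 < i" for i
      using that Suc.prems K(1) by (auto simp: T vac_change_A sel_def)
    have kept: "kept_strings T L rc (sel k) (Suc k) = rc (Suc k)" by (simp add: kept_strings_def sel_def)
    have j0: "0 < j" by (rule singular_at_pos[OF ok m(3)])
    have "chain T ?L' 1 rc (int (Suc k) + 1) (shorten T L rc (sel (Suc k))) \<and> sel_ok T L rc (sel (Suc k))"
    proof (rule chain_shorten[OF valid L Suc.IH node, of _ j])
      show "\<forall>c\<in>classical_nodes T. cartan T (Suc k) c \<noteq> 0 \<longrightarrow> (\<forall>i. i \<in># sel k c \<longrightarrow> i \<le> j)"
      proof (intro ballI impI allI)
        fix c i assume c: "cartan T (Suc k) c \<noteq> 0" "i \<in># sel k c"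
        then have "c = k" by (auto simp: T sel_def cartan_def dynkin_edge_def split: if_splits)
        then show "i \<le> j" using c(2) m(1,2) by (auto simp: sel_def split: if_splits)
      qed
      show "\<forall>i>0. - 1 \<le> vac_change T (sel k) (Suc k) i" using V m(1) by auto
      show "\<forall>i. (i, vacancy T L (shape rc) (Suc k) i) \<in># kept_strings T L rc (sel k) (Suc k) \<longrightarrow>
          vac_change T (sel k) (Suc k) i = - 1 \<longrightarrow> j \<le> i"
      proof (intro allI impI)
        fix i assume i: "(i, vacancy T L (shape rc) (Suc k) i) \<in># kept_strings T L rc (sel k) (Suc k)"
          "vac_change T (sel k) (Suc k) i = - 1"
        then have "singular_at T L rc (Suc k) i" unfolding kept by blast
        then show "j \<le> i" using V[of i] singular_at_pos[OF ok, where L = L and a = "Suc k" and i = i] m(1) m(4)[of i] i(2) by (auto split: if_splits)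
      qed
      show "vac_change T (sel k) (Suc k) j = - 1" using V[OF j0] m(1,2) by simp
      show "(sel k)(Suc k := add_mset j (sel k (Suc k))) = sel (Suc k)"
        using j by (auto simp: sel_def fun_eq_iff)
      show "letter_f T (Suc k) (int k + 1) = Some (int (Suc k) + 1)" by (simp add: T)
    qed (use Suc.prems m(3) kept in simp_all)
    then show ?case .
  qed
  then have C: "chain T ?L' 1 rc (int K + 1) (shorten T L rc (sel K))" "sel_ok T L rc (sel K)" by auto
  have selected: "selected T L rc = sel K"
  proof
    fix a
    have "ell T L rc a = ?l a" by (simp add: ell_def T)
    moreover have "?l a = None" if "K < a" "a \<le> n"
      using ell_chain_None[OF K(3), of a] that by auto
    ultimately show "selected T L rc a = sel K a"
      using K(1) by (auto simp: selected_def sel_def T classical_nodes_def)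
  qed
  have sel_c: "count_le (sel K a) i = ?c a i" if "1 \<le> a" "a \<le> n" for a i
    using that K ell_chain_None[OF K(3), of a] by (cases "a \<le> K") (auto simp: sel_def)
  have V: "vac_change T (sel K) (Suc a) i = - ?c a i + 2 * ?c (Suc a) i - (if Suc a < n then ?c (Suc (Suc a)) i else 0)"
    if "a < n" "0 < i" for a i
    using that by (auto simp: T vac_change_A sel_c simp del: ell_chain.simps(2))
  have "rc_valid T ?L' (shorten T L rc (sel K))"
  proof (rule shorten_valid[OF valid C(2) L])
    show "rc_ok T (shorten T L rc (sel K))" by (rule chain_ok[OF C(1) ok])
    fix a i assume "a \<in> classical_nodes T"
    then obtain b where b: "a = Suc b" "b < n" by (cases a) (auto simp: T classical_nodes_def)
    note mono = ell_chain_mono[of T L rc b i] ell_chain_mono[of T L rc "Suc b" i]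
    have nn: "0 \<le> ?c x i" "?c x i \<le> 1" for x by (auto simp: count_le_option split: option.splits)
    show "- 1 \<le> vac_change T (sel K) a i" if "0 < i"
      using V[OF b(2) that] b mono nn[of b] nn[of "Suc b"] nn[of "Suc (Suc b)"] by (auto split: if_splits simp del: ell_chain.simps(2))
    show "0 \<le> vac_change T (sel K) a i" if "(i, vacancy T L (shape rc) a i) \<in># kept_strings T L rc (sel K) a"
    proof -
      have sing: "singular_at T L rc a i" by (rule kept_mem[OF that])
      show ?thesis
        using V[OF b(2) singular_at_pos[OF ok sing]] b mono nn[of b] nn[of "Suc b"] nn[of "Suc (Suc b)"]
          ell_chain_gap[OF ok sing[unfolded b(1)]] by (auto split: if_splits simp del: ell_chain.simps(2))
    qed
  qed
  with C(1) show ?thesis unfolding deltabar_shorten selected by blast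
qed

section \<open>The selected lengths in type D\<close>

text \<open>\<open>N\<close> is the branching node \<open>n - 2\<close>, so \<open>Suc N\<close> and
  \<open>Suc (Suc N)\<close> are the two spin nodes. Below, \<open>fl\<close> holds the lengths
  selected on the way to the fork, \<open>fork1\<close> and \<open>fork2\<close> those at the spin
  nodes, and \<open>bl\<close> those on the way back.\<close>

locale delta_D =
  fixes N :: nat and L :: multiplicities and rc :: rigged
  assumes N2: "2 \<le> N" and valid: "rc_valid (TypeD (Suc (Suc N))) L rc" and L: "(1, 1) \<in># L"
begin

abbreviation T :: affine_type where "T \<equiv> TypeD (Suc (Suc N))"
abbreviation L' :: multiplicities where "L' \<equiv> L - {#(1, 1)#}"
abbreviation p :: "nat \<Rightarrow> nat \<Rightarrow> int" where "p \<equiv> vacancy T L (shape rc)"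

lemma ok: "rc_ok T rc" using valid by (simp add: rc_valid_def)

definition fl :: "nat \<Rightarrow> nat option" where "fl = ell_chain T L rc"
definition fork1 :: "nat option" where "fork1 = least_from (fl N) (singular_at T L rc (Suc N))"
definition fork2 :: "nat option" where "fork2 = least_from (fl N) (singular_at T L rc (Suc (Suc N)))"
definition bl :: "nat \<Rightarrow> nat option" where "bl a = ellbar_chain (Suc (Suc N)) L rc (Suc N - a)"

text \<open>Together with \<open>c1\<close>, \<open>c2\<close> and \<open>d\<close> these are 0-1
  indicators of a selected length being at most \<open>i\<close>. The changes of vacancy numbers are
  linear in them, and so are the comparisons made by the algorithm, which leaves linear
  arithmetic.\<close>

definition c :: "nat \<Rightarrow> nat \<Rightarrow> int" where "c a i = count_le (option_mset (fl a)) i"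
definition c1 :: "nat \<Rightarrow> int" where "c1 i = count_le (option_mset fork1) i"
definition c2 :: "nat \<Rightarrow> int" where "c2 i = count_le (option_mset fork2) i"
definition d :: "nat \<Rightarrow> nat \<Rightarrow> int" where "d a i = count_le (option_mset (bl a)) i"

text \<open>A singular string not yet taken on the way to the fork; this renders the requirement of
  two singular strings when both selected lengths agree.\<close>

definition spare :: "nat \<Rightarrow> nat \<Rightarrow> bool" where
  "spare a i \<longleftrightarrow> (i, p a i) \<in># rc a - image_mset (\<lambda>j. (j, p a j)) (option_mset (fl a))"

lemma ell_eq:
  "a \<le> N \<Longrightarrow> ell T L rc a = fl a" "ell T L rc (Suc N) = fork1" "ell T L rc (Suc (Suc N)) = fork2"
  by (simp_all add: ell_def fl_def fork1_def fork2_def Suc_le_eq singular_mult_pos[symmetric])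

lemma bl_top: "bl (Suc N) = (case (fork1, fork2) of (Some i, Some j) \<Rightarrow> Some (max i j) | _ \<Rightarrow> None)"
  by (simp add: bl_def ell_eq)

lemma spare_iff: "spare a i \<longleftrightarrow> (if fl a = Some i then 2 else 1) \<le> singular_mult T L rc a i"
  by (cases "fl a") (auto simp: spare_def singular_mult_def in_diff_count)

lemma bl_step:
  assumes "a \<le> N" "1 \<le> a"
  shows "bl a = least_from (bl (Suc a)) (spare a)"
proof -
  have 1: "Suc N - a = Suc (Suc N - Suc a)" using assms by simp
  have 2: "Suc (Suc N) - 1 - Suc (Suc N - Suc a) = a" using assms by simp
  have 3: "(\<lambda>i. (if fl a = Some i then 2 else 1) \<le> singular_mult T L rc a i) = spare a"
    by (rule ext) (simp only: spare_iff)
  show ?thesis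
    unfolding bl_def 1 ellbar_chain.simps Let_def 2 ell_eq(1)[OF assms(1)] 3 ..
qed

lemma c01: "0 \<le> c a i" "c a i \<le> 1" "0 \<le> c1 i" "c1 i \<le> 1" "0 \<le> c2 i" "c2 i \<le> 1" "0 \<le> d a i" "d a i \<le> 1"
  by (auto simp: c_def c1_def c2_def d_def count_le_option split: option.splits)

lemma c_0: "c 0 i = (if 1 \<le> i then 1 else 0)"
  by (simp add: c_def fl_def)

lemma c_mono: "c (Suc a) i \<le> c a i"
  unfolding c_def fl_def by (rule ell_chain_mono)

lemma c_gap: "singular_at T L rc (Suc a) i \<Longrightarrow> c a i \<le> c (Suc a) i"
  unfolding c_def fl_def by (rule ell_chain_gap[OF ok])

lemma least_from_counts:
  "count_le (option_mset (least_from l P)) i \<le> count_le (option_mset l) i"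
  "P i \<Longrightarrow> count_le (option_mset l) i \<le> count_le (option_mset (least_from l P)) i"
proof -
  have "count_le (option_mset (least_from l P)) i \<le> count_le (option_mset l) i \<and>
    (P i \<longrightarrow> count_le (option_mset l) i \<le> count_le (option_mset (least_from l P)) i)"
  proof (cases "least_from l P")
    case None
    then show ?thesis using least_from_NoneD[of _ P i] by (cases l) (auto simp: count_le_def)
  next
    case (Some j)
    then obtain m where "l = Some m" "m \<le> j" "P j" "\<And>i. m \<le> i \<Longrightarrow> P i \<Longrightarrow> j \<le> i"
      by (rule least_from_SomeD) blast
    with Some show ?thesis by auto
  qed
  then show "count_le (option_mset (least_from l P)) i \<le> count_le (option_mset l) i"
    "P i \<Longrightarrow> count_le (option_mset l) i \<le> count_le (option_mset (least_from l P)) i" by auto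
qed

lemma fork_mono: "c1 i \<le> c N i" "c2 i \<le> c N i"
  unfolding c1_def c2_def c_def fork1_def fork2_def by (rule least_from_counts(1))+

lemma fork_gap:
  "singular_at T L rc (Suc N) i \<Longrightarrow> c N i \<le> c1 i" "singular_at T L rc (Suc (Suc N)) i \<Longrightarrow> c N i \<le> c2 i"
  unfolding c1_def c2_def c_def fork1_def fork2_def by (rule least_from_counts(2); assumption)+

text \<open>The maximum of two lengths corresponds to the minimum of their indicators, written as
  three linear inequalities.\<close>

lemma d_top: "d (Suc N) i \<le> c1 i" "d (Suc N) i \<le> c2 i" "c1 i + c2 i - 1 \<le> d (Suc N) i"
  by (auto simp: d_def c1_def c2_def bl_top count_le_option split: option.splits)

lemma d_mono: "1 \<le> a \<Longrightarrow> a \<le> N \<Longrightarrow> d a i \<le> d (Suc a) i"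
  unfolding d_def bl_step by (rule least_from_counts(1))

lemma d_gap: "1 \<le> a \<Longrightarrow> a \<le> N \<Longrightarrow> spare a i \<Longrightarrow> d (Suc a) i \<le> d a i"
  unfolding d_def bl_step by (rule least_from_counts(2))

lemma d_le_c:
  assumes "1 \<le> a" "a \<le> N"
  shows "d (Suc a) i \<le> (if a = N then c1 i else c (Suc a) i)" "d (Suc a) i \<le> c a i"
proof -
  have *: "d (Suc a) i \<le> d (Suc N) i"
    using assms(2)
  proof (induction a rule: inc_induct)
    case (step k)
    then show ?case using d_mono[of "Suc k" i] by simp
  qed simp
  have **: "c N i \<le> c a i" if "a \<le> N" for a
    using that by (induction a rule: inc_induct) (use c_mono order_trans in \<open>auto, blast\<close>)
  have "d (Suc N) i \<le> c N i" using d_top(1)[of i] fork_mono(1)[of i] by simp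
  with * ** assms(2) show "d (Suc a) i \<le> c a i" by fastforce
  show "d (Suc a) i \<le> (if a = N then c1 i else c (Suc a) i)"
  proof (cases "a = N")
    case True
    then show ?thesis using d_top(1) by simp
  next
    case False
    then show ?thesis using * **[of "Suc a"] assms(2) \<open>d (Suc N) i \<le> c N i\<close> by fastforce
  qed
qed

text \<open>A stage of the algorithm: forward selections up to node \<open>f\<close>, spin nodes
  according to \<open>F1\<close> and \<open>F2\<close>, backward selections from node
  \<open>b\<close> on. The value \<open>b = Suc N\<close> means that the way back has not
  begun.\<close>

definition sel :: "nat \<Rightarrow> bool \<Rightarrow> bool \<Rightarrow> nat \<Rightarrow> nat \<Rightarrow> nat multiset" where
  "sel f F1 F2 b a = (if 1 \<le> a \<and> a \<le> N \<and> a \<le> f then option_mset (fl a) else {#}) +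
     (if a = Suc N \<and> F1 then option_mset fork1 else {#}) + (if a = Suc (Suc N) \<and> F2 then option_mset fork2 else {#}) +
     (if b \<le> a \<and> 1 \<le> a \<and> a \<le> N then option_mset (bl a) else {#})"

lemma vac_change_linear:
  assumes "1 \<le> a" "a < N"
  shows "vac_change T s a i = (if a = 1 then (if 1 \<le> i then - 1 else 0) else - count_le (s (a - 1)) i)
    + 2 * count_le (s a) i - count_le (s (Suc a)) i"
proof -
  let ?g = "\<lambda>c. count_le (s c) i"
  have "(\<Sum>c\<in>{1..Suc (Suc N)}. cartan T a c * ?g c) =
      (\<Sum>c\<in>{1..Suc (Suc N)}. (if c = a then 2 * ?g c else 0) - (if c = Suc a then ?g c else 0) - (if c = a - 1 then ?g c else 0))"
    using assms by (intro sum.cong) (auto simp: cartan_def dynkin_edge_def)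
  also have "\<dots> = 2 * ?g a - ?g (Suc a) - (if a = 1 then 0 else ?g (a - 1))"
    using assms by (auto simp: sum_subtractf sum.delta)
  finally show ?thesis by (simp add: vac_change_def classical_nodes_def)
qed

lemma vac_change_fork:
  "vac_change T s N i = - count_le (s (N - 1)) i + 2 * count_le (s N) i - count_le (s (Suc N)) i - count_le (s (Suc (Suc N))) i"
proof -
  let ?g = "\<lambda>c. count_le (s c) i"
  have "(\<Sum>c\<in>{1..Suc (Suc N)}. cartan T N c * ?g c) =
      (\<Sum>c\<in>{1..Suc (Suc N)}. (if c = N then 2 * ?g c else 0) - (if c = Suc N then ?g c else 0)
        - (if c = Suc (Suc N) then ?g c else 0) - (if c = N - 1 then ?g c else 0))"
    using N2 by (intro sum.cong) (auto simp: cartan_def dynkin_edge_def)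
  also have "\<dots> = 2 * ?g N - ?g (Suc N) - ?g (Suc (Suc N)) - ?g (N - 1)"
    using N2 by (auto simp: sum_subtractf sum.delta)
  finally show ?thesis using N2 by (simp add: vac_change_def classical_nodes_def)
qed

lemma vac_change_spin:
  assumes "a = Suc N \<or> a = Suc (Suc N)"
  shows "vac_change T s a i = 2 * count_le (s a) i - count_le (s N) i"
proof -
  let ?g = "\<lambda>c. count_le (s c) i"
  have "(\<Sum>c\<in>{1..Suc (Suc N)}. cartan T a c * ?g c) =
      (\<Sum>c\<in>{1..Suc (Suc N)}. (if c = a then 2 * ?g c else 0) - (if c = N then ?g c else 0))"
    using N2 assms by (intro sum.cong) (auto simp: cartan_def dynkin_edge_def)
  also have "\<dots> = 2 * ?g a - ?g N"
    using N2 assms by (auto simp: sum_subtractf sum.delta)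
  finally show ?thesis using N2 assms by (auto simp add: vac_change_def classical_nodes_def)
qed

lemma nodes: "classical_nodes T = {1..Suc (Suc N)}" by (simp add: classical_nodes_def)

definition reached :: "int \<Rightarrow> nat \<Rightarrow> bool \<Rightarrow> bool \<Rightarrow> nat \<Rightarrow> bool" where
  "reached y f F1 F2 b \<longleftrightarrow> chain T L' 1 rc y (shorten T L rc (sel f F1 F2 b)) \<and> sel_ok T L rc (sel f F1 F2 b)"

lemma count_sel:
  assumes "N < b"
  shows "1 \<le> a \<Longrightarrow> a \<le> N \<Longrightarrow> count_le (sel f F1 F2 b a) i = (if a \<le> f then c a i else 0)"
    "count_le (sel f F1 F2 b (Suc N)) i = (if F1 then c1 i else 0)"
    "count_le (sel f F1 F2 b (Suc (Suc N))) i = (if F2 then c2 i else 0)"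
  using assms by (auto simp: sel_def c_def c1_def c2_def)

lemma count_sel_back:
  shows "1 \<le> a \<Longrightarrow> a \<le> N \<Longrightarrow> count_le (sel N True True b a) i = c a i + (if b \<le> a then d a i else 0)"
    "count_le (sel N True True b (Suc N)) i = c1 i"
    "count_le (sel N True True b (Suc (Suc N))) i = c2 i"
  by (auto simp: sel_def c_def c1_def c2_def d_def)

lemma forward:
  assumes "\<And>a. a \<le> f \<Longrightarrow> fl a \<noteq> None" "f \<le> N"
  shows "reached (int f + 1) f False False (Suc N)"
  using assms
proof (induction f)
  case 0
  have "sel 0 False False (Suc N) = (\<lambda>_. {#})" by (rule ext) (use N2 in \<open>auto simp: sel_def\<close>)
  then show ?case using chain_refl shorten_empty sel_ok_empty by (simp add: reached_def)
next
  case (Suc k)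
  then have IH: "reached (int k + 1) k False False (Suc N)" by simp
  obtain j where j: "fl (Suc k) = Some j" using Suc.prems(1)[of "Suc k"] by auto
  obtain m where m: "fl k = Some m" "m \<le> j" "singular_at T L rc (Suc k) j"
    "\<And>i. m \<le> i \<Longrightarrow> singular_at T L rc (Suc k) i \<Longrightarrow> j \<le> i"
    using j unfolding fl_def by (rule ell_chain_Suc) blast
  let ?s = "sel k False False (Suc N)"
  have node: "Suc k \<in> classical_nodes T" using Suc.prems(2) by (simp add: nodes)
  have V: "vac_change T ?s (Suc k) i = - c k i" if "0 < i" for i
  proof (cases "Suc k = N")
    case True
    then have "vac_change T ?s N i = - c k i" using N2 vac_change_fork[of ?s i] count_sel[of "Suc N"] by auto
    with True show ?thesis by simp
  next
    case False
    then have "Suc k < N" using Suc.prems(2) by simp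
    then show ?thesis
      using vac_change_linear[of "Suc k" ?s i] count_sel[of "Suc N"] that c_0[of i] by auto
  qed
  have kept: "kept_strings T L rc ?s (Suc k) = rc (Suc k)"
    using Suc.prems(2) by (simp add: kept_strings_def sel_def)
  have j0: "0 < j" by (rule singular_at_pos[OF ok m(3)])
  have ck: "c k i = (if m \<le> i then 1 else 0)" for i using m(1) by (simp add: c_def)
  have "chain T L' 1 rc (int (Suc k) + 1) (shorten T L rc (sel (Suc k) False False (Suc N))) \<and>
      sel_ok T L rc (sel (Suc k) False False (Suc N))"
  proof (rule chain_shorten[OF valid L IH[unfolded reached_def] node, of _ j])
    show "\<forall>b\<in>classical_nodes T. cartan T (Suc k) b \<noteq> 0 \<longrightarrow> (\<forall>i. i \<in># ?s b \<longrightarrow> i \<le> j)"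
    proof (intro ballI impI allI)
      fix b i assume b: "cartan T (Suc k) b \<noteq> 0" "i \<in># ?s b"
      then have "b = k" using Suc.prems(2) by (auto simp: sel_def cartan_def dynkin_edge_def split: if_splits)
      then show "i \<le> j" using b(2) m(1,2) Suc.prems(2) by (auto simp: sel_def split: if_splits)
    qed
    show "\<forall>i>0. - 1 \<le> vac_change T ?s (Suc k) i" using V ck by auto
    show "\<forall>i. (i, p (Suc k) i) \<in># kept_strings T L rc ?s (Suc k) \<longrightarrow> vac_change T ?s (Suc k) i = - 1 \<longrightarrow> j \<le> i"
      unfolding kept
    proof (intro allI impI)
      fix i assume i: "singular_at T L rc (Suc k) i" "vac_change T ?s (Suc k) i = - 1"
      then show "j \<le> i" using V[OF singular_at_pos[OF ok i(1)]] ck[of i] m(4)[of i] by (auto split: if_splits)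
    qed
    show "vac_change T ?s (Suc k) j = - 1" using V[OF j0] ck m(2) by simp
    show "?s(Suc k := add_mset j (?s (Suc k))) = sel (Suc k) False False (Suc N)"
      using j Suc.prems(2) by (auto simp: sel_def fun_eq_iff)
    show "letter_f T (Suc k) (int k + 1) = Some (int (Suc k) + 1)" using Suc.prems(2) by simp
  qed (use m(3) kept in simp_all)
  then show ?case by (simp add: reached_def)
qed

text \<open>The letter \<open>y\<close> is left open, so that the lemma serves both for the first
  and for the second arrow at the fork.\<close>

lemma spin_step:
  assumes R: "reached y N F1 F2 (Suc N)"
    and a: "a = Suc N \<and> \<not> F1 \<and> l = fork1 \<and> F1' \<and> F2' = F2 \<or> a = Suc (Suc N) \<and> \<not> F2 \<and> l = fork2 \<and> F1' = F1 \<and> F2'"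
    and j: "l = Some j" and y: "letter_f T a y = Some z"
  shows "reached z N F1' F2' (Suc N)"
proof -
  have l: "l = least_from (fl N) (singular_at T L rc a)" using a by (auto simp: fork1_def fork2_def)
  obtain m where m: "fl N = Some m" "m \<le> j" "singular_at T L rc a j"
    "\<And>i. m \<le> i \<Longrightarrow> singular_at T L rc a i \<Longrightarrow> j \<le> i"
    using j[unfolded l] by (rule least_from_SomeD) blast
  let ?s = "sel N F1 F2 (Suc N)"
  have sa: "?s a = {#}" using a by (auto simp: sel_def)
  have node: "a \<in> classical_nodes T" using a by (auto simp: nodes)
  have cN: "c N i = (if m \<le> i then 1 else 0)" for i using m(1) by (simp add: c_def)
  have V: "vac_change T ?s a i = - c N i" for i
    using vac_change_spin[of a ?s i] a count_sel(1)[of "Suc N" N N F1 F2 i] N2 sa by auto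
  have kept: "kept_strings T L rc ?s a = rc a" by (simp add: kept_strings_def sa)
  have "chain T L' 1 rc z (shorten T L rc (sel N F1' F2' (Suc N))) \<and> sel_ok T L rc (sel N F1' F2' (Suc N))"
  proof (rule chain_shorten[OF valid L R[unfolded reached_def] node y, of j])
    show "\<forall>b\<in>classical_nodes T. cartan T a b \<noteq> 0 \<longrightarrow> (\<forall>i. i \<in># ?s b \<longrightarrow> i \<le> j)"
    proof (intro ballI impI allI)
      fix b i assume b: "cartan T a b \<noteq> 0" "i \<in># ?s b"
      then have "b = N" using a sa by (auto simp: sel_def cartan_def dynkin_edge_def split: if_splits)
      then show "i \<le> j" using b(2) m(1,2) by (auto simp: sel_def split: if_splits)
    qed
    show "\<forall>i>0. - 1 \<le> vac_change T ?s a i" using V cN by auto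
    show "\<forall>i. (i, p a i) \<in># kept_strings T L rc ?s a \<longrightarrow> vac_change T ?s a i = - 1 \<longrightarrow> j \<le> i"
      unfolding kept V using cN m(4) by (auto split: if_splits)
    show "vac_change T ?s a j = - 1" using V cN m(2) by simp
    have "option_mset l = {#j#}" by (simp add: j)
    then have "l = fork1 \<Longrightarrow> option_mset fork1 = {#j#}" "l = fork2 \<Longrightarrow> option_mset fork2 = {#j#}"
      by blast+
    then show "?s(a := add_mset j (?s a)) = sel N F1' F2' (Suc N)"
      using a by (auto simp: sel_def fun_eq_iff)
  qed (use m(3) kept in simp_all)
  then show ?thesis by (simp add: reached_def)
qed

text \<open>At node \<open>a\<close> the forward selection raises the vacancy numbers by 2 while the
  selections around it lower them by up to 3; the net loss is 1 exactly where all of them have been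
  made, which is where the algorithm looks for its next string.\<close>

lemma backward_step:
  assumes R: "reached (- int (Suc a)) N True True (Suc a)" and a: "1 \<le> a" "a \<le> N" and j: "bl a = Some j"
  shows "reached (- int a) N True True a"
proof -
  obtain m where m: "bl (Suc a) = Some m" "m \<le> j" "spare a j" "\<And>i. m \<le> i \<Longrightarrow> spare a i \<Longrightarrow> j \<le> i"
    using j[unfolded bl_step[OF a(2,1)]] by (rule least_from_SomeD) blast
  let ?s = "sel N True True (Suc a)"
  have node: "a \<in> classical_nodes T" using a by (auto simp: nodes)
  have dm: "d (Suc a) i = (if m \<le> i then 1 else 0)" for i using m(1) by (simp add: d_def)
  obtain a' where a': "a = Suc a'" using a(1) by (cases a) auto
  have V: "vac_change T ?s a i = - c a' i + 2 * c a i - (if a = N then c1 i + c2 i else c (Suc a) i + d (Suc a) i)"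
    if "0 < i" for i
  proof (cases "a = N")
    case True
    then have "vac_change T ?s N i = - c a' i + 2 * c N i - (c1 i + c2 i)"
      using N2 a' vac_change_fork[of ?s i] count_sel_back(1)[of a' "Suc a" i] count_sel_back(1)[of N "Suc a" i]
        count_sel_back(2,3)[of "Suc a" i] by auto
    with True show ?thesis by simp
  next
    case False
    then have "a < N" using a(2) by simp
    then show ?thesis
      using vac_change_linear[of a ?s i] a' that c_0[of i] count_sel_back(1)[of a' "Suc a" i]
        count_sel_back(1)[of a "Suc a" i] count_sel_back(1)[of "Suc a" "Suc a" i] by auto
  qed
  have kept: "kept_strings T L rc ?s a = rc a - image_mset (\<lambda>j. (j, p a j)) (option_mset (fl a))"
    using a by (simp add: kept_strings_def sel_def)
  have sing: "singular_at T L rc a i" if "spare a i" for i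
    using that unfolding spare_def by (rule in_diffD)
  have j0: "0 < j" by (rule singular_at_pos[OF ok sing[OF m(3)]])
  note facts = c_mono[of a'] c_mono[of a]
  \<comment> \<open>From length \<open>m\<close> on all indicators around \<open>a\<close> equal 1,
    so the vacancy numbers change by \<open>- 1 + 2 - 2\<close>.\<close>
  have one: "c a' i = 1 \<and> c a i = 1 \<and> (if a = N then c1 i = 1 \<and> c2 i = 1 else c (Suc a) i = 1) \<and> d (Suc a) i = 1" if "m \<le> i" for i
    using dm[of i] that facts(1)[of i] c01(1,2)[of a' i] c01(1,2)[of a i] c01(1,2)[of "Suc a" i] c01(3-6)[of i] c01(7,8)[of "Suc a" i] d_le_c[OF a, of i] d_top[of i] a' by (auto split: if_splits)
  have "chain T L' 1 rc (- int a) (shorten T L rc (sel N True True a)) \<and> sel_ok T L rc (sel N True True a)"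
  proof (rule chain_shorten[OF valid L R[unfolded reached_def] node, of _ j])
    show "\<forall>b\<in>classical_nodes T. cartan T a b \<noteq> 0 \<longrightarrow> (\<forall>i. i \<in># ?s b \<longrightarrow> i \<le> j)"
    proof (intro ballI impI allI)
      fix b i assume b: "b \<in> classical_nodes T" "cartan T a b \<noteq> 0" "i \<in># ?s b"
      have "b = a' \<or> b = a \<or> b = Suc a \<or> a = N \<and> b = Suc (Suc N)"
        using b(1,2) a a' by (auto simp: cartan_def dynkin_edge_def nodes split: if_splits)
      moreover have "i \<le> m" if "fl x = Some i" "c x m = 1" for x using that by (simp add: c_def split: if_splits)
      moreover have "i \<le> m" if "fork1 = Some i" "c1 m = 1" using that by (simp add: c1_def split: if_splits)
      moreover have "i \<le> m" if "fork2 = Some i" "c2 m = 1" using that by (simp add: c2_def split: if_splits)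
      ultimately have "i \<le> m"
        using b(3) one[of m] a a' m(1) unfolding sel_def by (auto split: if_splits)
      then show "i \<le> j" using m(2) by simp
    qed
    show "\<forall>i>0. - 1 \<le> vac_change T ?s a i"
    proof (intro allI impI)
      fix i :: nat assume i: "0 < i"
      show "- 1 \<le> vac_change T ?s a i"
        using V[OF i] facts(1)[of i] facts(2)[of i] fork_mono[of i] c01(1,2)[of a' i] c01(1,2)[of a i] c01(1,2)[of "Suc a" i] c01(3-6)[of i] c01(7,8)[of "Suc a" i]
          d_le_c[OF a, of i] d_top[of i] a' by (auto split: if_splits)
    qed
    show "\<forall>i. (i, p a i) \<in># kept_strings T L rc ?s a \<longrightarrow> vac_change T ?s a i = - 1 \<longrightarrow> j \<le> i"
      unfolding kept
    proof (intro allI impI)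
      fix i assume i: "(i, p a i) \<in># rc a - image_mset (\<lambda>j. (j, p a j)) (option_mset (fl a))" "vac_change T ?s a i = - 1"
      have sp: "spare a i" using i(1) by (simp add: spare_def)
      have i0: "0 < i" by (rule singular_at_pos[OF ok sing[OF sp]])
      have "c a' i \<le> c a i" using c_gap[where a = a' and i = i] sing[OF sp] a' by simp
      then have "d (Suc a) i = 1"
        using V[OF i0] i(2) facts(1)[of i] facts(2)[of i] fork_mono[of i] c01(1,2)[of a' i] c01(1,2)[of a i] c01(1,2)[of "Suc a" i] c01(3-6)[of i] c01(7,8)[of "Suc a" i]
          d_le_c[OF a, of i] d_top[of i] a' by (auto split: if_splits)
      then show "j \<le> i" using dm[of i] m(4)[OF _ sp] by (auto split: if_splits)
    qed
    show "vac_change T ?s a j = - 1" using V[OF j0] one[OF m(2)] by (auto split: if_splits)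
    show "(j, p a j) \<in># kept_strings T L rc ?s a" unfolding kept using m(3) by (simp add: spare_def)
    show "?s(a := add_mset j (?s a)) = sel N True True a"
      using j a by (auto simp: sel_def fun_eq_iff le_Suc_eq Suc_le_eq)
    show "letter_f T a (- int (Suc a)) = Some (- int a)" using a by simp
  qed
  then show ?thesis by (simp add: reached_def)
qed

end

context delta_D
begin

lemma selected_eq:
  "selected T L rc a = (if 1 \<le> a \<and> a \<le> N then option_mset (fl a) + option_mset (bl a)
     else if a = Suc N then option_mset fork1 else if a = Suc (Suc N) then option_mset fork2 else {#})"
proof -
  have "ellbar_chain (Suc (Suc N)) L rc (Suc (Suc N) - 1 - a) = bl a" by (simp add: bl_def)
  moreover have "1 \<le> a \<Longrightarrow> a \<le> Suc (Suc N) \<Longrightarrow> a \<le> N \<or> a = Suc N \<or> a = Suc (Suc N)" by auto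
  ultimately show ?thesis
    unfolding selected_def nodes by (auto simp: ell_eq)
qed

lemma count_selected:
  "1 \<le> a \<Longrightarrow> a \<le> N \<Longrightarrow> count_le (selected T L rc a) i = c a i + d a i"
  "count_le (selected T L rc (Suc N)) i = c1 i" "count_le (selected T L rc (Suc (Suc N))) i = c2 i"
  by (simp_all add: selected_eq c_def d_def c1_def c2_def)

lemma d_le: "1 \<le> a \<Longrightarrow> a \<le> N \<Longrightarrow> d a i \<le> c a i"
  using d_mono[of a i] d_le_c(2)[of a i] by simp

text \<open>Once no further string can be selected, a drop of the vacancy numbers and an unselected
  singular string never meet. At each node this is a consequence of the monotonicity of the selected
  lengths and of their minimality.\<close>

lemma deltabar_valid:
  assumes "sel_ok T L rc (selected T L rc)" "rc_ok T (deltabar T L rc)"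
  shows "rc_valid T L' (deltabar T L rc)"
  unfolding deltabar_shorten
proof (rule shorten_valid[OF valid assms(1) L])
  let ?s = "selected T L rc"
  show "rc_ok T (shorten T L rc ?s)" using assms(2) by (simp add: deltabar_shorten)
  fix a i assume a: "a \<in> classical_nodes T"
  have kept: "spare a i" if "(i, p a i) \<in># kept_strings T L rc ?s a" "1 \<le> a" "a \<le> N"
  proof -
    let ?m = "image_mset (\<lambda>j. (j, p a j))"
    have "kept_strings T L rc ?s a = rc a - ?m (option_mset (fl a)) - ?m (option_mset (bl a))"
      using that(2,3) by (simp add: kept_strings_def selected_eq)
    then show ?thesis using that(1) unfolding spare_def by (metis in_diffD)
  qed
  have bounds: "- 1 \<le> vac_change T ?s a i \<and> (singular_at T L rc a i \<longrightarrow> (a \<le> N \<longrightarrow> spare a i) \<longrightarrow> 0 \<le> vac_change T ?s a i)"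
    if i0: "0 < i"
  proof -
    obtain a' where a': "a = Suc a'" using a by (cases a) (auto simp: nodes)
    consider "a < N" | "a = N" | "a = Suc N" | "a = Suc (Suc N)" using a by (fastforce simp: nodes)
    then show ?thesis
    proof cases
      case 1
      have V: "vac_change T ?s a i = - (if a' = 0 then 1 else c a' i + d a' i) + 2 * (c a i + d a i) - (c (Suc a) i + d (Suc a) i)"
        using vac_change_linear[of a ?s i] 1 a' i0 count_selected(1)[of a' i] count_selected(1)[of a i] count_selected(1)[of "Suc a" i] by auto
      have c0: "a' = 0 \<Longrightarrow> c a' i = 1" using c_0[of i] i0 by simp
      show ?thesis
        using V c0 1 a' c_mono[of a' i] c_mono[of a i] d_mono[of a i] d_mono[of a' i] d_le[of a' i] d_le[of a i]
          d_le[of "Suc a" i] d_le_c[of a i] c01(1,2)[of a' i] c01(1,2)[of a i] c01(1,2)[of "Suc a" i]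
          c01(7,8)[of a' i] c01(7,8)[of a i] c01(7,8)[of "Suc a" i] c_gap[where a = a' and i = i] d_gap[of a i]
        by (cases "a' = 0") auto
    next
      case 2
      have V: "vac_change T ?s a i = - (c a' i + d a' i) + 2 * (c a i + d a i) - c1 i - c2 i"
        using vac_change_fork[of ?s i] 2 a' N2 count_selected(1)[of a' i] count_selected(1)[of a i] count_selected(2,3)[of i] by auto
      show ?thesis
        using V 2 a' N2 c_mono[of a' i] d_mono[of a i] d_mono[of a' i] d_le[of a i] d_le_c[of a i] d_top[of i] fork_mono[of i]
          c01(1,2)[of a' i] c01(1,2)[of a i] c01(3-6)[of i] c01(7,8)[of a' i] c01(7,8)[of a i] c01(7,8)[of "Suc a" i]
          c_gap[where a = a' and i = i] d_gap[of a i]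
        by auto
    next
      case 3
      have V: "vac_change T ?s a i = 2 * c1 i - (c N i + d N i)"
        using vac_change_spin[of a ?s i] 3 N2 count_selected(1)[of N i] count_selected(2,3)[of i] by auto
      show ?thesis
        using V 3 N2 d_mono[of N i] d_top[of i] fork_mono[of i] c01(1,2)[of N i] c01(3-6)[of i] c01(7,8)[of N i] fork_gap[of i]
        by auto
    next
      case 4
      have V: "vac_change T ?s a i = 2 * c2 i - (c N i + d N i)"
        using vac_change_spin[of a ?s i] 4 N2 count_selected(1)[of N i] count_selected(2,3)[of i] by auto
      show ?thesis
        using V 4 N2 d_mono[of N i] d_top[of i] fork_mono[of i] c01(1,2)[of N i] c01(3-6)[of i] c01(7,8)[of N i] fork_gap[of i]
        by auto
    qed
  qed
  show "- 1 \<le> vac_change T ?s a i" if "0 < i" using bounds[OF that] by blast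
  show "0 \<le> vac_change T ?s a i" if k: "(i, p a i) \<in># kept_strings T L rc ?s a"
  proof -
    have "singular_at T L rc a i" by (rule kept_mem[OF k])
    moreover have "1 \<le> a" using a by (simp add: nodes)
    ultimately show ?thesis using bounds[OF singular_at_pos[OF ok]] kept[OF k] by blast
  qed
qed

lemma finish:
  assumes "reached x f F1 F2 b" "sel f F1 F2 b = selected T L rc"
  shows "\<exists>x. chain T L' 1 rc x (deltabar T L rc) \<and> rc_valid T L' (deltabar T L rc)"
proof -
  have C: "chain T L' 1 rc x (deltabar T L rc)" "sel_ok T L rc (selected T L rc)"
    using assms by (auto simp: reached_def deltabar_shorten)
  show ?thesis using C deltabar_valid[OF C(2) chain_ok[OF C(1) ok]] by blast
qed

lemma fl_None: "fl a = None \<Longrightarrow> a \<le> b \<Longrightarrow> fl b = None"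
  unfolding fl_def by (rule ell_chain_None)

lemma bl_None:
  assumes "bl b = None" "1 \<le> a" "a \<le> b" "b \<le> Suc N"
  shows "bl a = None"
  using assms(3,2)
proof (induction a rule: inc_induct)
  case (step k)
  then show ?case using bl_step[of k] assms(4) by simp
qed (rule assms(1))

text \<open>The selection may end before the fork, at the fork with at most one spin node, or on the
  way back. In each case the stage reached is the complete selection.\<close>

lemma delta_chain: "\<exists>x. chain T L' 1 rc x (deltabar T L rc) \<and> rc_valid T L' (deltabar T L rc)"
proof -
  obtain K where K: "K \<le> N" "\<And>a. a \<le> K \<Longrightarrow> fl a \<noteq> None" "K < N \<Longrightarrow> fl (Suc K) = None"
    using option_prefix[of fl N] by (auto simp: fl_def)
  note F = forward[OF K(2,1)]
  show ?thesis
  proof (cases "fork1 = None \<or> fork2 = None")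
    case True
    then have "bl (Suc N) = None" by (auto simp: bl_top split: option.splits)
    then have bN: "bl a = None" if "1 \<le> a" "a \<le> N" for a using bl_None that by auto
    have eq: "sel N (fork1 \<noteq> None) (fork2 \<noteq> None) (Suc N) a = selected T L rc a" for a
      using bN[of a] by (auto simp: sel_def selected_eq)
    show ?thesis
    proof (cases "K < N")
      case True
      then have none: "fl a = None" if "K < a" for a using fl_None[OF K(3)[OF True], of a] that by simp
      have forks: "fork1 = None" "fork2 = None" using none[of N] True by (auto simp: fork1_def fork2_def)
      have "sel K False False (Suc N) = selected T L rc"
      proof
        fix a
        have "sel K False False (Suc N) a = sel N False False (Suc N) a"
          using none[of a] by (auto simp: sel_def)
        then show "sel K False False (Suc N) a = selected T L rc a" using eq[of a] forks by simp
      qed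
      then show ?thesis using finish[OF F] by blast
    next
      case False
      then have R: "reached (int N + 1) N False False (Suc N)" using F K(1) by simp
      have "\<exists>x. reached x N (fork1 \<noteq> None) (fork2 \<noteq> None) (Suc N)"
      proof (cases fork1)
        case None
        show ?thesis
        proof (cases fork2)
          case n2: None
          then show ?thesis using R None by auto
        next
          case (Some j)
          have "letter_f T (Suc (Suc N)) (int N + 1) = Some (- int (Suc (Suc N)))" by simp
          from spin_step[OF R _ Some this, where F1' = False and F2' = True] show ?thesis using None Some by auto
        qed
      next
        case (Some j)
        then have "fork2 = None" using True by simp
        have "letter_f T (Suc N) (int N + 1) = Some (int N + 2)" by simp
        from spin_step[OF R _ Some this, where F1' = True and F2' = False] show ?thesis using \<open>fork2 = None\<close> Some by auto
      qed
      moreover have "sel N (fork1 \<noteq> None) (fork2 \<noteq> None) (Suc N) = selected T L rc" using eq by auto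
      ultimately show ?thesis using finish by blast
    qed
  next
    case False
    then obtain i j where ij: "fork1 = Some i" "fork2 = Some j" by auto
    from ij(1) have "fl N \<noteq> None" unfolding fork1_def by (rule least_from_SomeD) simp
    then have KN: "K = N" using K(1,3) fl_None[of "Suc K" N] by (cases "K < N") auto
    have R: "reached (int N + 1) N False False (Suc N)" using F KN by simp
    have l1: "letter_f T (Suc N) (int N + 1) = Some (int N + 2)" by simp
    have R1: "reached (int N + 2) N True False (Suc N)"
      by (rule spin_step[OF R _ ij(1) l1]) simp
    have l2: "letter_f T (Suc (Suc N)) (int N + 2) = Some (- int (Suc N))" by simp
    have R2: "reached (- int (Suc N)) N True True (Suc N)"
      by (rule spin_step[OF R1 _ ij(2) l2]) simp
    obtain k where k: "k \<le> N" "\<And>t. t \<le> k \<Longrightarrow> bl (Suc N - t) \<noteq> None" "k < N \<Longrightarrow> bl (Suc N - Suc k) = None"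
      using option_prefix[of "\<lambda>t. bl (Suc N - t)" N] ij by (auto simp: bl_top)
    have "reached (- int (Suc N - t)) N True True (Suc N - t)" if "t \<le> k" for t
      using that
    proof (induction t)
      case 0
      then show ?case using R2 by simp
    next
      case (Suc t)
      have s: "Suc (Suc N - Suc t) = Suc N - t" using Suc.prems k(1) by simp
      obtain m where m: "bl (Suc N - Suc t) = Some m" using k(2)[OF Suc.prems] by auto
      show ?case
        by (rule backward_step[OF _ _ _ m]) (use Suc s k(1) in auto)
    qed
    then have "reached (- int (Suc N - k)) N True True (Suc N - k)" by simp
    moreover have "sel N True True (Suc N - k) = selected T L rc"
    proof
      fix a
      have "bl a = None" if "1 \<le> a" "a < Suc N - k"
      proof (rule bl_None[OF k(3) that(1)])
        show "k < N" using that by simp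
      qed (use that in auto)
      then show "sel N True True (Suc N - k) a = selected T L rc a"
        by (auto simp: sel_def selected_eq)
    qed
    ultimately show ?thesis by (rule finish)
  qed
qed

end

theorem delta_chain:
  assumes "valid_type T" "rc_valid T L rc" "(1, 1) \<in># L"
  obtains x where "chain T (L - {#(1, 1)#}) 1 rc x (deltabar T L rc)" "rc_valid T (L - {#(1, 1)#}) (deltabar T L rc)"
proof (cases T)
  case (TypeA n)
  then show ?thesis using delta_chain_A[OF TypeA assms(2,3)] that by blast
next
  case (TypeD n)
  then obtain N where N: "n = Suc (Suc N)" "2 \<le> N"
    using assms(1) that[of "n - 2"] by auto
  interpret delta_D N L rc
    by unfold_locales (use N TypeD assms in auto)
  show ?thesis using delta_chain that TypeD N by blast
qed

section \<open>Reading words of rigged configurations\<close>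

text \<open>Extends the inverse of \<phi>, which is given for highest weight vectors, to all
  configurations bounded by the vacancy numbers. The rules follow \<open>lh\<close>,
  \<open>ls\<close> and \<open>lb\<close>; the letter of a box is the one at which the chain to a
  valid configuration ends.\<close>

inductive reads :: "affine_type \<Rightarrow> (nat \<times> nat) list \<Rightarrow> int list \<Rightarrow> rigged \<Rightarrow> bool" for T where
  reads_Nil: "reads T [] [] (\<lambda>_. {#})"
| reads_box: "rc_valid T (mset ((1, 1) # B)) rc \<Longrightarrow> chain T (mset B) 1 rc x X \<Longrightarrow> reads T B w X \<Longrightarrow>
    reads T ((1, 1) # B) (x # w) rc"
| reads_column: "rc_valid T (mset ((r, s) # B)) rc \<Longrightarrow> 2 \<le> s \<Longrightarrow> reads T ((r, 1) # (r, s - 1) # B) w rc \<Longrightarrow>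
    reads T ((r, s) # B) w rc"
| reads_cell: "rc_valid T (mset ((r, 1) # B)) rc \<Longrightarrow> 2 \<le> r \<Longrightarrow> T = TypeA n \<Longrightarrow> r \<le> n \<Longrightarrow>
    reads T ((1, 1) # (r - 1, 1) # B) w (ibar T (mset ((r, 1) # B)) r rc) \<Longrightarrow> reads T ((r, 1) # B) w rc"

lemma reads_valid: "reads T B w rc \<Longrightarrow> rc_valid T (mset B) rc"
  by (cases rule: reads.cases) (auto simp: rc_valid_def rc_ok_def node_valid_def)

text \<open>The identity \<Lambda>_1 + \<Lambda>_(r-1) - \<Lambda>_r = \<alpha>_1 + ... +
  \<alpha>_(r-1): the new strings of length 1 compensate the change of the factors at every positive
  length.\<close>

lemma ibar_vacancy:
  assumes "2 \<le> r" "r \<le> n" "1 \<le> a" "a \<le> n" "1 \<le> i" "(r, 1) \<in># L"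
  shows "vacancy (TypeA n) (L - {#(r, 1)#} + {#(1, 1), (r - 1, 1)#})
      (\<lambda>a. if 1 \<le> a \<and> a < r then add_mset 1 (nu a) else nu a) a i = vacancy (TypeA n) L nu a i"
proof -
  obtain K where K: "L = add_mset (r, 1) K" using multi_member_split[OF assms(6)] by blast
  let ?nu = "\<lambda>a. if 1 \<le> a \<and> a < r then add_mset 1 (nu a) else nu a"
  have "(\<Sum>b\<in>{1..n}. cartan (TypeA n) a b * min_sum (?nu b) i) =
      (\<Sum>b\<in>{1..n}. cartan (TypeA n) a b * min_sum (nu b) i + (if b < r then cartan (TypeA n) a b else 0))"
    using assms(5) by (intro sum.cong) (auto simp: algebra_simps)
  also have "\<dots> = (\<Sum>b\<in>{1..n}. cartan (TypeA n) a b * min_sum (nu b) i) + (\<Sum>b\<in>{1..n}. if b < r then cartan (TypeA n) a b else 0)"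
    by (rule sum.distrib)
  also have "(\<Sum>b\<in>{1..n}. if b < r then cartan (TypeA n) a b else 0) =
      (\<Sum>b\<in>{1..n}. (if b = a then (if a < r then 2 else 0) else 0) - (if b = Suc a then (if Suc a < r then 1 else 0) else 0)
         - (if b = a - 1 then (if a - 1 < r then 1 else 0) else 0))"
    using assms(3) by (intro sum.cong) (auto simp: cartan_def dynkin_edge_def)
  also have "\<dots> = (if a < r then 2 else 0) - (if Suc a < r then 1 else 0) - (if a = 1 then 0 else if a - 1 < r then 1 else 0)"
    using assms(1-4) by (auto simp: sum_subtractf sum.delta)
  also have "\<dots> = (if a = 1 then 1 else 0) + (if a = r - 1 then 1 else 0) - (if a = r then 1 else 0)"
    using assms(1-4) by auto
  finally show ?thesis
    unfolding vacancy_min_sum classical_nodes_def K using assms(1,5) by auto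
qed

lemma ibar_eq:
  assumes "2 \<le> r" "r \<le> n" "(r, 1) \<in># L"
  shows "ibar (TypeA n) L r rc a =
    (if 1 \<le> a \<and> a < r then add_mset (1, vacancy (TypeA n) L (shape rc) a 1) (rc a) else rc a)"
  using ibar_vacancy[OF assms(1,2) _ _ _ assms(3), of a 1 "shape rc"] assms(2) by (simp add: ibar_def Let_def)

lemma shape_ibar:
  assumes "2 \<le> r" "r \<le> n" "(r, 1) \<in># L"
  shows "shape (ibar (TypeA n) L r rc) = (\<lambda>a. if 1 \<le> a \<and> a < r then add_mset 1 (shape rc a) else shape rc a)"
  by (auto simp: fun_eq_iff shape_def ibar_eq[OF assms])

lemma vacancy_nonneg_valid:
  assumes "rc_valid T L rc" "a \<in> classical_nodes T"
  shows "- int (rc_eps rc a) \<le> vacancy T L (shape rc) a i"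
proof (rule vacancy_ge[OF assms(2)])
  fix i assume "i \<in># shape rc a"
  then obtain x where x: "(i, x) \<in># rc a" by (rule shape_memE)
  then have "x \<le> vacancy T L (shape rc) a i" using assms(1) by (auto simp: rc_valid_def node_valid_def)
  then show "- int (rc_eps rc a) \<le> vacancy T L (shape rc) a i" using rc_eps_le[of i x rc a] x by simp
qed simp

text \<open>In crystal terms, \<open>phi\<close>, the sum of \<open>rc_eps\<close> and the weight,
  is nonnegative.\<close>

lemma rc_wt_ge_valid:
  assumes "rc_valid T L rc" "a \<in> classical_nodes T"
  shows "- int (rc_eps rc a) \<le> rc_wt T L (shape rc) a"
  using vacancy_large[of T L "shape rc" a] vacancy_nonneg_valid[OF assms] by (metis order_refl)

lemma vacancy_below_e_sel:
  assumes "rc_valid T L rc" "e_sel rc a k l" "0 < i" "i < l"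
  shows "- k < vacancy T L (shape rc) a i"
proof -
  have ok: "rc_ok T rc" using assms(1) by (simp add: rc_valid_def)
  have a: "a \<in> classical_nodes T" by (rule e_sel_node[OF ok assms(2)])
  show ?thesis
  proof (rule concave_gt[where j = l])
    show "- k \<le> vacancy T L (shape rc) a l"
      using vacancy_nonneg_valid[OF assms(1) a, of l] e_sel_eps[OF assms(2)] by simp
    show "- k < vacancy T L (shape rc) a i \<or> concave_at (vacancy T L (shape rc) a) i" if i: "0 < i" "i < l" for i
    proof (cases "i \<in># shape rc a")
      case True
      then obtain x where x: "(i, x) \<in># rc a" by (rule shape_memE)
      then have "- k < x" using assms(2) i(2) unfolding e_sel_def by (metis leD order_le_imp_less_or_eq)
      then show ?thesis using x assms(1) by (fastforce simp: rc_valid_def node_valid_def)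
    next
      case False
      then show ?thesis using vacancy_concave[OF a i(1)] by blast
    qed
    show "- k < vacancy T L (shape rc) a 0" using assms(2) by (simp add: e_sel_def)
  qed (use assms in auto)
qed

text \<open>The added singular string of length 1 has the vacancy number as its rigging. This is at
  least \<open>- k\<close>, with equality only if the selected string has length 1 as well, so the
  selection is unchanged.\<close>

lemma e_sel_ibar:
  assumes "rc_valid (TypeA n) L rc" "2 \<le> r" "r \<le> n" "(r, 1) \<in># L" "e_sel rc a k l"
  shows "e_sel (ibar (TypeA n) L r rc) a k l"
    "e_app (TypeA n) a k l (ibar (TypeA n) L r rc) = ibar (TypeA n) L r (e_app (TypeA n) a k l rc)"
proof -
  let ?T = "TypeA n" and ?p = "vacancy (TypeA n) L (shape rc)"
  have ok: "rc_ok ?T rc" using assms(1) by (simp add: rc_valid_def)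
  have a: "a \<in> classical_nodes ?T" by (rule e_sel_node[OF ok assms(5)])
  have l: "0 < l" by (rule e_sel_length[OF ok assms(5)])
  note I = ibar_eq[OF assms(2-4)]
  have p1: "- k \<le> ?p a 1 \<and> (?p a 1 = - k \<longrightarrow> l \<le> 1)"
    using vacancy_nonneg_valid[OF assms(1) a, of 1] e_sel_eps[OF assms(5)] vacancy_below_e_sel[OF assms(1,5), of 1]
    by (cases "l \<le> 1") auto
  show "e_sel (ibar ?T L r rc) a k l"
    using assms(5) p1 unfolding e_sel_def I by auto
  show "e_app ?T a k l (ibar ?T L r rc) = ibar ?T L r (e_app ?T a k l rc)"
  proof
    fix b
    have V: "vacancy ?T L (shape (e_app ?T a k l rc)) b 1 = ?p b 1 + (if l \<le> 1 then cartan ?T b a else 0)"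
      by (rule vacancy_e_app(1)[OF ok assms(5)])
    obtain M where M: "rc a = add_mset (l, - k) M"
      using assms(5) multi_member_split[of "(l, - k)" "rc a"] by (auto simp: e_sel_def)
    have R: "ibar ?T L r (e_app ?T a k l rc) b =
        (if 1 \<le> b \<and> b < r then add_mset (1, ?p b 1 + (if l \<le> 1 then cartan ?T b a else 0)) (e_app ?T a k l rc b) else e_app ?T a k l rc b)"
      unfolding I V ..
    show "e_app ?T a k l (ibar ?T L r rc) b = ibar ?T L r (e_app ?T a k l rc) b"
    proof (cases "b = a")
      case True
      then show ?thesis unfolding R using M by (simp add: e_app_def I)
    next
      case False
      then show ?thesis unfolding R using cartan_sym[of ?T a b] by (simp add: e_app_def I)
    qed
  qed
qed

lemma rc_eps_ibar:
  assumes "rc_valid (TypeA n) L rc" "2 \<le> r" "r \<le> n" "(r, 1) \<in># L"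
  shows "rc_eps (ibar (TypeA n) L r rc) a = rc_eps rc a"
proof (cases "rc_eps rc a = 0")
  case True
  note I = ibar_eq[OF assms(2-4)]
  show ?thesis unfolding True
  proof (rule rc_eps_eqI)
    fix i x assume "(i, x) \<in># ibar (TypeA n) L r rc a"
    then consider "(i, x) \<in># rc a" | "1 \<le> a" "a < r" "x = vacancy (TypeA n) L (shape rc) a 1"
      unfolding I by (auto split: if_splits)
    then show "- int 0 \<le> x"
    proof cases
      case 1
      then show ?thesis using rc_eps_le[of i x rc a] True by simp
    next
      case 2
      then have "a \<in> classical_nodes (TypeA n)" using assms(3) by (simp add: classical_nodes_def)
      then show ?thesis using vacancy_nonneg_valid[OF assms(1), of a 1] True 2 by simp
    qed
  qed simp
next
  case False
  then obtain l where "e_sel rc a (int (rc_eps rc a)) l" using e_sel_ex by blast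
  from e_sel_eps[OF e_sel_ibar(1)[OF assms this]] show ?thesis by simp
qed

lemma vacancy_limit: "\<exists>J. \<forall>i\<ge>J. vacancy T L nu a i = rc_wt T L nu a"
  using vacancy_large[of T L nu a] by metis

lemma rc_wt_ibar:
  assumes "2 \<le> r" "r \<le> n" "1 \<le> a" "a \<le> n"
  shows "rc_wt (TypeA n) (mset ((1, 1) # (r - 1, 1) # B)) (shape (ibar (TypeA n) (mset ((r, 1) # B)) r rc)) a =
    rc_wt (TypeA n) (mset ((r, 1) # B)) (shape rc) a"
proof -
  let ?L = "mset ((r, 1) # B)" and ?L' = "mset ((1, 1) # (r - 1, 1) # B)"
  let ?nu = "\<lambda>a. if 1 \<le> a \<and> a < r then add_mset 1 (shape rc a) else shape rc a"
  obtain J where J: "\<And>i. J \<le> i \<Longrightarrow> vacancy (TypeA n) ?L (shape rc) a i = rc_wt (TypeA n) ?L (shape rc) a"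
    using vacancy_limit[of "TypeA n" ?L "shape rc" a] by blast
  obtain J' where J': "\<And>i. J' \<le> i \<Longrightarrow> vacancy (TypeA n) ?L' ?nu a i = rc_wt (TypeA n) ?L' ?nu a"
    using vacancy_limit[of "TypeA n" ?L' ?nu a] by blast
  let ?i = "max 1 (max J J')"
  have "vacancy (TypeA n) ?L' ?nu a ?i = vacancy (TypeA n) ?L (shape rc) a ?i"
  proof -
    have eq: "?L - {#(r, 1)#} + {#(1, 1), (r - 1, 1)#} = ?L'"
      unfolding mset.simps by (simp only: add_mset_remove_trivial union_mset_add_mset_right add_0_right)
    have i: "1 \<le> ?i" by (rule max.cobounded1)
    have L: "(r, 1) \<in># ?L" by simp
    show ?thesis by (rule ibar_vacancy[OF assms i L, of "shape rc", unfolded eq])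
  qed
  moreover have "vacancy (TypeA n) ?L (shape rc) a ?i = rc_wt (TypeA n) ?L (shape rc) a" by (rule J) simp
  moreover have "vacancy (TypeA n) ?L' ?nu a ?i = rc_wt (TypeA n) ?L' ?nu a" by (rule J') simp
  moreover have "shape (ibar (TypeA n) ?L r rc) = ?nu" by (rule shape_ibar[OF assms(1,2)]) simp
  ultimately show ?thesis by (simp only:)
qed

lemma letter_wt_one: "a \<in> classical_nodes T \<Longrightarrow> valid_type T \<Longrightarrow> letter_wt T a 1 = (if a = 1 then 1 else 0)"
  by (erule (1) classical_nodes_cases) (auto simp: letter_wt_def)

lemma rc_wt_box:
  "rc_wt T (mset ((1, 1) # B)) nu a = rc_wt T (mset B) nu a + (if a = 1 then 1 else 0)"
  by (simp add: rc_wt_def)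

lemma delta_chain_Cons:
  assumes "valid_type T" "rc_valid T (mset ((1, 1) # B)) rc"
  shows "\<exists>x. chain T (mset B) 1 rc x (deltabar T (mset ((1, 1) # B)) rc) \<and>
    rc_valid T (mset B) (deltabar T (mset ((1, 1) # B)) rc)"
proof -
  have "(1, 1) \<in># mset ((1, 1) # B)" by simp
  from delta_chain[OF assms this] show ?thesis by (metis add_mset_remove_trivial mset.simps(2))
qed

text \<open>For a box the two alternatives of \<open>chain_e\<close> are the two branches of the
  tensor product rule; splitting a factor changes neither the word nor the operators.\<close>

theorem reads_crystal:
  assumes "reads T B w rc" "valid_type T" "a \<in> classical_nodes T"
  shows "w_eps T a w = rc_eps rc a"
    "int (w_phi T a w) - int (w_eps T a w) = rc_wt T (mset B) (shape rc) a"
    "e_sel rc a k l \<Longrightarrow> \<exists>w'. w_e T a w = Some w' \<and> reads T B w' (e_app T a k l rc)"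
proof -
  have "w_eps T a w = rc_eps rc a \<and> int (w_phi T a w) - int (w_eps T a w) = rc_wt T (mset B) (shape rc) a \<and>
    (\<forall>k l. e_sel rc a k l \<longrightarrow> (\<exists>w'. w_e T a w = Some w' \<and> reads T B w' (e_app T a k l rc)))"
    using assms(1)
  proof (induction rule: reads.induct)
    case reads_Nil
    show ?case by (auto simp: rc_eps_def rc_wt_def shape_def e_sel_def)
  next
    case (reads_box B rc x X w)
    note valid = reads_box.hyps(1) and chain = reads_box.hyps(2)
    have ok: "rc_ok T rc" using valid by (simp add: rc_valid_def)
    have validX: "rc_valid T (mset B) X" by (rule reads_valid[OF reads_box.hyps(3)])
    have IH: "w_eps T a w = rc_eps X a" "int (w_phi T a w) = int (rc_eps X a) + rc_wt T (mset B) (shape X) a"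
      "\<And>k l. e_sel X a k l \<Longrightarrow> \<exists>w'. w_e T a w = Some w' \<and> reads T B w' (e_app T a k l X)"
      using reads_box.IH by auto
    have wt: "rc_wt T (mset B) (shape X) a + letter_wt T a x = rc_wt T (mset ((1, 1) # B)) (shape rc) a"
      using chain_wt[OF chain ok assms(3,2)] unfolding rc_wt_box letter_wt_one[OF assms(3,2)] .
    have wtge: "- int (rc_eps rc a) \<le> rc_wt T (mset ((1, 1) # B)) (shape rc) a"
      by (rule rc_wt_ge_valid[OF valid assms(3)])
    have lx: "letter_wt T a x = - 1" if "letter_e T a x \<noteq> None"
      using that letter_status(1)[OF assms(3,2), of x] by (auto simp: letter_wt_def)
    have wt': "int (w_phi T a (x # w)) - int (w_eps T a (x # w)) = rc_wt T (mset ((1, 1) # B)) (shape rc) a"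
      unfolding w_wt_Cons using IH(1,2) wt by simp
    show ?case
    proof (cases "rc_eps rc a = 0")
      case True
      then have "rc_eps X a = 0" by (rule chain_eps_zero[OF chain ok])
      \<comment> \<open>A letter that can be raised has weight \<open>- 1\<close>, so the remaining
        configuration has weight one more than \<open>rc\<close>; as \<open>phi\<close> of
        \<open>rc\<close> is nonnegative, that of the rest is positive and prevents the raising of
        \<open>x\<close>.\<close>
      then have "w_phi T a w \<ge> 1" if "letter_e T a x \<noteq> None"
        using lx[OF that] IH(2) wt wtge True by simp
      then have "w_eps T a (x # w) = 0" using IH(1) \<open>rc_eps X a = 0\<close> by auto
      moreover have "\<not> e_sel rc a k l" for k l using e_sel_eps[of rc a k l] True by (auto simp: e_sel_def)
      ultimately show ?thesis using True wt' by simp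
    next
      case False
      define k where "k = int (rc_eps rc a)"
      obtain l where l: "e_sel rc a k l" using False e_sel_ex unfolding k_def by blast
      let ?rc = "e_app T a k l rc"
      have valid2: "rc_valid T (mset ((1, 1) # B)) ?rc" by (rule rc_valid_e_app[OF valid l])
      obtain x2 X2 where X2: "chain T (mset B) 1 ?rc x2 X2" "rc_valid T (mset B) X2"
        using delta_chain_Cons[OF assms(2) valid2] by blast
      have "w_eps T a (x # w) = rc_eps rc a \<and> (\<exists>w'. w_e T a (x # w) = Some w' \<and> reads T ((1, 1) # B) w' ?rc)"
        using chain_e[OF chain ok validX assms(2) l X2]
      proof
        assume "\<exists>l'. x2 = x \<and> e_sel X a k l' \<and> X2 = e_app T a k l' X"
        then obtain l' where l': "x2 = x" "e_sel X a k l'" "X2 = e_app T a k l' X" by blast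
        have eps: "rc_eps X a = rc_eps rc a" using e_sel_eps[OF l'(2)] by (simp add: k_def)
        have phi: "w_phi T a w \<ge> 1" if "letter_e T a x \<noteq> None"
          using lx[OF that] IH(2) wt wtge eps by simp
        obtain w' where w': "w_e T a w = Some w'" "reads T B w' X2" using IH(3)[OF l'(2)] l'(3) by blast
        have "w_eps T a (x # w) = rc_eps rc a" "w_e T a (x # w) = Some (x # w')"
          using phi IH(1) eps w'(1) by auto
        moreover have "reads T ((1, 1) # B) (x # w') ?rc"
          by (rule reads.reads_box[OF valid2 X2(1)[unfolded l'(1)] w'(2)])
        ultimately show ?thesis by blast
      next
        \<comment> \<open>The coincidence case: \<open>phi\<close> of the rest is
          \<open>(k - 1) + (1 - k) = 0\<close>, and the operator reaches the letter.\<close>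
        assume E: "X2 = X \<and> letter_e T a x = Some x2 \<and> int (rc_eps X a) = k - 1 \<and> rc_wt T (mset B) (shape X) a = 1 - k"
        then have "w_phi T a w = 0" using IH(2) by simp
        then have "w_eps T a (x # w) = rc_eps rc a" "w_e T a (x # w) = Some (x2 # w)"
          using E IH(1) by (auto simp: k_def)
        moreover have "reads T ((1, 1) # B) (x2 # w) ?rc"
          using reads.reads_box[OF valid2 X2(1)] reads_box.hyps(3) E by blast
        ultimately show ?thesis by blast
      qed
      moreover have "k' = k \<and> l' = l" if "e_sel rc a k' l'" for k' l'
        using that l e_sel_eps e_sel_unique by metis
      ultimately show ?thesis using wt' by blast
    qed
  next
    case (reads_column r s B rc w)
    have "rc_wt T (mset ((r, 1) # (r, s - 1) # B)) (shape rc) a = rc_wt T (mset ((r, s) # B)) (shape rc) a"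
      using reads_column.hyps(2) by (simp add: rc_wt_def)
    moreover have "\<exists>w'. w_e T a w = Some w' \<and> reads T ((r, s) # B) w' (e_app T a k l rc)" if "e_sel rc a k l" for k l
      using reads_column.IH that reads.reads_column[OF rc_valid_e_app[OF reads_column.hyps(1) that] reads_column.hyps(2)]
      by blast
    ultimately show ?case using reads_column.IH by simp
  next
    case (reads_cell r B rc n w)
    have L: "(r, 1) \<in># mset ((r, 1) # B)" by simp
    have A: "1 \<le> a" "a \<le> n" using assms(3) reads_cell.hyps(3) by (auto simp: classical_nodes_def)
    note I = reads_cell.hyps(1)[unfolded reads_cell.hyps(3)] reads_cell.hyps(2,4) L
    have "\<exists>w'. w_e T a w = Some w' \<and> reads T ((r, 1) # B) w' (e_app T a k l rc)" if e: "e_sel rc a k l" for k l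
    proof -
      obtain w' where w': "w_e T a w = Some w'"
        "reads T ((1, 1) # (r - 1, 1) # B) w' (e_app T a k l (ibar T (mset ((r, 1) # B)) r rc))"
        using reads_cell.IH e_sel_ibar(1)[OF I e] reads_cell.hyps(3) by blast
      then have "reads T ((1, 1) # (r - 1, 1) # B) w' (ibar T (mset ((r, 1) # B)) r (e_app T a k l rc))"
        using e_sel_ibar(2)[OF I e] reads_cell.hyps(3) by simp
      from reads.reads_cell[OF rc_valid_e_app[OF reads_cell.hyps(1) e] reads_cell.hyps(2,3,4) this] w'(1)
      show ?thesis by blast
    qed
    then show ?case
      using reads_cell.IH rc_eps_ibar[OF I, of a] rc_wt_ibar[OF reads_cell.hyps(2,4) A, of B rc] reads_cell.hyps(3) by simp
  qed
  then show "w_eps T a w = rc_eps rc a"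
    "int (w_phi T a w) - int (w_eps T a w) = rc_wt T (mset B) (shape rc) a"
    "e_sel rc a k l \<Longrightarrow> \<exists>w'. w_e T a w = Some w' \<and> reads T B w' (e_app T a k l rc)"
    by blast+
qed

lemma reads_fun:
  assumes "reads T B w rc" "reads T B w' rc" "valid_type T"
  shows "w = w'"
  using assms(1,2)
proof (induction arbitrary: w' rule: reads.induct)
  case reads_Nil
  then show ?case by (auto elim: reads.cases)
next
  case (reads_box B rc x X w)
  from reads_box.prems obtain x' X' v where v: "w' = x' # v" "chain T (mset B) 1 rc x' X'" "reads T B v X'"
    by (cases rule: reads.cases) auto
  have "rc_ok T rc" using reads_box.hyps(1) by (simp add: rc_valid_def)
  from chain_unique[OF reads_box.hyps(2) this reads_valid[OF reads_box.hyps(3)] assms(3) v(2) reads_valid[OF v(3)]]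
  show ?case using reads_box.IH v by blast
next
  case (reads_column r s B rc w)
  from reads_column.prems reads_column.hyps(2) have "reads T ((r, 1) # (r, s - 1) # B) w' rc"
    by (cases rule: reads.cases) auto
  then show ?case by (rule reads_column.IH)
next
  case (reads_cell r B rc n w)
  from reads_cell.prems reads_cell.hyps(2) have "reads T ((1, 1) # (r - 1, 1) # B) w' (ibar T (mset ((r, 1) # B)) r rc)"
    by (cases rule: reads.cases) auto
  then show ?case by (rule reads_cell.IH)
qed

section \<open>Paths\<close>

lemma letter_ef_letters:
  assumes "i \<in> classical_nodes T" "valid_type T" "c \<in> letters T"
  shows "letter_f T i c = Some d \<Longrightarrow> d \<in> letters T" "letter_e T i c = Some d \<Longrightarrow> d \<in> letters T"
proof -
  have "(letter_f T i c = Some d \<longrightarrow> d \<in> letters T) \<and> (letter_e T i c = Some d \<longrightarrow> d \<in> letters T)"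
    using assms by (cases rule: classical_nodes_cases) (auto simp: letters_def)
  then show "letter_f T i c = Some d \<Longrightarrow> d \<in> letters T" "letter_e T i c = Some d \<Longrightarrow> d \<in> letters T" by auto
qed

lemma one_letter: "valid_type T \<Longrightarrow> 1 \<in> letters T"
  by (cases T) (auto simp: letters_def)

lemma letter_raisable:
  assumes "valid_type T" "c \<in> letters T" "c \<noteq> 1"
  shows "\<exists>a\<in>classical_nodes T. letter_e T a c \<noteq> None"
proof (cases T)
  case (TypeA n)
  then show ?thesis using assms by (intro bexI[of _ "nat (c - 1)"]) (auto simp: letters_def classical_nodes_def)
next
  case (TypeD n)
  consider "1 < c" "c \<le> int n" | "- int n < c" "c < 0" | "c = - int n"
    using assms TypeD by (fastforce simp: letters_def)
  then show ?thesis
  proof cases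
    case 1
    then show ?thesis using TypeD by (intro bexI[of _ "nat (c - 1)"]) (auto simp: classical_nodes_def)
  next
    case 2
    then show ?thesis using TypeD by (intro bexI[of _ "nat (- c)"]) (auto simp: classical_nodes_def)
  next
    case 3
    then show ?thesis using TypeD assms(1) by (intro bexI[of _ n]) (auto simp: classical_nodes_def)
  qed
qed

text \<open>Equal weights mean the same incoming arrows. Raising both letters by a common one keeps
  the weights equal, until the letter 1 is reached, the only letter without incoming arrows.\<close>

lemma letter_wt_inj:
  assumes "valid_type T" "x \<in> letters T" "y \<in> letters T" "\<And>a. a \<in> classical_nodes T \<Longrightarrow> letter_wt T a x = letter_wt T a y"
  shows "x = y"
  using assms(2-4)
proof (induction "nat (letter_height T x)" arbitrary: x y rule: less_induct)
  case less
  have e: "letter_e T a c \<noteq> None \<longleftrightarrow> letter_wt T a c = - 1" if "a \<in> classical_nodes T" for a c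
    using letter_status(1)[OF that assms(1), of c] by (auto simp: letter_wt_def)
  show ?case
  proof (cases "x = 1")
    case True
    have "letter_e T a 1 = None" if "a \<in> classical_nodes T" for a
      using e[OF that, of 1] letter_wt_one[OF that assms(1)] by (auto split: if_splits)
    then show ?thesis
      using True letter_raisable[OF assms(1) less.prems(2)] e less.prems(3) by metis
  next
    case False
    then obtain a where a: "a \<in> classical_nodes T" "letter_e T a x \<noteq> None"
      using letter_raisable[OF assms(1) less.prems(1)] by blast
    then obtain x' y' where xy: "letter_e T a x = Some x'" "letter_e T a y = Some y'"
      using e[OF a(1), of x] e[OF a(1), of y] less.prems(3)[OF a(1)] by auto
    have f: "letter_f T a x' = Some x" "letter_f T a y' = Some y" using xy letter_ef[OF a(1) assms(1)] by blast+
    have "x' = y'"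
    proof (rule less.hyps)
      show "nat (letter_height T x') < nat (letter_height T x)"
        using letter_e_height[OF a(1) assms(1) xy(1)] by simp
      show "x' \<in> letters T" "y' \<in> letters T" using letter_ef_letters(2)[OF a(1) assms(1)] less.prems(1,2) xy by blast+
      show "letter_wt T b x' = letter_wt T b y'" if "b \<in> classical_nodes T" for b
        using letter_wt_f[OF a(1) that assms(1) f(1)] letter_wt_f[OF a(1) that assms(1) f(2)] less.prems(3)[OF that] by simp
    qed
    with f show ?thesis by simp
  qed
qed

lemma chain_letters: "chain T L y Y x X \<Longrightarrow> valid_type T \<Longrightarrow> y \<in> letters T \<Longrightarrow> x \<in> letters T"
  by (induction rule: chain.induct) (auto dest: letter_ef_letters(1))

definition index_lens :: "(nat \<times> nat) list \<Rightarrow> nat list list" where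
  "index_lens B = map (\<lambda>(r, s). replicate s r) B"

lemma KR_lens: "t \<in> KR T p \<Longrightarrow> map length t = replicate (snd p) (fst p)"
  by (auto simp: KR_def case_prod_beta' intro!: nth_equalityI)

lemma elements_lens: "b \<in> elements T B \<Longrightarrow> path_lens b = index_lens B"
  unfolding elements_def path_lens_def index_lens_def mem_Collect_eq
  by (induction rule: list_all2_induct) (auto simp: KR_lens case_prod_beta')

lemma elements_Cons: "b \<in> elements T (p # B) \<longleftrightarrow> (\<exists>t b'. b = t # b' \<and> t \<in> KR T p \<and> b' \<in> elements T B)"
  by (auto simp: elements_def list_all2_Cons2)

lemma elements_append: "b \<in> elements T (B @ C) \<longleftrightarrow> (\<exists>u v. b = u @ v \<and> u \<in> elements T B \<and> v \<in> elements T C)"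
  by (auto simp: elements_def list_all2_append2 list_all2_appendI) (metis list_all2_lengthD list_all2_append)

lemma elements_appendI: "u \<in> elements T B \<Longrightarrow> v \<in> elements T C \<Longrightarrow> u @ v \<in> elements T (B @ C)"
  by (auto simp: elements_append)

lemma elements_Nil: "b \<in> elements T [] \<longleftrightarrow> b = []"
  by (simp add: elements_def)

lemma elements_word_inj: "b \<in> elements T B \<Longrightarrow> c \<in> elements T B \<Longrightarrow> path_word b = path_word c \<Longrightarrow> b = c"
  by (rule path_word_inj) (auto simp: elements_lens)

lemma path_word_simps [simp]:
  "path_word [] = []" "path_word (t # b) = concat t @ path_word b" "path_word (b @ c) = path_word b @ path_word c"
  by (simp_all add: path_word_def)

lemma paths_iff: "b \<in> paths T B \<longleftrightarrow> b \<in> elements T B \<and> w_hw T (path_word b)"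
  by (simp add: paths_def classical_hw_word)

lemma induced_hw: "valid_type T \<Longrightarrow> w_hw T (path_word (g b)) \<Longrightarrow> induced T g b = g b"
  by (simp add: induced_def highest_self classical_hw_word)

lemma w_hw_append: "w_hw T (v @ w) \<Longrightarrow> w_hw T w"
  by (auto simp: w_hw_def tensor_eps_phi_append)

lemma w_hw_Cons: "w_hw T (x # w) \<Longrightarrow> w_hw T w"
  using w_hw_append[of T "[x]" w] by simp

lemma KR_box: "t \<in> KR T (1, 1) \<longleftrightarrow> (\<exists>x. t = [[x]] \<and> x \<in> letters T)"
proof -
  have "length t = 1 \<longleftrightarrow> (\<exists>c. t = [c])" for t :: tableau by (auto simp: length_Suc_conv)
  moreover have "length c = 1 \<longleftrightarrow> (\<exists>x. c = [x])" for c :: "int list" by (auto simp: length_Suc_conv)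
  ultimately show ?thesis by (cases T) (auto simp: KR_def)
qed

lemma KR_split_left:
  assumes "t \<in> KR T (r, s)" "1 \<le> s"
  shows "[hd t] \<in> KR T (r, 1)" "tl t \<in> KR T (r, s - 1)" "t = hd t # tl t"
proof -
  obtain c u where t: "t = c # u" using assms by (cases t) (auto simp: KR_def)
  show "[hd t] \<in> KR T (r, 1)" "tl t \<in> KR T (r, s - 1)" "t = hd t # tl t"
    using assms(1) unfolding t KR_def by (cases T; auto simp: sorted_wrt_append)+
qed

lemma KR_split_right:
  assumes "t \<in> KR T (r, s)" "1 \<le> s"
  shows "butlast t \<in> KR T (r, s - 1)" "[last t] \<in> KR T (r, 1)" "t = butlast t @ [last t]"
proof -
  obtain c u where t: "t = u @ [c]" using assms by (cases t rule: rev_cases) (auto simp: KR_def)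
  show "butlast t \<in> KR T (r, s - 1)" "[last t] \<in> KR T (r, 1)" "t = butlast t @ [last t]"
    using assms(1) unfolding t KR_def by (cases T; auto simp: sorted_wrt_append sorted_append)+
qed

lemma KR_column_A:
  "t \<in> KR (TypeA n) (r, 1) \<longleftrightarrow> (\<exists>c. t = [c] \<and> length c = r \<and> set c \<subseteq> letters (TypeA n) \<and> sorted_wrt (>) c)"
proof -
  have "length t = 1 \<longleftrightarrow> (\<exists>c. t = [c])" for t :: tableau by (auto simp: length_Suc_conv)
  then show ?thesis by (auto simp: KR_def)
qed

lemma path_ls:
  assumes "valid_type T" "b \<in> paths T ((r, s) # B)" "2 \<le> s"
  shows "ls b \<in> paths T ((r, 1) # (r, s - 1) # B)" "path_word (ls b) = path_word b" "induced T ls b = ls b"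
proof -
  obtain t b' where b: "b = t # b'" "t \<in> KR T (r, s)" "b' \<in> elements T B"
    using assms(2) by (auto simp: paths_iff elements_Cons)
  note K = KR_split_left[OF b(2)]
  have s: "1 \<le> s" using assms(3) by simp
  have "concat t = hd t @ concat (tl t)" using arg_cong[OF K(3)[OF s], of concat] by simp
  then show w: "path_word (ls b) = path_word b" by (simp add: ls_def b(1))
  have "ls b \<in> elements T ((r, 1) # (r, s - 1) # B)"
    using K(1,2)[OF s] b by (simp add: elements_Cons ls_def)
  then show "ls b \<in> paths T ((r, 1) # (r, s - 1) # B)" using w assms(2) by (simp only: paths_iff)
  show "induced T ls b = ls b" by (rule induced_hw[OF assms(1)]) (use w assms(2) in \<open>simp add: paths_iff\<close>)
qed

lemma path_rs:
  assumes "valid_type T" "b \<in> paths T (B @ [(r, s)])" "2 \<le> s"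
  shows "rs b \<in> paths T (B @ [(r, s - 1), (r, 1)])" "path_word (rs b) = path_word b" "induced T rs b = rs b"
proof -
  obtain t b' where b: "b = b' @ [t]" "t \<in> KR T (r, s)" "b' \<in> elements T B"
    using assms(2) by (auto simp: paths_iff elements_append elements_Cons elements_Nil)
  note K = KR_split_right[OF b(2)]
  have s: "1 \<le> s" using assms(3) by simp
  have "concat t = concat (butlast t) @ last t" using arg_cong[OF K(3)[OF s], of concat] by simp
  then show w: "path_word (rs b) = path_word b" by (simp add: rs_def b(1))
  have "[butlast t, [last t]] \<in> elements T [(r, s - 1), (r, 1)]"
    using K(1,2)[OF s] by (simp add: elements_Cons elements_Nil)
  from elements_appendI[OF b(3) this] have "rs b \<in> elements T (B @ [(r, s - 1), (r, 1)])"
    by (simp add: rs_def b(1))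
  then show "rs b \<in> paths T (B @ [(r, s - 1), (r, 1)])" using w assms(2) by (simp only: paths_iff)
  show "induced T rs b = rs b" by (rule induced_hw[OF assms(1)]) (use w assms(2) in \<open>simp add: paths_iff\<close>)
qed

lemma path_lb:
  assumes "valid_type (TypeA n)" "b \<in> paths (TypeA n) ((r, 1) # B)" "2 \<le> r"
  shows "lb b \<in> paths (TypeA n) ((1, 1) # (r - 1, 1) # B)" "path_word (lb b) = path_word b" "induced (TypeA n) lb b = lb b"
proof -
  let ?T = "TypeA n"
  obtain t b' where b: "b = t # b'" "t \<in> KR ?T (r, 1)" "b' \<in> elements ?T B"
    using assms(2) by (auto simp: paths_iff elements_Cons)
  obtain c where c: "t = [c]" "length c = r" "set c \<subseteq> letters ?T" "sorted_wrt (>) c"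
    using b(2) unfolding KR_column_A by blast
  obtain x c' where x: "c = x # c'" using c(2) assms(3) by (cases c) auto
  show w: "path_word (lb b) = path_word b" by (simp add: lb_def b(1) c(1) x Let_def)
  have "[[x]] \<in> KR ?T (1, 1)" "[c'] \<in> KR ?T (r - 1, 1)" unfolding KR_column_A using c x by auto
  then show "lb b \<in> paths ?T ((1, 1) # (r - 1, 1) # B)"
    using assms(2) w b by (auto simp: paths_iff elements_Cons lb_def c(1) x Let_def)
  show "induced ?T lb b = lb b" by (rule induced_hw[OF assms(1)]) (use w assms(2) in \<open>simp add: paths_iff\<close>)
qed

lemma path_rb:
  assumes "valid_type (TypeA n)" "b \<in> paths (TypeA n) (B @ [(r, 1)])" "2 \<le> r"
  shows "rb b \<in> paths (TypeA n) (B @ [(r - 1, 1), (1, 1)])" "path_word (rb b) = path_word b" "induced (TypeA n) rb b = rb b"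
proof -
  let ?T = "TypeA n"
  obtain t b' where b: "b = b' @ [t]" "t \<in> KR ?T (r, 1)" "b' \<in> elements ?T B"
    using assms(2) by (auto simp: paths_iff elements_append elements_Cons elements_Nil)
  obtain c where c: "t = [c]" "length c = r" "set c \<subseteq> letters ?T" "sorted_wrt (>) c"
    using b(2) unfolding KR_column_A by blast
  obtain x c' where x: "c = c' @ [x]" using c(2) assms(3) by (cases c rule: rev_cases) auto
  show w: "path_word (rb b) = path_word b" by (simp add: rb_def b(1) c(1) x Let_def)
  have "[[x]] \<in> KR ?T (1, 1)" "[c'] \<in> KR ?T (r - 1, 1)" unfolding KR_column_A using c x by (auto simp: sorted_wrt_append)
  then have "[[c'], [[x]]] \<in> elements ?T [(r - 1, 1), (1, 1)]" by (simp add: elements_Cons elements_Nil)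
  from elements_appendI[OF b(3) this] have "rb b \<in> elements ?T (B @ [(r - 1, 1), (1, 1)])"
    by (simp add: rb_def b(1) c(1) x Let_def)
  then show "rb b \<in> paths ?T (B @ [(r - 1, 1), (1, 1)])" using w assms(2) by (simp only: paths_iff)
  show "induced ?T rb b = rb b" by (rule induced_hw[OF assms(1)]) (use w assms(2) in \<open>simp add: paths_iff\<close>)
qed

lemma path_lh:
  assumes "valid_type T" "b \<in> paths T ((1, 1) # B)"
  obtains x where "x \<in> letters T" "b = [[x]] # lh b" "lh b \<in> paths T B" "path_word b = x # path_word (lh b)" "induced T lh b = lh b"
proof -
  obtain x b' where b: "b = [[x]] # b'" "x \<in> letters T" "b' \<in> elements T B" "w_hw T (x # path_word b')"
    using assms(2) unfolding paths_iff elements_Cons KR_box by auto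
  have hw: "w_hw T (path_word b')" using w_hw_Cons b(4) by blast
  show ?thesis
  proof (rule that[of x])
    show "induced T lh b = lh b" by (rule induced_hw[OF assms(1)]) (simp add: lh_def b(1) hw)
  qed (use b hw in \<open>auto simp: lh_def paths_iff\<close>)
qed

section \<open>Rigged configurations of highest weight vectors\<close>

lemma rc_wt_eq:
  "rc_wt T L nu b = (\<Sum>p \<in># filter_mset (\<lambda>p. fst p = b) L. int (snd p)) -
     (\<Sum>a\<in>classical_nodes T. int (\<Sum>\<^sub># (nu a)) * cartan T a b)"
  unfolding rc_wt_def row_lengths_def
  by (simp add: cartan_sym[of T b] mult.commute image_mset.compositionality comp_def del: of_nat_sum_mset)
    (simp add: of_nat_sum_mset image_mset.compositionality comp_def)

text \<open>Nonnegative riggings mean \<open>rc_eps\<close> 0, that is, a highest weight vector.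
  Nonnegativity of all vacancy numbers, also at lengths that do not occur, then follows by
  concavity.\<close>

lemma RC_iff:
  "rc \<in> RC T L lam \<longleftrightarrow> rc_valid T L rc \<and> (\<forall>a\<in>classical_nodes T. rc_eps rc a = 0 \<and> rc_wt T L (shape rc) a = int (lam a))"
proof
  assume R: "rc \<in> RC T L lam"
  have ok: "rc_ok T rc" using R by (fastforce simp: RC_def rc_ok_def intro: shape_memI)
  have nv: "node_valid T L rc a" for a
    using R ok by (cases "a \<in> classical_nodes T") (fastforce simp: RC_def node_valid_def rc_ok_def)+
  have "rc_eps rc a = 0" if "a \<in> classical_nodes T" for a
    by (rule rc_eps_eqI) (use R that in \<open>fastforce simp: RC_def\<close>)+
  moreover have "rc_wt T L (shape rc) a = int (lam a)" if "a \<in> classical_nodes T" for a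
    using R that unfolding rc_wt_eq RC_def by simp
  ultimately show "rc_valid T L rc \<and> (\<forall>a\<in>classical_nodes T. rc_eps rc a = 0 \<and> rc_wt T L (shape rc) a = int (lam a))"
    using ok nv by (simp add: rc_valid_def)
next
  assume R: "rc_valid T L rc \<and> (\<forall>a\<in>classical_nodes T. rc_eps rc a = 0 \<and> rc_wt T L (shape rc) a = int (lam a))"
  then have V: "rc_valid T L rc" by blast
  have ok: "rc_ok T rc" using R by (simp add: rc_valid_def)
  have "1 \<le> i" if "i \<in># shape rc a" for i a
    using that ok by (auto elim!: shape_memE simp: rc_ok_def Suc_le_eq)
  moreover have "0 \<le> vacancy T L (shape rc) a i" if "a \<in> classical_nodes T" for a i
    using vacancy_nonneg_valid[OF V that, of i] R that by simp
  moreover have "0 \<le> x \<and> x \<le> vacancy T L (shape rc) a i" if "a \<in> classical_nodes T" "(i, x) \<in># rc a" for a i x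
    using rc_eps_le[of i x rc a] R that by (simp add: rc_valid_def node_valid_def)
  ultimately show "rc \<in> RC T L lam"
    using R ok unfolding RC_def rc_wt_eq by (auto simp: rc_ok_def)
qed

section \<open>Highest weight vectors in small tensor products\<close>

lemma w_eps_suffix: "w_eps T i (v @ w) = 0 \<Longrightarrow> w_eps T i w = 0"
  by (simp add: tensor_eps_phi_append)

lemma w_eps_head:
  assumes "w_eps T i (x # w) = 0" "letter_e T i x \<noteq> None"
  shows "1 \<le> w_phi T i w"
  using assms by (auto split: if_splits)

text \<open>The columns of a tableau, read from top to bottom, are \<open>1, \<dots>, m, k + 1, \<dots>, k + r - m\<close>.\<close>

definition two_runs :: "int \<Rightarrow> int list \<Rightarrow> bool" where
  "two_runs k c \<longleftrightarrow> (\<forall>j<length c. rev c ! j = 1 \<or> rev c ! j = k + 1 \<or> 0 < j \<and> rev c ! j = rev c ! (j - 1) + 1)"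

section \<open>Type A: rectangular tableaux, and tensor products of two of them\<close>

text \<open>In a strict column an entry \<open>i\<close> stands directly after \<open>i + 1\<close>
  in the reading order, and the two cancel.\<close>

lemma strict_column_phi:
  assumes "sorted_wrt (>) c" "int i \<in> set c \<Longrightarrow> int i + 1 \<in> set c"
  shows "w_phi (TypeA n) i c = 0"
proof (cases "int i \<in> set c")
  case False
  have *: "int i \<notin> set v \<Longrightarrow> w_phi (TypeA n) i v = 0" for v
    by (induction v) auto
  from *[OF False] show ?thesis .
next
  case True
  then have "int i + 1 \<in> set c" by (rule assms(2))
  then obtain u v where c: "c = u @ (int i + 1) # v" by (auto simp: in_set_conv_decomp)
  have "\<forall>x\<in>set u. int i + 1 < x" "\<forall>x\<in>set v. x < int i + 1" "int i \<in> set v"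
    using assms(1) True unfolding c by (auto simp: sorted_wrt_append)
  then obtain v1 v2 where v: "v = v1 @ int i # v2" by (auto simp: in_set_conv_decomp)
  have "\<forall>x\<in>set v1. int i < x" "\<forall>x\<in>set v2. x < int i" using assms(1) unfolding c v by (auto simp: sorted_wrt_append)
  then have "v1 = []" using \<open>\<forall>x\<in>set v. x < int i + 1\<close> unfolding v by (cases v1) auto
  have triv: "w_eps (TypeA n) i z = 0 \<and> w_phi (TypeA n) i z = 0" if "int i \<notin> set z" "int i + 1 \<notin> set z" for z
    using that by (induction z) auto
  have "w_eps (TypeA n) i u = 0 \<and> w_phi (TypeA n) i u = 0"
    by (rule triv) (use \<open>\<forall>x\<in>set u. int i + 1 < x\<close> in force)+
  moreover have "w_eps (TypeA n) i v2 = 0 \<and> w_phi (TypeA n) i v2 = 0"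
    by (rule triv) (use \<open>\<forall>x\<in>set v2. x < int i\<close> in force)+
  ultimately show ?thesis unfolding c v \<open>v1 = []\<close> by (simp add: tensor_eps_phi_append)
qed

lemma w_phi_concat_zero:
  "(\<And>c. c \<in> set cs \<Longrightarrow> w_phi T i c = 0) \<Longrightarrow> w_phi T i (concat cs) = 0"
  by (induction cs) (simp_all add: tensor_eps_phi_append)

lemma KR_word_length: "t \<in> KR T (r, s) \<Longrightarrow> length (concat t) = r * s"
  using KR_lens[of t T "(r, s)"] by (simp add: length_concat sum_list_replicate)

lemma KR_A_iff:
  "b \<in> KR (TypeA n) (r, s) \<longleftrightarrow> length b = s \<and>
     (\<forall>c\<in>set b. length c = r \<and> set c \<subseteq> {1..int n + 1} \<and> sorted_wrt (>) c) \<and> (\<forall>k<r. sorted (map (\<lambda>c. c ! k) b))"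
  by (auto simp: KR_def letters_def)

lemma column_lower_bound:
  assumes "sorted_wrt (>) c" "set c \<subseteq> {1..}" "j < length c"
  shows "int j + 1 \<le> rev c ! j"
  using assms(3)
proof (induction j)
  case 0
  then have "rev c ! 0 \<in> set c" by (metis nth_mem length_rev set_rev)
  then show ?case using assms(2) by auto
next
  case (Suc j)
  have "sorted_wrt (<) (rev c)" using assms(1) by (simp add: sorted_wrt_rev)
  then have "rev c ! j < rev c ! Suc j" using Suc.prems by (intro sorted_wrt_nth_less) auto
  with Suc show ?case by simp
qed

lemma sorted_less_nth_le:
  fixes xs :: "int list"
  assumes "sorted_wrt (<) xs" "i \<le> j" "j < length xs"
  shows "xs ! i \<le> xs ! j"
  using sorted_wrt_nth_less[OF assms(1), of i j] assms(2,3) by (cases "i = j") auto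

text \<open>Columns are treated from right to left. An entry \<open>i + 1\<close> with
  \<open>i \<noteq> k\<close> that does not continue the run above it must be cancelled by an
  unmatched \<open>i\<close> in a column further right; weakly increasing rows then force
  \<open>i\<close> into the present column as well.\<close>

lemma KR_A_two_runs:
  assumes "b \<in> KR (TypeA n) (r, s)" "\<And>i. 1 \<le> i \<Longrightarrow> i \<le> n \<Longrightarrow> i \<noteq> k \<Longrightarrow> w_eps (TypeA n) i (concat b) = 0"
  shows "\<forall>c\<in>set b. two_runs (int k) c"
  using assms
proof (induction b arbitrary: s)
  case (Cons C b)
  let ?T = "TypeA n"
  have b: "b \<in> KR ?T (r, s - 1)" using KR_split_left(2)[OF Cons.prems(1)] Cons.prems(1) by (force simp: KR_A_iff)
  have runs: "\<forall>c\<in>set b. two_runs (int k) c"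
    by (rule Cons.IH[OF b]) (use Cons.prems(2) w_eps_suffix in force)
  have C: "length C = r" "set C \<subseteq> {1..int n + 1}" "sorted_wrt (>) C"
    and cols: "\<And>D. D \<in> set b \<Longrightarrow> length D = r \<and> set D \<subseteq> {1..int n + 1} \<and> sorted_wrt (>) D"
    using Cons.prems(1) by (auto simp: KR_A_iff)
  have le: "rev C ! j \<le> rev D ! j" if "D \<in> set b" "j < r" for D j
  proof -
    have "sorted (map (\<lambda>c. c ! (r - 1 - j)) (C # b))" using Cons.prems(1) that(2) unfolding KR_A_iff by auto
    then show ?thesis using that cols[OF that(1)] C(1) by (auto simp: rev_nth)
  qed
  have "two_runs (int k) C"
    unfolding two_runs_def
  proof (intro allI impI)
    fix j assume j: "j < length C"
    define z where "z = rev C ! j"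
    have "z = 1 \<or> z = int k + 1 \<or> 0 < j \<and> z = rev C ! (j - 1) + 1"
    proof (rule ccontr)
      assume H: "\<not> (z = 1 \<or> z = int k + 1 \<or> 0 < j \<and> z = rev C ! (j - 1) + 1)"
      define i where "i = nat (z - 1)"
      have zin: "z \<in> set C" using j unfolding z_def by (metis nth_mem length_rev set_rev)
      then have z: "1 \<le> z" "z \<le> int n + 1" using C(2) by auto
      have i: "z = int i + 1" "1 \<le> i" "i \<le> n" "i \<noteq> k" using z H by (auto simp: i_def)
      obtain u v where uv: "C = u @ z # v" "length v = j"
      proof
        have "length C - 1 - j < length C" using j by simp
        from id_take_nth_drop[OF this] show "C = take (length C - 1 - j) C @ z # drop (Suc (length C - 1 - j)) C"
          using j by (simp add: rev_nth z_def)
        show "length (drop (Suc (length C - 1 - j)) C) = j" using j by simp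
      qed
      have low: "p < j \<Longrightarrow> rev C ! p = rev v ! p" for p
        using uv(2) unfolding uv(1) by (simp add: nth_append)
      have sv: "\<forall>x\<in>set v. x < z" using C(3) uv(1) by (metis sorted_wrt_append sorted_wrt.simps(2))
      have iv: "int i \<notin> set v"
      proof
        assume iv: "int i \<in> set v"
        then have j0: "0 < j" using uv(2) by auto
        have last: "rev C ! (j - 1) = rev v ! (j - 1)" by (rule low) (use j0 in simp)
        obtain q where q: "q < j" "rev v ! q = int i" using iv uv(2) by (metis in_set_conv_nth length_rev set_rev)
        have sr: "sorted_wrt (<) (rev v)" using C(3) unfolding uv(1) by (simp add: sorted_wrt_append sorted_wrt_rev)
        have "rev v ! q \<le> rev v ! (j - 1)"
          by (rule sorted_less_nth_le[OF sr]) (use q uv(2) in auto)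
        moreover have "rev v ! (j - 1) \<in> set v" using uv(2) j0 by (metis diff_less length_rev less_numeral_extra(1) nth_mem set_rev)
        ultimately have "rev v ! (j - 1) = int i" using sv q(2) i(1) by fastforce
        then show False using H last i(1) j0 by simp
      qed
      have "w_eps ?T i (z # v @ concat b) = 0"
        using w_eps_suffix[of ?T i u "z # v @ concat b"] Cons.prems(2)[OF i(2-4)] uv(1) by simp
      then have "1 \<le> w_phi ?T i (v @ concat b)" using i(1) by (intro w_eps_head) auto
      moreover have "w_phi ?T i v = 0" using iv by (induction v) auto
      ultimately have "w_phi ?T i (concat b) \<noteq> 0" by (simp add: tensor_eps_phi_append)
      then obtain D where D: "D \<in> set b" "w_phi ?T i D \<noteq> 0" using w_phi_concat_zero[of b ?T i] by metis
      \<comment> \<open>By induction \<open>D\<close> consists of two runs, and since it has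
        \<open>i\<close> but not \<open>i + 1\<close>, its first run ends with
        \<open>i\<close>.\<close>
      have iD: "int i \<in> set D" "int i + 1 \<notin> set D"
        by (rule ccontr, use D strict_column_phi[of D i n] cols[OF D(1)] in simp)+
      obtain q where q: "q < r" "rev D ! q = int i" using iD(1) cols[OF D(1)] by (metis in_set_conv_nth length_rev set_rev)
      have sD: "sorted_wrt (<) (rev D)" using cols[OF D(1)] by (simp add: sorted_wrt_rev)
      have jr: "j < r" using j C(1) by simp
      have "z \<le> rev D ! j" unfolding z_def by (rule le[OF D(1) jr])
      then have qj: "q < j"
        using sorted_less_nth_le[OF sD, of j q] q i(1) cols[OF D(1)] by (cases "q < j") auto
      have "rev D ! Suc q \<in> set D" using qj jr cols[OF D(1)] by (metis nth_mem length_rev set_rev less_trans_Suc)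
      moreover have "rev D ! q < rev D ! Suc q" using sorted_wrt_nth_less[OF sD, of q "Suc q"] qj jr cols[OF D(1)] by simp
      moreover have "two_runs (int k) D" using runs D(1) by blast
      then have "rev D ! Suc q = 1 \<or> rev D ! Suc q = int k + 1 \<or> rev D ! Suc q = rev D ! q + 1"
        unfolding two_runs_def using qj jr cols[OF D(1)] by (metis diff_Suc_1 less_trans_Suc)
      ultimately have ik: "rev D ! Suc q = int k + 1" "i < k" using iD(2) q(2) i(2,4) by (cases "i = k"; auto)+
      have initial: "p \<le> q \<Longrightarrow> rev D ! p = int p + 1" for p
      proof (induction p)
        case 0
        have "rev D ! 0 \<le> rev D ! q" by (rule sorted_less_nth_le[OF sD]) (use q cols[OF D(1)] in auto)
        then have "rev D ! 0 \<noteq> int k + 1" using q(2) ik(2) by simp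
        moreover have "rev D ! 0 = 1 \<or> rev D ! 0 = int k + 1"
          using \<open>two_runs (int k) D\<close> q(1) cols[OF D(1)] unfolding two_runs_def by (metis gr_implies_not0 neq0_conv)
        ultimately show ?case by simp
      next
        case (Suc p)
        have "rev D ! Suc p \<le> rev D ! q"
          by (rule sorted_less_nth_le[OF sD]) (use q Suc.prems cols[OF D(1)] in auto)
        then have "rev D ! Suc p \<noteq> int k + 1" using q(2) ik(2) by simp
        moreover have "rev D ! Suc p = 1 \<or> rev D ! Suc p = int k + 1 \<or> rev D ! Suc p = rev D ! p + 1"
          using \<open>two_runs (int k) D\<close> q(1) Suc.prems cols[OF D(1)] unfolding two_runs_def
          by (metis diff_Suc_1 le_less_trans)
        moreover have "rev D ! p < rev D ! Suc p"
          using sorted_wrt_nth_less[OF sD, of p "Suc p"] q Suc.prems cols[OF D(1)] by simp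
        ultimately show ?case using Suc by simp
      qed
      \<comment> \<open>The entry of \<open>D\<close> in row \<open>q\<close>, counted from 0, is
        \<open>q + 1\<close>, the least possible value there, so the entry of \<open>C\<close> in
        that row is the same, namely \<open>i\<close>.\<close>
      have "rev C ! q \<le> int q + 1" using le[OF D(1) q(1)] initial[of q] by simp
      moreover have "int q + 1 \<le> rev C ! q" by (rule column_lower_bound[OF C(3)]) (use C q in auto)
      ultimately have "rev C ! q = int i" using initial[of q] q(2) by simp
      moreover have "rev C ! q \<in> set v"
      proof -
        have "rev C ! q = rev v ! q" by (rule low[OF qj])
        then show ?thesis using uv(2) qj by (metis nth_mem length_rev set_rev)
      qed
      ultimately show False using iv by simp
    qed
    then show "rev C ! j = 1 \<or> rev C ! j = int k + 1 \<or> 0 < j \<and> rev C ! j = rev C ! (j - 1) + 1" unfolding z_def .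
  qed
  with runs show ?case by simp
qed simp


lemma two_runs_form:
  assumes "two_runs (int k) c" "sorted_wrt (>) c" "set c \<subseteq> {1..}"
  shows "\<exists>q m. m \<le> k \<and> c = rev [int k + 1..int (k + q)] @ rev [1..int m]"
  using assms
proof (induction c)
  case Nil
  have "[] = rev [int k + 1..int (k + 0)] @ rev [1..int 0]" by simp
  then show ?case by blast
next
  case (Cons x c)
  have "two_runs (int k) c" unfolding two_runs_def
  proof (intro allI impI)
    fix j assume j: "j < length c"
    then have "rev (x # c) ! j = 1 \<or> rev (x # c) ! j = int k + 1 \<or> 0 < j \<and> rev (x # c) ! j = rev (x # c) ! (j - 1) + 1"
      using Cons.prems(1) unfolding two_runs_def by simp
    then show "rev c ! j = 1 \<or> rev c ! j = int k + 1 \<or> 0 < j \<and> rev c ! j = rev c ! (j - 1) + 1"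
      using j by (simp add: nth_append less_imp_diff_less)
  qed
  with Cons obtain q m where c: "m \<le> k" "c = rev [int k + 1..int (k + q)] @ rev [1..int m]" by auto
  have x: "1 \<le> x" "\<forall>y\<in>set c. y < x" using Cons.prems by auto
  have "rev (x # c) ! length c = 1 \<or> rev (x # c) ! length c = int k + 1 \<or>
      0 < length c \<and> rev (x # c) ! length c = rev (x # c) ! (length c - 1) + 1"
    using Cons.prems(1) by (auto simp: two_runs_def dest!: spec[of _ "length c"])
  then have alt: "x = 1 \<or> x = int k + 1 \<or> c \<noteq> [] \<and> x = hd c + 1"
    by (cases c) (auto simp: nth_append)
  have up: "rev [a..b + 1] = (b + 1) # rev [a..b]" if "a \<le> b + 1" for a b :: int
    using that by (simp add: upto_rec2)
  consider "x = int k + 1" | "x \<noteq> int k + 1" "x = 1" | "x \<noteq> int k + 1" "c \<noteq> []" "x = hd c + 1" using alt by blast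
  then show ?case
  proof cases
    case 1
    have "q = 0"
    proof (rule ccontr)
      assume "q \<noteq> 0"
      then have "int k + 1 \<in> set c" unfolding c(2) by simp
      with x(2) 1 show False by blast
    qed
    then have "x # c = rev [int k + 1..int (k + 1)] @ rev [1..int m]" using 1 c(2) by (simp add: add.commute)
    then show ?thesis using c(1) by blast
  next
    case 2
    have "c = []" using 2 x Cons.prems(3) by (cases c) auto
    then have "x # c = rev [int k + 1..int (k + 0)] @ rev [1..int 1]" using 2 by simp
    moreover have "1 \<le> k" using 2 by simp
    ultimately show ?thesis by blast
  next
    case 3
    show ?thesis
    proof (cases q)
      case 0
      with 3 c(2) have "0 < m" by (cases m) auto
      then have "x = int m + 1" using 3 c(2) 0 up[of 1 "int m - 1"] by simp
      then have "x # c = rev [int k + 1..int (k + 0)] @ rev [1..int (Suc m)]" "Suc m \<le> k"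
        using c 0 up[of 1 "int m"] 3(1) by (auto simp: add.commute)
      then show ?thesis by blast
    next
      case (Suc p)
      then have "x = int (k + q) + 1" using 3 c(2) up[of "int k + 1" "int (k + p)"] by (simp add: add.commute add.left_commute)
      then have "x # c = rev [int k + 1..int (k + Suc q)] @ rev [1..int m]"
        using c up[of "int k + 1" "int (k + q)"] by (simp add: add.commute add.left_commute)
      then show ?thesis using c(1) by blast
    qed
  qed
qed

text \<open>The first run of the leftmost column ends with the largest letter at most
  \<open>k\<close> of the whole tableau, so the content determines it; the height of the column
  determines the second run. Then this column is removed.\<close>

lemma KR_A_content:
  assumes "x \<in> KR (TypeA n) (r, s)" "y \<in> KR (TypeA n) (r, s)" "\<forall>c\<in>set x. two_runs (int k) c" "\<forall>c\<in>set y. two_runs (int k) c"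
    and "mset (concat x) = mset (concat y)"
  shows "x = y"
  using assms
proof (induction x arbitrary: y s)
  case Nil
  then show ?case by (auto simp: KR_A_iff)
next
  case (Cons C x)
  then obtain D y' where y: "y = D # y'" by (cases y) (auto simp: KR_A_iff)
  let ?T = "TypeA n"
  have form: "\<exists>q m. m \<le> k \<and> c = rev [int k + 1..int (k + q)] @ rev [1..int m]" if "c \<in> set (C # x) \<union> set y" for c
  proof (rule two_runs_form)
    show "two_runs (int k) c" using that Cons.prems(3,4) by auto
    have "sorted_wrt (>) c \<and> set c \<subseteq> {1..int n + 1}" using that Cons.prems(1,2) unfolding KR_A_iff by blast
    then show "sorted_wrt (>) c" "set c \<subseteq> {1..}" by auto
  qed
  obtain q m where C: "m \<le> k" "C = rev [int k + 1..int (k + q)] @ rev [1..int m]" using form[of C] by auto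
  obtain q' m' where D: "m' \<le> k" "D = rev [int k + 1..int (k + q')] @ rev [1..int m']" using form[of D] y by auto
  \<comment> \<open>A column further right with a longer first run would have the entry
    \<open>m2\<close> in a row where the leftmost column already has an entry above
    \<open>k\<close>, against the order in rows.\<close>
  have *: "m2 \<le> m1" if A: "A # u \<in> KR ?T (r, s)" "m1 \<le> k" "A = rev [int k + 1..int (k + q1)] @ rev [1..int m1]"
      and E: "\<And>c. c \<in> set u \<Longrightarrow> \<exists>q m. m \<le> k \<and> c = rev [int k + 1..int (k + q)] @ rev [1..int m]"
      and m2: "int m2 \<in> set (concat (A # u))" "m2 \<le> k" for A u m1 m2 q1
  proof (rule ccontr)
    assume H: "\<not> m2 \<le> m1"
    have "int m2 \<notin> set A" using H m2(2) unfolding A(3) by auto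
    then obtain c where c: "c \<in> set u" "int m2 \<in> set c" using m2(1) by auto
    obtain q3 m3 where c3: "m3 \<le> k" "c = rev [int k + 1..int (k + q3)] @ rev [1..int m3]" using E[OF c(1)] by blast
    have m3: "m2 \<le> m3" using c(2) m2(2) unfolding c3(2) by auto
    have len: "length c = r" "length A = r" using A(1) c(1) by (auto simp: KR_A_iff)
    have "m2 \<le> r" using m3 len(1) unfolding c3(2) by simp
    then have "sorted (map (\<lambda>c. c ! (r - m2)) (A # u))" using A(1) H unfolding KR_A_iff by auto
    then have le: "rev A ! (m2 - 1) \<le> rev c ! (m2 - 1)" using c(1) len H \<open>m2 \<le> r\<close> by (auto simp: rev_nth)
    have "rev c = [1..int m3] @ [int k + 1..int (k + q3)]" unfolding c3(2) by simp
    then have c4: "rev c ! (m2 - 1) = int m2" using m3 H by (auto simp: nth_append)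
    have "rev A = [1..int m1] @ [int k + 1..int (k + q1)]" unfolding A(3) by simp
    moreover have "m2 - 1 - m1 < q1" using len(2) \<open>m2 \<le> r\<close> H unfolding A(3) by simp
    ultimately have "int k + 1 \<le> rev A ! (m2 - 1)" using H by (auto simp: nth_append)
    then show False using le c4 m2(2) by simp
  qed
  have sets: "set (concat (C # x)) = set (concat y)" using Cons.prems(5) by (metis set_mset_mset)
  have "m' \<le> m"
  proof (cases "m' = 0")
    case False
    then have "int m' \<in> set (concat (C # x))" unfolding sets y D(2) by simp
    then show ?thesis by (rule *[OF Cons.prems(1) C _ _ D(1), rotated]) (rule form, simp)
  qed simp
  moreover have "m \<le> m'"
  proof (cases "m = 0")
    case False
    then have "int m \<in> set (concat (D # y'))" unfolding y[symmetric] sets[symmetric] C(2) by simp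
    then show ?thesis by (rule *[OF Cons.prems(2)[unfolded y] D _ _ C(1), rotated]) (rule form, simp add: y)
  qed simp
  ultimately have "m = m'" by simp
  moreover have "length C = length D" using Cons.prems(1,2) unfolding y KR_A_iff by auto
  ultimately have CD: "C = D" unfolding C(2) D(2) by simp
  have s: "1 \<le> s" using Cons.prems(1) by (auto simp: KR_A_iff)
  have "x = y'"
    by (rule Cons.IH[of "s - 1"])
      (use Cons.prems KR_split_left(2)[OF Cons.prems(1) s] KR_split_left(2)[OF Cons.prems(2) s] y CD in auto)
  with CD y show ?case by simp
qed

text \<open>The weights at the nodes fix the differences of consecutive multiplicities, and the
  length fixes their sum.\<close>

lemma content_A:
  assumes "set v \<subseteq> {1..int n + 1}" "set w \<subseteq> {1..int n + 1}" "length v = length w"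
    and "\<And>i. 1 \<le> i \<Longrightarrow> i \<le> n \<Longrightarrow> int (w_phi (TypeA n) i v) - int (w_eps (TypeA n) i v) =
      int (w_phi (TypeA n) i w) - int (w_eps (TypeA n) i w)"
  shows "mset v = mset w"
proof -
  have wt: "int (w_phi (TypeA n) i u) - int (w_eps (TypeA n) i u) = int (count (mset u) (int i)) - int (count (mset u) (int i + 1))"
    if "1 \<le> i" "i \<le> n" for i u
  proof (induction u)
    case (Cons x u)
    have "letter_wt (TypeA n) i x = (if x = int i then 1 else 0) - (if x = int i + 1 then 1 else 0)"
      by (simp add: letter_wt_def)
    with Cons show ?case unfolding w_wt_Cons by simp
  qed simp
  define d where "d j = int (count (mset v) (int j)) - int (count (mset w) (int j))" for j :: nat
  have step: "i \<le> n \<Longrightarrow> d (Suc i) = d 1" for i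
  proof (induction i)
    case (Suc i)
    have "d (Suc (Suc i)) = d (Suc i)" using assms(4)[of "Suc i"] Suc.prems wt[of "Suc i"] by (simp add: d_def add.commute)
    then show ?case using Suc by simp
  qed simp
  have d: "d j = d 1" if j: "1 \<le> j" "j \<le> n + 1" for j
  proof -
    obtain i where "j = Suc i" "i \<le> n" using j by (cases j) auto
    then show ?thesis using step by metis
  qed
  have len: "length u = (\<Sum>j\<in>{1..n + 1}. count (mset u) (int j))" if "set u \<subseteq> {1..int n + 1}" for u
    using that
  proof (induction u)
    case (Cons x u)
    obtain k where k: "x = int k" "k \<in> {1..n + 1}" using Cons.prems that[of "nat x"] by (auto simp: nat_le_iff)
    have "(\<Sum>j\<in>{1..n + 1}. count (mset (x # u)) (int j)) =
        (\<Sum>j\<in>{1..n + 1}. count (mset u) (int j) + (if j = k then 1 else 0))"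
      by (rule sum.cong) (auto simp: k(1))
    also have "\<dots> = (\<Sum>j\<in>{1..n + 1}. count (mset u) (int j)) + 1"
      unfolding sum.distrib by (subst sum.delta) (use k(2) in auto)
    also have "(\<Sum>j\<in>{1..n + 1}. count (mset u) (int j)) = length u" using Cons.prems by (intro Cons.IH[symmetric]) auto
    finally show ?case by simp
  qed simp
  have "(\<Sum>j\<in>{1..n + 1}. d j) = int (length v) - int (length w)"
    unfolding len[OF assms(1)] len[OF assms(2)] d_def sum_subtractf of_nat_sum ..
  then have "0 = (\<Sum>j\<in>{1..n + 1}. d j)" using assms(3) by simp
  also have "\<dots> = (\<Sum>j\<in>{1..n + 1}. d 1)" by (rule sum.cong[OF refl], rule d) auto
  also have "\<dots> = int (n + 1) * d 1" by simp
  finally have d0: "d 1 = 0" by simp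
  show ?thesis
  proof (rule multiset_eqI)
    fix x
    show "count (mset v) x = count (mset w) x"
    proof (cases "x \<in> {1..int n + 1}")
      case True
      then have "1 \<le> nat x" "nat x \<le> n + 1" by auto
      from d[OF this] have "d (nat x) = 0" using d0 by simp
      then show ?thesis using True by (simp add: d_def)
    next
      case False
      then show ?thesis using assms(1,2) by (metis count_inI set_mset_mset subsetD)
    qed
  qed
qed

lemma paths_single_A:
  assumes "b \<in> paths (TypeA n) [(r, s)]"
  shows "b = [replicate s (rev [1..int r])]"
proof -
  obtain x where b: "b = [x]" "x \<in> KR (TypeA n) (r, s)" "w_hw (TypeA n) (concat x)"
    using assms by (auto simp: paths_iff elements_Cons elements_Nil)
  \<comment> \<open>The value \<open>n + 1\<close> is not a node, so no condition is exempted; a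
    second run would begin with \<open>n + 2\<close>, which is not a letter.\<close>
  have runs: "\<forall>c\<in>set x. two_runs (int (n + 1)) c"
    by (rule KR_A_two_runs[OF b(2)]) (use b(3) in \<open>auto simp: w_hw_def classical_nodes_def\<close>)
  have "c = rev [1..int r]" if c: "c \<in> set x" for c
  proof -
    have K: "length c = r" "set c \<subseteq> {1..int n + 1}" "sorted_wrt (>) c" using b(2) c by (auto simp: KR_A_iff)
    obtain q m where f: "c = rev [int (n + 1) + 1..int (n + 1 + q)] @ rev [1..int m]"
      using two_runs_form[of "n + 1" c] runs c K by fastforce
    have "q = 0" using K(2) unfolding f by (cases q) auto
    with f K(1) show ?thesis by simp
  qed
  then have "x = replicate s (rev [1..int r])" using b(2) by (auto simp: KR_A_iff intro!: replicate_eqI)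
  then show ?thesis by (simp add: b(1))
qed

text \<open>The right factor is itself of highest weight and so has only one form; its
  \<open>phi\<close> vanishes except at its height \<open>r\<close>. Hence the left factor is of
  highest weight except at \<open>r\<close>, and its content determines it.\<close>

lemma paths_pair_A:
  assumes "b \<in> paths (TypeA n) [p, q]" "c \<in> paths (TypeA n) [p, q]"
    and "\<And>a. a \<in> classical_nodes (TypeA n) \<Longrightarrow> w_phi (TypeA n) a (path_word b) = w_phi (TypeA n) a (path_word c)"
  shows "b = c"
proof -
  let ?T = "TypeA n"
  obtain r s where q: "q = (r, s)" by fastforce
  obtain r' s' where p: "p = (r', s')" by fastforce
  define z where "z = replicate s (rev [1..int r])"
  have split: "\<exists>x. b = [x, z] \<and> x \<in> KR ?T (r', s') \<and> (\<forall>c\<in>set x. two_runs (int r) c) \<and> z \<in> KR ?T (r, s) \<and>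
      w_hw ?T (concat x @ concat z)" if "b \<in> paths ?T [p, q]" for b
  proof -
    obtain x y where b: "b = [x, y]" "x \<in> KR ?T p" "y \<in> KR ?T q" "w_hw ?T (concat x @ concat y)"
      using \<open>b \<in> paths ?T [p, q]\<close> by (auto simp: paths_iff elements_Cons elements_Nil)
    have "[y] \<in> paths ?T [(r, s)]" using b w_hw_append by (auto simp: paths_iff elements_Cons elements_Nil q)
    from paths_single_A[OF this] have y: "y = z" by (simp add: z_def)
    have "\<forall>c\<in>set x. two_runs (int r) c"
    proof (rule KR_A_two_runs[OF b(2)[unfolded p]])
      fix i assume i: "1 \<le> i" "i \<le> n" "i \<noteq> r"
      have "w_phi ?T i (concat y) = 0"
      proof (rule w_phi_concat_zero)
        fix c assume c: "c \<in> set y"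
        then have "c = rev [1..int r]" unfolding y z_def by simp
        moreover have "sorted_wrt (>) c" using b(3) c by (auto simp: q KR_A_iff)
        ultimately show "w_phi ?T i c = 0" using i by (intro strict_column_phi) auto
      qed
      moreover have "w_eps ?T i (concat x @ concat y) = 0" using b(4) i by (auto simp: w_hw_def classical_nodes_def)
      ultimately show "w_eps ?T i (concat x) = 0" by (simp add: tensor_eps_phi_append)
    qed
    with b p q y show ?thesis by auto
  qed
  obtain x where x: "b = [x, z]" "x \<in> KR ?T (r', s')" "\<forall>c\<in>set x. two_runs (int r) c" "z \<in> KR ?T (r, s)"
    "w_hw ?T (concat x @ concat z)" using split[OF assms(1)] by blast
  obtain y where y: "c = [y, z]" "y \<in> KR ?T (r', s')" "\<forall>c\<in>set y. two_runs (int r) c"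
    "w_hw ?T (concat y @ concat z)" using split[OF assms(2)] by blast
  note len = KR_word_length[of _ ?T r' s']
  have "mset (concat x @ concat z) = mset (concat y @ concat z)"
  proof (rule content_A)
    show "set (concat x @ concat z) \<subseteq> {1..int n + 1}" "set (concat y @ concat z) \<subseteq> {1..int n + 1}"
      using x(2,4) y(2) by (auto simp: KR_A_iff; fastforce)+
    show "length (concat x @ concat z) = length (concat y @ concat z)" using len[OF x(2)] len[OF y(2)] by simp
    show "int (w_phi ?T i (concat x @ concat z)) - int (w_eps ?T i (concat x @ concat z)) =
        int (w_phi ?T i (concat y @ concat z)) - int (w_eps ?T i (concat y @ concat z))" if "1 \<le> i" "i \<le> n" for i
    proof -
      have i: "i \<in> classical_nodes ?T" using that by (simp add: classical_nodes_def)
      have "w_eps ?T i (concat x @ concat z) = 0" "w_eps ?T i (concat y @ concat z) = 0"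
        using x(5) y(4) i by (auto simp: w_hw_def)
      moreover have "w_phi ?T i (concat x @ concat z) = w_phi ?T i (concat y @ concat z)"
        using assms(3)[OF i] by (simp add: x(1) y(1))
      ultimately show ?thesis by simp
    qed
  qed
  then have "mset (concat x) = mset (concat y)" by simp
  from KR_A_content[OF x(2) y(2) x(3) y(3) this] show ?thesis by (simp add: x(1) y(1))
qed

lemma KR_D_iff:
  "b \<in> KR (TypeD n) (Suc 0, s) \<longleftrightarrow> length b = s \<and> (\<forall>c\<in>set b. length c = 1) \<and> set (concat b) \<subseteq> letters (TypeD n) \<and>
     sorted_wrt (letter_le (TypeD n)) (concat b)"
  by (auto simp: KR_def)

section \<open>Type D: tableaux with one row\<close>

lemma hw_word_D:
  assumes n: "4 \<le> n" and "sorted_wrt (letter_le (TypeD n)) v" "set v \<subseteq> letters (TypeD n)"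
    and "\<And>i. 2 \<le> i \<Longrightarrow> i \<le> n \<Longrightarrow> w_eps (TypeD n) i v = 0"
  shows "\<exists>a b c. v = replicate a 1 @ replicate b 2 @ replicate c (- 1)"
  using assms(2-4)
proof (induction v)
  case Nil
  have "[] = replicate 0 (1 :: int) @ replicate 0 2 @ replicate 0 (- 1)" by simp
  then show ?case by blast
next
  case (Cons x v)
  have "\<exists>a b c. v = replicate a 1 @ replicate b 2 @ replicate c (- 1)"
    by (rule Cons.IH) (use Cons.prems in \<open>auto\<close>)
  then obtain a b c where v: "v = replicate a 1 @ replicate b 2 @ replicate c (- 1)" by blast
  have x: "x \<in> letters (TypeD n)" using Cons.prems(2) by simp
  then have xr: "x \<noteq> 0" "- int n \<le> x" "x \<le> int n" by (auto simp: letters_def)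
  consider "1 \<le> a" | "a = 0" "1 \<le> b" | "a = 0" "b = 0" by linarith
  then show ?case
  proof cases
    case 1
    then have "letter_le (TypeD n) x 1" using Cons.prems(1) by (simp add: v)
    then have "x = 1" using xr n by (auto simp: letter_le_def letter_height_def split: if_splits)
    then have "x # v = replicate (Suc a) 1 @ replicate b 2 @ replicate c (- 1)" by (simp add: v)
    then show ?thesis by blast
  next
    case 2
    then have "letter_le (TypeD n) x 2" using Cons.prems(1) by (simp add: v)
    then have "x = 1 \<or> x = 2" using xr n by (auto simp: letter_le_def letter_height_def split: if_splits)
    then have "x # v = replicate 1 1 @ replicate b 2 @ replicate c (- 1) \<or>
        x # v = replicate 0 1 @ replicate (Suc b) 2 @ replicate c (- 1)" by (auto simp: v 2)
    then show ?thesis by blast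
  next
    case 3
    then have vc: "v = replicate c (- 1)" by (simp add: v)
    have phi: "w_phi (TypeD n) i (replicate c (- 1)) = 0" if "2 \<le> i" for i
      using that n by (induction c) auto
    have none: "letter_e (TypeD n) i x = None" if "2 \<le> i" "i \<le> n" for i
      using w_eps_head[of "TypeD n" i x v] Cons.prems(3)[OF that] phi[OF that(1)] vc by fastforce
    have "x \<in> {1, 2, - 1}"
    proof (rule ccontr)
      assume H: "x \<notin> {1, 2, - 1}"
      show False
      proof (cases "0 < x")
        case True
        then obtain j where "x = int j + 1" using that[of "nat (x - 1)"] by simp
        then show False using none[of j] H xr n by (auto split: if_splits)
      next
        case False
        then obtain j where "x = - int j" using that[of "nat (- x)"] by simp
        then show False using none[of j] H xr n by (auto split: if_splits)
      qed
    qed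
    then consider "x = 1" | "x = 2" | "x = - 1" by blast
    then have "x # v = replicate 1 1 @ replicate 0 2 @ replicate c (- 1) \<or>
        x # v = replicate 0 1 @ replicate 1 2 @ replicate c (- 1) \<or>
        x # v = replicate 0 1 @ replicate 0 2 @ replicate (Suc c) (- 1)" by (cases) (auto simp: vc)
    then show ?thesis by blast
  qed
qed

lemma wt_replicate:
  "int (w_phi T i (replicate m x)) - int (w_eps T i (replicate m x)) = int m * letter_wt T i x"
proof (induction m)
  case (Suc m)
  show ?case unfolding replicate_Suc w_wt_Cons Suc.IH by (simp add: algebra_simps)
qed simp

lemma hw_word_wt_D:
  assumes "4 \<le> n"
  shows "int (w_phi (TypeD n) 1 (replicate a 1 @ replicate b 2 @ replicate c (- 1))) -
      int (w_eps (TypeD n) 1 (replicate a 1 @ replicate b 2 @ replicate c (- 1))) = int a - int b - int c"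
    "int (w_phi (TypeD n) 2 (replicate a 1 @ replicate b 2 @ replicate c (- 1))) -
      int (w_eps (TypeD n) 2 (replicate a 1 @ replicate b 2 @ replicate c (- 1))) = int b"
  unfolding w_wt_append wt_replicate letter_wt_def using assms by auto

lemma paths_single_D:
  assumes "4 \<le> n" "b \<in> paths (TypeD n) [(1, s)]"
  shows "path_word b = replicate s 1"
proof -
  let ?T = "TypeD n"
  obtain x where b: "b = [x]" "x \<in> KR ?T (1, s)" "w_hw ?T (concat x)"
    using assms(2) by (auto simp: paths_iff elements_Cons elements_Nil)
  have len: "length (concat x) = s" using KR_word_length[OF b(2)] by simp
  have eps: "w_eps ?T i (concat x) = 0" if "1 \<le> i" "i \<le> n" for i
    using b(3) that by (auto simp: w_hw_def classical_nodes_def)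
  obtain i j k where w: "concat x = replicate i 1 @ replicate j 2 @ replicate k (- 1)"
    using hw_word_D[OF assms(1), of "concat x"] b(2) eps by (auto simp: KR_D_iff)
  have "k = 0"
  proof (rule ccontr)
    assume "k \<noteq> 0"
    then have "replicate k (- 1 :: int) = replicate (k - 1) (- 1) @ [- 1]" by (cases k) (simp_all add: replicate_append_same)
    then have "w_eps ?T 1 [- 1] = 0"
      using eps[of 1] w_eps_suffix[of ?T 1 "replicate i 1 @ replicate j 2 @ replicate (k - 1) (- 1)" "[- 1]"] assms(1)
      unfolding w by simp
    then show False using assms(1) by simp
  qed
  moreover have "j = 0"
  proof (rule ccontr)
    assume "j \<noteq> 0"
    then have "replicate j (2 :: int) = replicate (j - 1) 2 @ [2]" by (cases j) (simp_all add: replicate_append_same)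
    then have "w_eps ?T 1 [2] = 0"
      using eps[of 1] w_eps_suffix[of ?T 1 "replicate i 1 @ replicate (j - 1) 2" "[2]"] assms(1) \<open>k = 0\<close>
      unfolding w by simp
    then show False using assms(1) by simp
  qed
  ultimately have "concat x = replicate s 1" using w len by simp
  then show ?thesis by (simp add: b(1))
qed

text \<open>The right factor is a power of 1, with \<open>phi\<close> only at node 1. The three
  exponents of the left factor are determined by its length and by the weights at nodes 1 and
  2.\<close>

lemma paths_pair_D:
  assumes n: "4 \<le> n" and "b \<in> paths (TypeD n) [(1, s), (1, t)]" "c \<in> paths (TypeD n) [(1, s), (1, t)]"
    and "\<And>a. a \<in> classical_nodes (TypeD n) \<Longrightarrow> w_phi (TypeD n) a (path_word b) = w_phi (TypeD n) a (path_word c)"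
  shows "b = c"
proof -
  let ?T = "TypeD n"
  have split: "\<exists>i j k. path_word b = replicate i 1 @ replicate j 2 @ replicate k (- 1) @ replicate t 1 \<and> i + j + k = s"
    if b: "b \<in> paths ?T [(1, s), (1, t)]" for b
  proof -
    obtain x y where xy: "b = [x, y]" "x \<in> KR ?T (1, s)" "y \<in> KR ?T (1, t)" "w_hw ?T (concat x @ concat y)"
      using b by (auto simp: paths_iff elements_Cons elements_Nil)
    have "[y] \<in> paths ?T [(1, t)]" using xy w_hw_append by (auto simp: paths_iff elements_Cons elements_Nil)
    from paths_single_D[OF n this] have y: "concat y = replicate t 1" by simp
    have phi: "w_phi ?T i (replicate t 1) = 0" if "2 \<le> i" for i
      using that n by (induction t) auto
    have "w_eps ?T i (concat x) = 0" if "2 \<le> i" "i \<le> n" for i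
    proof -
      have "w_eps ?T i (concat x @ concat y) = 0" using xy(4) that by (auto simp: w_hw_def classical_nodes_def)
      then show ?thesis using phi[OF that(1)] y by (simp add: tensor_eps_phi_append)
    qed
    then obtain i j k where w: "concat x = replicate i 1 @ replicate j 2 @ replicate k (- 1)"
      using hw_word_D[OF n, of "concat x"] xy(2) by (auto simp: KR_D_iff)
    have "length (concat x) = s" using KR_word_length[OF xy(2)] by simp
    then have "i + j + k = s" unfolding w by simp
    with w y xy(1) show ?thesis by auto
  qed
  obtain i j k where w: "path_word b = replicate i 1 @ replicate j 2 @ replicate k (- 1) @ replicate t 1" "i + j + k = s"
    using split[OF assms(2)] by blast
  obtain i' j' k' where w': "path_word c = replicate i' 1 @ replicate j' 2 @ replicate k' (- 1) @ replicate t 1" "i' + j' + k' = s"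
    using split[OF assms(3)] by blast
  have wt: "int (w_phi ?T a (path_word b)) - int (w_eps ?T a (path_word b)) =
      int (w_phi ?T a (path_word c)) - int (w_eps ?T a (path_word c))" if "a \<in> classical_nodes ?T" for a
    using assms(2-4) that by (auto simp: paths_iff w_hw_def)
  have *: "int (w_phi ?T a (replicate i 1 @ replicate j 2 @ replicate k (- 1))) -
      int (w_eps ?T a (replicate i 1 @ replicate j 2 @ replicate k (- 1))) =
      int (w_phi ?T a (replicate i' 1 @ replicate j' 2 @ replicate k' (- 1))) -
      int (w_eps ?T a (replicate i' 1 @ replicate j' 2 @ replicate k' (- 1)))" if "a \<in> classical_nodes ?T" for a
    using wt[OF that] unfolding w w' w_wt_append by simp
  have "1 \<in> classical_nodes ?T" "2 \<in> classical_nodes ?T" using n by (auto simp: classical_nodes_def)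
  from *[OF this(1)] *[OF this(2)] have "i = i'" "j = j'" "k = k'"
    unfolding hw_word_wt_D[OF n] using w(2) w'(2) by linarith+
  with w w' have "path_word b = path_word c" by simp
  then show ?thesis using assms(2,3) elements_word_inj unfolding paths_iff by blast
qed

lemma paths_single:
  assumes "valid_type T" "(r, s) \<in> KR_indices T" "b \<in> paths T [(r, s)]" "c \<in> paths T [(r, s)]"
  shows "b = c"
proof (cases T)
  case (TypeA n)
  then show ?thesis using assms paths_single_A by metis
next
  case (TypeD n)
  then have "r = 1" "4 \<le> n" using assms by (auto simp: KR_indices_def)
  then have "path_word b = path_word c" using assms paths_single_D TypeD by metis
  then show ?thesis using assms(3,4) elements_word_inj unfolding paths_iff by blast
qed

lemma paths_pair:
  assumes "valid_type T" "p \<in> KR_indices T" "q \<in> KR_indices T" "b \<in> paths T [p, q]" "c \<in> paths T [p, q]"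
    and "\<And>a. a \<in> classical_nodes T \<Longrightarrow> w_phi T a (path_word b) = w_phi T a (path_word c)"
  shows "b = c"
proof (cases T)
  case (TypeA n)
  show ?thesis by (rule paths_pair_A[of b n p q c]) (use assms TypeA in auto)
next
  case (TypeD n)
  obtain s t where st: "p = (1, s)" "q = (1, t)" using assms(2,3) TypeD by (cases p; cases q) (auto simp: KR_indices_def)
  show ?thesis by (rule paths_pair_D[of n b s t c]) (use assms TypeD st in auto)
qed

section \<open>Rigged configurations of paths\<close>

lemma KR_indices_cases:
  assumes "(r, s) \<in> KR_indices T"
  obtains "s = 1" "r = 1" | "2 \<le> s" "1 \<le> r" | n where "s = 1" "2 \<le> r" "T = TypeA n" "r \<le> n"
  using assms that by (cases "s = 1"; cases "r = 1"; cases T) (auto simp: KR_indices_def)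

lemma tensor_class_simps [simp]:
  "[] \<in> tensor_class T" "p # B \<in> tensor_class T \<longleftrightarrow> p \<in> KR_indices T \<and> B \<in> tensor_class T"
  "B @ C \<in> tensor_class T \<longleftrightarrow> B \<in> tensor_class T \<and> C \<in> tensor_class T"
  "rev B \<in> tensor_class T \<longleftrightarrow> B \<in> tensor_class T"
  by (auto simp: tensor_class_def)

lemma KR_indices_split:
  assumes "(r, s) \<in> KR_indices T" "1 \<le> i" "i \<le> s"
  shows "(r, i) \<in> KR_indices T"
  using assms by (cases T) (auto simp: KR_indices_def)

lemma KR_indices_A: "1 \<le> r \<Longrightarrow> r \<le> n \<Longrightarrow> 1 \<le> s \<Longrightarrow> (r, s) \<in> KR_indices (TypeA n)"
  by (simp add: KR_indices_def)

text \<open>Two for each cell, minus one for each factor: splitting a factor keeps the cells and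
  adds a factor, removing a box costs two and returns one, so every reduction decreases the
  sum.\<close>

definition cell_measure :: "(nat \<times> nat) list \<Rightarrow> nat" where
  "cell_measure B = (\<Sum>(r, s)\<leftarrow>B. 2 * (r * s) - 1)"

lemma cell_measure_append [simp]: "cell_measure (B @ C) = cell_measure B + cell_measure C"
  by (simp add: cell_measure_def)

lemma cell_measure_simps:
  "cell_measure B < cell_measure ((1, 1) # B)"
  "2 \<le> s \<Longrightarrow> 1 \<le> r \<Longrightarrow> cell_measure ((r, 1) # (r, s - 1) # B) < cell_measure ((r, s) # B)"
  "2 \<le> r \<Longrightarrow> cell_measure ((1, 1) # (r - 1, 1) # B) < cell_measure ((r, 1) # B)"
proof -
  show "cell_measure B < cell_measure ((1, 1) # B)" by (simp add: cell_measure_def)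
  assume "2 \<le> s" "1 \<le> r"
  then obtain s' r' where "s = Suc (Suc s')" "r = Suc r'" by (cases s; cases "s - 1"; cases r) auto
  then show "cell_measure ((r, 1) # (r, s - 1) # B) < cell_measure ((r, s) # B)"
    by (simp add: cell_measure_def algebra_simps)
next
  assume "2 \<le> r"
  then obtain r' where "r = Suc (Suc r')" by (cases r; cases "r - 1") auto
  then show "cell_measure ((1, 1) # (r - 1, 1) # B) < cell_measure ((r, 1) # B)" by (simp add: cell_measure_def)
qed

abbreviation (input) nonneg :: "rigged \<Rightarrow> bool" where
  "nonneg rc \<equiv> \<forall>a. rc_eps rc a = 0"

lemma rc_eps_outside: "rc_ok T rc \<Longrightarrow> a \<notin> classical_nodes T \<Longrightarrow> rc_eps rc a = 0"
  by (simp add: rc_ok_def rc_eps_def)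

lemma nonneg_label: "rc_eps rc a = 0 \<Longrightarrow> (i, x) \<in># rc a \<Longrightarrow> 0 \<le> x"
  using rc_eps_le[of i x rc a] by simp

lemma reads_nonneg: "reads T B w rc \<Longrightarrow> valid_type T \<Longrightarrow> w_hw T w \<longleftrightarrow> nonneg rc"
  using reads_crystal(1)[of T B w rc] reads_valid[of T B w rc] rc_eps_outside[of T rc]
  by (auto simp: w_hw_def rc_valid_def)

text \<open>
  \<open>C\<close> is a right tail of the tensor product, \<open>C'\<close> what replaces it, and \<open>u\<close> the part of the word
  that is lost.
\<close>

lemma reads_right:
  assumes T: "valid_type T"
    and base: "\<And>w rc. reads T C w rc \<Longrightarrow> w_hw T w \<Longrightarrow> \<exists>v. reads T C' v (F rc) \<and> v @ u = w"
    and valid: "\<And>B rc. rc_valid T (mset (B @ C)) rc \<Longrightarrow> nonneg rc \<Longrightarrow> rc_valid T (mset (B @ C')) (F rc)"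
    and es: "\<And>B Y a m. rc_ok T Y \<Longrightarrow> nonneg Y \<Longrightarrow> es_sel T (mset (B @ C)) Y a m \<Longrightarrow>
      es_sel T (mset (B @ C')) (F Y) a m \<and> es_app T (mset (B @ C')) a m (F Y) = F (es_app T (mset (B @ C)) a m Y)"
    and cell: "\<And>n r B rc. T = TypeA n \<Longrightarrow> 2 \<le> r \<Longrightarrow> r \<le> n \<Longrightarrow> rc_ok T rc \<Longrightarrow>
      ibar T (mset ((r, 1) # B @ C')) r (F rc) = F (ibar T (mset ((r, 1) # B @ C)) r rc)"
    and "reads T (B @ C) w rc" "w_hw T w"
  shows "\<exists>v. reads T (B @ C') v (F rc) \<and> v @ u = w"
proof -
  \<comment> \<open>Nonnegativity of the riggings persists along the chain and is carried with it,
    as the hypothesis on single operators is only available under it.\<close>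
  have chains: "chain T (mset (B @ C')) y (F Y) x (F X)"
    if "chain T (mset (B @ C)) y Y x X" "rc_ok T Y" "nonneg Y" for B y Y x X
    using that
  proof (induction rule: chain.induct)
    case (chain_refl y Y)
    show ?case by (rule chain.chain_refl)
  next
    case (chain_step a y z Y m x X)
    have "rc_eps (es_app T (mset (B @ C)) a m Y) b = 0" for b
      by (rule chain_eps_zero[OF chain.chain_step[OF chain_step.hyps(1,2,3) chain.chain_refl]]) (use chain_step.prems in auto)
    then show ?case
      using chain.chain_step[OF chain_step.hyps(1,2), of "mset (B @ C')" "F Y" m] chain_step.IH
        es[OF chain_step.prems chain_step.hyps(3)] rc_ok_es_app[OF chain_step.prems(1) chain_step.hyps(3)] by simp
  qed
  have "reads T D w rc \<Longrightarrow> D = B @ C \<Longrightarrow> w_hw T w \<Longrightarrow> \<exists>v. reads T (B @ C') v (F rc) \<and> v @ u = w" for D B w rc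
  proof (induction arbitrary: B rule: reads.induct)
    case reads_Nil
    then show ?case using base[of "[]" "\<lambda>_. {#}"] reads.reads_Nil[of T] by auto
  next
    case (reads_box D rc x X w)
    have all: "reads T ((1, 1) # D) (x # w) rc" using reads_box.hyps by (rule reads.reads_box)
    show ?case
    proof (cases B)
      case Nil
      then show ?thesis using base[of "x # w" rc] all reads_box.prems by simp
    next
      case (Cons p B')
      then have D: "p = (1, 1)" "D = B' @ C" using reads_box.prems(1) by auto
      obtain v where v: "reads T (B' @ C') v (F X)" "v @ u = w"
        using reads_box.IH[OF D(2)] w_hw_Cons[OF reads_box.prems(2)] by blast
      have nn: "nonneg rc" using reads_nonneg[OF all T] reads_box.prems(2) by simp
      have "rc_ok T rc" using reads_box.hyps(1) by (simp add: rc_valid_def)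
      note ch = chains[OF reads_box.hyps(2)[unfolded D(2)] this nn]
      have "reads T ((1, 1) # (B' @ C')) (x # v) (F rc)"
        by (rule reads.reads_box[OF _ ch v(1)]) (use valid[of B rc] reads_box.hyps(1) nn Cons D in simp)
      then show ?thesis using Cons D v(2) by auto
    qed
  next
    case (reads_column r s D rc w)
    have all: "reads T ((r, s) # D) w rc" using reads_column.hyps by (rule reads.reads_column)
    show ?case
    proof (cases B)
      case Nil
      then show ?thesis using base[of w rc] all reads_column.prems by simp
    next
      case (Cons p B')
      then have D: "p = (r, s)" "D = B' @ C" using reads_column.prems(1) by auto
      obtain v where v: "reads T ((r, 1) # (r, s - 1) # B' @ C') v (F rc)" "v @ u = w"
        using reads_column.IH[of "(r, 1) # (r, s - 1) # B'"] D(2) reads_column.prems(2) by auto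
      have nn: "nonneg rc" using reads_nonneg[OF all T] reads_column.prems(2) by simp
      have "reads T ((r, s) # (B' @ C')) v (F rc)"
        by (rule reads.reads_column[OF _ reads_column.hyps(2) v(1)]) (use valid[of B rc] reads_column.hyps(1) nn Cons D in simp)
      then show ?thesis using Cons D v(2) by auto
    qed
  next
    case (reads_cell r D rc n w)
    have all: "reads T ((r, 1) # D) w rc" using reads_cell.hyps by (rule reads.reads_cell)
    show ?case
    proof (cases B)
      case Nil
      then show ?thesis using base[of w rc] all reads_cell.prems by simp
    next
      case (Cons p B')
      then have D: "p = (r, 1)" "D = B' @ C" using reads_cell.prems(1) by auto
      obtain v where v: "reads T ((1, 1) # (r - 1, 1) # B' @ C') v (F (ibar T (mset ((r, 1) # D)) r rc))" "v @ u = w"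
        using reads_cell.IH[of "(1, 1) # (r - 1, 1) # B'"] D(2) reads_cell.prems(2) by auto
      have nn: "nonneg rc" using reads_nonneg[OF all T] reads_cell.prems(2) by simp
      have ok: "rc_ok T rc" using reads_cell.hyps(1) by (simp add: rc_valid_def)
      have "reads T ((r, 1) # (B' @ C')) v (F rc)"
        by (rule reads.reads_cell[OF _ reads_cell.hyps(2-4)])
          (use valid[of B rc] reads_cell.hyps(1) nn Cons D v(1) cell[OF reads_cell.hyps(3,2,4) ok, of B'] in simp_all)
      then show ?thesis using Cons D v(2) by auto
    qed
  qed
  then show ?thesis using assms(6,7) by blast
qed

section \<open>Uniform shifts of riggings, and conjugation\<close>

definition shift_labels :: "(nat \<Rightarrow> nat \<Rightarrow> int) \<Rightarrow> rigged \<Rightarrow> rigged" where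
  "shift_labels g rc a = image_mset (\<lambda>(i, x). (i, x + g a i)) (rc a)"

lemma shift_labels_mem: "(i, x) \<in># shift_labels g rc a \<longleftrightarrow> (i, x - g a i) \<in># rc a"
proof
  show "(i, x) \<in># shift_labels g rc a \<Longrightarrow> (i, x - g a i) \<in># rc a" by (auto simp: shift_labels_def)
  assume "(i, x - g a i) \<in># rc a"
  then show "(i, x) \<in># shift_labels g rc a" unfolding shift_labels_def by force
qed

lemma shape_shift_labels [simp]: "shape (shift_labels g rc) = shape rc"
  by (simp add: fun_eq_iff shape_def shift_labels_def image_mset.compositionality comp_def case_prod_beta')

lemma shift_labels_inj: "shift_labels g rc = shift_labels g rc' \<Longrightarrow> rc = rc'"
proof
  fix a assume "shift_labels g rc = shift_labels g rc'"
  then have "image_mset (\<lambda>(i, x). (i, x - g a i)) (shift_labels g rc a) = image_mset (\<lambda>(i, x). (i, x - g a i)) (shift_labels g rc' a)" by simp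
  then show "rc a = rc' a"
    by (simp add: shift_labels_def image_mset.compositionality comp_def case_prod_beta')
qed

text \<open>If vacancy numbers and riggings are shifted alike, all coriggings stay the same. Upper
  bounds and conjugate operators therefore do not notice the shift.\<close>

locale label_shift =
  fixes T :: affine_type and g :: "nat \<Rightarrow> nat \<Rightarrow> int" and L L' :: multiplicities
  assumes vac: "\<And>nu a i. 0 < i \<Longrightarrow> vacancy T L' nu a i = vacancy T L nu a i + g a i"
begin

lemma shift_valid:
  assumes "rc_valid T L rc"
  shows "rc_valid T L' (shift_labels g rc)"
proof -
  have "x \<le> vacancy T L' (shape rc) a i" if "(i, x - g a i) \<in># rc a" for a i x
  proof -
    have "0 < i" "x - g a i \<le> vacancy T L (shape rc) a i"
      using assms that by (auto simp: rc_valid_def rc_ok_def node_valid_def)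
    then show ?thesis using vac by simp
  qed
  moreover have "rc_ok T (shift_labels g rc)"
    using assms unfolding rc_valid_def rc_ok_def shift_labels_mem by (auto simp: shift_labels_def)
  ultimately show ?thesis by (simp add: rc_valid_def node_valid_def shift_labels_mem)
qed

lemma shift_es:
  assumes "rc_ok T Y" "es_sel T L Y a m"
  shows "es_sel T L' (shift_labels g Y) a m"
    "es_app T L' a m (shift_labels g Y) = shift_labels g (es_app T L a m Y)"
proof -
  have pos: "(i, x) \<in># Y a \<Longrightarrow> 0 < i" for i x using assms(1) by (auto simp: rc_ok_def)
  have m: "0 < m" by (rule es_sel_length[OF assms])
  show "es_sel T L' (shift_labels g Y) a m"
    unfolding es_sel_def shift_labels_mem shape_shift_labels
  proof (intro conjI allI impI)
    show "(m, vacancy T L' (shape Y) a m + 1 - g a m) \<in># Y a" using assms(2) vac[OF m] by (simp add: es_sel_def)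
    fix i x assume x: "(i, x - g a i) \<in># Y a"
    then have v: "vacancy T L' (shape Y) a i = vacancy T L (shape Y) a i + g a i" using vac pos by blast
    have *: "x - g a i \<le> vacancy T L (shape Y) a i + 1 \<and> (x - g a i = vacancy T L (shape Y) a i + 1 \<longrightarrow> m \<le> i)"
      using assms(2) x unfolding es_sel_def by blast
    show "x \<le> vacancy T L' (shape Y) a i + 1" using * unfolding v by linarith
    show "m \<le> i" if "x = vacancy T L' (shape Y) a i + 1" using * that unfolding v by simp
  qed
  obtain N where N: "Y a = add_mset (m, vacancy T L (shape Y) a m + 1) N"
    using assms(2) multi_member_split[of "(m, vacancy T L (shape Y) a m + 1)" "Y a"] by (auto simp: es_sel_def)
  have "es_app T L' a m (shift_labels g Y) b = shift_labels g (es_app T L a m Y) b" for b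
    unfolding es_app_def shape_shift_labels shift_labels_def using N m by (auto simp: vac shift_labels_def ac_simps)
  then show "es_app T L' a m (shift_labels g Y) = shift_labels g (es_app T L a m Y)" by blast
qed

end

lemma label_shift_ibar:
  assumes "label_shift (TypeA n) g L L'" "2 \<le> r" "r \<le> n" "(r, 1) \<in># L" "(r, 1) \<in># L'"
  shows "ibar (TypeA n) L' r (shift_labels g rc) = shift_labels g (ibar (TypeA n) L r rc)"
  using assms label_shift.vac[OF assms(1), of 1]
  by (auto simp: fun_eq_iff ibar_eq shift_labels_def)

lemma theta_mem: "(i, x) \<in># theta T L rc a \<longleftrightarrow> (i, vacancy T L (shape rc) a i - x) \<in># rc a"
proof
  show "(i, x) \<in># theta T L rc a \<Longrightarrow> (i, vacancy T L (shape rc) a i - x) \<in># rc a" by (auto simp: theta_def)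
  assume "(i, vacancy T L (shape rc) a i - x) \<in># rc a"
  then show "(i, x) \<in># theta T L rc a" unfolding theta_def by force
qed

lemma shape_theta [simp]: "shape (theta T L rc) = shape rc"
  by (simp add: fun_eq_iff shape_def theta_def image_mset.compositionality comp_def case_prod_beta')

text \<open>Conjugation with respect to two different multiplicity arrays is a shift of the riggings
  by the difference of the vacancy numbers; in this form a removed right factor meets the definition
  of \<open>deltatilde\<close>.\<close>

lemma theta_theta: "theta T L' (theta T L rc) = shift_labels (\<lambda>a i. vacancy T L' (shape rc) a i - vacancy T L (shape rc) a i) rc"
  by (simp add: fun_eq_iff theta_def[of T L' "theta T L rc"])
    (simp add: theta_def shift_labels_def image_mset.compositionality comp_def case_prod_beta' algebra_simps)

lemma theta_involution: "theta T L (theta T L rc) = rc"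
  unfolding theta_theta by (simp add: fun_eq_iff shift_labels_def)

lemma theta_nonneg:
  assumes "rc_valid T L rc"
  shows "nonneg (theta T L rc)"
proof -
  have "0 \<le> x" if "(i, x) \<in># theta T L rc a" for i x a
    using that assms unfolding theta_mem rc_valid_def node_valid_def by force
  then show ?thesis by (auto intro: rc_eps_eqI)
qed

lemma theta_valid:
  assumes "rc_valid T L rc" "nonneg rc"
  shows "rc_valid T L (theta T L rc)"
proof -
  have "x \<le> vacancy T L (shape rc) a i" if "(i, vacancy T L (shape rc) a i - x) \<in># rc a" for a i x
    using nonneg_label[of rc a i] that assms(2) by fastforce
  moreover have "rc_ok T (theta T L rc)"
    using assms(1) unfolding rc_valid_def rc_ok_def theta_mem by (auto simp: theta_def)
  ultimately show ?thesis by (simp add: rc_valid_def node_valid_def theta_mem)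
qed


lemma empty_valid: "valid_type T \<Longrightarrow> rc_valid T L (\<lambda>_. {#})"
  by (simp add: rc_valid_def rc_ok_def node_valid_def)

lemma rc_eps_empty: "rc_eps (\<lambda>_. {#}) a = 0"
  by (simp add: rc_eps_def)

section \<open>Consequences of bijectivity\<close>

locale path_bijection =
  fixes T :: affine_type and \<phi> :: "(nat \<times> nat) list \<Rightarrow> path \<Rightarrow> rigged"
  assumes T: "valid_type T" and bij: "path_RC_bijection T \<phi>"
begin

lemma phi_Nil: "\<phi> [] [] = (\<lambda>_. {#})"
  and phi_lh: "(1, 1) # B \<in> tensor_class T \<Longrightarrow> b \<in> paths T ((1, 1) # B) \<Longrightarrow>
    \<phi> B (lh b) = deltabar T (mset ((1, 1) # B)) (\<phi> ((1, 1) # B) b)"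
  and phi_ls: "(r, s) # B \<in> tensor_class T \<Longrightarrow> 2 \<le> s \<Longrightarrow> b \<in> paths T ((r, s) # B) \<Longrightarrow>
    \<phi> ((r, 1) # (r, s - 1) # B) (ls b) = \<phi> ((r, s) # B) b"
  and phi_lb: "T = TypeA n \<Longrightarrow> (r, 1) # B \<in> tensor_class T \<Longrightarrow> 2 \<le> r \<Longrightarrow> b \<in> paths T ((r, 1) # B) \<Longrightarrow>
    \<phi> ((1, 1) # (r - 1, 1) # B) (lb b) = ibar T (mset ((r, 1) # B)) r (\<phi> ((r, 1) # B) b)"
proof -
  show "\<phi> [] [] = (\<lambda>_. {#})" using bij by (simp add: path_RC_bijection_def)
  show "\<phi> B (lh b) = deltabar T (mset ((1, 1) # B)) (\<phi> ((1, 1) # B) b)"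
    if "(1, 1) # B \<in> tensor_class T" "b \<in> paths T ((1, 1) # B)"
  proof -
    have "induced T lh b = lh b" using path_lh[OF T that(2)] by blast
    then show ?thesis using bij that unfolding path_RC_bijection_def by metis
  qed
  show "\<phi> ((r, 1) # (r, s - 1) # B) (ls b) = \<phi> ((r, s) # B) b"
    if "(r, s) # B \<in> tensor_class T" "2 \<le> s" "b \<in> paths T ((r, s) # B)"
    using bij that path_ls(3)[OF T that(3,2)] unfolding path_RC_bijection_def jbar_def by metis
  show "\<phi> ((1, 1) # (r - 1, 1) # B) (lb b) = ibar T (mset ((r, 1) # B)) r (\<phi> ((r, 1) # B) b)"
    if "T = TypeA n" "(r, 1) # B \<in> tensor_class T" "2 \<le> r" "b \<in> paths T ((r, 1) # B)"
  proof -
    have "induced T lb b = lb b" using path_lb(3)[of n b r B] T that by simp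
    then show ?thesis using bij that unfolding path_RC_bijection_def by metis
  qed
qed

lemma phi_bij: "B \<in> tensor_class T \<Longrightarrow> bij_betw (\<phi> B) (paths_wt T B lam) (RC T (mset B) lam)"
  using bij by (simp add: path_RC_bijection_def)

lemma paths_wt_iff:
  "b \<in> paths_wt T B lam \<longleftrightarrow> b \<in> paths T B \<and> (\<forall>a\<in>classical_nodes T. w_phi T a (path_word b) = lam a)"
  by (auto simp: paths_wt_def path_weight_word paths_iff w_hw_def)

lemma phi_valid:
  assumes "B \<in> tensor_class T" "b \<in> paths T B"
  shows "rc_valid T (mset B) (\<phi> B b)" "nonneg (\<phi> B b)"
    "a \<in> classical_nodes T \<Longrightarrow> rc_wt T (mset B) (shape (\<phi> B b)) a = int (w_phi T a (path_word b))"
proof -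
  let ?lam = "\<lambda>a. w_phi T a (path_word b)"
  have "b \<in> paths_wt T B ?lam" using assms(2) by (simp add: paths_wt_iff)
  then have "\<phi> B b \<in> RC T (mset B) ?lam" using phi_bij[OF assms(1)] bij_betwE by blast
  then have *: "rc_valid T (mset B) (\<phi> B b)" "\<forall>a\<in>classical_nodes T. rc_eps (\<phi> B b) a = 0 \<and>
      rc_wt T (mset B) (shape (\<phi> B b)) a = int (w_phi T a (path_word b))" unfolding RC_iff by auto
  then show "rc_valid T (mset B) (\<phi> B b)" "nonneg (\<phi> B b)"
    "a \<in> classical_nodes T \<Longrightarrow> rc_wt T (mset B) (shape (\<phi> B b)) a = int (w_phi T a (path_word b))"
    using rc_eps_outside unfolding rc_valid_def by blast+
qed

lemma phi_inj:
  assumes "B \<in> tensor_class T" "b \<in> paths T B" "c \<in> paths T B" "\<phi> B b = \<phi> B c"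
  shows "b = c"
proof -
  let ?lam = "\<lambda>a. w_phi T a (path_word b)"
  have "c \<in> paths_wt T B ?lam"
    using phi_valid(3)[OF assms(1,2)] phi_valid(3)[OF assms(1,3)] assms(3,4) by (simp add: paths_wt_iff)
  moreover have "b \<in> paths_wt T B ?lam" using assms(2) by (simp add: paths_wt_iff)
  ultimately show ?thesis using phi_bij[OF assms(1), of ?lam] assms(4) by (auto simp: bij_betw_def inj_on_def)
qed

text \<open>A nonnegative configuration that is bounded by the vacancy numbers has a dominant
  weight, so it belongs to one of the sets onto which \<phi> is bijective.\<close>

lemma phi_surj:
  assumes "B \<in> tensor_class T" "rc_valid T (mset B) rc" "nonneg rc"
  obtains b where "b \<in> paths T B" "\<phi> B b = rc"
proof -
  let ?lam = "\<lambda>a. nat (rc_wt T (mset B) (shape rc) a)"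
  have "rc \<in> RC T (mset B) ?lam" using rc_wt_ge_valid[OF assms(2)] assms(2,3) by (simp add: RC_iff)
  then have "rc \<in> \<phi> B ` paths_wt T B ?lam" using phi_bij[OF assms(1), of ?lam] by (simp add: bij_betw_def)
  then obtain b where "b \<in> paths_wt T B ?lam" "\<phi> B b = rc" by blast
  then show ?thesis using that[of b] unfolding paths_wt_iff by blast
qed

text \<open>For a box the path and the chain remove letters with the same weight, since both account
  for the difference between the same two weights, and letters are separated by their
  weights.\<close>

lemma phi_reads:
  assumes "B \<in> tensor_class T" "b \<in> paths T B"
  shows "reads T B (path_word b) (\<phi> B b)"
  using assms
proof (induction "cell_measure B" arbitrary: B b rule: less_induct)
  case less
  note valid = phi_valid(1)[OF less.prems]
  show ?case
  proof (cases B)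
    case Nil
    then show ?thesis using less.prems phi_Nil reads_Nil[of T] by (simp add: paths_iff elements_Nil)
  next
    case (Cons p B')
    obtain r s where p: "p = (r, s)" by fastforce
    have rs: "(r, s) \<in> KR_indices T" and B': "B' \<in> tensor_class T" using less.prems(1) Cons p by auto
    from rs show ?thesis
    proof (cases rule: KR_indices_cases)
      case 1
      then have B: "B = (1, 1) # B'" using Cons p by simp
      obtain x where x: "x \<in> letters T" "lh b \<in> paths T B'" "path_word b = x # path_word (lh b)"
        using path_lh[OF T less.prems(2)[unfolded B]] by blast
      have r: "reads T B' (path_word (lh b)) (\<phi> B' (lh b))"
        by (rule less.hyps) (use B B' x(2) cell_measure_simps(1)[of B'] in auto)
      have X: "\<phi> B' (lh b) = deltabar T (mset ((1, 1) # B')) (\<phi> B b)"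
        using phi_lh[of B' b] less.prems unfolding B by simp
      obtain y where y: "chain T (mset B') 1 (\<phi> B b) y (\<phi> B' (lh b))"
        using delta_chain_Cons[OF T valid[unfolded B]] X unfolding B by auto
      have ok: "rc_ok T (\<phi> B b)" using valid by (simp add: rc_valid_def)
      have "x = y"
      proof (rule letter_wt_inj[OF T x(1) chain_letters[OF y T one_letter[OF T]]])
        fix a assume a: "a \<in> classical_nodes T"
        have "rc_wt T (mset B') (shape (\<phi> B' (lh b))) a + letter_wt T a y =
            rc_wt T (mset B') (shape (\<phi> B b)) a + letter_wt T a 1" by (rule chain_wt[OF y ok a T])
        moreover have "rc_wt T (mset B) (shape (\<phi> B b)) a = rc_wt T (mset B') (shape (\<phi> B b)) a + letter_wt T a 1"
          unfolding B rc_wt_box letter_wt_one[OF a T] ..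
        moreover have "int (w_phi T a (path_word b)) = letter_wt T a x + int (w_phi T a (path_word (lh b)))"
          using w_wt_Cons[of T a x "path_word (lh b)"] less.prems(2) x(2,3) a by (auto simp: paths_iff w_hw_def)
        ultimately show "letter_wt T a x = letter_wt T a y"
          using phi_valid(3)[OF less.prems a] phi_valid(3)[OF B' x(2) a] by simp
      qed
      then show ?thesis using reads_box[OF valid[unfolded B] _ r, of y] y B x(3) by simp
    next
      case 2
      note b = path_ls[OF T less.prems(2)[unfolded Cons p] 2(1)]
      have "reads T ((r, 1) # (r, s - 1) # B') (path_word (ls b)) (\<phi> ((r, 1) # (r, s - 1) # B') (ls b))"
        by (rule less.hyps) (use Cons p cell_measure_simps(2)[OF 2] B' b(1) KR_indices_split[OF rs] 2 in auto)
      then show ?thesis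
        using phi_ls[of r s B' b] less.prems 2 b(2) valid unfolding Cons p by (auto intro: reads_column)
    next
      case (3 n)
      have b: "lb b \<in> paths T ((1, 1) # (r - 1, 1) # B')" "path_word (lb b) = path_word b"
        using path_lb[of n b r B', OF _ _ 3(2)] less.prems(2) T unfolding Cons p 3(1,3) by auto
      have "reads T ((1, 1) # (r - 1, 1) # B') (path_word (lb b)) (\<phi> ((1, 1) # (r - 1, 1) # B') (lb b))"
        by (rule less.hyps) (use Cons p cell_measure_simps(3)[OF 3(2)] B' b(1) 3 in \<open>auto intro: KR_indices_A\<close>)
      then show ?thesis
        using phi_lb[of n r B' b, OF 3(3) _ 3(2)] less.prems b(2) valid reads_cell[of T r B' "\<phi> B b" n, OF _ 3(2-4)]
        unfolding Cons p 3(1) by simp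
    qed
  qed
qed

lemma reads_phi:
  assumes "B \<in> tensor_class T" "reads T B w rc" "w_hw T w"
  obtains b where "b \<in> paths T B" "\<phi> B b = rc" "path_word b = w"
proof -
  obtain b where b: "b \<in> paths T B" "\<phi> B b = rc"
    using phi_surj[OF assms(1) reads_valid[OF assms(2)]] reads_nonneg[OF assms(2) T] assms(3) by blast
  have "path_word b = w" using reads_fun[OF phi_reads[OF assms(1) b(1)] _ T] assms(2) b(2) by simp
  with b that show thesis by blast
qed

text \<open>The empty configuration is the image of some path, and a single factor admits only
  one.\<close>

lemma phi_single:
  assumes "(r, s) \<in> KR_indices T" "b \<in> paths T [(r, s)]"
  shows "\<phi> [(r, s)] b = (\<lambda>_. {#})"
proof -
  have B: "[(r, s)] \<in> tensor_class T" using assms(1) by simp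
  obtain c where "c \<in> paths T [(r, s)]" "\<phi> [(r, s)] c = (\<lambda>_. {#})"
    using phi_surj[OF B empty_valid[OF T]] rc_eps_empty by blast
  then show ?thesis using paths_single[OF T assms] by blast
qed

text \<open>Two factors are multiplicity free, so an admissible configuration of the right weight
  has to be the image. This provides the base cases of the operations on the right.\<close>

lemma phi_pair:
  assumes "p \<in> KR_indices T" "q \<in> KR_indices T" "b \<in> paths T [p, q]"
    and "rc_valid T (mset [p, q]) rc" "nonneg rc"
    and "\<And>a. a \<in> classical_nodes T \<Longrightarrow> rc_wt T (mset [p, q]) (shape rc) a = int (w_phi T a (path_word b))"
  shows "\<phi> [p, q] b = rc"
proof -
  have B: "[p, q] \<in> tensor_class T" using assms(1,2) by simp
  obtain c where c: "c \<in> paths T [p, q]" "\<phi> [p, q] c = rc" using phi_surj[OF B assms(4,5)] by blast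
  have "c = b"
    by (rule paths_pair[OF T assms(1,2) c(1) assms(3)]) (use phi_valid(3)[OF B c(1)] c(2) assms(6) in simp)
  then show ?thesis using c(2) by simp
qed

text \<open>A path is determined by its word once the factors are known, so it is enough that the
  modified configuration reads the same word.\<close>

lemma phi_right:
  assumes "b \<in> paths T (B @ C)" "B @ C \<in> tensor_class T" "B @ C' \<in> tensor_class T" "path_word c = path_word b" "c \<in> elements T (B @ C')"
    and "\<exists>v. reads T (B @ C') v (F (\<phi> (B @ C) b)) \<and> v @ [] = path_word b"
  shows "\<phi> (B @ C') c = F (\<phi> (B @ C) b)"
proof -
  have r: "reads T (B @ C') (path_word b) (F (\<phi> (B @ C) b))" using assms(6) by simp
  have "w_hw T (path_word b)" using assms(1) by (simp add: paths_iff)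
  then obtain d where d: "d \<in> paths T (B @ C')" "\<phi> (B @ C') d = F (\<phi> (B @ C) b)" "path_word d = path_word b"
    using reads_phi[OF assms(3) r] by blast
  then have "d = c" using elements_word_inj[OF _ assms(5)] assms(4) by (auto simp: paths_iff)
  then show ?thesis using d(2) by simp
qed

end

section \<open>Operations on the right factor\<close>

lemma highest_up:
  assumes "valid_type T" "(w_up T)\<^sup>*\<^sup>* (path_word b) (path_word c)" "path_lens c = path_lens b" "w_hw T (path_word c)"
  shows "highest T b = c"
proof -
  obtain d where d: "path_word d = path_word c" "path_lens d = path_lens b" "equivclp (classical_arrow T) b d"
    using w_up_lift[OF assms(1,2)] by blast
  have "d = c" by (rule path_word_inj) (use d assms(3) in auto)
  then show ?thesis using highest_eqI[OF assms(1)] d(3) assms(4) classical_hw_word by blast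
qed

text \<open>Conjugation exchanges riggings and coriggings, so the least corigging \<open>- 1\<close>
  becomes the least rigging \<open>- 1\<close>, that is, \<open>k = 1\<close>.\<close>

lemma theta_es:
  assumes "rc_ok T Y" "es_sel T L Y a m"
  shows "e_sel (theta T L Y) a 1 m" "theta T L (es_app T L a m Y) = e_app T a 1 m (theta T L Y)"
proof -
  let ?p = "vacancy T L (shape Y)"
  have m: "0 < m" by (rule es_sel_length[OF assms])
  show "e_sel (theta T L Y) a 1 m"
    unfolding e_sel_def theta_mem
  proof (intro conjI allI impI)
    show "(m, ?p a m - - 1) \<in># Y a" using assms(2) by (simp add: es_sel_def)
    fix i x assume "(i, ?p a i - x) \<in># Y a"
    then have *: "?p a i - x \<le> ?p a i + 1 \<and> (?p a i - x = ?p a i + 1 \<longrightarrow> m \<le> i)" using assms(2) unfolding es_sel_def by blast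
    then show "- 1 \<le> x" by simp
    show "m \<le> i" if "x = - 1" using * that by simp
  qed simp
  obtain N where N: "Y a = add_mset (m, ?p a m + 1) N"
    using assms(2) multi_member_split[of "(m, ?p a m + 1)" "Y a"] by (auto simp: es_sel_def)
  note v = vacancy_es_app(1)[OF assms, of L]
  have "theta T L (es_app T L a m Y) b = e_app T a 1 m (theta T L Y) b" for b
  proof (cases "b = a")
    case True
    then show ?thesis
      using m N unfolding theta_def[of T L "es_app T L a m Y"] v
      by (auto simp: es_app_def e_app_def theta_def relabel_def image_mset.compositionality comp_def case_prod_beta' intro!: image_mset_cong)
  next
    case False
    then show ?thesis
      unfolding theta_def[of T L "es_app T L a m Y"] v
      by (auto simp: es_app_def e_app_def theta_def relabel_def image_mset.compositionality comp_def case_prod_beta' cartan_sym[of T b a]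
          intro!: image_mset_cong)
  qed
  then show "theta T L (es_app T L a m Y) = e_app T a 1 m (theta T L Y)" by blast
qed

text \<open>Seen through \<open>theta\<close>, the repairs that make up \<delta> are raising
  operators, so they move the word upwards in its component.\<close>

lemma theta_chain:
  assumes "chain T (mset B) y Y x X" "rc_ok T Y" "reads T B v (theta T (mset B) Y)" "valid_type T"
  shows "\<exists>v'. (w_up T)\<^sup>*\<^sup>* v v' \<and> reads T B v' (theta T (mset B) X)"
  using assms
proof (induction arbitrary: v rule: chain.induct)
  case (chain_step a y z Y m x X)
  note e = theta_es[OF chain_step.prems(1) chain_step.hyps(3)]
  obtain v' where v': "w_e T a v = Some v'" "reads T B v' (theta T (mset B) (es_app T (mset B) a m Y))"
    using reads_crystal(3)[OF chain_step.prems(2,3) chain_step.hyps(1) e(1)] e(2) by auto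
  have "w_up T v v'" using v'(1) chain_step.hyps(1) by (auto simp: w_up_def)
  with chain_step.IH[OF rc_ok_es_app[OF chain_step.prems(1) chain_step.hyps(3)] v'(2) chain_step.prems(3)]
  show ?case by (meson converse_rtranclp_into_rtranclp)
qed auto

lemma shift_labels_empty [simp]: "shift_labels g (\<lambda>_. {#}) = (\<lambda>_. {#})"
  by (simp add: fun_eq_iff shift_labels_def)

definition jtilde_shift :: "nat \<Rightarrow> nat \<Rightarrow> nat \<Rightarrow> nat \<Rightarrow> int" where
  "jtilde_shift r s a i = (if a = r \<and> i < s then 1 else 0)"

lemma jtilde_shift: "jtilde r s = shift_labels (jtilde_shift r s)"
  by (auto simp: fun_eq_iff jtilde_def shift_labels_def jtilde_shift_def intro!: image_mset_cong)

lemma label_shift_jtilde: "2 \<le> s \<Longrightarrow> label_shift T (jtilde_shift r s) (mset (B @ [(r, s)])) (mset (B @ [(r, s - 1), (r, 1)]))"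
  by (auto simp: label_shift_def vacancy_min_sum jtilde_shift_def)

text \<open>With one factor \<open>(1, 1)\<close> less, the vacancy numbers of node 1 drop by one at
  every positive length.\<close>

definition box_shift :: "nat \<Rightarrow> nat \<Rightarrow> int" where
  "box_shift a i = (if a = 1 then - 1 else 0)"

lemma label_shift_box: "label_shift T box_shift (mset (B @ [(1, 1)])) (mset (B @ []))"
  by (auto simp: label_shift_def vacancy_min_sum box_shift_def)

lemma theta_theta_box:
  assumes "rc_ok T rc"
  shows "theta T (mset B) (theta T (mset (B @ [(1, 1)])) rc) = shift_labels box_shift rc"
proof -
  have "0 < i" if "(i, x) \<in># rc a" for a i x using assms that by (auto simp: rc_ok_def)
  then show ?thesis
    using label_shift.vac[OF label_shift_box[of T B]]
    unfolding theta_theta by (auto simp: fun_eq_iff shift_labels_def intro!: image_mset_cong)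
qed

section \<open>Insertion of cosingular strings\<close>

lemma itilde_vacancy:
  assumes "2 \<le> r" "r \<le> n" "a \<in> classical_nodes (TypeA n)" "0 < i"
  shows "vacancy (TypeA n) (mset (B @ [(r - 1, 1), (1, 1)])) (shape (itilde r rc)) a i =
    vacancy (TypeA n) (mset (B @ [(r, 1)])) (shape rc) a i"
proof -
  have "shape (itilde r rc) = (\<lambda>a. if 1 \<le> a \<and> a < r then add_mset 1 (shape rc a) else shape rc a)"
    by (auto simp: fun_eq_iff shape_def itilde_def)
  moreover have "mset (B @ [(r - 1, 1), (1, 1)]) = mset (B @ [(r, 1)]) - {#(r, 1)#} + {#(1, 1), (r - 1, 1)#}"
    by simp
  ultimately show ?thesis using ibar_vacancy[of r n a i "mset (B @ [(r, 1)])" "shape rc"] assms by (simp add: classical_nodes_def add_mset_commute)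
qed

lemma rc_ok_itilde: "r \<le> n \<Longrightarrow> rc_ok (TypeA n) rc \<Longrightarrow> rc_ok (TypeA n) (itilde r rc)"
  unfolding rc_ok_def itilde_def classical_nodes_def by (auto split: if_splits)

lemma itilde_valid:
  assumes "2 \<le> r" "r \<le> n" "rc_valid (TypeA n) (mset (B @ [(r, 1)])) rc" "nonneg rc"
  shows "rc_valid (TypeA n) (mset (B @ [(r - 1, 1), (1, 1)])) (itilde r rc)"
  unfolding rc_valid_def node_valid_def
proof (intro conjI allI impI)
  have ok: "rc_ok (TypeA n) rc" using assms(3) by (simp add: rc_valid_def)
  show ok': "rc_ok (TypeA n) (itilde r rc)" by (rule rc_ok_itilde[OF assms(2) ok])
  fix a i x assume x: "(i, x) \<in># itilde r rc a"
  then have a: "a \<in> classical_nodes (TypeA n)" and i: "0 < i" using ok' by (auto simp: rc_ok_def)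
  have "(i, x) \<in># rc a \<or> i = 1 \<and> x = 0" using x by (auto simp: itilde_def split: if_splits)
  then show "x \<le> vacancy (TypeA n) (mset (B @ [(r - 1, 1), (1, 1)])) (shape (itilde r rc)) a i"
    unfolding itilde_vacancy[OF assms(1,2) a i]
    using assms(3,4) vacancy_nonneg_valid[OF assms(3) a, of 1] by (auto simp: rc_valid_def node_valid_def)
qed

text \<open>The corigging of the new string \<open>(1, 0)\<close> is the vacancy number at 1.
  Nonnegative riggings and the minimum principle show that this is at least \<open>- 1\<close>, and
  larger if the selected string is longer than 1, so the selection does not move to the new
  string.\<close>

lemma itilde_es:
  assumes "2 \<le> r" "r \<le> n" "rc_ok (TypeA n) Y" "nonneg Y" "es_sel (TypeA n) (mset (B @ [(r, 1)])) Y a m"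
  shows "es_sel (TypeA n) (mset (B @ [(r - 1, 1), (1, 1)])) (itilde r Y) a m"
    "es_app (TypeA n) (mset (B @ [(r - 1, 1), (1, 1)])) a m (itilde r Y) =
      itilde r (es_app (TypeA n) (mset (B @ [(r, 1)])) a m Y)"
proof -
  let ?T = "TypeA n" and ?p = "vacancy (TypeA n) (mset (B @ [(r, 1)])) (shape Y) a"
  have a: "a \<in> classical_nodes ?T" by (rule es_sel_node[OF assms(3,5)])
  have m: "0 < m" by (rule es_sel_length[OF assms(3,5)])
  have lab: "0 \<le> x" "0 < i" "x \<le> ?p i + 1" "x = ?p i + 1 \<Longrightarrow> m \<le> i" if "(i, x) \<in># Y a" for i x
    using nonneg_label[OF spec[OF assms(4)] that] assms(3,5) that by (auto simp: rc_ok_def es_sel_def)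
  have ge: "- 1 \<le> ?p i" for i
  proof (rule vacancy_ge[OF a])
    fix i assume "i \<in># shape Y a"
    then obtain x where "(i, x) \<in># Y a" by (rule shape_memE)
    then show "- 1 \<le> ?p i" using lab by fastforce
  qed simp
  have gt: "- 1 < ?p 1" if "1 < m"
  proof (rule concave_gt[where j = m and p = ?p])
    show "- 1 < ?p i \<or> concave_at ?p i" if i: "0 < i" "i < m" for i
    proof (cases "i \<in># shape Y a")
      case True
      then obtain x where "(i, x) \<in># Y a" by (rule shape_memE)
      from lab[OF this] show ?thesis using i(2) by fastforce
    next
      case False
      then show ?thesis using vacancy_concave[OF a i(1)] by blast
    qed
  qed (use ge that in auto)
  note v = itilde_vacancy[OF assms(1,2) a, of _ B Y]
  show "es_sel ?T (mset (B @ [(r - 1, 1), (1, 1)])) (itilde r Y) a m"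
    unfolding es_sel_def
  proof (intro conjI allI impI)
    show "(m, vacancy ?T (mset (B @ [(r - 1, 1), (1, 1)])) (shape (itilde r Y)) a m + 1) \<in># itilde r Y a"
      unfolding v[OF m] using assms(5) by (simp add: es_sel_def itilde_def)
    fix i x assume "(i, x) \<in># itilde r Y a"
    then have x: "(i, x) \<in># Y a \<or> i = 1 \<and> x = 0" by (auto simp: itilde_def split: if_splits)
    then have i: "0 < i" using lab(2) by auto
    show "x \<le> vacancy ?T (mset (B @ [(r - 1, 1), (1, 1)])) (shape (itilde r Y)) a i + 1"
      unfolding v[OF i] using x lab(3) ge[of 1] by fastforce
    show "m \<le> i" if "x = vacancy ?T (mset (B @ [(r - 1, 1), (1, 1)])) (shape (itilde r Y)) a i + 1"
      using x lab(4) gt that unfolding v[OF i] by fastforce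
  qed
  obtain N where N: "Y a = add_mset (m, ?p m + 1) N"
    using assms(5) multi_member_split[of "(m, ?p m + 1)" "Y a"] by (auto simp: es_sel_def)
  have "es_app ?T (mset (B @ [(r - 1, 1), (1, 1)])) a m (itilde r Y) b = itilde r (es_app ?T (mset (B @ [(r, 1)])) a m Y) b" for b
    unfolding es_app_def v[OF m] using N m v[of "m - 1"] by (auto simp: itilde_def)
  then show "es_app ?T (mset (B @ [(r - 1, 1), (1, 1)])) a m (itilde r Y) = itilde r (es_app ?T (mset (B @ [(r, 1)])) a m Y)" by blast
qed

lemma itilde_ibar:
  assumes "2 \<le> r" "r \<le> n" "2 \<le> q" "q \<le> n"
  shows "ibar (TypeA n) (mset ((q, 1) # B @ [(r - 1, 1), (1, 1)])) q (itilde r rc) =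
    itilde r (ibar (TypeA n) (mset ((q, 1) # B @ [(r, 1)])) q rc)"
proof
  fix a
  have "vacancy (TypeA n) (mset ((q, 1) # B @ [(r - 1, 1), (1, 1)])) (shape (itilde r rc)) a 1 =
      vacancy (TypeA n) (mset ((q, 1) # B @ [(r, 1)])) (shape rc) a 1" if "1 \<le> a" "a < q"
    using itilde_vacancy[OF assms(1,2), of a 1 "(q, 1) # B" rc] that assms(4) by (simp add: classical_nodes_def)
  then show "ibar (TypeA n) (mset ((q, 1) # B @ [(r - 1, 1), (1, 1)])) q (itilde r rc) a =
    itilde r (ibar (TypeA n) (mset ((q, 1) # B @ [(r, 1)])) q rc) a"
    by (subst (1 2) ibar_eq[OF assms(3,4)] | simp add: itilde_def ibar_eq[OF assms(3,4)] add_mset_commute)+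
qed

lemma rc_wt_itilde:
  assumes "2 \<le> r" "r \<le> n" "a \<in> classical_nodes (TypeA n)"
  shows "rc_wt (TypeA n) (mset (B @ [(r - 1, 1), (1, 1)])) (shape (itilde r rc)) a =
    rc_wt (TypeA n) (mset (B @ [(r, 1)])) (shape rc) a"
proof -
  obtain J where J: "\<And>i. J \<le> i \<Longrightarrow> vacancy (TypeA n) (mset (B @ [(r - 1, 1), (1, 1)])) (shape (itilde r rc)) a i =
      rc_wt (TypeA n) (mset (B @ [(r - 1, 1), (1, 1)])) (shape (itilde r rc)) a"
    using vacancy_limit by blast
  obtain K where K: "\<And>i. K \<le> i \<Longrightarrow> vacancy (TypeA n) (mset (B @ [(r, 1)])) (shape rc) a i = rc_wt (TypeA n) (mset (B @ [(r, 1)])) (shape rc) a"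
    using vacancy_limit by blast
  let ?i = "Suc (J + K)"
  show ?thesis using J[of ?i] K[of ?i] itilde_vacancy[OF assms, of ?i B rc] by simp
qed

context path_bijection
begin

theorem phi_rs:
  assumes "B @ [(r, s)] \<in> tensor_class T" "2 \<le> s" "b \<in> paths T (B @ [(r, s)])"
  shows "\<phi> (B @ [(r, s - 1), (r, 1)]) (rs b) = jtilde r s (\<phi> (B @ [(r, s)]) b)"
proof -
  have rs: "(r, s) \<in> KR_indices T" and B': "B @ [(r, s - 1), (r, 1)] \<in> tensor_class T"
    using assms(1,2) KR_indices_split[of r s T] by auto
  note p = path_rs[OF T assms(3,2)]
  show ?thesis
  proof (rule phi_right[OF assms(3,1) B' p(2)])
    show "rs b \<in> elements T (B @ [(r, s - 1), (r, 1)])" using p(1) by (simp add: paths_iff)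
    show "\<exists>v. reads T (B @ [(r, s - 1), (r, 1)]) v (jtilde r s (\<phi> (B @ [(r, s)]) b)) \<and> v @ [] = path_word b"
      unfolding jtilde_shift
    proof (rule reads_right[OF T, where C = "[(r, s)]" and F = "shift_labels (jtilde_shift r s)"])
      show "reads T (B @ [(r, s)]) (path_word b) (\<phi> (B @ [(r, s)]) b)" by (rule phi_reads[OF assms(1,3)])
      show "w_hw T (path_word b)" using assms(3) by (simp add: paths_iff)
    next
      fix w rc assume w: "reads T [(r, s)] w rc" "w_hw T w"
      obtain d where d: "d \<in> paths T [(r, s)]" "\<phi> [(r, s)] d = rc" "path_word d = w"
        using reads_phi[of "[(r, s)]" w rc] w rs by auto
      have rc: "rc = (\<lambda>_. {#})" using phi_single[OF rs d(1)] d(2) by simp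
      have q: "rs d \<in> paths T [(r, s - 1), (r, 1)]" "path_word (rs d) = path_word d"
        using path_rs[OF T _ assms(2), of d "[]" r] d(1) by auto
      have i: "(r, s - 1) \<in> KR_indices T" "(r, 1) \<in> KR_indices T" using B' by auto
      \<comment> \<open>Splitting a rectangle into two parts of the same height leaves the weight
        unchanged, so the empty configuration still has the required weight.\<close>
      have "\<phi> [(r, s - 1), (r, 1)] (rs d) = (\<lambda>_. {#})"
      proof (rule phi_pair[OF i q(1) empty_valid[OF T]])
        fix a assume a: "a \<in> classical_nodes T"
        have "rc_wt T (mset [(r, s)]) (shape (\<lambda>_. {#})) a = int (w_phi T a (path_word d))"
          using phi_valid(3)[of "[(r, s)]" d a] rs d a rc by simp
        then show "rc_wt T (mset [(r, s - 1), (r, 1)]) (shape (\<lambda>_. {#})) a = int (w_phi T a (path_word (rs d)))"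
          using assms(2) q(2) by (cases "a = r") (simp_all add: rc_wt_def)
      qed (simp add: rc_eps_empty)
      then have "reads T [(r, s - 1), (r, 1)] w (\<lambda>_. {#})"
        using phi_reads[of "[(r, s - 1), (r, 1)]" "rs d"] i q d(3) by simp
      then show "\<exists>v. reads T [(r, s - 1), (r, 1)] v (shift_labels (jtilde_shift r s) rc) \<and> v @ [] = w" by (simp add: rc)
    next
      fix B rc assume "rc_valid T (mset (B @ [(r, s)])) rc"
      then show "rc_valid T (mset (B @ [(r, s - 1), (r, 1)])) (shift_labels (jtilde_shift r s) rc)"
        by (rule label_shift.shift_valid[OF label_shift_jtilde[OF assms(2)]])
    next
      fix B Y a m assume "rc_ok T Y" "es_sel T (mset (B @ [(r, s)])) Y a m"
      from label_shift.shift_es[OF label_shift_jtilde[OF assms(2)] this]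
      show "es_sel T (mset (B @ [(r, s - 1), (r, 1)])) (shift_labels (jtilde_shift r s) Y) a m \<and>
        es_app T (mset (B @ [(r, s - 1), (r, 1)])) a m (shift_labels (jtilde_shift r s) Y) =
        shift_labels (jtilde_shift r s) (es_app T (mset (B @ [(r, s)])) a m Y)" by blast
    next
      fix n q B rc assume n: "T = TypeA n" "2 \<le> q" "q \<le> n"
      show "ibar T (mset ((q, 1) # B @ [(r, s - 1), (r, 1)])) q (shift_labels (jtilde_shift r s) rc) =
          shift_labels (jtilde_shift r s) (ibar T (mset ((q, 1) # B @ [(r, s)])) q rc)"
        unfolding n(1)
        by (rule label_shift_ibar[OF _ n(2,3)]) (use label_shift_jtilde[OF assms(2), of "TypeA n" r "(q, 1) # B"] in auto)
    qed
  qed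
qed

theorem phi_rb:
  assumes n: "T = TypeA n" and "B @ [(r, 1)] \<in> tensor_class T" "2 \<le> r" "b \<in> paths T (B @ [(r, 1)])"
  shows "\<phi> (B @ [(r - 1, 1), (1, 1)]) (rb b) = itilde r (\<phi> (B @ [(r, 1)]) b)"
proof -
  have r: "r \<le> n" using assms(2) n by (auto simp: KR_indices_def)
  have i: "(r, 1) \<in> KR_indices T" "(r - 1, 1) \<in> KR_indices T" "(1, 1) \<in> KR_indices T"
    and B': "B @ [(r - 1, 1), (1, 1)] \<in> tensor_class T"
    using assms(2,3) r n by (auto simp: KR_indices_def)
  note p = path_rb[OF T[unfolded n] assms(4)[unfolded n] assms(3), folded n]
  show ?thesis
  proof (rule phi_right[OF assms(4,2) B' p(2)])
    show "rb b \<in> elements T (B @ [(r - 1, 1), (1, 1)])" using p(1) by (simp add: paths_iff)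
    show "\<exists>v. reads T (B @ [(r - 1, 1), (1, 1)]) v (itilde r (\<phi> (B @ [(r, 1)]) b)) \<and> v @ [] = path_word b"
    proof (rule reads_right[OF T, where C = "[(r, 1)]" and F = "itilde r"])
      show "reads T (B @ [(r, 1)]) (path_word b) (\<phi> (B @ [(r, 1)]) b)" by (rule phi_reads[OF assms(2,4)])
      show "w_hw T (path_word b)" using assms(4) by (simp add: paths_iff)
    next
      fix w rc assume w: "reads T [(r, 1)] w rc" "w_hw T w"
      obtain d where d: "d \<in> paths T [(r, 1)]" "\<phi> [(r, 1)] d = rc" "path_word d = w"
        using reads_phi[of "[(r, 1)]" w rc] w i by auto
      have rc: "rc = (\<lambda>_. {#})" using phi_single[OF i(1) d(1)] d(2) by simp
      have q: "rb d \<in> paths T [(r - 1, 1), (1, 1)]" "path_word (rb d) = path_word d"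
        using path_rb[OF T[unfolded n], of d "[]" r] assms(3) d(1) n by auto
      have "\<phi> [(r - 1, 1), (1, 1)] (rb d) = itilde r rc"
      proof (rule phi_pair[OF i(2,3) q(1)])
        show "rc_valid T (mset [(r - 1, 1), (1, 1)]) (itilde r rc)"
          using itilde_valid[OF assms(3) r, of "[]" rc] empty_valid[OF T] rc_eps_empty n rc by simp
        show "nonneg (itilde r rc)" by (auto simp: rc itilde_def intro!: rc_eps_eqI split: if_splits)
        fix a assume a: "a \<in> classical_nodes T"
        have "rc_wt T (mset [(r, 1)]) (shape rc) a = int (w_phi T a (path_word d))"
          using phi_valid(3)[of "[(r, 1)]" d a] i d a by simp
        then show "rc_wt T (mset [(r - 1, 1), (1, 1)]) (shape (itilde r rc)) a = int (w_phi T a (path_word (rb d)))"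
          using rc_wt_itilde[OF assms(3) r, of a "[]" rc] a n q(2) by simp
      qed
      then have "reads T [(r - 1, 1), (1, 1)] w (itilde r rc)"
        using phi_reads[of "[(r - 1, 1), (1, 1)]" "rb d"] i q d(3) by simp
      then show "\<exists>v. reads T [(r - 1, 1), (1, 1)] v (itilde r rc) \<and> v @ [] = w" by simp
    next
      fix B rc assume "rc_valid T (mset (B @ [(r, 1)])) rc" "nonneg rc"
      then show "rc_valid T (mset (B @ [(r - 1, 1), (1, 1)])) (itilde r rc)"
        using itilde_valid[OF assms(3) r] n by simp
    next
      fix B Y a m assume Y: "rc_ok T Y" "nonneg Y" "es_sel T (mset (B @ [(r, 1)])) Y a m"
      from itilde_es[OF assms(3) r Y[unfolded n]]
      show "es_sel T (mset (B @ [(r - 1, 1), (1, 1)])) (itilde r Y) a m \<and>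
        es_app T (mset (B @ [(r - 1, 1), (1, 1)])) a m (itilde r Y) = itilde r (es_app T (mset (B @ [(r, 1)])) a m Y)"
        unfolding n by blast
    next
      fix m q B rc assume m: "T = TypeA m" "2 \<le> q" "q \<le> m"
      then show "ibar T (mset ((q, 1) # B @ [(r - 1, 1), (1, 1)])) q (itilde r rc) =
          itilde r (ibar T (mset ((q, 1) # B @ [(r, 1)])) q rc)"
        using itilde_ibar[OF assms(3) r, of q B rc] n by simp
    qed
  qed
qed

theorem phi_rh:
  assumes "B @ [(1, 1)] \<in> tensor_class T" "b \<in> paths T (B @ [(1, 1)])"
  shows "highest T (rh b) \<in> paths T B" "\<phi> B (highest T (rh b)) = deltatilde T (mset (B @ [(1, 1)])) (\<phi> (B @ [(1, 1)]) b)"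
proof -
  let ?L = "mset (B @ [(1, 1)])" and ?rc = "\<phi> (B @ [(1, 1)]) b"
  have B: "B \<in> tensor_class T" "(1, 1) \<in> KR_indices T" using assms(1) by auto
  note val = phi_valid(1,2)[OF assms]
  have ok: "rc_ok T ?rc" using val(1) by (simp add: rc_valid_def)
  obtain b' x where b: "b = b' @ [[[x]]]" "b' \<in> elements T B"
    using assms(2) unfolding paths_iff elements_append elements_Cons elements_Nil KR_box by blast
  have "\<exists>v. reads T (B @ []) v (shift_labels box_shift ?rc) \<and> v @ [1] = path_word b"
  proof (rule reads_right[OF T, where C = "[(1, 1)]" and F = "shift_labels box_shift"])
    show "reads T (B @ [(1, 1)]) (path_word b) ?rc" by (rule phi_reads[OF assms])
    show "w_hw T (path_word b)" using assms(2) by (simp add: paths_iff)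
  next
    fix w rc assume w: "reads T [(1, 1)] w rc" "w_hw T w"
    obtain d where d: "d \<in> paths T [(1, 1)]" "\<phi> [(1, 1)] d = rc" "path_word d = w"
      using reads_phi[of "[(1, 1)]" w rc] w B by auto
    have rc: "rc = (\<lambda>_. {#})" using phi_single[OF B(2) d(1)] d(2) by simp
    obtain y where y: "y \<in> letters T" "w = [y]"
      using d(1,3) unfolding paths_iff elements_Cons elements_Nil KR_box by auto
    \<comment> \<open>The letter on the far right of a highest weight word can be cancelled by
      nothing, so it is the letter 1; this is the lost part of the word.\<close>
    have "y = 1"
    proof (rule ccontr)
      assume "y \<noteq> 1"
      then obtain a where "a \<in> classical_nodes T" "letter_e T a y \<noteq> None" using letter_raisable[OF T y(1)] by blast
      then show False using w(2) unfolding y(2) w_hw_def by force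
    qed
    then show "\<exists>v. reads T [] v (shift_labels box_shift rc) \<and> v @ [1] = w" using reads_Nil[of T] y(2) rc by simp
  next
    fix B rc assume "rc_valid T (mset (B @ [(1, 1)])) rc"
    then show "rc_valid T (mset (B @ [])) (shift_labels box_shift rc)"
      by (rule label_shift.shift_valid[OF label_shift_box])
  next
    fix B Y a m assume "rc_ok T Y" "es_sel T (mset (B @ [(1, 1)])) Y a m"
    from label_shift.shift_es[OF label_shift_box this]
    show "es_sel T (mset (B @ [])) (shift_labels box_shift Y) a m \<and>
      es_app T (mset (B @ [])) a m (shift_labels box_shift Y) = shift_labels box_shift (es_app T (mset (B @ [(1, 1)])) a m Y)" by blast
  next
    fix n q B rc assume n: "T = TypeA n" "2 \<le> q" "q \<le> n"
    show "ibar T (mset ((q, 1) # B @ [])) q (shift_labels box_shift rc) =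
        shift_labels box_shift (ibar T (mset ((q, 1) # B @ [(1, 1)])) q rc)"
      unfolding n(1)
      by (rule label_shift_ibar[OF _ n(2,3)]) (use label_shift_box[of "TypeA n" "(q, 1) # B"] in auto)
  qed
  \<comment> \<open>The shift for the removed box is a composition of two conjugations. So the word
    without its last letter is read by \<open>theta\<close> of the very configuration from which
    \<delta> starts inside \<open>deltatilde\<close>.\<close>
  then obtain v where v: "reads T B v (theta T (mset B) (theta T ?L ?rc))" "v @ [1] = path_word b"
    unfolding theta_theta_box[OF ok] by auto
  have vb: "path_word (rh b) = v" using v(2) by (simp add: b(1) rh_def)
  have tv: "rc_valid T ?L (theta T ?L ?rc)" by (rule theta_valid[OF val])
  obtain z where z: "chain T (?L - {#(1, 1)#}) 1 (theta T ?L ?rc) z (deltabar T ?L (theta T ?L ?rc))"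
    "rc_valid T (?L - {#(1, 1)#}) (deltabar T ?L (theta T ?L ?rc))"
    using delta_chain[OF T tv] by auto
  have L: "?L - {#(1, 1)#} = mset B" by simp
  obtain v' where v': "(w_up T)\<^sup>*\<^sup>* v v'" "reads T B v' (theta T (mset B) (deltabar T ?L (theta T ?L ?rc)))"
    using theta_chain[OF z(1)[unfolded L] _ v(1) T] tv by (auto simp: rc_valid_def)
  have dt: "theta T (mset B) (deltabar T ?L (theta T ?L ?rc)) = deltatilde T ?L ?rc" unfolding deltatilde_def L ..
  have "w_hw T v'" using reads_nonneg[OF v'(2) T] theta_nonneg[OF z(2)] unfolding L by blast
  then obtain c where c: "c \<in> paths T B" "\<phi> B c = deltatilde T ?L ?rc" "path_word c = v'"
    using reads_phi[OF B(1) v'(2)] dt by auto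
  have "highest T (rh b) = c"
  proof (rule highest_up[OF T])
    show "(w_up T)\<^sup>*\<^sup>* (path_word (rh b)) (path_word c)" using v'(1) vb c(3) by simp
    show "path_lens c = path_lens (rh b)" using c(1) b elements_lens[of _ T B] by (simp add: paths_iff rh_def)
    show "w_hw T (path_word c)" using c(1) by (simp add: paths_iff)
  qed
  with c show "highest T (rh b) \<in> paths T B" "\<phi> B (highest T (rh b)) = deltatilde T ?L ?rc" by auto
qed

end

section \<open>Tableaux are closed under the operators\<close>

text \<open>The last clause, that no factor further left could have been selected, is what keeps
  tableaux semistandard under the operator.\<close>

lemma tensor_e_split:
  "tensor_e C i bs = Some cs \<Longrightarrow> \<exists>u x y v. bs = u @ x # v \<and> cs = u @ y # v \<and> cr_e C i x = Some y \<and>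
     tensor_phi C i v < cr_eps C i x \<and> (\<forall>u1 z u2. u = u1 @ z # u2 \<longrightarrow> cr_eps C i z \<le> tensor_phi C i (u2 @ x # v))"
proof (induction bs arbitrary: cs)
  case (Cons b bs)
  show ?case
  proof (cases "tensor_phi C i bs < cr_eps C i b")
    case True
    then obtain y where "cr_e C i b = Some y" "cs = y # bs" using Cons.prems by auto
    then show ?thesis using True
      by (intro exI[of _ "[]"] exI[of _ b] exI[of _ y] exI[of _ bs]) simp
  next
    case False
    then obtain cs' where cs: "tensor_e C i bs = Some cs'" "cs = b # cs'" using Cons.prems by auto
    from Cons.IH[OF cs(1)] obtain u x y v where *: "bs = u @ x # v" "cs' = u @ y # v" "cr_e C i x = Some y"
      "tensor_phi C i v < cr_eps C i x" "\<forall>u1 z u2. u = u1 @ z # u2 \<longrightarrow> cr_eps C i z \<le> tensor_phi C i (u2 @ x # v)" by blast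
    have "\<forall>u1 z u2. b # u = u1 @ z # u2 \<longrightarrow> cr_eps C i z \<le> tensor_phi C i (u2 @ x # v)"
    proof (intro allI impI)
      fix u1 z u2 assume u: "b # u = u1 @ z # u2"
      show "cr_eps C i z \<le> tensor_phi C i (u2 @ x # v)"
      proof (cases u1)
        case Nil
        then show ?thesis using u False *(1) by auto
      next
        case (Cons b' u1')
        then show ?thesis using u *(5) by auto
      qed
    qed
    then show ?thesis using *(1-4) cs(2)
      by (intro exI[of _ "b # u"] exI[of _ x] exI[of _ y] exI[of _ v]) simp
  qed
qed simp

lemma w_phi_A_pos: "int i + 1 \<notin> set v \<Longrightarrow> int i \<in> set v \<Longrightarrow> 0 < w_phi (TypeA n) i v"
  by (induction v) auto

lemma w_eps_A_pos: "int i \<notin> set v \<Longrightarrow> int i + 1 \<in> set v \<Longrightarrow> 0 < w_eps (TypeA n) i v"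
proof (induction v)
  case (Cons x v)
  have "int i \<notin> set v \<Longrightarrow> w_phi (TypeA n) i v = 0" by (induction v) auto
  with Cons show ?case by auto
qed simp

text \<open>Only the entry \<open>i + 1\<close> that becomes \<open>i\<close> matters. Within its
  column no \<open>i\<close> stands above it, since the selection rule leaves no \<open>phi\<close>
  there; towards the left the rows could fail only if a left neighbour were also
  \<open>i + 1\<close>.\<close>

lemma KR_A_e:
  assumes i: "1 \<le> i" "i \<le> n" and t: "t \<in> KR (TypeA n) (r, s)"
    and e: "tensor_e (tensor_crystal (letter_crystal (TypeA n))) i t = Some t'"
  shows "t' \<in> KR (TypeA n) (r, s)"
proof -
  let ?T = "TypeA n"
  obtain u C C' v where t1: "t = u @ C # v" "t' = u @ C' # v" "w_e ?T i C = Some C'"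
    "w_phi ?T i (concat v) < w_eps ?T i C"
    "\<And>u1 D u2. u = u1 @ D # u2 \<Longrightarrow> w_eps ?T i D \<le> w_phi ?T i (concat (u2 @ C # v))"
    using tensor_e_split[OF e] unfolding tensor_crystal_sel tensor_flatten by blast
  obtain c1 x y c2 where c: "C = c1 @ x # c2" "C' = c1 @ y # c2" "letter_e ?T i x = Some y"
    "w_phi ?T i c2 < (if letter_e ?T i x = None then 0 else 1)"
    using tensor_e_split[OF t1(3)] unfolding letter_crystal_sel by blast
  have x: "x = int i + 1" "y = int i" using c(3) by (auto split: if_splits)
  have K: "length E = r" "set E \<subseteq> {1..int n + 1}" "sorted_wrt (>) E" if "E \<in> set t" for E
    using t that by (auto simp: KR_A_iff)
  have Ct: "C \<in> set t" by (simp add: t1(1))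
  have sC: "\<forall>z\<in>set c1. int i + 1 < z" "\<forall>z\<in>set c2. z < int i + 1" "sorted_wrt (>) c1" "sorted_wrt (>) c2"
    "\<forall>a\<in>set c1. \<forall>b\<in>set c2. b < a"
    using K(3)[OF Ct] by (auto simp: c(1) x(1) sorted_wrt_append)
  have ic2: "int i \<notin> set c2"
  proof
    assume "int i \<in> set c2"
    then have "0 < w_phi ?T i c2" using sC(2) by (intro w_phi_A_pos) auto
    then show False using c(3,4) by simp
  qed
  have below: "z < int i" if "z \<in> set c2" for z using sC(2) ic2 that by (metis le_neq_trans zle_add1_eq_le)
  define k0 where "k0 = length c1"
  have k0: "C ! k0 = int i + 1" "k0 < r" using K(1)[OF Ct] by (auto simp: k0_def c(1) x(1))
  have row: "sorted (map (\<lambda>c. c ! k) t)" if "k < r" for k using t that by (auto simp: KR_A_iff)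
  have mono: "E ! k \<le> C ! k" if "E \<in> set u" "k < r" for E k
    using row[OF that(2)] that(1) by (auto simp: t1(1) sorted_append)
  have no_i: "w_phi ?T i E = 0 \<and> int i \<notin> set E \<and> int i + 1 \<in> set E" if E: "E \<in> set t" "E ! k0 = int i + 1" "\<And>k. k < r \<Longrightarrow> E ! k \<le> C ! k" for E
  proof -
    have "int i \<notin> set E"
    proof
      assume "int i \<in> set E"
      then obtain k where k: "k < r" "E ! k = int i" using K(1)[OF E(1)] by (metis in_set_conv_nth)
      have "k0 < k"
        using sorted_wrt_nth_less[OF K(3)[OF E(1)], of k k0] k k0(2) E(2) K(1)[OF E(1)] by (cases "k = k0"; cases "k < k0") auto
      then have "C ! k \<in> set c2" using k(1) K(1)[OF Ct] by (auto simp: c(1) nth_append k0_def nth_Cons split: nat.splits)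
      then show False using below E(3)[OF k(1)] k(2) by fastforce
    qed
    moreover have "int i + 1 \<in> set E" using E(2) k0(2) K(1)[OF E(1)] by (metis nth_mem)
    ultimately show ?thesis using strict_column_phi[OF K(3)[OF E(1)]] by blast
  qed
  have phiC: "w_phi ?T i C = 0" using no_i[OF Ct k0(1)] by blast
  \<comment> \<open>If \<open>D\<close> had \<open>i + 1\<close> in this row, so would all columns
    between it and \<open>C\<close>, each without an \<open>i\<close>. Nothing would then cancel the
    \<open>i + 1\<close> of \<open>D\<close>, and the operator would have acted further
    left.\<close>
  have left: "D ! k0 \<le> int i" if Du: "D \<in> set u" for D
  proof (rule ccontr)
    assume H: "\<not> D ! k0 \<le> int i"
    obtain u1 u2 where u: "u = u1 @ D # u2" using split_list[OF Du] by blast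
    have Dk: "D ! k0 = int i + 1" using H mono[OF Du k0(2)] k0(1) by simp
    have "w_phi ?T i E = 0" if "E \<in> set u2" for E
    proof -
      have "D ! k0 \<le> E ! k0" using row[OF k0(2)] that by (auto simp: t1(1) u sorted_append)
      then have "E ! k0 = int i + 1" using mono[of E k0] that k0 Dk by (simp add: u)
      then show ?thesis using no_i[of E] mono[of E] that by (simp add: t1(1) u)
    qed
    then have "w_phi ?T i (concat u2) = 0" by (rule w_phi_concat_zero)
    then have "w_phi ?T i (concat (u2 @ C # v)) = 0" using phiC t1(4) by (simp add: tensor_eps_phi_append)
    moreover have "0 < w_eps ?T i D"
      using no_i[of D] mono[of D] Dk Du by (intro w_eps_A_pos) (auto simp: t1(1) u)
    ultimately show False using t1(5)[OF u] by simp
  qed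
  have nth: "C' ! k = (if k = k0 then int i else C ! k)" for k
    by (auto simp: c(1,2) k0_def x nth_append nth_Cons split: nat.splits)
  show ?thesis
    unfolding KR_A_iff
  proof (intro conjI ballI allI impI)
    show "length t' = s" using t by (auto simp: KR_A_iff t1)
    fix E assume "E \<in> set t'"
    then consider "E \<in> set t" | "E = C'" by (auto simp: t1)
    then have "length E = r \<and> set E \<subseteq> {1..int n + 1} \<and> sorted_wrt (>) E"
    proof cases
      case 1
      then show ?thesis using K by blast
    next
      case 2
      then show ?thesis using K[OF Ct] sC below i by (fastforce simp: c x sorted_wrt_append)
    qed
    then show "length E = r" "set E \<subseteq> {1..int n + 1}" "sorted_wrt (>) E" by blast+
  next
    fix k assume k: "k < r"
    have "\<forall>D\<in>set u. D ! k \<le> C' ! k" using mono k left nth by auto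
    moreover have "C' ! k \<le> C ! k" using nth k0(1) by simp
    ultimately show "sorted (map (\<lambda>c. c ! k) t')" using row[OF k] by (fastforce simp: t1(1,2) sorted_append)
  qed
qed

lemma letter_e_step:
  assumes "i \<in> classical_nodes T" "valid_type T" "letter_e T i x = Some y" "x \<in> letters T"
  shows "letter_height T y = letter_height T x - 1"
  using assms [[linarith_neq_limit = 1]]
  by (cases rule: classical_nodes_cases) (auto simp: letter_height_def letters_def split: if_splits)

lemma w_phi_zero: "\<forall>t\<in>set u. letter_f T i t = None \<Longrightarrow> w_phi T i u = 0"
  by (induction u) auto

lemma KR_D_e:
  assumes i: "i \<in> classical_nodes (TypeD n)" and n: "4 \<le> n" and t: "t \<in> KR (TypeD n) (1, s)"
    and e: "tensor_e (tensor_crystal (letter_crystal (TypeD n))) i t = Some t'"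
  shows "t' \<in> KR (TypeD n) (1, s)"
proof -
  let ?T = "TypeD n"
  have T: "valid_type ?T" using n by simp
  have we: "w_e ?T i (concat t) = Some (concat t')" using tensor_e_flatten[of "letter_crystal ?T" i t] e by simp
  have lens: "map length t' = map length t"
    by (rule tensor_e_map[OF _ e]) (auto simp: tensor_e_length)
  obtain u x y v where w: "concat t = u @ x # v" "concat t' = u @ y # v" "letter_e ?T i x = Some y"
    "w_phi ?T i v < (if letter_e ?T i x = None then 0 else 1)"
    "\<And>u1 z u2. u = u1 @ z # u2 \<Longrightarrow> (if letter_e ?T i z = None then 0 else 1) \<le> w_phi ?T i (u2 @ x # v)"
    using tensor_e_split[OF we] unfolding letter_crystal_sel by blast
  have S: "sorted_wrt (letter_le ?T) (u @ x # v)" and L: "set (u @ x # v) \<subseteq> letters ?T"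
    using t unfolding One_nat_def KR_D_iff w(1) by auto
  have x: "x \<in> letters ?T" and y: "y \<in> letters ?T" using L letter_ef_letters(2)[OF i T _ w(3)] by auto
  have h: "letter_height ?T y = letter_height ?T x - 1" by (rule letter_e_step[OF i T w(3) x])
  have fx: "letter_f ?T i x = None" using letter_status(1)[OF i T, of x] w(3) by simp
  have phi: "w_phi ?T i (x # v) = 0" using w(3,4) fx by simp
  have left: "letter_le ?T z y" if z: "z \<in> set u" for z
  proof (rule ccontr)
    assume H: "\<not> letter_le ?T z y"
    obtain u1 u2 where u: "u = u1 @ z # u2" using z by (auto simp: in_set_conv_decomp)
    have zx: "letter_le ?T z x" using S by (auto simp: u sorted_wrt_append)
    have zl: "z \<in> letters ?T" using L by (auto simp: u)
    have ez: "letter_e ?T i z \<noteq> None"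
    proof (cases "z = x")
      case False
      \<comment> \<open>Heights drop by one under raising, so a letter below \<open>x\<close> but
        not below \<open>y\<close> has the height of \<open>y\<close>. This leaves the incomparable
        letters \<open>n\<close> and \<open>- n\<close>, and then the same node raises
        \<open>z\<close> too.\<close>
      then have "letter_height ?T z = letter_height ?T y" "z \<noteq> y" using zx H h unfolding letter_le_def by auto
      then have *: "z = int n \<and> y = - int n \<or> z = - int n \<and> y = int n"
        using zl y [[linarith_neq_limit = 1]] by (auto simp: letter_height_def letters_def split: if_splits)
      have "i \<le> n" using i by (simp add: classical_nodes_def)
      then have "z = int n \<and> i = n - 1 \<or> z = - int n \<and> i = n"
        using * w(3) n [[linarith_neq_limit = 1]] by (auto split: if_splits)
      then show ?thesis using n by auto
    qed (use w(3) in simp)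
    have "letter_f ?T i s = None" if "s \<in> set u2" for s
    proof -
      have "letter_le ?T z s" "letter_le ?T s x" using S that by (auto simp: u sorted_wrt_append)
      then have "s = z \<or> s = x" using H h unfolding letter_le_def by auto
      then show ?thesis using ez fx letter_status(1)[OF i T, of z] by metis
    qed
    then have "w_phi ?T i u2 = 0" by (intro w_phi_zero) auto
    then have "w_phi ?T i (u2 @ x # v) = 0" using phi by (simp only: tensor_eps_phi_append)
    then show False using w(5)[OF u] ez by (simp del: letter_e.simps)
  qed
  have right: "letter_le ?T y z" if "z \<in> set v" for z
  proof -
    have "letter_le ?T x z" using S that by (auto simp: sorted_wrt_append)
    then show ?thesis using h unfolding letter_le_def by auto
  qed
  have "sorted_wrt (letter_le ?T) (concat t')" using S left right unfolding w(2) by (auto simp: sorted_wrt_append)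
  moreover have "set (concat t') \<subseteq> letters ?T" using L y unfolding w(2) by auto
  moreover have "length t' = s" "\<forall>c\<in>set t'. length c = 1"
  proof -
    have "map length t' = replicate s 1" using KR_lens[OF t] lens by simp
    then show "length t' = s" "\<forall>c\<in>set t'. length c = 1"
      by (metis length_map length_replicate) (metis \<open>map length t' = replicate s 1\<close> in_set_replicate image_eqI list.set_map)
  qed
  ultimately show ?thesis unfolding One_nat_def KR_D_iff by simp
qed

lemma KR_e:
  assumes "i \<in> classical_nodes T" "valid_type T" "p \<in> KR_indices T" "t \<in> KR T p"
    and "tensor_e (tensor_crystal (letter_crystal T)) i t = Some t'"
  shows "t' \<in> KR T p"
proof (cases T)
  case (TypeA n)
  obtain r s where "p = (r, s)" by fastforce
  then show ?thesis using KR_A_e[of i n t r s t'] assms TypeA by (simp add: classical_nodes_def)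
next
  case (TypeD n)
  obtain s where "p = (1, s)" using assms(3) TypeD by (cases p) (auto simp: KR_indices_def)
  then show ?thesis using KR_D_e[of i n t s t'] assms TypeD by simp
qed

lemma elements_e:
  assumes "i \<in> classical_nodes T" "valid_type T" "B \<in> tensor_class T" "b \<in> elements T B" "cr_e (path_crystal T) i b = Some c"
  shows "c \<in> elements T B"
  using assms(3-5) unfolding path_crystal_eq[OF classical_node_pos[OF assms(1)]]
proof (induction B arbitrary: b c)
  case Nil
  then show ?case by (simp add: elements_Nil)
next
  case (Cons p B)
  then obtain t b' where b: "b = t # b'" "t \<in> KR T p" "b' \<in> elements T B" by (auto simp: elements_Cons)
  have p: "p \<in> KR_indices T" "B \<in> tensor_class T" using Cons.prems(1) by auto
  show ?case
    using Cons.prems(3) KR_e[OF assms(1,2) p(1) b(2)] Cons.IH[OF p(2) b(3)] b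
    by (auto simp: elements_Cons split: if_splits)
qed

lemma elements_up:
  assumes "valid_type T" "B \<in> tensor_class T" "b \<in> elements T B" "(w_up T)\<^sup>*\<^sup>* (path_word b) (path_word c)" "path_lens c = path_lens b"
  shows "c \<in> elements T B"
proof -
  have "\<exists>d. d \<in> elements T B \<and> path_word d = w \<and> path_lens d = path_lens b" if "(w_up T)\<^sup>*\<^sup>* (path_word b) w" for w
    using that
  proof (induction rule: rtranclp_induct)
    case base
    then show ?case using assms(3) by blast
  next
    case (step v w)
    then obtain d where d: "d \<in> elements T B" "path_word d = v" "path_lens d = path_lens b" by blast
    obtain i where i: "i \<in> classical_nodes T" "w_e T i (path_word d) = Some w" using step(2) d(2) by (auto simp: w_up_def)
    obtain d' where d': "cr_e (path_crystal T) i d = Some d'" "path_word d' = w" by (rule path_e_lift[OF i])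
    have "d' \<in> elements T B" by (rule elements_e[OF i(1) assms(1,2) d(1) d'(1)])
    moreover have "path_lens d' = path_lens b" using path_e_lens[OF classical_node_pos[OF i(1)] d'(1)] d(3) by simp
    ultimately show ?case using d'(2) by blast
  qed
  from this[OF assms(4)] obtain d where "d \<in> elements T B" "path_word d = path_word c" "path_lens d = path_lens b" by blast
  then show ?thesis using path_word_inj[of d c] assms(5) by simp
qed

lemma highest_paths:
  assumes "valid_type T" "B \<in> tensor_class T" "b \<in> elements T B"
  shows "highest T b \<in> paths T B"
  using elements_up[OF assms highest_props(3,4)[OF assms(1), of b]] highest_props(2)[OF assms(1), of b]
  by (simp add: paths_def)

section \<open>The involution on words\<close>

text \<open>The diagram automorphism given by minus the longest element of the Weyl group; in type D
  it is nontrivial for odd \<open>n\<close> only, exchanging the spin nodes.\<close>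

definition node_star :: "affine_type \<Rightarrow> nat \<Rightarrow> nat" where
  "node_star T i = (case T of TypeA n \<Rightarrow> n + 1 - i
    | TypeD n \<Rightarrow> if odd n \<and> i = n then n - 1 else if odd n \<and> i = n - 1 then n else i)"

definition word_star :: "affine_type \<Rightarrow> int list \<Rightarrow> int list" where
  "word_star T w = rev (map (letter_star T) w)"

lemma node_star: "i \<in> classical_nodes T \<Longrightarrow> valid_type T \<Longrightarrow> node_star T i \<in> classical_nodes T"
  by (cases T) (auto simp: node_star_def classical_nodes_def)

lemma letter_star_involution [simp]: "letter_star T (letter_star T x) = x"
  by (cases T) auto

lemma word_star_involution [simp]: "word_star T (word_star T w) = w"
  by (simp add: word_star_def rev_map comp_def)

lemma letter_star_ef:
  assumes "i \<in> classical_nodes T" "valid_type T"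
  shows "letter_e T (node_star T i) (letter_star T x) = map_option (letter_star T) (letter_f T i x)"
    "letter_f T (node_star T i) (letter_star T x) = map_option (letter_star T) (letter_e T i x)"
proof -
  have "letter_e T (node_star T i) (letter_star T x) = map_option (letter_star T) (letter_f T i x) \<and>
    letter_f T (node_star T i) (letter_star T x) = map_option (letter_star T) (letter_e T i x)"
    using assms
  proof (cases rule: classical_nodes_cases)
    case (A n)
    then show ?thesis by (auto simp: node_star_def of_nat_diff)
  next
    case (D n)
    show ?thesis
    proof (cases "odd n")
      case False
      then show ?thesis using D by (auto simp: node_star_def)
    next
      case True
      show ?thesis
      proof (cases "i = n - 1")
        case i: True
        obtain m where "n = Suc m" using D by (cases n) auto
        then have m: "n = Suc m" "i = m" using i by auto
        have "node_star T i = Suc m" using True m D by (simp add: node_star_def)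
        moreover have "x = int m \<or> x = - int (Suc m) \<or> x = int (Suc m) \<or> x = - int m \<or>
          x \<noteq> int m \<and> x \<noteq> - int (Suc m) \<and> x \<noteq> int (Suc m) \<and> x \<noteq> - int m" by blast
        ultimately show ?thesis using True m D by auto
      next
        case False
        then have "node_star T i = i" using D by (simp add: node_star_def)
        moreover have "x = int i \<or> x = - int i - 1 \<or> x = int i + 1 \<or> x = - int i \<or>
          x \<noteq> int i \<and> x \<noteq> - int i - 1 \<and> x \<noteq> int i + 1 \<and> x \<noteq> - int i" by blast
        ultimately show ?thesis using True D False by auto
      qed
    qed
  next
    case (Dn n)
    show ?thesis
    proof (cases "odd n")
      case False
      then show ?thesis using Dn by (auto simp: node_star_def)
    next
      case True
      obtain m where m: "n = Suc m" using Dn by (cases n) auto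
      have "node_star T i = m" using True m Dn by (simp add: node_star_def)
      moreover have "x = int m \<or> x = - int (Suc m) \<or> x = int (Suc m) \<or> x = - int m \<or>
        x \<noteq> int m \<and> x \<noteq> - int (Suc m) \<and> x \<noteq> int (Suc m) \<and> x \<noteq> - int m" by blast
      ultimately show ?thesis using True m Dn by auto
    qed
  qed
  then show "letter_e T (node_star T i) (letter_star T x) = map_option (letter_star T) (letter_f T i x)"
    "letter_f T (node_star T i) (letter_star T x) = map_option (letter_star T) (letter_e T i x)" by auto
qed

text \<open>The involution exchanges raising and lowering on letters, and the reversal of the word
  turns the tensor product rule into the one for the opposite operators.\<close>

lemma word_star_eps_phi:
  assumes "i \<in> classical_nodes T" "valid_type T"
  shows "w_eps T (node_star T i) (word_star T w) = w_phi T i w" "w_phi T (node_star T i) (word_star T w) = w_eps T i w"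
  by (induction w) (auto simp: word_star_def tensor_eps_phi_append letter_star_ef[OF assms])

lemma word_star_e:
  assumes "i \<in> classical_nodes T" "valid_type T"
  shows "w_e T (node_star T i) (word_star T w) = map_option (word_star T) (w_f T i w)"
proof (induction w)
  case (Cons x w)
  have s: "word_star T (x # w) = word_star T w @ [letter_star T x]" for x w by (simp add: word_star_def)
  show ?case
    unfolding s tensor_e_append word_star_eps_phi[OF assms] Cons.IH
    by (auto simp: letter_star_ef[OF assms] s option.map_comp comp_def)
qed (simp add: word_star_def)

lemma word_star_up:
  assumes "valid_type T" "(w_up T)\<^sup>*\<^sup>* v w"
  shows "(w_up T)\<^sup>*\<^sup>* (word_star T w) (word_star T v)"
  using assms(2)
proof (induction rule: rtranclp_induct)
  case (step u w)
  then obtain i where i: "i \<in> classical_nodes T" "w_e T i u = Some w" by (auto simp: w_up_def)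
  have "w_f T i w = Some u" using normal_atD(1)[OF normal_at_tensor[OF normal_at_letter[OF i(1) assms(1)]]] i(2) by simp
  then have "w_e T (node_star T i) (word_star T w) = Some (word_star T u)" using word_star_e[OF i(1) assms(1)] by simp
  then have "w_up T (word_star T w) (word_star T u)" using node_star[OF i(1) assms(1)] by (auto simp: w_up_def)
  then show ?case using step.IH by (rule converse_rtranclp_into_rtranclp)
qed simp

lemma path_word_star: "path_word (path_star T b) = word_star T (path_word b)"
proof -
  have "concat (tableau_star T t) = word_star T (concat t)" for t
    by (induction t) (simp_all add: tableau_star_def word_star_def)
  then show ?thesis by (induction b) (simp_all add: path_star_def word_star_def)
qed

lemma letter_star_letters: "valid_type T \<Longrightarrow> x \<in> letters T \<Longrightarrow> letter_star T x \<in> letters T"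
  by (cases T) (auto simp: letters_def)

lemma letter_star_le:
  assumes "4 \<le> n" "letter_le (TypeD n) x y" "x \<in> letters (TypeD n)" "y \<in> letters (TypeD n)"
  shows "letter_le (TypeD n) (letter_star (TypeD n) y) (letter_star (TypeD n) x)"
proof -
  have "letter_height (TypeD n) (letter_star (TypeD n) z) = 2 * int n - letter_height (TypeD n) z" if "z \<in> letters (TypeD n)" for z
    using that assms(1) by (auto simp: letter_height_def letters_def)
  then show ?thesis using assms(2-4) by (auto simp: letter_le_def simp del: letter_star.simps)
qed

lemma tableau_star_KR:
  assumes "valid_type T" "p \<in> KR_indices T" "t \<in> KR T p"
  shows "tableau_star T t \<in> KR T p"
proof (cases T)
  case (TypeA n)
  obtain r s where p: "p = (r, s)" by fastforce
  have K: "length c = r" "set c \<subseteq> {1..int n + 1}" "sorted_wrt (>) c" if "c \<in> set t" for c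
    using assms(3) that unfolding TypeA p KR_A_iff by auto
  let ?c = "\<lambda>c. rev (map (letter_star (TypeA n)) c)"
  have "length (?c c) = r \<and> set (?c c) \<subseteq> {1..int n + 1} \<and> sorted_wrt (>) (?c c)" if "c \<in> set t" for c
    using K[OF that] by (auto simp: sorted_wrt_rev sorted_wrt_map)
  moreover have "sorted (map (\<lambda>c. c ! k) (rev (map ?c t)))" if k: "k < r" for k
  proof -
    have "sorted (map (\<lambda>c. c ! (r - 1 - k)) t)" using assms(3) k unfolding TypeA p KR_A_iff by auto
    then have "sorted_wrt (\<lambda>c d. c ! (r - 1 - k) \<le> d ! (r - 1 - k)) t" by (simp add: sorted_map)
    then have "sorted_wrt (\<lambda>c d. ?c d ! k \<le> ?c c ! k) t"
      by (rule sorted_wrt_mono_rel[rotated]) (use K(1) k in \<open>simp add: rev_nth\<close>)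
    then show ?thesis unfolding sorted_map sorted_wrt_rev sorted_wrt_map by simp
  qed
  ultimately show ?thesis using assms(3) unfolding TypeA p KR_A_iff tableau_star_def by auto
next
  case (TypeD n)
  then have n: "4 \<le> n" using assms(1) by simp
  obtain s where p: "p = (1, s)" using assms(2) TypeD by (cases p) (auto simp: KR_indices_def)
  have t: "length t = s" "\<forall>c\<in>set t. length c = 1" "set (concat t) \<subseteq> letters T" "sorted_wrt (letter_le T) (concat t)"
    using assms(3) unfolding p TypeD One_nat_def KR_D_iff by auto
  have c: "concat (tableau_star T t) = word_star T (concat t)" using path_word_star[of T "[t]"] by (simp add: path_star_def)
  have "sorted_wrt (letter_le T) (word_star T (concat t))"
    unfolding word_star_def sorted_wrt_rev sorted_wrt_map
    by (rule sorted_wrt_mono_rel[OF _ t(4)]) (use letter_star_le[OF n] t(3) TypeD in blast)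
  moreover have "set (word_star T (concat t)) \<subseteq> letters T"
    using t(3) letter_star_letters[OF assms(1)] by (auto simp: word_star_def)
  ultimately show ?thesis
    using t unfolding p TypeD One_nat_def KR_D_iff c[unfolded TypeD] by (auto simp: tableau_star_def)
qed

lemma path_star_elements:
  assumes "valid_type T" "B \<in> tensor_class T" "b \<in> elements T B"
  shows "path_star T b \<in> elements T (rev B)"
  using assms(2,3)
proof (induction B arbitrary: b)
  case Nil
  then show ?case by (simp add: elements_Nil path_star_def)
next
  case (Cons p B)
  then obtain t b' where b: "b = t # b'" "t \<in> KR T p" "b' \<in> elements T B" by (auto simp: elements_Cons)
  have "path_star T b = path_star T b' @ [tableau_star T t]" by (simp add: b(1) path_star_def)
  moreover have "[tableau_star T t] \<in> elements T [p]"
    using tableau_star_KR[OF assms(1) _ b(2)] Cons.prems(1) by (simp add: elements_Cons elements_Nil)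
  ultimately show ?case using Cons.IH[OF _ b(3)] Cons.prems(1) by (auto intro: elements_appendI)
qed

section \<open>The weight of the highest weight vector of a dual component\<close>

definition content_rank :: "affine_type \<Rightarrow> nat" where
  "content_rank T = (case T of TypeA n \<Rightarrow> n + 1 | TypeD n \<Rightarrow> n)"

definition coord :: "nat \<Rightarrow> int \<Rightarrow> int" where
  "coord j x = (if x = int j then 1 else 0) - (if x = - int j then 1 else 0)"

text \<open>The weight in orthogonal coordinates; barred letters count negatively.\<close>

definition content :: "int list \<Rightarrow> nat \<Rightarrow> int" where
  "content w j = (\<Sum>x\<leftarrow>w. coord j x)"

lemma content_simps [simp]:
  "content [] j = 0" "content (x # w) j = coord j x + content w j" "content (v @ w) j = content v j + content w j"
  by (simp_all add: content_def)

text \<open>In orthogonal coordinates the simple root of node \<open>i\<close> is \<open>\<epsilon>\<^sub>p - s \<epsilon>\<^sub>q\<close> with \<open>s = 1\<close> or \<open>s = -1\<close>.\<close>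

definition root_p :: "affine_type \<Rightarrow> nat \<Rightarrow> nat" where
  "root_p T i = (if T = TypeD i then i - 1 else i)"

definition root_q :: "affine_type \<Rightarrow> nat \<Rightarrow> nat" where
  "root_q T i = (if T = TypeD i then i else i + 1)"

definition root_s :: "affine_type \<Rightarrow> nat \<Rightarrow> int" where
  "root_s T i = (if T = TypeD i then - 1 else 1)"

definition content_wt :: "affine_type \<Rightarrow> (nat \<Rightarrow> int) \<Rightarrow> nat \<Rightarrow> int" where
  "content_wt T X i = X (root_p T i) - root_s T i * X (root_q T i)"

lemma root_props:
  assumes "i \<in> classical_nodes T" "valid_type T"
  shows "root_p T i \<in> {1..content_rank T}" "root_q T i \<in> {1..content_rank T}" "root_p T i \<noteq> root_q T i"
    "root_s T i * root_s T i = 1" "\<bar>root_s T i\<bar> = 1"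
  using assms by (cases rule: classical_nodes_cases; auto simp: root_p_def root_q_def root_s_def content_rank_def)+

lemma letter_wt_coord:
  assumes "i \<in> classical_nodes T" "valid_type T" "x \<in> letters T"
  shows "letter_wt T i x = coord (root_p T i) x - root_s T i * coord (root_q T i) x"
  using assms [[linarith_neq_limit = 1]]
  by (cases rule: classical_nodes_cases)
    (auto simp: letter_wt_def root_p_def root_q_def root_s_def coord_def letters_def)

lemma coord_e:
  assumes "i \<in> classical_nodes T" "valid_type T" "x \<in> letters T" "letter_e T i x = Some y" "1 \<le> j"
  shows "coord j y = coord j x + (if j = root_p T i then 1 else 0) - (if j = root_q T i then root_s T i else 0)"
proof -
  have c: "coord j (int m) = (if j = m then 1 else 0)" "coord j (- int m) = (if j = m then - 1 else 0)" if "1 \<le> m" for m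
    using assms(5) that by (auto simp: coord_def)
  show ?thesis
    using assms(1,2)
  proof (cases rule: classical_nodes_cases)
    case (A n)
    then have "x = int (i + 1)" "y = int i" using assms(4) by (auto split: if_splits)
    then show ?thesis using A c[of i] c[of "i + 1"] by (simp add: root_p_def root_q_def root_s_def)
  next
    case (D n)
    then have "x = int (i + 1) \<and> y = int i \<or> x = - int i \<and> y = - int (i + 1)" using assms(4) by (auto split: if_splits)
    then show ?thesis using D c[of i] c[of "i + 1"] by (elim disjE conjE) (simp_all add: root_p_def root_q_def root_s_def)
  next
    case (Dn n)
    then have "x = - int n \<and> y = int (n - 1) \<or> x = - int (n - 1) \<and> y = int n" using assms(4) by (auto split: if_splits)
    then show ?thesis using Dn c[of n] c[of "n - 1"] by (elim disjE conjE) (simp_all add: root_p_def root_q_def root_s_def)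
  qed
qed

lemma content_weight:
  assumes "i \<in> classical_nodes T" "valid_type T" "set w \<subseteq> letters T"
  shows "int (w_phi T i w) - int (w_eps T i w) = content_wt T (content w) i"
  using assms(3)
proof (induction w)
  case (Cons x w)
  then show ?case using letter_wt_coord[OF assms(1,2), of x] unfolding w_wt_Cons by (simp add: content_wt_def algebra_simps)
qed (simp add: content_wt_def)

lemma content_e:
  assumes "i \<in> classical_nodes T" "valid_type T" "set w \<subseteq> letters T" "w_e T i w = Some v"
  shows "set v \<subseteq> letters T" "length v = length w"
    "1 \<le> j \<Longrightarrow> content v j = content w j + (if j = root_p T i then 1 else 0) - (if j = root_q T i then root_s T i else 0)"
proof -
  obtain u x y z where w: "w = u @ x # z" "v = u @ y # z" "letter_e T i x = Some y"
    using tensor_e_split[OF assms(4)] by auto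
  then show "set v \<subseteq> letters T" "length v = length w"
    using assms(3) letter_ef_letters(2)[OF assms(1,2) _ w(3)] by auto
  show "content v j = content w j + (if j = root_p T i then 1 else 0) - (if j = root_q T i then root_s T i else 0)" if "1 \<le> j"
    using coord_e[OF assms(1,2) _ w(3) that] assms(3) by (simp add: w(1,2))
qed

lemma content_power_e:
  assumes "i \<in> classical_nodes T" "valid_type T" "set w \<subseteq> letters T" "k \<le> w_eps T i w"
  shows "\<exists>v. (w_up T)\<^sup>*\<^sup>* w v \<and> set v \<subseteq> letters T \<and> length v = length w \<and>
    (\<forall>j\<ge>1. content v j = content w j + int k * ((if j = root_p T i then 1 else 0) - (if j = root_q T i then root_s T i else 0)))"
  using assms(3,4)
proof (induction k arbitrary: w)
  case 0
  then show ?case by auto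
next
  case (Suc k)
  then obtain v where v: "w_e T i w = Some v" using w_e_defined[OF assms(1,2), of w] by auto
  have "w_eps T i w = Suc (w_eps T i v)"
    using normal_atD(4)[OF normal_at_tensor[OF normal_at_letter[OF assms(1,2)]]] v by simp
  then have k: "k \<le> w_eps T i v" using Suc.prems(2) by simp
  note c = content_e[OF assms(1,2) Suc.prems(1) v]
  obtain u where u: "(w_up T)\<^sup>*\<^sup>* v u" "set u \<subseteq> letters T" "length u = length v"
    "\<forall>j\<ge>1. content u j = content v j + int k * ((if j = root_p T i then 1 else 0) - (if j = root_q T i then root_s T i else 0))"
    using Suc.IH[OF c(1) k] by blast
  have "w_up T w v" using v assms(1) by (auto simp: w_up_def)
  then have "(w_up T)\<^sup>*\<^sup>* w u" using u(1) by (rule converse_rtranclp_into_rtranclp)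
  moreover have "content u j = content w j + int (Suc k) * ((if j = root_p T i then 1 else 0) - (if j = root_q T i then root_s T i else 0))"
    if "1 \<le> j" for j using u(4) c(3)[OF that] that by (auto simp: algebra_simps)
  ultimately show ?case using u(2,3) c(2) by auto
qed

section \<open>Weyl group invariants and dominant weights\<close>

text \<open>Invariant under permutations and changes of sign. In type D only an even number of signs
  changes, and \<open>content_prod\<close> records the remaining sign; in type A the coordinates in
  question are nonnegative.\<close>

definition abs_content :: "affine_type \<Rightarrow> (nat \<Rightarrow> int) \<Rightarrow> int multiset" where
  "abs_content T X = image_mset (\<lambda>j. \<bar>X j\<bar>) (mset_set {1..content_rank T})"

definition content_prod :: "affine_type \<Rightarrow> (nat \<Rightarrow> int) \<Rightarrow> int" where
  "content_prod T X = (\<Prod>j\<in>{1..content_rank T}. X j)"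

lemma reflection_invariant:
  assumes "i \<in> classical_nodes T" "valid_type T"
    and "\<And>j. 1 \<le> j \<Longrightarrow> Y j = (if j = root_p T i then root_s T i * X (root_q T i)
       else if j = root_q T i then root_s T i * X (root_p T i) else X j)"
  shows "abs_content T Y = abs_content T X" "content_prod T Y = content_prod T X"
proof -
  let ?p = "root_p T i" and ?q = "root_q T i" and ?s = "root_s T i"
  note R = root_props[OF assms(1,2)]
  define S where "S = {1..content_rank T} - {?p, ?q}"
  have S: "{1..content_rank T} = insert ?p (insert ?q S)" "?p \<notin> S" "?q \<notin> S" "finite S"
    using R(1,2) by (auto simp: S_def)
  have Yp: "Y ?p = ?s * X ?q" "Y ?q = ?s * X ?p" using assms(3) R(1-3) by auto
  have Yj: "Y j = X j" if "j \<in> S" for j using assms(3)[of j] that by (auto simp: S_def)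
  have "image_mset (\<lambda>j. \<bar>Y j\<bar>) (mset_set S) = image_mset (\<lambda>j. \<bar>X j\<bar>) (mset_set S)"
    by (rule image_mset_cong) (use Yj S(4) in auto)
  then show "abs_content T Y = abs_content T X"
    using S R(3,5) Yp by (simp add: abs_content_def abs_mult add_mset_commute)
  have "(\<Prod>j\<in>S. Y j) = (\<Prod>j\<in>S. X j)" by (rule prod.cong) (use Yj in auto)
  moreover have "(?s * X ?q) * (?s * X ?p) = X ?p * X ?q" using R(4) by (metis mult.assoc mult.commute mult.left_commute mult_1)
  ultimately show "content_prod T Y = content_prod T X"
    using S R(3) Yp by (simp add: content_prod_def mult.assoc[symmetric])
qed

lemma w_up_word_height:
  assumes "valid_type T" "(w_up T)\<^sup>*\<^sup>* v w"
  shows "word_height T w \<le> word_height T v" "word_height T w = word_height T v \<Longrightarrow> w = v"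
proof -
  have "w = v \<or> word_height T w < word_height T v"
    using assms(2)
  proof (induction rule: rtranclp_induct)
    case (step u w)
    then show ?case using w_up_height[OF assms(1) step(2)] by auto
  qed simp
  then show "word_height T w \<le> word_height T v" "word_height T w = word_height T v \<Longrightarrow> w = v" by auto
qed

text \<open>Where the weight is negative, the raising operator can be applied as often as needed to
  realise the simple reflection. Invariants are kept and the height decreases, so a dominant weight
  is reached.\<close>

lemma raise_dominant:
  assumes "valid_type T" "set w \<subseteq> letters T"
  shows "\<exists>g. (w_up T)\<^sup>*\<^sup>* w g \<and> set g \<subseteq> letters T \<and> length g = length w \<and>
    (\<forall>i\<in>classical_nodes T. 0 \<le> content_wt T (content g) i) \<and>
    abs_content T (content g) = abs_content T (content w) \<and> content_prod T (content g) = content_prod T (content w)"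
  using assms(2)
proof (induction "word_height T w" arbitrary: w rule: less_induct)
  case less
  show ?case
  proof (cases "\<forall>i\<in>classical_nodes T. 0 \<le> content_wt T (content w) i")
    case True
    then show ?thesis using less.prems by blast
  next
    case False
    then obtain i where i: "i \<in> classical_nodes T" "content_wt T (content w) i < 0" by auto
    note R = root_props[OF i(1) assms(1)]
    let ?p = "root_p T i" and ?q = "root_q T i" and ?s = "root_s T i"
    \<comment> \<open>Minus the pairing with the coroot: this many raising steps carry the weight to
      its reflection, and \<open>eps\<close> is at least as large.\<close>
    define k where "k = nat (- content_wt T (content w) i)"
    have k: "int k = ?s * content w ?q - content w ?p" "0 < k" using i(2) by (auto simp: k_def content_wt_def)
    have "k \<le> w_eps T i w" using content_weight[OF i(1) assms(1) less.prems] by (simp add: k_def)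
    from content_power_e[OF i(1) assms(1) less.prems this]
    obtain v where v: "(w_up T)\<^sup>*\<^sup>* w v" "set v \<subseteq> letters T" "length v = length w"
      "\<And>j. 1 \<le> j \<Longrightarrow> content v j = content w j + int k * ((if j = ?p then 1 else 0) - (if j = ?q then ?s else 0))" by blast
    have sk: "content w ?q - int k * ?s = ?s * content w ?p"
      unfolding k(1) using R(4) by (simp add: algebra_simps)
    have refl_v: "content v j = (if j = ?p then ?s * content w ?q else if j = ?q then ?s * content w ?p else content w j)"
      if "1 \<le> j" for j
    proof (cases "j = ?p")
      case True
      then show ?thesis using v(4)[OF that] R(3) k(1) by simp
    next
      case False
      then show ?thesis using v(4)[OF that] R(3) sk by auto
    qed
    have inv: "abs_content T (content v) = abs_content T (content w)" "content_prod T (content v) = content_prod T (content w)"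
      by (rule reflection_invariant[OF i(1) assms(1)]; rule refl_v; assumption)+
    have "v \<noteq> w" using v(4)[of ?p] R(1,3) k(2) by auto
    then have "word_height T v < word_height T w" using w_up_word_height[OF assms(1) v(1)] by linarith
    from less.hyps[OF this v(2)] obtain g where g: "(w_up T)\<^sup>*\<^sup>* v g" "set g \<subseteq> letters T \<and> length g = length v \<and>
      (\<forall>i\<in>classical_nodes T. 0 \<le> content_wt T (content g) i) \<and>
      abs_content T (content g) = abs_content T (content v) \<and> content_prod T (content g) = content_prod T (content v)" by blast
    have "(w_up T)\<^sup>*\<^sup>* w g" using v(1) g(1) by simp
    with g(2) v(3) inv show ?thesis by (intro exI[of _ g]) simp
  qed
qed

lemma decreasing_unique:
  fixes f g :: "nat \<Rightarrow> int"
  assumes "\<And>j. 1 \<le> j \<Longrightarrow> j < N \<Longrightarrow> f (Suc j) \<le> f j" "\<And>j. 1 \<le> j \<Longrightarrow> j < N \<Longrightarrow> g (Suc j) \<le> g j"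
    and "image_mset f (mset_set {1..N}) = image_mset g (mset_set {1..N})" "j \<in> {1..N}"
  shows "f j = g j"
proof -
  have mono: "h j \<le> h i" if "\<And>j. 1 \<le> j \<Longrightarrow> j < N \<Longrightarrow> h (Suc j) \<le> h j" "1 \<le> i" "i \<le> j" "j \<le> N" for h :: "nat \<Rightarrow> int" and i j
    using that(3,4)
  proof (induction rule: dec_induct)
    case (step j)
    then show ?case using that(1)[of j] that(2) by simp
  qed simp
  have sorted: "sorted (rev (map h [1..<Suc N]))" if "\<And>j. 1 \<le> j \<Longrightarrow> j < N \<Longrightarrow> h (Suc j) \<le> h j" for h :: "nat \<Rightarrow> int"
    unfolding sorted_wrt_rev sorted_wrt_map
    by (rule sorted_wrt_mono_rel[OF _ sorted_wrt_upt]) (use mono[of h] that in auto)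
  have sorted_f: "sorted (rev (map f [1..<Suc N]))" by (rule sorted) (rule assms(1))
  have sorted_g: "sorted (rev (map g [1..<Suc N]))" by (rule sorted) (rule assms(2))
  have "mset (rev (map h [1..<Suc N])) = image_mset h (mset_set {1..N})" for h :: "nat \<Rightarrow> int"
    unfolding mset_rev mset_map mset_upt by (simp add: atLeastLessThanSuc_atLeastAtMost)
  then have "mset (rev (map f [1..<Suc N])) = mset (rev (map g [1..<Suc N]))" using assms(3) by simp
  then have "rev (map f [1..<Suc N]) = rev (map g [1..<Suc N])"
    using properties_for_sort sorted_f sorted_g by metis
  then have "map f [1..<Suc N] = map g [1..<Suc N]" by (simp only: rev_is_rev_conv)
  then have "\<forall>j\<in>set [1..<Suc N]. f j = g j" by (simp only: map_eq_conv)
  moreover have "j \<in> set [1..<Suc N]" using assms(4) by auto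
  ultimately show ?thesis by blast
qed

lemma dominant_D:
  assumes "4 \<le> n" "\<forall>i\<in>classical_nodes (TypeD n). 0 \<le> content_wt (TypeD n) X i"
  shows "1 \<le> j \<Longrightarrow> j < n \<Longrightarrow> X (Suc j) \<le> X j" "\<bar>X n\<bar> \<le> X (n - 1)" "1 \<le> j \<Longrightarrow> j < n \<Longrightarrow> 0 \<le> X j"
proof -
  have desc: "X (Suc i) \<le> X i" if "1 \<le> i" "i < n" for i
  proof -
    have "i \<in> classical_nodes (TypeD n)" using that by (simp add: classical_nodes_def)
    then have "0 \<le> content_wt (TypeD n) X i" using assms(2) by blast
    then show ?thesis using that by (simp add: content_wt_def root_p_def root_q_def root_s_def)
  qed
  then show "1 \<le> j \<Longrightarrow> j < n \<Longrightarrow> X (Suc j) \<le> X j" .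
  have "n \<in> classical_nodes (TypeD n)" using assms(1) by (simp add: classical_nodes_def)
  then have "0 \<le> content_wt (TypeD n) X n" using assms(2) by blast
  then have last: "0 \<le> X (n - 1) + X n" by (simp add: content_wt_def root_p_def root_q_def root_s_def)
  have "Suc (n - 1) = n" using assms(1) by simp
  then have "X n \<le> X (n - 1)" using desc[of "n - 1"] assms(1) by simp
  then show top: "\<bar>X n\<bar> \<le> X (n - 1)" using last by simp
  have "1 \<le> j \<Longrightarrow> 0 \<le> X j" if "j \<le> n - 1" for j
    using that
  proof (induction rule: inc_induct)
    case base
    then show ?case using top by simp
  next
    case (step i)
    have "X (Suc i) \<le> X i" by (rule desc) (use step in auto)
    then show ?case using step by simp
  qed
  then show "1 \<le> j \<Longrightarrow> j < n \<Longrightarrow> 0 \<le> X j" by simp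
qed

lemma dominant_decreasing:
  assumes "valid_type T" "\<forall>i\<in>classical_nodes T. 0 \<le> content_wt T X i" "\<And>n j. T = TypeA n \<Longrightarrow> 0 \<le> X j"
    and "1 \<le> j" "j < content_rank T"
  shows "\<bar>X (Suc j)\<bar> \<le> \<bar>X j\<bar>"
proof (cases T)
  case (TypeA n)
  then have "j \<in> classical_nodes T" using assms(4,5) by (simp add: classical_nodes_def content_rank_def)
  then have "0 \<le> content_wt T X j" using assms(2) by blast
  then show ?thesis using assms(3)[OF TypeA] TypeA by (simp add: content_wt_def root_p_def root_q_def root_s_def)
next
  case (TypeD n)
  then have j: "j < n" and n: "4 \<le> n" using assms(1,5) by (auto simp: content_rank_def)
  note D = dominant_D[OF n assms(2)[unfolded TypeD]]
  show ?thesis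
  proof (cases "Suc j = n")
    case True
    then show ?thesis using D(2) by auto
  next
    case False
    then show ?thesis using D(1,3)[of j] D(3)[of "Suc j"] assms(4) j by simp
  qed
qed

text \<open>Absolute values decrease along the coordinates of a dominant weight, so their multiset
  fixes each of them; only the sign of the last coordinate in type D is left to the product.\<close>

lemma dominant_unique:
  assumes T: "valid_type T"
    and X: "\<forall>i\<in>classical_nodes T. 0 \<le> content_wt T X i" "\<And>n j. T = TypeA n \<Longrightarrow> 0 \<le> X j"
    and Y: "\<forall>i\<in>classical_nodes T. 0 \<le> content_wt T Y i" "\<And>n j. T = TypeA n \<Longrightarrow> 0 \<le> Y j"
    and "abs_content T X = abs_content T Y" "content_prod T X = content_prod T Y" "j \<in> {1..content_rank T}"
  shows "X j = Y j"
proof -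
  note dX = dominant_decreasing[OF T X] and dY = dominant_decreasing[OF T Y]
  have abs: "\<bar>X j\<bar> = \<bar>Y j\<bar>" if "j \<in> {1..content_rank T}" for j
    by (rule decreasing_unique[where N = "content_rank T" and f = "\<lambda>j. \<bar>X j\<bar>" and g = "\<lambda>j. \<bar>Y j\<bar>"])
      (use dX dY assms(6) that in \<open>auto simp: abs_content_def\<close>)
  show ?thesis
  proof (cases T)
    case (TypeA n)
    then show ?thesis using abs[OF assms(8)] X(2) Y(2) by simp
  next
    case (TypeD n)
    then have n: "4 \<le> n" "content_rank T = n" using T by (auto simp: content_rank_def)
    have eq: "X i = Y i" if "1 \<le> i" "i < n" for i
      using abs[of i] dominant_D(3)[OF n(1), of X i] dominant_D(3)[OF n(1), of Y i] X(1) Y(1) that TypeD n(2) by simp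
    show ?thesis
    proof (cases "j = n")
      case False
      then show ?thesis using eq assms(8) n(2) by simp
    next
      case True
      have set: "{1..n} = insert n {1..n - 1}" using n(1) by auto
      have "X n * (\<Prod>i\<in>{1..n - 1}. X i) = Y n * (\<Prod>i\<in>{1..n - 1}. Y i)"
        using assms(7) n set by (simp add: content_prod_def)
      moreover have "(\<Prod>i\<in>{1..n - 1}. Y i) = (\<Prod>i\<in>{1..n - 1}. X i)" by (rule prod.cong) (use eq n(1) in auto)
      \<comment> \<open>If the product of the other coordinates vanishes, the product says nothing
        about the sign, but then the last coordinate, the smallest in absolute value, is 0.\<close>
      ultimately consider "X n = Y n" | "(\<Prod>i\<in>{1..n - 1}. X i) = 0" by auto
      then show ?thesis
      proof cases
        case 1
        then show ?thesis using True by simp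
      next
        case 2
        then obtain i where i: "1 \<le> i" "i \<le> n - 1" "X i = 0" by auto
        have "\<bar>X n\<bar> \<le> \<bar>X i\<bar>"
        proof -
          have "i \<le> n" using i(2) by simp
          then show ?thesis
          proof (induction rule: dec_induct)
            case (step m)
            have "\<bar>X (Suc m)\<bar> \<le> \<bar>X m\<bar>"
              by (rule dominant_decreasing[OF T X(1)]) (use step i(1) n(2) TypeD in auto)
            then show ?case using step by simp
          qed simp
        qed
        then have "X n = 0" using i(3) by simp
        then show ?thesis using abs[of n] True n by simp
      qed
    qed
  qed
qed

text \<open>In type A the coordinates are reversed. In type D they are negated, except for the last
  one when \<open>n\<close> is odd, so the number of changed signs is even.\<close>

lemma content_star:
  assumes "valid_type T" "set w \<subseteq> letters T"
  shows "abs_content T (content (word_star T w)) = abs_content T (content w)"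
    "content_prod T (content (word_star T w)) = content_prod T (content w)"
proof -
  have "abs_content T (content (word_star T w)) = abs_content T (content w) \<and>
    content_prod T (content (word_star T w)) = content_prod T (content w)"
  proof (cases T)
    case (TypeA n)
    have c: "content (word_star T w) j = content w (n + 2 - j)" if "j \<in> {1..n + 1}" for j
      using assms(2)
    proof (induction w)
      case (Cons x w)
      then have "1 \<le> x" "x \<le> int n + 1" using TypeA by (auto simp: letters_def)
      then have "coord j (letter_star T x) = coord (n + 2 - j) x" using that TypeA by (auto simp: coord_def of_nat_diff)
      then show ?case using Cons by (simp add: word_star_def)
    qed (simp add: word_star_def)
    have inj: "inj_on (\<lambda>j. n + 2 - j) {1..n + 1}" by (auto simp: inj_on_def)
    have im: "(\<lambda>j. n + 2 - j) ` {1..n + 1} = {1..n + 1}"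
    proof
      show "{1..n + 1} \<subseteq> (\<lambda>j. n + 2 - j) ` {1..n + 1}"
      proof
        fix j assume "j \<in> {1..n + 1}"
        then have "j = n + 2 - (n + 2 - j)" "n + 2 - j \<in> {1..n + 1}" by auto
        then show "j \<in> (\<lambda>j. n + 2 - j) ` {1..n + 1}" by blast
      qed
    qed auto
    have N: "content_rank T = n + 1" using TypeA by (simp add: content_rank_def)
    have "image_mset (\<lambda>j. \<bar>content (word_star T w) j\<bar>) (mset_set {1..n + 1}) =
        image_mset (\<lambda>j. \<bar>content w (n + 2 - j)\<bar>) (mset_set {1..n + 1})"
      by (rule image_mset_cong) (use c in auto)
    also have "\<dots> = image_mset (\<lambda>j. \<bar>content w j\<bar>) (image_mset (\<lambda>j. n + 2 - j) (mset_set {1..n + 1}))"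
      by (simp add: image_mset.compositionality comp_def)
    also have "image_mset (\<lambda>j. n + 2 - j) (mset_set {1..n + 1}) = mset_set {1..n + 1}"
      unfolding image_mset_mset_set[OF inj] im ..
    finally have 1: "abs_content T (content (word_star T w)) = abs_content T (content w)" unfolding abs_content_def N .
    have "(\<Prod>j\<in>{1..n + 1}. content (word_star T w) j) = (\<Prod>j\<in>{1..n + 1}. content w (n + 2 - j))"
      by (rule prod.cong) (use c in auto)
    also have "\<dots> = (\<Prod>j\<in>(\<lambda>j. n + 2 - j) ` {1..n + 1}. content w j)" using prod.reindex[OF inj, of "content w"] by (simp add: comp_def)
    finally have "content_prod T (content (word_star T w)) = content_prod T (content w)" unfolding content_prod_def N im .
    with 1 show ?thesis by blast
  next
    case (TypeD n)
    then have n: "4 \<le> n" "content_rank T = n" using assms(1) by (auto simp: content_rank_def)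
    define s where "s j = (if odd n \<and> j = n then 1 else - 1 :: int)" for j
    have c: "content (word_star T w) j = s j * content w j" if "1 \<le> j" for j
    proof (induction w)
      case (Cons x w)
      have "coord j (letter_star T x) = s j * coord j x" using that TypeD by (auto simp: coord_def s_def)
      then show ?case using Cons by (simp add: word_star_def algebra_simps)
    qed (simp add: word_star_def)
    have "abs_content T (content (word_star T w)) = abs_content T (content w)"
      unfolding abs_content_def by (rule image_mset_cong) (auto simp: c s_def)
    moreover have "(\<Prod>j\<in>{1..n}. s j) = 1"
    proof (cases "odd n")
      case True
      have "{1..n} = insert n {1..n - 1}" using n(1) by auto
      then have "(\<Prod>j\<in>{1..n}. s j) = s n * (\<Prod>j\<in>{1..n - 1}. s j)" using n(1) by simp
      also have "(\<Prod>j\<in>{1..n - 1}. s j) = (\<Prod>j\<in>{1..n - 1}. - 1)" by (rule prod.cong) (use n(1) in \<open>auto simp: s_def\<close>)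
      finally show ?thesis using True by (simp add: s_def)
    next
      case False
      then have "(\<Prod>j\<in>{1..n}. s j) = (- 1) ^ n" by (simp add: s_def)
      then show ?thesis using False by simp
    qed
    moreover have "(\<Prod>j\<in>{1..n}. content (word_star T w) j) = (\<Prod>j\<in>{1..n}. s j * content w j)"
      by (rule prod.cong) (use c in auto)
    ultimately show ?thesis unfolding content_prod_def n(2) by (simp add: prod.distrib)
  qed
  then show "abs_content T (content (word_star T w)) = abs_content T (content w)"
    "content_prod T (content (word_star T w)) = content_prod T (content w)" by auto
qed

text \<open>The height is an affine function of the coordinates, so the height of a word depends on
  its length and content only.\<close>

lemma letter_height_coord:
  assumes "valid_type T"
  shows "\<exists>c k. \<forall>x\<in>letters T. letter_height T x = c + (\<Sum>j\<in>{1..content_rank T}. k j * coord j x)"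
proof -
  have sum: "(\<Sum>j\<in>{1..N}. k j * coord j (int m)) = k m" "(\<Sum>j\<in>{1..N}. k j * coord j (- int m)) = - k m"
    if "1 \<le> m" "m \<le> N" for k :: "nat \<Rightarrow> int" and m N
  proof -
    have "(\<Sum>j\<in>{1..N}. k j * coord j (int m)) = (\<Sum>j\<in>{1..N}. if j = m then k m else 0)"
      "(\<Sum>j\<in>{1..N}. k j * coord j (- int m)) = (\<Sum>j\<in>{1..N}. if j = m then - k m else 0)"
      by (rule sum.cong; use that in \<open>auto simp: coord_def\<close>)+
    then show "(\<Sum>j\<in>{1..N}. k j * coord j (int m)) = k m" "(\<Sum>j\<in>{1..N}. k j * coord j (- int m)) = - k m"
      using that by auto
  qed
  show ?thesis
  proof (cases T)
    case (TypeA n)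
    have "\<forall>x\<in>letters T. letter_height T x = 0 + (\<Sum>j\<in>{1..content_rank T}. int j * coord j x)"
    proof
      fix x assume x: "x \<in> letters T"
      then obtain m where m: "x = int m" "1 \<le> m" "m \<le> n + 1"
        using TypeA zero_le_imp_eq_int[of x] by (auto simp: letters_def)
      then show "letter_height T x = 0 + (\<Sum>j\<in>{1..content_rank T}. int j * coord j x)"
        using sum(1)[of m "n + 1" int] TypeA by (simp add: letter_height_def content_rank_def)
    qed
    then show ?thesis by blast
  next
    case (TypeD n)
    have "\<forall>x\<in>letters T. letter_height T x = int n + (\<Sum>j\<in>{1..content_rank T}. (int j - int n) * coord j x)"
    proof
      fix x assume x: "x \<in> letters T"
      then consider m where "x = int m" "1 \<le> m" "m \<le> n" | m where "x = - int m" "1 \<le> m" "m \<le> n"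
        using TypeD that(1)[of "nat x"] that(2)[of "nat (- x)"] by (auto simp: letters_def)
      then show "letter_height T x = int n + (\<Sum>j\<in>{1..content_rank T}. (int j - int n) * coord j x)"
        using sum[of _ n "\<lambda>j. int j - int n"] TypeD by cases (simp_all add: letter_height_def content_rank_def)
    qed
    then show ?thesis by (intro exI[of _ "int n"] exI[of _ "\<lambda>j. int j - int n"])
  qed
qed

lemma word_height_content:
  assumes "valid_type T" "set v \<subseteq> letters T" "set w \<subseteq> letters T" "length v = length w"
    and "\<And>j. j \<in> {1..content_rank T} \<Longrightarrow> content v j = content w j"
  shows "word_height T v = word_height T w"
proof -
  obtain c k where ck: "\<forall>x\<in>letters T. letter_height T x = c + (\<Sum>j\<in>{1..content_rank T}. k j * coord j x)"
    using letter_height_coord[OF assms(1)] by blast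
  have "int (word_height T u) = c * int (length u) + (\<Sum>j\<in>{1..content_rank T}. k j * content u j)" if "set u \<subseteq> letters T" for u
    using that
  proof (induction u)
    case (Cons x u)
    then have x: "x \<in> letters T" by simp
    have "0 \<le> letter_height T x" using x by (cases T) (auto simp: letter_height_def letters_def)
    then have "int (nat (letter_height T x)) = c + (\<Sum>j\<in>{1..content_rank T}. k j * coord j x)" using ck x by simp
    then show ?case using Cons by (simp add: word_height_def algebra_simps sum.distrib)
  qed (simp add: word_height_def)
  moreover have "(\<Sum>j\<in>{1..content_rank T}. k j * content v j) = (\<Sum>j\<in>{1..content_rank T}. k j * content w j)"
    by (rule sum.cong) (use assms(5) in auto)
  ultimately have "int (word_height T v) = int (word_height T w)" using assms(2-4) by simp
  then show ?thesis by simp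
qed

lemma content_A_nonneg:
  assumes "set w \<subseteq> letters (TypeA n)"
  shows "0 \<le> content w j"
  using assms
proof (induction w)
  case (Cons x w)
  then have "0 \<le> coord j x" by (auto simp: coord_def letters_def)
  then show ?case using Cons by simp
qed simp

lemma w_hw_dominant:
  assumes "valid_type T" "set w \<subseteq> letters T" "w_hw T w"
  shows "\<forall>i\<in>classical_nodes T. 0 \<le> content_wt T (content w) i"
  using content_weight[OF _ assms(1,2)] assms(3) unfolding w_hw_def
  by (metis diff_zero of_nat_0 of_nat_0_le_iff)

text \<open>The dual word can be raised to a word \<open>g\<close> of dominant weight in the Weyl
  orbit of its own weight; that dominant weight is the weight of \<open>w\<close>. By confluence
  \<open>g\<close> still lies below \<open>h\<close>.\<close>

lemma star_raise:
  assumes "valid_type T" "set w \<subseteq> letters T" "w_hw T w" "(w_up T)\<^sup>*\<^sup>* (word_star T w) h" "w_hw T h"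
  shows "\<exists>g. (w_up T)\<^sup>*\<^sup>* g h \<and> (\<forall>j\<in>{1..content_rank T}. content g j = content w j) \<and> word_height T g = word_height T w"
proof -
  have sl: "set (word_star T w) \<subseteq> letters T" using assms(2) letter_star_letters[OF assms(1)] by (auto simp: word_star_def)
  obtain g where g: "(w_up T)\<^sup>*\<^sup>* (word_star T w) g" "set g \<subseteq> letters T" "length g = length (word_star T w)"
    "\<forall>i\<in>classical_nodes T. 0 \<le> content_wt T (content g) i"
    "abs_content T (content g) = abs_content T (content (word_star T w))"
    "content_prod T (content g) = content_prod T (content (word_star T w))"
    using raise_dominant[OF assms(1) sl] by blast
  obtain h' where h': "(w_up T)\<^sup>*\<^sup>* g h'" "w_hw T h'" using w_raise[OF assms(1)] by blast
  have "(w_up T)\<^sup>*\<^sup>* (word_star T w) h'" using g(1) h'(1) by simp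
  then have "h' = h" using w_raise_unique[OF assms(1) _ h'(2) assms(4,5)] by blast
  moreover have c: "content g j = content w j" if "j \<in> {1..content_rank T}" for j
    by (rule dominant_unique[OF assms(1) g(4) _ w_hw_dominant[OF assms(1-3)] _ _ _ that])
      (use g(2,5,6) assms(2) content_star[OF assms(1,2)] content_A_nonneg in auto)
  moreover have "word_height T g = word_height T w"
    by (rule word_height_content[OF assms(1) g(2) assms(2)]) (use g(3) c in \<open>auto simp: word_star_def\<close>)
  ultimately show ?thesis using h'(1) by blast
qed

text \<open>By \<open>star_raise\<close> the height of \<open>h\<close> is at most that of
  \<open>w\<close>. The same argument from \<open>h\<close> back to \<open>w\<close> gives the
  opposite inequality, so nothing remains to be raised from \<open>g\<close> to \<open>h\<close>,
  and the weights agree.\<close>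

theorem star_weight:
  assumes "valid_type T" "set w \<subseteq> letters T" "w_hw T w" "(w_up T)\<^sup>*\<^sup>* (word_star T w) h" "set h \<subseteq> letters T" "w_hw T h"
    and a: "a \<in> classical_nodes T"
  shows "w_phi T a h = w_phi T a w"
proof -
  obtain g where g: "(w_up T)\<^sup>*\<^sup>* g h" "\<forall>j\<in>{1..content_rank T}. content g j = content w j" "word_height T g = word_height T w"
    using star_raise[OF assms(1-4,6)] by blast
  have "(w_up T)\<^sup>*\<^sup>* (word_star T h) w" using word_star_up[OF assms(1,4)] by simp
  then obtain g' where g': "(w_up T)\<^sup>*\<^sup>* g' w" "word_height T g' = word_height T h"
    using star_raise[OF assms(1,5,6) _ assms(3)] by blast
  have "h = g" using w_up_word_height[OF assms(1) g(1)] w_up_word_height(1)[OF assms(1) g'(1)] g(3) g'(2) by simp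
  then have "content_wt T (content h) a = content_wt T (content w) a"
    using g(2) root_props(1,2)[OF a assms(1)] by (simp add: content_wt_def)
  then show ?thesis
    using content_weight[OF a assms(1,5)] content_weight[OF a assms(1,2)] assms(3,6) a by (simp add: w_hw_def)
qed

section \<open>The involution and the combinatorial R-matrices\<close>

lemma elements_letters: "b \<in> elements T B \<Longrightarrow> set (path_word b) \<subseteq> letters T"
proof (induction B arbitrary: b)
  case (Cons p B)
  then obtain t b' where b: "b = t # b'" "t \<in> KR T p" "b' \<in> elements T B" by (auto simp: elements_Cons)
  then show ?case using Cons.IH[OF b(3)] by (fastforce simp: KR_def)
qed (simp add: elements_Nil)

text \<open>Each raising step acts either on the last letter or on the rest, where it is a raising
  step by itself. Hence dropping the right factor respects raising.\<close>

lemma w_up_butlast: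
  assumes "(w_up T)\<^sup>*\<^sup>* (v @ [z]) w"
  shows "(w_up T)\<^sup>*\<^sup>* v (butlast w) \<and> w \<noteq> []"
  using assms
proof (induction rule: rtranclp_induct)
  case (step w w')
  then obtain u y where w: "w = u @ [y]" by (cases w rule: rev_cases) auto
  obtain i where i: "i \<in> classical_nodes T" "w_e T i (u @ [y]) = Some w'" using step(2) w by (auto simp: w_up_def)
  then have "(\<exists>u'. w_e T i u = Some u' \<and> w' = u' @ [y]) \<or> (\<exists>y'. w' = u @ [y'])"
    unfolding tensor_e_append by (auto split: if_splits)
  then have "(butlast w' = u \<or> w_up T u (butlast w')) \<and> w' \<noteq> []" using i(1) by (auto simp: w_up_def)
  then show ?case using step.IH w by (auto intro: rtranclp.rtrancl_into_rtrancl)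
qed simp

lemma theta_shift:
  assumes "label_shift T g L L'" "rc_ok T rc"
  shows "theta T L' rc = shift_labels g (theta T L rc)"
proof -
  have "0 < i" if "(i, x) \<in># rc a" for a i x using assms(2) that by (auto simp: rc_ok_def)
  then show ?thesis
    using label_shift.vac[OF assms(1)]
    by (auto simp: fun_eq_iff theta_def shift_labels_def image_mset.compositionality comp_def intro!: image_mset_cong)
qed

lemma itilde_inj: "itilde r rc = itilde r rc' \<Longrightarrow> rc = rc'"
proof
  fix a assume "itilde r rc = itilde r rc'"
  from fun_cong[OF this, of a] show "rc a = rc' a" by (auto simp: itilde_def split: if_splits)
qed

lemma ibar_inj:
  assumes "2 \<le> r" "r \<le> n" "(r, 1) \<in># L" "ibar (TypeA n) L r rc = ibar (TypeA n) L r rc'"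
  shows "rc = rc'"
proof
  have "shape (ibar (TypeA n) L r rc) a = shape (ibar (TypeA n) L r rc') a" for a using assms(4) by simp
  then have "shape rc a = shape rc' a" for a
    unfolding shape_ibar[OF assms(1-3)] by (metis add_mset_eq_singleton_iff add_mset_add_single union_right_cancel)
  then have sh: "shape rc = shape rc'" by blast
  fix a
  show "rc a = rc' a" using fun_cong[OF assms(4), of a] unfolding ibar_eq[OF assms(1-3)] sh by (auto split: if_splits)
qed

text \<open>The vacancy numbers are unchanged, so conjugation turns the added singular strings into
  cosingular ones.\<close>

lemma theta_ibar:
  assumes "2 \<le> r" "r \<le> n" "rc_ok (TypeA n) rc"
  shows "theta (TypeA n) (mset ((1, 1) # (r - 1, 1) # B)) (ibar (TypeA n) (mset ((r, 1) # B)) r rc) =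
    itilde r (theta (TypeA n) (mset ((r, 1) # B)) rc)"
proof
  fix a
  let ?L = "mset ((r, 1) # B)" and ?L' = "mset ((1, 1) # (r - 1, 1) # B)"
  have m: "(r, 1) \<in># ?L" by simp
  have L: "?L' = ?L - {#(r, 1)#} + {#(1, 1), (r - 1, 1)#}" by simp
  show "theta (TypeA n) ?L' (ibar (TypeA n) ?L r rc) a = itilde r (theta (TypeA n) ?L rc) a"
  proof (cases "a \<in> classical_nodes (TypeA n)")
    case True
    have v: "vacancy (TypeA n) ?L' (shape (ibar (TypeA n) ?L r rc)) a i = vacancy (TypeA n) ?L (shape rc) a i" if "0 < i" for i
      using ibar_vacancy[OF assms(1,2) _ _ _ m, of a i "shape rc"] that True
      unfolding L shape_ibar[OF assms(1,2) m] by (simp add: classical_nodes_def)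
    have pos: "0 < i" if "(i, x) \<in># rc a" for i x using assms(3) that by (auto simp: rc_ok_def)
    show ?thesis
      using v pos unfolding theta_def itilde_def ibar_eq[OF assms(1,2) m]
      by (auto intro!: image_mset_cong)
  next
    case False
    then show ?thesis using assms
      unfolding theta_def itilde_def ibar_eq[OF assms(1,2) m] by (auto simp: classical_nodes_def rc_ok_def)
  qed
qed

lemma cell_measure_right:
  "cell_measure B < cell_measure (B @ [(1, 1)])"
  "2 \<le> s \<Longrightarrow> 1 \<le> r \<Longrightarrow> cell_measure (B @ [(r, s - 1), (r, 1)]) < cell_measure (B @ [(r, s)])"
  "2 \<le> r \<Longrightarrow> cell_measure (B @ [(r - 1, 1), (1, 1)]) < cell_measure (B @ [(r, 1)])"
  using cell_measure_simps(1)[of "[]"] cell_measure_simps(2)[of s r "[]"] cell_measure_simps(3)[of r "[]"]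
  by (simp_all add: cell_measure_def)

context path_bijection
begin

text \<open>The images determine the paths without their first letters; the weights then determine
  the weight of the first letter, hence the letter.\<close>

lemma deltabar_inj:
  assumes "(1, 1) # B \<in> tensor_class T" "b \<in> paths T ((1, 1) # B)" "c \<in> paths T ((1, 1) # B)"
    and "deltabar T (mset ((1, 1) # B)) (\<phi> ((1, 1) # B) b) = deltabar T (mset ((1, 1) # B)) (\<phi> ((1, 1) # B) c)"
    and "\<And>a. a \<in> classical_nodes T \<Longrightarrow> w_phi T a (path_word b) = w_phi T a (path_word c)"
  shows "b = c"
proof -
  obtain x where x: "x \<in> letters T" "b = [[x]] # lh b" "lh b \<in> paths T B" "path_word b = x # path_word (lh b)"
    using path_lh[OF T assms(2)] by blast
  obtain y where y: "y \<in> letters T" "c = [[y]] # lh c" "lh c \<in> paths T B" "path_word c = y # path_word (lh c)"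
    using path_lh[OF T assms(3)] by blast
  have B: "B \<in> tensor_class T" using assms(1) by simp
  have "\<phi> B (lh b) = \<phi> B (lh c)" using phi_lh[OF assms(1,2)] phi_lh[OF assms(1,3)] assms(4) by simp
  then have eq: "lh b = lh c" using phi_inj[OF B x(3) y(3)] by blast
  have "x = y"
  proof (rule letter_wt_inj[OF T x(1) y(1)])
    fix a assume a: "a \<in> classical_nodes T"
    have "w_eps T a (x # path_word (lh b)) = 0" "w_eps T a (y # path_word (lh b)) = 0"
      using assms(2,3) a x(4) y(4) eq by (auto simp: paths_iff w_hw_def simp del: tensor_eps.simps)
    then show "letter_wt T a x = letter_wt T a y"
      using w_wt_Cons[of T a x "path_word (lh b)"] w_wt_Cons[of T a y "path_word (lh b)"] assms(5)[OF a] x(4) y(4) eq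
      by (simp del: tensor_eps.simps tensor_phi.simps)
  qed
  then show ?thesis using x(2) y(2) eq by simp
qed

text \<open>Rigged configurations depend only on the multiset of factors, so the conjugate is the
  image of a path for any order of the factors, with the same weight since the shapes agree.\<close>

lemma phi_theta:
  assumes "B \<in> tensor_class T" "b \<in> paths T B" "B' \<in> tensor_class T" "mset B' = mset B"
  obtains c where "c \<in> paths T B'" "\<phi> B' c = theta T (mset B) (\<phi> B b)"
    "\<And>a. a \<in> classical_nodes T \<Longrightarrow> w_phi T a (path_word c) = w_phi T a (path_word b)"
proof -
  note v = phi_valid[OF assms(1,2)]
  obtain c where c: "c \<in> paths T B'" "\<phi> B' c = theta T (mset B) (\<phi> B b)"
    using phi_surj[OF assms(3), of "theta T (mset B) (\<phi> B b)"] theta_valid[OF v(1,2)] theta_nonneg[OF v(1)] assms(4) by auto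
  moreover have "w_phi T a (path_word c) = w_phi T a (path_word b)" if "a \<in> classical_nodes T" for a
    using phi_valid(3)[OF assms(3) c(1) that] v(3)[OF that] c(2) assms(4) by simp
  ultimately show ?thesis using that by blast
qed

text \<open>Obtained by conjugating twice. It moves a configuration to another order of the factors,
  where it can be compared with the image of a given path.\<close>

lemma phi_transport:
  assumes "B \<in> tensor_class T" "b \<in> paths T B" "B' \<in> tensor_class T" "mset B' = mset B"
  obtains c where "c \<in> paths T B'" "\<phi> B' c = \<phi> B b"
    "\<And>a. a \<in> classical_nodes T \<Longrightarrow> w_phi T a (path_word c) = w_phi T a (path_word b)"
proof -
  obtain c where c: "c \<in> paths T B" "\<phi> B c = theta T (mset B) (\<phi> B b)"
    "\<And>a. a \<in> classical_nodes T \<Longrightarrow> w_phi T a (path_word c) = w_phi T a (path_word b)"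
    using phi_theta[OF assms(1,2,1) refl] by blast
  obtain d where "d \<in> paths T B'" "\<phi> B' d = theta T (mset B) (\<phi> B c)"
    "\<And>a. a \<in> classical_nodes T \<Longrightarrow> w_phi T a (path_word d) = w_phi T a (path_word c)"
    using phi_theta[OF assms(1) c(1) assms(3,4)] by blast
  then show ?thesis using that[of d] c(2,3) theta_involution by simp
qed

text \<open>Conjugation reduces this to \<delta>, after both configurations are moved to an order in
  which the box stands on the left.\<close>

lemma deltatilde_inj:
  assumes "B @ [(1, 1)] \<in> tensor_class T" "b \<in> paths T (B @ [(1, 1)])"
    and "B' @ [(1, 1)] \<in> tensor_class T" "c \<in> paths T (B' @ [(1, 1)])" "mset B' = mset B"
    and "deltatilde T (mset (B @ [(1, 1)])) (\<phi> (B @ [(1, 1)]) b) = deltatilde T (mset (B @ [(1, 1)])) (\<phi> (B' @ [(1, 1)]) c)"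
    and wt: "\<And>a. a \<in> classical_nodes T \<Longrightarrow> w_phi T a (path_word b) = w_phi T a (path_word c)"
  shows "\<phi> (B @ [(1, 1)]) b = \<phi> (B' @ [(1, 1)]) c"
proof -
  let ?D = "(1, 1) # B" and ?L = "mset (B @ [(1, 1)])"
  have D: "?D \<in> tensor_class T" "mset ?D = ?L" "mset (B' @ [(1, 1)]) = ?L" using assms(1,5) by auto
  obtain x where x: "x \<in> paths T ?D" "\<phi> ?D x = theta T ?L (\<phi> (B @ [(1, 1)]) b)"
    "\<And>a. a \<in> classical_nodes T \<Longrightarrow> w_phi T a (path_word x) = w_phi T a (path_word b)"
    using phi_theta[OF assms(1,2) D(1,2)] by blast
  obtain y where y: "y \<in> paths T ?D" "\<phi> ?D y = theta T ?L (\<phi> (B' @ [(1, 1)]) c)"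
    "\<And>a. a \<in> classical_nodes T \<Longrightarrow> w_phi T a (path_word y) = w_phi T a (path_word c)"
    using phi_theta[OF assms(3,4) D(1)] unfolding D(3) D(2) by blast
  have "deltabar T (mset ?D) (\<phi> ?D x) = deltabar T (mset ?D) (\<phi> ?D y)"
    using arg_cong[OF assms(6), of "theta T (?L - {#(1, 1)#})"] unfolding deltatilde_def theta_involution x(2) y(2) D(2) .
  then have "x = y" using deltabar_inj[OF D(1) x(1) y(1)] x(3) y(3) wt by simp
  then show ?thesis using x(2) y(2) theta_involution by metis
qed

theorem phi_star:
  assumes "B \<in> tensor_class T" "b \<in> paths T B"
  shows "\<phi> (rev B) (highest T (path_star T b)) = theta T (mset B) (\<phi> B b)"
  using assms
proof (induction "cell_measure B" arbitrary: B b rule: less_induct)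
  case less
  define d where "d = highest T (path_star T b)"
  have bE: "b \<in> elements T B" "w_hw T (path_word b)" using less.prems(2) by (auto simp: paths_iff)
  have rB: "rev B \<in> tensor_class T" using less.prems(1) by simp
  have sE: "path_star T b \<in> elements T (rev B)" by (rule path_star_elements[OF T less.prems(1) bE(1)])
  have d: "d \<in> paths T (rev B)" unfolding d_def by (rule highest_paths[OF T rB sE])
  have up: "(w_up T)\<^sup>*\<^sup>* (word_star T (path_word b)) (path_word d)"
    using highest_props(3)[OF T, of "path_star T b"] unfolding path_word_star d_def .
  have dE: "d \<in> elements T (rev B)" "w_hw T (path_word d)" using d by (auto simp: paths_iff)
  have wt: "w_phi T a (path_word d) = w_phi T a (path_word b)" if "a \<in> classical_nodes T" for a
    by (rule star_weight[OF T elements_letters[OF bE(1)] bE(2) up elements_letters[OF dE(1)] dE(2) that])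
  have ok: "rc_ok T (\<phi> B b)" using phi_valid(1)[OF less.prems] by (simp add: rc_valid_def)
  have highest_star: "highest T (path_star T c) = e"
    if c: "c \<in> elements T C" "C \<in> tensor_class T" "path_word c = path_word b" "e \<in> paths T (rev C)" "path_word e = path_word d" for c e C
  proof (rule highest_up[OF T])
    show "(w_up T)\<^sup>*\<^sup>* (path_word (path_star T c)) (path_word e)" using up c by (simp add: path_word_star)
    show "path_lens e = path_lens (path_star T c)"
      using elements_lens[OF path_star_elements[OF T c(2,1)]] elements_lens[of e T "rev C"] c(4) by (simp add: paths_iff)
    show "w_hw T (path_word e)" using dE(2) c(5) by simp
  qed
  have "\<phi> (rev B) d = theta T (mset B) (\<phi> B b)"
  proof (cases B)
    case Nil
    then have "b = []" "d = []" using bE(1) dE(1) by (auto simp: elements_Nil)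
    then show ?thesis using phi_Nil Nil by (simp add: fun_eq_iff theta_def)
  next
    case (Cons p B')
    obtain r s where p: "p = (r, s)" by fastforce
    have rs: "(r, s) \<in> KR_indices T" and B': "B' \<in> tensor_class T" using less.prems(1) Cons p by auto
    from rs show ?thesis
    proof (cases rule: KR_indices_cases)
      case 1
      then have B: "B = (1, 1) # B'" using Cons p by simp
      let ?L = "mset B"
      obtain x where x: "b = [[x]] # lh b" "lh b \<in> paths T B'"
        using path_lh[OF T less.prems(2)[unfolded B]] by blast
      have IH: "\<phi> (rev B') (highest T (path_star T (lh b))) = theta T (mset B') (\<phi> B' (lh b))"
        by (rule less.hyps) (use B B' x(2) cell_measure_simps(1)[of B'] in auto)
      have X: "\<phi> B' (lh b) = deltabar T ?L (\<phi> B b)" using phi_lh[of B' b] less.prems unfolding B by simp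
      have dB: "d \<in> paths T (rev B' @ [(1, 1)])" "rev B' @ [(1, 1)] \<in> tensor_class T" using d rB B by auto
      have mL: "mset (rev B' @ [(1, 1)]) = ?L" "?L - {#(1, 1)#} = mset B'" by (auto simp: B)
      note rh = phi_rh[OF dB(2,1), unfolded mL]
      obtain d0 z where d0: "d = d0 @ [[[z]]]" "d0 \<in> elements T (rev B')"
        using dB(1) unfolding paths_iff elements_append elements_Cons elements_Nil KR_box by blast
      \<comment> \<open>The involution sends the first letter of the word to the last place, so
        dropping the left box before corresponds to dropping the right box after; raising is
        compatible with the latter, and both sides end at the same highest weight vector.\<close>
      have "word_star T (path_word b) = path_word (path_star T (lh b)) @ [letter_star T x]"
        by (subst x(1)) (simp add: path_word_star word_star_def)
      then have "(w_up T)\<^sup>*\<^sup>* (path_word (path_star T (lh b))) (path_word d0)"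
        using w_up_butlast[of T "path_word (path_star T (lh b))" "letter_star T x" "path_word d"] up d0(1) by simp
      moreover have "(w_up T)\<^sup>*\<^sup>* (path_word d0) (path_word (highest T (rh d)))"
        using highest_props(3)[OF T, of "rh d"] d0(1) by (simp add: rh_def)
      ultimately have "(w_up T)\<^sup>*\<^sup>* (path_word (path_star T (lh b))) (path_word (highest T (rh d)))" by simp
      then have "highest T (path_star T (lh b)) = highest T (rh d)"
      proof (rule highest_up[OF T])
        have "path_star T (lh b) \<in> elements T (rev B')" using path_star_elements[OF T B'] x(2) by (simp add: paths_iff)
        then show "path_lens (highest T (rh d)) = path_lens (path_star T (lh b))"
          using rh(1) elements_lens by (metis paths_iff)
        show "w_hw T (path_word (highest T (rh d)))" using rh(1) by (simp add: paths_iff)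
      qed
      then have "deltatilde T ?L (\<phi> (rev B) d) = theta T (mset B') (deltabar T ?L (\<phi> B b))"
        using rh(2) IH X B by simp
      then have eq: "deltabar T ?L (theta T ?L (\<phi> (rev B) d)) = deltabar T ?L (\<phi> B b)"
        using arg_cong[of _ _ "theta T (mset B')"] theta_involution unfolding deltatilde_def mL(2) by metis
      \<comment> \<open>The conjugate of the image of \<open>d\<close> is realised by a path in
        \<open>B\<close> itself, with the weight of \<open>b\<close> by \<open>star_weight\<close>,
        so that injectivity of \<delta> identifies it with \<open>b\<close>.\<close>
      obtain c where c: "c \<in> paths T B" "\<phi> B c = theta T ?L (\<phi> (rev B) d)"
        "\<And>a. a \<in> classical_nodes T \<Longrightarrow> w_phi T a (path_word c) = w_phi T a (path_word d)"
        using phi_theta[OF rB d less.prems(1)] by auto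
      have "c = b"
        using deltabar_inj[of B' c b] c less.prems eq wt unfolding B[symmetric] by simp
      then show ?thesis using c(2) theta_involution by metis
    next
      case 2
      let ?B2 = "(r, 1) # (r, s - 1) # B'"
      note b2 = path_ls[OF T less.prems(2)[unfolded Cons p] 2(1)]
      have B2: "?B2 \<in> tensor_class T" using KR_indices_split[OF rs] 2 B' by auto
      have IH: "\<phi> (rev ?B2) (highest T (path_star T (ls b))) = theta T (mset ?B2) (\<phi> ?B2 (ls b))"
        by (rule less.hyps) (use Cons p cell_measure_simps(2)[OF 2] B2 b2(1) in auto)
      have dB: "d \<in> paths T (rev B' @ [(r, s)])" "rev B' @ [(r, s)] \<in> tensor_class T" using d rB Cons p by auto
      note q = path_rs[OF T dB(1) 2(1)]
      have "highest T (path_star T (ls b)) = rs d"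
        by (rule highest_star[of _ ?B2]) (use b2 B2 q in \<open>auto simp: paths_iff\<close>)
      then have "jtilde r s (\<phi> (rev B) d) = theta T (mset ?B2) (\<phi> B b)"
        using IH phi_ls[of r s B' b] less.prems 2 phi_rs[OF dB(2) 2(1) dB(1)] Cons p by simp
      also have "\<dots> = jtilde r s (theta T (mset B) (\<phi> B b))"
        unfolding jtilde_shift
        by (rule theta_shift[OF _ ok]) (use label_shift_jtilde[OF 2(1), of T r "B'"] Cons p in \<open>simp add: add_mset_commute\<close>)
      finally show ?thesis unfolding jtilde_shift by (rule shift_labels_inj)
    next
      case (3 n)
      let ?B2 = "(1, 1) # (r - 1, 1) # B'"
      have Br: "B = (r, 1) # B'" using Cons p 3(1) by simp
      have b2: "lb b \<in> paths T ?B2" "path_word (lb b) = path_word b"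
        using path_lb[of n b r B', OF _ _ 3(2)] less.prems(2) T unfolding Br 3(3) by auto
      have B2: "?B2 \<in> tensor_class T" using B' 3 by (auto intro: KR_indices_A)
      have IH: "\<phi> (rev ?B2) (highest T (path_star T (lb b))) = theta T (mset ?B2) (\<phi> ?B2 (lb b))"
        by (rule less.hyps) (use Br cell_measure_simps(3)[OF 3(2)] B2 b2(1) in auto)
      have dB: "d \<in> paths T (rev B' @ [(r, 1)])" "rev B' @ [(r, 1)] \<in> tensor_class T" using d rB Br by auto
      have q: "rb d \<in> paths T (rev B' @ [(r - 1, 1), (1, 1)])" "path_word (rb d) = path_word d"
        using path_rb[of n d "rev B'" r, OF _ _ 3(2)] dB(1) T unfolding 3(3) by auto
      have "highest T (path_star T (lb b)) = rb d"
        by (rule highest_star[of _ ?B2]) (use b2 B2 q in \<open>auto simp: paths_iff\<close>)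
      then have "itilde r (\<phi> (rev B) d) = theta T (mset ?B2) (ibar T (mset B) r (\<phi> B b))"
        using IH phi_lb[of n r B' b, OF 3(3) _ 3(2)] less.prems phi_rb[OF 3(3) dB(2) 3(2) dB(1)] Br by simp
      also have "\<dots> = itilde r (theta T (mset B) (\<phi> B b))"
        using theta_ibar[OF 3(2,4), of "\<phi> B b" B'] ok unfolding 3(3) Br by simp
      finally show ?thesis by (rule itilde_inj)
    qed
  qed
  then show ?case unfolding d_def .
qed

end

section \<open>Combinatorial R-matrices acting on adjacent factors\<close>

lemma combinatorial_RD:
  assumes "combinatorial_R T p q R" "z \<in> elements T [p, q]"
  shows "R z \<in> elements T [q, p]"
    and "i \<in> classical_nodes T \<Longrightarrow> cr_e (path_crystal T) i (R z) = map_option R (cr_e (path_crystal T) i z)"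
    and "i \<in> classical_nodes T \<Longrightarrow> cr_eps (path_crystal T) i (R z) = cr_eps (path_crystal T) i z"
    and "i \<in> classical_nodes T \<Longrightarrow> cr_phi (path_crystal T) i (R z) = cr_phi (path_crystal T) i z"
  using assms bij_betwE unfolding combinatorial_R_def crystal_iso_def by (blast, simp_all)

lemma split_at_two:
  assumes "Suc j < length B"
  shows "B = take j B @ [B ! j, B ! Suc j] @ drop (j + 2) B"
proof -
  have "drop j B = B ! j # B ! Suc j # drop (Suc (Suc j)) B" using assms by (simp add: Cons_nth_drop_Suc)
  then show ?thesis using append_take_drop_id[of j B] by simp
qed

lemma elements_two:
  assumes "b \<in> elements T B" "Suc j < length B"
  obtains u x y v where "b = u @ [x, y] @ v" "length u = j" "u \<in> elements T (take j B)" "[x, y] \<in> elements T [B ! j, B ! Suc j]"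
    "v \<in> elements T (drop (j + 2) B)"
proof -
  have "b \<in> elements T (take j B @ [B ! j, B ! Suc j] @ drop (j + 2) B)" using assms split_at_two by metis
  then obtain u z v where b: "b = u @ z @ v" "u \<in> elements T (take j B)" "z \<in> elements T [B ! j, B ! Suc j]"
    "v \<in> elements T (drop (j + 2) B)" unfolding elements_append by blast
  moreover obtain x y where "z = [x, y]" using b(3) by (auto simp: elements_Cons elements_Nil)
  moreover have "length u = j" using b(2) assms(2) by (auto simp: elements_def dest!: list_all2_lengthD)
  ultimately show thesis using that by blast
qed

lemma apply_at_append: "length u = j \<Longrightarrow> length z = 2 \<Longrightarrow> apply_at j R (u @ z @ v) = u @ R z @ v"
proof -
  assume "length u = j" "length z = 2"
  moreover then obtain x y where "z = [x, y]" by (auto simp: numeral_2_eq_2 length_Suc_conv)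
  ultimately show ?thesis by (simp add: apply_at_def nth_append)
qed

lemma apply_at_elements:
  assumes "combinatorial_R T (B ! j) (B ! Suc j) R" "Suc j < length B" "b \<in> elements T B"
  shows "apply_at j R b \<in> elements T (swap_at j B)"
proof -
  obtain u x y v where b: "b = u @ [x, y] @ v" "length u = j" "u \<in> elements T (take j B)"
    "[x, y] \<in> elements T [B ! j, B ! Suc j]" "v \<in> elements T (drop (j + 2) B)" using elements_two[OF assms(3,2)] .
  have "apply_at j R b = u @ R [x, y] @ v" unfolding b(1) by (rule apply_at_append) (use b(2) in auto)
  then show ?thesis
    using elements_appendI[OF b(3) elements_appendI[OF combinatorial_RD(1)[OF assms(1) b(4)] b(5)]]
    unfolding swap_at_def by simp
qed

text \<open>By associativity, a morphism on a block of factors extends by the identity to the whole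
  product.\<close>

lemma apply_at_crystal:
  assumes "combinatorial_R T (B ! j) (B ! Suc j) R" "Suc j < length B" "b \<in> elements T B" "i \<in> classical_nodes T"
  shows "cr_e (path_crystal T) i (apply_at j R b) = map_option (apply_at j R) (cr_e (path_crystal T) i b)"
    "w_eps T i (path_word (apply_at j R b)) = w_eps T i (path_word b)"
    "w_phi T i (path_word (apply_at j R b)) = w_phi T i (path_word b)"
proof -
  obtain u x y v where b: "b = u @ [x, y] @ v" "length u = j" "u \<in> elements T (take j B)"
    "[x, y] \<in> elements T [B ! j, B ! Suc j]" "v \<in> elements T (drop (j + 2) B)" using elements_two[OF assms(3,2)] .
  let ?C = "KR_crystal T"
  define z where "z = [x, y]"
  have z: "z \<in> elements T [B ! j, B ! Suc j]" "length z = 2" using b(4) by (auto simp: z_def)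
  note RD = combinatorial_RD[OF assms(1) z(1)]
  have a: "apply_at j R b = u @ R z @ v" unfolding b(1) z_def by (rule apply_at_append) (use b(2) in auto)
  have R: "tensor_e ?C i (R z) = map_option R (tensor_e ?C i z)" "tensor_eps ?C i (R z) = tensor_eps ?C i z"
    "tensor_phi ?C i (R z) = tensor_phi ?C i z"
    using RD(2-4)[OF assms(4)] by (simp_all add: path_crystal_def)
  have i0: "i \<noteq> 0" using classical_node_pos[OF assms(4)] .
  have eq: "tensor_eps ?C i (u @ R z @ v) = tensor_eps ?C i (u @ z @ v)" "tensor_phi ?C i (u @ R z @ v) = tensor_phi ?C i (u @ z @ v)"
    by (simp_all only: tensor_eps_phi_append R)
  then show "w_eps T i (path_word (apply_at j R b)) = w_eps T i (path_word b)"
    "w_phi T i (path_word (apply_at j R b)) = w_phi T i (path_word b)"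
    unfolding path_eps_phi[OF i0, symmetric] a
    unfolding b(1) z_def[symmetric] path_crystal_def by simp_all
  have len: "tensor_e ?C i s = Some s' \<Longrightarrow> length s' = length s" for s s' by (rule tensor_e_length)
  have e: "tensor_e ?C i (u @ R z @ v) = map_option (apply_at j R) (tensor_e ?C i (u @ z @ v))"
    unfolding tensor_e_append tensor_eps_phi_append R
    using len[of u] len[of z] b(2) z(2)
    by (cases "tensor_e ?C i u"; cases "tensor_e ?C i z"; cases "tensor_e ?C i v") (auto simp: apply_at_append)
  then show "cr_e (path_crystal T) i (apply_at j R b) = map_option (apply_at j R) (cr_e (path_crystal T) i b)"
    unfolding a unfolding b(1) z_def[symmetric] path_crystal_def by simp
qed

text \<open>The raising path to the highest weight vector is mapped step by step to a raising path
  of the image. This is required because dropping a right box produces elements that are not of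
  highest weight.\<close>

lemma apply_at_highest:
  assumes T: "valid_type T" and B: "B \<in> tensor_class T"
    and R: "combinatorial_R T (B ! j) (B ! Suc j) R" and j: "Suc j < length B" and b: "b \<in> elements T B"
  shows "highest T (apply_at j R b) = apply_at j R (highest T b)"
proof -
  have "\<exists>c. c \<in> elements T B \<and> path_word c = w \<and> path_lens c = path_lens b \<and>
      (w_up T)\<^sup>*\<^sup>* (path_word (apply_at j R b)) (path_word (apply_at j R c))" if "(w_up T)\<^sup>*\<^sup>* (path_word b) w" for w
    using that
  proof (induction rule: rtranclp_induct)
    case base
    show ?case using b by blast
  next
    case (step v w)
    then obtain c where c: "c \<in> elements T B" "path_word c = v" "path_lens c = path_lens b"
      "(w_up T)\<^sup>*\<^sup>* (path_word (apply_at j R b)) (path_word (apply_at j R c))" by blast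
    obtain i where i: "i \<in> classical_nodes T" "w_e T i (path_word c) = Some w" using step(2) c(2) by (auto simp: w_up_def)
    obtain d where d: "cr_e (path_crystal T) i c = Some d" "path_word d = w" by (rule path_e_lift[OF i])
    have "cr_e (path_crystal T) i (apply_at j R c) = Some (apply_at j R d)"
      using apply_at_crystal(1)[OF R j c(1) i(1)] d(1) by simp
    then have "w_up T (path_word (apply_at j R c)) (path_word (apply_at j R d))"
      unfolding path_e_iff[OF i(1) T] using i(1) by (auto simp: w_up_def)
    then have "(w_up T)\<^sup>*\<^sup>* (path_word (apply_at j R b)) (path_word (apply_at j R d))"
      using c(4) by (meson rtranclp.rtrancl_into_rtrancl)
    moreover have "d \<in> elements T B" by (rule elements_e[OF i(1) T B c(1) d(1)])
    moreover have "path_lens d = path_lens b" using path_e_lens[OF classical_node_pos[OF i(1)] d(1)] c(3) by simp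
    ultimately show ?case using d(2) by blast
  qed
  from this[OF highest_props(3)[OF T]] obtain c where c: "c \<in> elements T B" "path_word c = path_word (highest T b)"
    "path_lens c = path_lens b" "(w_up T)\<^sup>*\<^sup>* (path_word (apply_at j R b)) (path_word (apply_at j R c))" by blast
  have ch: "c = highest T b" by (rule path_word_inj) (use c highest_props(4)[OF T, of b] in auto)
  have hw: "w_hw T (path_word c)" using highest_props(2)[OF T, of b] classical_hw_word ch by simp
  show ?thesis
  proof (rule highest_up[OF T])
    show "(w_up T)\<^sup>*\<^sup>* (path_word (apply_at j R b)) (path_word (apply_at j R (highest T b)))" using c(4) ch by simp
    show "path_lens (apply_at j R (highest T b)) = path_lens (apply_at j R b)"
      using apply_at_elements[OF R j b] apply_at_elements[OF R j c(1)] ch elements_lens by metis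
    show "w_hw T (path_word (apply_at j R (highest T b)))"
      using apply_at_crystal(2)[OF R j c(1)] hw ch by (simp add: w_hw_def)
  qed
qed

lemma apply_at_paths:
  assumes "combinatorial_R T (B ! j) (B ! Suc j) R" "Suc j < length B" "b \<in> paths T B"
  shows "apply_at j R b \<in> paths T (swap_at j B)"
proof -
  have b: "b \<in> elements T B" "w_hw T (path_word b)" using assms(3) by (auto simp: paths_iff)
  show ?thesis
    using apply_at_elements[OF assms(1,2) b(1)] apply_at_crystal(2)[OF assms(1,2) b(1)] b(2) by (auto simp: paths_iff w_hw_def)
qed

lemma swap_at_mset: "Suc j < length B \<Longrightarrow> mset (swap_at j B) = mset B"
  by (subst (2) split_at_two[of j B]) (auto simp: swap_at_def add_mset_commute)

lemma swap_at_class: "Suc j < length B \<Longrightarrow> B \<in> tensor_class T \<Longrightarrow> swap_at j B \<in> tensor_class T"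
  using swap_at_mset[of j B] by (metis tensor_class_def in_listsD in_listsI set_mset_mset)

lemma apply_at_Cons: "apply_at (Suc j) R (t # b) = t # apply_at j R b"
  by (simp add: apply_at_def)

lemma swap_at_Cons: "swap_at (Suc j) (p # B) = p # swap_at j B"
  by (simp add: swap_at_def)

context path_bijection
begin

theorem phi_R:
  assumes "B \<in> tensor_class T" "Suc j < length B" "combinatorial_R T (B ! j) (B ! Suc j) R" "b \<in> paths T B"
  shows "\<phi> (swap_at j B) (apply_at j R b) = \<phi> B b"
  using assms
proof (induction "cell_measure B" arbitrary: B j b rule: less_induct)
  case less
  note R = less.prems(3) and j = less.prems(2)
  define c where "c = apply_at j R b"
  have c: "c \<in> paths T (swap_at j B)" unfolding c_def by (rule apply_at_paths[OF R j less.prems(4)])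
  have bE: "b \<in> elements T B" using less.prems(4) by (simp add: paths_iff)
  have S: "swap_at j B \<in> tensor_class T" "mset (swap_at j B) = mset B"
    using swap_at_class swap_at_mset less.prems(1) j by auto
  have wt: "w_phi T a (path_word c) = w_phi T a (path_word b)" if "a \<in> classical_nodes T" for a
    unfolding c_def by (rule apply_at_crystal(3)[OF R j bE that])
  \<comment> \<open>The configuration of the image is brought back to the original order of the
    factors, so that it can be compared with \<open>b\<close> inside one set of paths.\<close>
  obtain c2 where c2: "c2 \<in> paths T B" "\<phi> B c2 = \<phi> (swap_at j B) c"
    "\<And>a. a \<in> classical_nodes T \<Longrightarrow> w_phi T a (path_word c2) = w_phi T a (path_word c)"
    using phi_transport[OF S(1) c less.prems(1)] S(2) by metis
  have "\<phi> (swap_at j B) c = \<phi> B b"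
  proof (cases j)
    \<comment> \<open>The leftmost factor is not touched, so a box, column or cell is split off or
      removed there.\<close>
    case (Suc i)
    obtain p B1 where Bp: "B = p # B1" using j by (cases B) auto
    obtain r s where p: "p = (r, s)" by fastforce
    have rs: "(r, s) \<in> KR_indices T" and B1: "B1 \<in> tensor_class T" using less.prems(1) Bp p by auto
    have i: "Suc i < length B1" "combinatorial_R T (B1 ! i) (B1 ! Suc i) R" using j R Suc Bp by auto
    have Sp: "swap_at j B = p # swap_at i B1" unfolding Suc Bp swap_at_Cons ..
    obtain t b1 where b: "b = t # b1" "t \<in> KR T p" using bE Bp by (auto simp: elements_Cons)
    have ct: "c = t # apply_at i R b1" unfolding c_def b(1) Suc apply_at_Cons ..
    have c': "c \<in> paths T (p # swap_at i B1)" using c unfolding Sp .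
    have S1: "swap_at i B1 \<in> tensor_class T" "mset (swap_at i B1) = mset B1"
      using swap_at_class swap_at_mset B1 i(1) by auto
    from rs show ?thesis
    proof (cases rule: KR_indices_cases)
      case 1
      then have p1: "p = (1, 1)" using p by simp
      have "lh b \<in> paths T B1" using path_lh[OF T] less.prems(4) Bp p1 by metis
      then have "\<phi> (swap_at i B1) (apply_at i R (lh b)) = \<phi> B1 (lh b)"
        by (intro less.hyps) (use i B1 Bp p1 cell_measure_simps(1)[of B1] in auto)
      then have "\<phi> (swap_at i B1) (lh c) = \<phi> B1 (lh b)" unfolding lh_def b(1) ct by simp
      then have "deltabar T (mset B) (\<phi> (p # swap_at i B1) c) = deltabar T (mset B) (\<phi> B b)"
        using phi_lh[of "swap_at i B1" c] phi_lh[of B1 b] c' S1 less.prems(1,4) unfolding Bp p1 by simp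
      then have "c2 = b"
        using deltabar_inj[of B1 c2 b] c2[unfolded Sp] less.prems(1,4) wt unfolding Bp p1 by simp
      then show ?thesis using c2(2) by simp
    next
      case 2
      let ?B2 = "(r, 1) # (r, s - 1) # B1"
      have Br: "B = (r, s) # B1" using Bp p by simp
      have B2: "?B2 \<in> tensor_class T" using KR_indices_split[OF rs] 2 B1 by auto
      have "\<phi> (swap_at (Suc (Suc i)) ?B2) (apply_at (Suc (Suc i)) R (ls b)) = \<phi> ?B2 (ls b)"
        by (rule less.hyps) (use i B2 Br cell_measure_simps(2)[OF 2] path_ls(1)[OF T less.prems(4)[unfolded Br] 2(1)] in auto)
      moreover have "apply_at (Suc (Suc i)) R (ls b) = ls c" unfolding ls_def b(1) ct apply_at_Cons by (simp add: apply_at_Cons)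
      ultimately show ?thesis
        using phi_ls[of r s "swap_at i B1" c] phi_ls[of r s B1 b] c' S1(1) rs less.prems(1,4) 2(1)
        unfolding Sp unfolding Br p swap_at_Cons by simp
    next
      case (3 n)
      let ?B2 = "(1, 1) # (r - 1, 1) # B1"
      have Br: "B = (r, 1) # B1" using Bp p 3(1) by simp
      have Sr: "swap_at j B = (r, 1) # swap_at i B1" using Sp p 3(1) by simp
      have B2: "?B2 \<in> tensor_class T" using B1 3 by (auto intro: KR_indices_A)
      have lb: "lb b \<in> paths T ?B2" using path_lb(1)[of n b r B1, OF _ _ 3(2)] less.prems(4) T unfolding Br 3(3) by simp
      have "\<phi> (swap_at (Suc (Suc i)) ?B2) (apply_at (Suc (Suc i)) R (lb b)) = \<phi> ?B2 (lb b)"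
        by (rule less.hyps) (use i B2 Br cell_measure_simps(3)[OF 3(2)] lb in auto)
      moreover have "apply_at (Suc (Suc i)) R (lb b) = lb c"
        unfolding lb_def b(1) ct by (simp add: apply_at_Cons Let_def)
      ultimately have "ibar T (mset B) r (\<phi> (swap_at j B) c) = ibar T (mset B) r (\<phi> B b)"
        using phi_lb[of n r "swap_at i B1" c, OF 3(3) _ 3(2)] phi_lb[of n r B1 b, OF 3(3) _ 3(2)] c' S1 rs less.prems(1,4) 3(1)
        unfolding Sr unfolding Br p swap_at_Cons by simp
      then show ?thesis using ibar_inj[OF 3(2,4), of "mset B"] unfolding 3(3) by (simp add: Br)
    qed
  next
    case 0
    obtain p q B1 where Bpq: "B = p # q # B1" using j by (cases B; cases "tl B") auto
    have R0: "combinatorial_R T p q R" using R 0 Bpq by simp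
    show ?thesis
    \<comment> \<open>The exchange takes place at the left end, so the reduction continues from the
      right. When no factor is left there, two factors remain, and weights separate their
      paths.\<close>
    proof (cases B1 rule: rev_cases)
      case Nil
      have "c2 = b"
        by (rule paths_pair[OF T, of p q]) (use less.prems(1,4) c2 wt Bpq Nil in auto)
      then show ?thesis using c2(2) by simp
    next
      case (snoc B0 z)
      let ?D = "p # q # B0" and ?S = "q # p # B0"
      have Bz: "B = ?D @ [z]" using Bpq snoc by simp
      have Sz: "swap_at j B = ?S @ [z]" "swap_at 0 ?D = ?S" by (simp_all add: 0 Bz swap_at_def)
      obtain r s where z: "z = (r, s)" by fastforce
      have rs: "(r, s) \<in> KR_indices T" and D: "?D \<in> tensor_class T" "?S \<in> tensor_class T" using less.prems(1) Bz z by auto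
      obtain x y b0 t where b: "b = x # y # b0 @ [t]" "x # y # b0 \<in> elements T ?D"
        using bE unfolding Bz elements_append by (auto simp: elements_Cons elements_Nil)
      have ct: "c = R [x, y] @ b0 @ [t]" unfolding c_def 0 b(1) by (simp add: apply_at_def)
      have IH: "\<phi> (?S @ C) (apply_at 0 R e) = \<phi> (?D @ C) e"
        if "cell_measure (?D @ C) < cell_measure B" "?D @ C \<in> tensor_class T" "e \<in> paths T (?D @ C)" for C e
        using less.hyps[OF that(1,2) _ _ that(3), of 0] R0 by (simp add: swap_at_def)
      from rs show ?thesis
      proof (cases rule: KR_indices_cases)
        case 1
        then have z1: "z = (1, 1)" using z by simp
        have bD: "b \<in> paths T (?D @ [(1, 1)])" "?D @ [(1, 1)] \<in> tensor_class T" using less.prems(1,4) Bz z1 by auto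
        have cS: "c \<in> paths T (?S @ [(1, 1)])" "?S @ [(1, 1)] \<in> tensor_class T" using c S Sz(1) z1 by auto
        note hb = phi_rh[OF bD(2,1)] and hc = phi_rh[OF cS(2,1)]
        have "rh b = x # y # b0" "rh c = R [x, y] @ b0" by (simp_all add: rh_def b(1) ct butlast_append)
        then have "rh c = apply_at 0 R (rh b)" "rh b \<in> elements T ?D" using b(2) by (simp_all add: apply_at_def)
        then have "highest T (rh c) = apply_at 0 R (highest T (rh b))"
          using apply_at_highest[OF T D(1), of 0 R "rh b"] R0 by simp
        moreover have "\<phi> ?S (apply_at 0 R (highest T (rh b))) = \<phi> ?D (highest T (rh b))"
          using IH[of "[]" "highest T (rh b)"] hb(1) D(1) cell_measure_right(1)[of ?D] Bz z1 by simp
        moreover have mS: "mset (?S @ [(1, 1)]) = mset (?D @ [(1, 1)])" "mset ?S = mset ?D" by auto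
        ultimately have "deltatilde T (mset (?D @ [(1, 1)])) (\<phi> (?D @ [(1, 1)]) b) =
            deltatilde T (mset (?D @ [(1, 1)])) (\<phi> (?S @ [(1, 1)]) c)"
          using hb(2) hc(2) unfolding mS(1) by simp
        then have "\<phi> (?D @ [(1, 1)]) b = \<phi> (?S @ [(1, 1)]) c"
          by (rule deltatilde_inj[OF bD(2,1) cS(2,1) mS(2)]) (use wt in simp)
        then show ?thesis using Bz Sz(1) z1 by simp
      next
        case 2
        have bD: "b \<in> paths T (?D @ [(r, s)])" "?D @ [(r, s)] \<in> tensor_class T" using less.prems(1,4) Bz z by auto
        have cS: "c \<in> paths T (?S @ [(r, s)])" "?S @ [(r, s)] \<in> tensor_class T" using c S Sz(1) z by auto
        have "apply_at 0 R (rs b) = rs c" by (simp add: rs_def b(1) ct apply_at_def butlast_append)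
        moreover have "\<phi> (?S @ [(r, s - 1), (r, 1)]) (apply_at 0 R (rs b)) = \<phi> (?D @ [(r, s - 1), (r, 1)]) (rs b)"
          by (rule IH) (use cell_measure_right(2)[OF 2, of ?D] Bz z D KR_indices_split[OF rs] 2 path_rs(1)[OF T bD(1) 2(1)] in auto)
        ultimately have "jtilde r s (\<phi> (?S @ [(r, s)]) c) = jtilde r s (\<phi> (?D @ [(r, s)]) b)"
          using phi_rs[OF bD(2) 2(1) bD(1)] phi_rs[OF cS(2) 2(1) cS(1)] by simp
        then have "\<phi> (?S @ [(r, s)]) c = \<phi> (?D @ [(r, s)]) b" unfolding jtilde_shift by (rule shift_labels_inj)
        then show ?thesis using Bz Sz(1) z by simp
      next
        case (3 n)
        have bD: "b \<in> paths T (?D @ [(r, 1)])" "?D @ [(r, 1)] \<in> tensor_class T" using less.prems(1,4) Bz z 3(1) by auto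
        have cS: "c \<in> paths T (?S @ [(r, 1)])" "?S @ [(r, 1)] \<in> tensor_class T" using c S Sz(1) z 3(1) by auto
        have "apply_at 0 R (rb b) = rb c" by (simp add: rb_def b(1) ct apply_at_def butlast_append Let_def)
        moreover have "rb b \<in> paths T (?D @ [(r - 1, 1), (1, 1)])"
          using path_rb(1)[of n b ?D r, OF _ _ 3(2)] bD(1) T unfolding 3(3) by simp
        then have "\<phi> (?S @ [(r - 1, 1), (1, 1)]) (apply_at 0 R (rb b)) = \<phi> (?D @ [(r - 1, 1), (1, 1)]) (rb b)"
          using IH[of "[(r - 1, 1), (1, 1)]" "rb b"] cell_measure_right(3)[OF 3(2), of ?D] Bz z D 3
            KR_indices_A[of "r - 1" n 1] KR_indices_A[of 1 n 1] by simp
        ultimately have "itilde r (\<phi> (?S @ [(r, 1)]) c) = itilde r (\<phi> (?D @ [(r, 1)]) b)"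
          using phi_rb[OF 3(3) bD(2) 3(2) bD(1)] phi_rb[OF 3(3) cS(2) 3(2) cS(1)] by simp
        then have "\<phi> (?S @ [(r, 1)]) c = \<phi> (?D @ [(r, 1)]) b" by (rule itilde_inj)
        then show ?thesis using Bz Sz(1) z 3(1) by simp
      qed
    qed
  qed
  then show ?case unfolding c_def .
qed

end

theorem theorem8p6:
  fixes T :: affine_type
    and \<phi> :: "(nat \<times> nat) list \<Rightarrow> path \<Rightarrow> rigged"
  assumes "valid_type T"
    and "path_RC_bijection T \<phi>"
  shows
    "(\<forall>r s B'. (r, s) # B' \<in> tensor_class T \<longrightarrow> 2 \<le> s \<longrightarrow>
        (\<forall>b \<in> paths T ((r, s) # B').
           \<phi> ((r, 1) # (r, s - 1) # B') (induced T ls b) = jbar (\<phi> ((r, s) # B') b)))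
   \<and> (\<forall>B'. (1, 1) # B' \<in> tensor_class T \<longrightarrow>
        (\<forall>b \<in> paths T ((1, 1) # B').
           \<phi> B' (induced T lh b) = deltabar T (mset ((1, 1) # B')) (\<phi> ((1, 1) # B') b)))
   \<and> (\<forall>r s B'. B' @ [(r, s)] \<in> tensor_class T \<longrightarrow> 2 \<le> s \<longrightarrow>
        (\<forall>b \<in> paths T (B' @ [(r, s)]).
           \<phi> (B' @ [(r, s - 1), (r, 1)]) (induced T rs b) = jtilde r s (\<phi> (B' @ [(r, s)]) b)))
   \<and> (\<forall>B'. B' @ [(1, 1)] \<in> tensor_class T \<longrightarrow>
        (\<forall>b \<in> paths T (B' @ [(1, 1)]).
           \<phi> B' (induced T rh b) = deltatilde T (mset (B' @ [(1, 1)])) (\<phi> (B' @ [(1, 1)]) b)))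
   \<and> (\<forall>B \<in> tensor_class T. \<forall>b \<in> paths T B.
        \<phi> (rev B) (induced T (path_star T) b) = theta T (mset B) (\<phi> B b))
   \<and> (\<forall>B \<in> tensor_class T. \<forall>j R. Suc j < length B \<longrightarrow> combinatorial_R T (B ! j) (B ! Suc j) R \<longrightarrow>
        (\<forall>b \<in> paths T B. \<phi> (swap_at j B) (induced T (apply_at j R) b) = \<phi> B b))
   \<and> (\<forall>n. T = TypeA n \<longrightarrow>
        (\<forall>r B'. (r, 1) # B' \<in> tensor_class T \<longrightarrow> 2 \<le> r \<longrightarrow>
           (\<forall>b \<in> paths T ((r, 1) # B').
              \<phi> ((1, 1) # (r - 1, 1) # B') (induced T lb b) =
                ibar T (mset ((r, 1) # B')) r (\<phi> ((r, 1) # B') b))) \<and>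
        (\<forall>r B'. B' @ [(r, 1)] \<in> tensor_class T \<longrightarrow> 2 \<le> r \<longrightarrow>
           (\<forall>b \<in> paths T (B' @ [(r, 1)]).
              \<phi> (B' @ [(r - 1, 1), (1, 1)]) (induced T rb b) = itilde r (\<phi> (B' @ [(r, 1)]) b))))"
proof -
  interpret path_bijection T \<phi> by unfold_locales (use assms in auto)
  have ls: "\<phi> ((r, 1) # (r, s - 1) # B') (induced T ls b) = jbar (\<phi> ((r, s) # B') b)"
    if "(r, s) # B' \<in> tensor_class T" "2 \<le> s" "b \<in> paths T ((r, s) # B')" for r s B' b
    using bij that unfolding path_RC_bijection_def by metis
  have lh: "\<phi> B' (induced T lh b) = deltabar T (mset ((1, 1) # B')) (\<phi> ((1, 1) # B') b)"
    if "(1, 1) # B' \<in> tensor_class T" "b \<in> paths T ((1, 1) # B')" for B' b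
    using bij that unfolding path_RC_bijection_def by metis
  have lb: "\<phi> ((1, 1) # (r - 1, 1) # B') (induced T lb b) = ibar T (mset ((r, 1) # B')) r (\<phi> ((r, 1) # B') b)"
    if "T = TypeA n" "(r, 1) # B' \<in> tensor_class T" "2 \<le> r" "b \<in> paths T ((r, 1) # B')" for n r B' b
    using bij that unfolding path_RC_bijection_def by metis
  have rh: "\<phi> B' (induced T rh b) = deltatilde T (mset (B' @ [(1, 1)])) (\<phi> (B' @ [(1, 1)]) b)"
    if "B' @ [(1, 1)] \<in> tensor_class T" "b \<in> paths T (B' @ [(1, 1)])" for B' b
    unfolding induced_def by (rule phi_rh(2)[OF that])
  have rs: "\<phi> (B' @ [(r, s - 1), (r, 1)]) (induced T rs b) = jtilde r s (\<phi> (B' @ [(r, s)]) b)"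
    if "B' @ [(r, s)] \<in> tensor_class T" "2 \<le> s" "b \<in> paths T (B' @ [(r, s)])" for r s B' b
    using phi_rs[OF that] path_rs(3)[OF T that(3,2)] by simp
  have star: "\<phi> (rev B) (induced T (path_star T) b) = theta T (mset B) (\<phi> B b)"
    if "B \<in> tensor_class T" "b \<in> paths T B" for B b
    unfolding induced_def by (rule phi_star[OF that])
  have R: "\<phi> (swap_at j B) (induced T (apply_at j R) b) = \<phi> B b"
    if "B \<in> tensor_class T" "Suc j < length B" "combinatorial_R T (B ! j) (B ! Suc j) R" "b \<in> paths T B" for B j R b
  proof -
    have "w_hw T (path_word (apply_at j R b))" using apply_at_paths[OF that(3,2,4)] by (simp add: paths_iff)
    then show ?thesis using phi_R[OF that] induced_hw[OF T] by metis
  qed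
  have rb: "\<phi> (B' @ [(r - 1, 1), (1, 1)]) (induced T rb b) = itilde r (\<phi> (B' @ [(r, 1)]) b)"
    if "T = TypeA n" "B' @ [(r, 1)] \<in> tensor_class T" "2 \<le> r" "b \<in> paths T (B' @ [(r, 1)])" for n r B' b
    using phi_rb[OF that] path_rb(3)[of n b B' r] T that by simp
  show ?thesis
    by (intro conjI allI impI ballI; (rule ls lh rs rh star R lb rb; assumption))
qed

end
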